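(* Let $k\ge 1$ and let $g\in\mathcal{Z}^\pi$ be such that the operator $U^a\circ g$ (multiplication by $g$ followed by $U^a$) on $\mathcal{Z}^\pi$ is completely continuous. Then $$\mathrm{Tr}\big((U^a\circ g)^k\,\big|\,\mathcal{Z}^\pi\big)=(q^k-1)^{-1}\sum_{x_0\in\widehat{\mathbb{F}_{q^k}^\times},\ x_0\neq\widehat{P}_1,\dots,\widehat{P}_\ell}\rho_{x_0}\big(g(x)g(x^{q})\cdots g(x^{q^{k-1}})\big).$$
   Context: Let $p$ be a prime, $q=p^a$ with $a\ge1$, $\mathbb{Q}_q$ the unramified extension of $\mathbb{Q}_p$ of degree $a$ with ring of integers $\mathbb{Z}_q$. Let $\ell\ge2$, and let $P_1=\infty$, $P_2=0$, $P_3,\dots,P_\ell$ be distinct elements of $\mathbb{F}_q\cup\{\infty\}$. $\widehat{x}$ denotes the Teichmüller lift, $\widehat{S}$ the set of Teichmüller lifts of elements of $S$, and $\frac{1}{x-\widehat{P}_1}:=x$. $\pi$ is a formal variable; on $\mathbb{Z}_q[[\pi]]$ put $|\sum b_i\pi^i|_{\pi,p}=\max_i|b_i|_pp^{-i}$. Let $\mathcal{O}_a=\mathbb{Z}_q[[\pi]]\hat\otimes_{\mathbb{Z}_q}\mathbb{Z}_q$ (identified with $\mathbb{Z}_q[[\pi]]$ via $b\otimes r\mapsto rb$) and $\mathcal{C}=\mathbb{Z}_q[[\pi]]\hat\otimes_{\mathbb{Z}_q}\mathbb{C}_p$, with the completed tensor product norms. Let $B_{ij}=(x-\widehat{P}_j)^{-i}$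 for $i\ge0$, $1\le j\le\ell$ (so $B_{i1}=x^i$, and $B_{0j}=1$ for every $j$, this element being counted once). $\mathcal{Z}^\pi$ is the $\mathcal{O}_a$-module of sums $\sum c_{ij}(1\otimes B_{ij})$ with $c_{ij}\in\mathcal{O}_a$, $|c_{ij}|_{\pi,p}\to0$, inside $\mathbb{Z}_q[[\pi]]\hat\otimes_{\mathbb{Z}_q}\mathcal{H}_{1,1}$, where $\mathcal{H}_{1,1}$ is the algebra of rigid analytic functions over $\mathbb{C}_p$ on $\mathbb{A}_{1,1}=\{x\in\mathbb{C}_p:|x|_p\le1,\ |x-\widehat{P}_j|_p\ge1\ (2\le j\le\ell)\}$. These representations are unique, so the $1\otimes B_{ij}$ form an orthonormal basis. $g(x^{q^m})$ denotes $g$ with $x$ replaced by $x^{q^m}$. $U$ is the $\mathcal{C}$-linear extension ($b\otimes\xi\mapsto b\otimes U_p\xi$) of $(U_p\xi)(x)=\frac1p\sum_{z^p=x}\xi(z)$; $U^a$ maps $\mathcal{Z}^\pi$ to itself. For $x_0\in\mathbb{A}_{1,1}$, $\rho_{x_0}:\mathcal{Z}^\pi\to\mathcal{C}$ is evaluation, $\sum c_{ij}(1\otimes B_{ij})\mapsto\sum c_{ij}(x_0-\widehat{P}_j)^{-i}$. Write an $\mathcal{O}_a$-linear endomorphism $\phi$ of $\mathcal{Z}^\pi$ in the orthonormal basis as $\phi(1\otimes B_{ij})=\sum_{(n,m)}b_{(ij),(nm)}(1\otimes B_{nm})$. $\phi$ is completely continuous if $\sup_{(i,j)}|b_{(ij),(nm)}|_{\pi,p}\to0$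 as $(n,m)\to\infty$. The trace is $\mathrm{Tr}(\phi|\mathcal{Z}^\pi)=\sum_{(i,j)}b_{(ij),(ij)}$. *)

theory Defs
  imports
    "HOL-Algebra.QuotRing"
    "HOL-Algebra.Embedded_Algebras"
    "HOL-Algebra.Algebraic_Closure_Type"
    "HOL-Computational_Algebra.Formal_Power_Series"
    "HOL-Library.Function_Algebras"
begin

section \<open>The field \<open>\<complex>\<^sub>p\<close> and its subfields\<close>

text \<open>
  \<open>Qp v\<close> is the topological closure of the rationals in a valued field, i.e. their
  completion when the field is complete.
\<close>

definition Qp :: "('c::field_char_0 \<Rightarrow> real) \<Rightarrow> 'c set" where
  "Qp v = {x. \<forall>e>0. \<exists>r::rat. v (x - of_rat r) < e}"

definition algebraic_over :: "'c::field set \<Rightarrow> 'c \<Rightarrow> bool" where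
  "algebraic_over F x \<longleftrightarrow>
     (\<exists>f::'c poly. f \<noteq> 0 \<and> (\<forall>i. Polynomial.coeff f i \<in> F) \<and> poly f x = 0)"

text \<open>
  \<open>\<complex>\<^sub>p\<close> is the completion of an algebraic closure of \<open>\<rat>\<^sub>p\<close>, and it is algebraically closed.
  The locale describes it up to isometric isomorphism: a complete, algebraically closed
  field with an ultrametric absolute value extending the \<open>p\<close>-adic one, in which the elements
  algebraic over \<open>\<rat>\<^sub>p\<close> are dense.
\<close>

locale padic_complex_field =
  fixes p :: nat and v :: "'c::{alg_closed_field, field_char_0} \<Rightarrow> real"
  assumes prime_p: "prime p"
    and v_nonneg: "0 \<le> v x"
    and v_eq_0_iff: "v x = 0 \<longleftrightarrow> x = 0"
    and v_mult: "v (x * y) = v x * v y"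
    and v_add: "v (x + y) \<le> max (v x) (v y)"
    and v_p: "v (of_nat p) = 1 / real p"
    and v_complete: "(\<forall>e>0. \<exists>N. \<forall>m\<ge>N. \<forall>n\<ge>N. v (Y m - Y n) < e)
                       \<Longrightarrow> \<exists>x. (\<lambda>n. v (Y n - x)) \<longlonglongrightarrow> 0"
    and algebraic_dense: "0 < e \<Longrightarrow> \<exists>y. algebraic_over (Qp v) y \<and> v (x - y) < e"

text \<open>
  The residue field of \<open>\<rat>\<^sub>p\<close> is perfect, so an extension of \<open>\<rat>\<^sub>p\<close> is unramified iff it has the
  same value group. (Such a \<open>K\<close> of given degree is unique inside \<open>\<complex>\<^sub>p\<close>.)
\<close>

definition unramified_extension :: "('c::field_char_0 \<Rightarrow> real) \<Rightarrow> nat \<Rightarrow> 'c set \<Rightarrow> bool" where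
  "unramified_extension v a K \<longleftrightarrow>
     subfield K ring_of_type_algebra \<and> Qp v \<subseteq> K \<and>
     ring.dimension ring_of_type_algebra a (Qp v) K \<and>
     v ` K = v ` Qp v"

definition Zq :: "('c \<Rightarrow> real) \<Rightarrow> 'c set \<Rightarrow> 'c set" where
  "Zq v K = {x \<in> K. v x \<le> 1}"


section \<open>Residue field and Teichmueller lifts\<close>

definition residue_field :: "('c::field \<Rightarrow> real) \<Rightarrow> 'c set ring" where
  "residue_field v =
     (ring_of_type_algebra \<lparr>carrier := {x. v x \<le> 1}\<rparr>) Quot {x. v x < 1}"

text \<open>
  The finite field with \<open>n\<close> elements inside the residue field of \<open>\<complex>\<^sub>p\<close>, which is an
  algebraic closure of the prime field (\<open>n\<close> a power of \<open>p\<close>). For \<open>n = q\<close> it is the image of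
  \<open>\<int>\<^sub>q\<close>. Its elements are cosets, i.e. sets of elements of \<open>\<complex>\<^sub>p\<close>.
\<close>

definition GFq :: "('c::field \<Rightarrow> real) \<Rightarrow> nat \<Rightarrow> 'c set set" where
  "GFq v n = {c \<in> carrier (residue_field v). c [^]\<^bsub>residue_field v\<^esub> n = c}"

definition teich :: "nat \<Rightarrow> 'c::field set \<Rightarrow> 'c" where
  "teich p c = (THE z. z \<in> c \<and> (\<exists>n\<ge>1. z ^ (p ^ n) = z))"

text \<open>
  Points of the projective line over the residue field: \<open>None\<close> is \<open>\<infinity>\<close>, and the lift of
  \<open>\<infinity>\<close> is \<open>\<infinity>\<close>.
\<close>

definition teich_pt :: "nat \<Rightarrow> 'c::field set option \<Rightarrow> 'c option" where
  "teich_pt p = map_option (teich p)"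

definition hat :: "nat \<Rightarrow> (nat \<Rightarrow> 'c::field set option) \<Rightarrow> nat \<Rightarrow> 'c" where
  "hat p P j = the (teich_pt p (P j))"


section \<open>Rigid analytic functions on \<open>\<A>\<^sub>1\<^sub>,\<^sub>1\<close>\<close>

definition A11 :: "('c::field \<Rightarrow> real) \<Rightarrow> nat \<Rightarrow> (nat \<Rightarrow> 'c set option) \<Rightarrow> nat \<Rightarrow> 'c set" where
  "A11 v p P l = {x. v x \<le> 1 \<and> (\<forall>j\<in>{2..l}. 1 \<le> v (x - hat p P j))}"

text \<open>
  A rigid analytic function on a connected affinoid subset of the projective line is a uniform
  limit of rational functions without poles in it. All functions are extended by \<open>0\<close> to the
  whole of \<open>\<complex>\<^sub>p\<close>, so that \<open>supnorm\<close> is the supremum norm on \<open>\<A>\<^sub>1\<^sub>,\<^sub>1\<close>.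
\<close>

definition H11 :: "('c::field \<Rightarrow> real) \<Rightarrow> nat \<Rightarrow> (nat \<Rightarrow> 'c set option) \<Rightarrow> nat \<Rightarrow> ('c \<Rightarrow> 'c) set" where
  "H11 v p P l = {\<xi>. (\<forall>x. x \<notin> A11 v p P l \<longrightarrow> \<xi> x = 0) \<and>
     (\<forall>e>0. \<exists>N D. (\<forall>x\<in>A11 v p P l. poly D x \<noteq> 0) \<and>
                   (\<forall>x\<in>A11 v p P l. v (\<xi> x - poly N x / poly D x) < e))}"

definition supnorm :: "('c \<Rightarrow> real) \<Rightarrow> ('c \<Rightarrow> 'c) \<Rightarrow> real" where
  "supnorm v \<xi> = (SUP x. v (\<xi> x))"


section \<open>Completed tensor products\<close>

record ('r, 'm) normed_module =
  mcarrier :: "'m set"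
  mscale :: "'r \<Rightarrow> 'm \<Rightarrow> 'm"
  mnorm :: "'m \<Rightarrow> real"

text \<open>
  A multiset of pairs stands for the formal sum of the corresponding elementary tensors;
  \<open>tensor_eq R M N\<close> is equality in the algebraic tensor product \<open>M \<otimes>\<^sub>R N\<close>.
\<close>

inductive tensor_eq ::
  "'r set \<Rightarrow> ('r, 'm::ab_group_add) normed_module \<Rightarrow> ('r, 'n::ab_group_add) normed_module \<Rightarrow>
   ('m \<times> 'n) multiset \<Rightarrow> ('m \<times> 'n) multiset \<Rightarrow> bool"
  for R M N where
  refl: "set_mset s \<subseteq> mcarrier M \<times> mcarrier N \<Longrightarrow> tensor_eq R M N s s"
| sym: "tensor_eq R M N s s' \<Longrightarrow> tensor_eq R M N s' s"
| trans: "tensor_eq R M N s s' \<Longrightarrow> tensor_eq R M N s' s'' \<Longrightarrow> tensor_eq R M N s s''"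
| cong: "tensor_eq R M N s s' \<Longrightarrow> tensor_eq R M N u u' \<Longrightarrow> tensor_eq R M N (s + u) (s' + u')"
| add_left: "m \<in> mcarrier M \<Longrightarrow> m' \<in> mcarrier M \<Longrightarrow> n \<in> mcarrier N \<Longrightarrow>
    tensor_eq R M N {#(m + m', n)#} {#(m, n), (m', n)#}"
| add_right: "m \<in> mcarrier M \<Longrightarrow> n \<in> mcarrier N \<Longrightarrow> n' \<in> mcarrier N \<Longrightarrow>
    tensor_eq R M N {#(m, n + n')#} {#(m, n), (m, n')#}"
| zero: "n \<in> mcarrier N \<Longrightarrow> tensor_eq R M N {#(0, n)#} {#}"
| scale: "r \<in> R \<Longrightarrow> m \<in> mcarrier M \<Longrightarrow> n \<in> mcarrier N \<Longrightarrow>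
    tensor_eq R M N {#(mscale M r m, n)#} {#(m, mscale N r n)#}"

definition tensor_seminorm ::
  "'r set \<Rightarrow> ('r, 'm::ab_group_add) normed_module \<Rightarrow> ('r, 'n::ab_group_add) normed_module \<Rightarrow>
   ('m \<times> 'n) multiset \<Rightarrow> real" where
  "tensor_seminorm R M N s =
     Inf {Max (insert 0 ((\<lambda>(m, n). mnorm M m * mnorm N n) ` set_mset s')) |s'. tensor_eq R M N s s'}"

text \<open>
  \<open>completed_tensor R M N \<tau> T nT\<close>: \<open>T\<close> with norm \<open>nT\<close> is the completed tensor product
  of \<open>M\<close> and \<open>N\<close> over \<open>R\<close>, with \<open>\<tau> m n\<close> in the role of \<open>m \<otimes> n\<close>. This says that \<open>T\<close> is
  complete and contains isometrically, as a dense subgroup, the algebraic tensor product with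
  its tensor seminorm (modulo elements of seminorm \<open>0\<close>).
\<close>

definition completed_tensor ::
  "'r set \<Rightarrow> ('r, 'm::ab_group_add) normed_module \<Rightarrow> ('r, 'n::ab_group_add) normed_module \<Rightarrow>
   ('m \<Rightarrow> 'n \<Rightarrow> 't::ab_group_add) \<Rightarrow> 't set \<Rightarrow> ('t \<Rightarrow> real) \<Rightarrow> bool" where
  "completed_tensor R M N \<tau> T nT \<longleftrightarrow>
     0 \<in> T \<and> (\<forall>x\<in>T. \<forall>y\<in>T. x - y \<in> T \<and> nT (x - y) \<le> max (nT x) (nT y)) \<and>
     (\<forall>x\<in>T. 0 \<le> nT x \<and> (nT x = 0 \<longleftrightarrow> x = 0)) \<and>
     (\<forall>m\<in>mcarrier M. \<forall>n\<in>mcarrier N. \<tau> m n \<in> T) \<and>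
     (\<forall>s s'. tensor_eq R M N s s' \<longrightarrow> (\<Sum>(m, n)\<in>#s. \<tau> m n) = (\<Sum>(m, n)\<in>#s'. \<tau> m n)) \<and>
     (\<forall>s. set_mset s \<subseteq> mcarrier M \<times> mcarrier N \<longrightarrow>
            nT (\<Sum>(m, n)\<in>#s. \<tau> m n) = tensor_seminorm R M N s) \<and>
     (\<forall>x\<in>T. \<forall>e>0. \<exists>s. set_mset s \<subseteq> mcarrier M \<times> mcarrier N \<and>
            nT (x - (\<Sum>(m, n)\<in>#s. \<tau> m n)) < e) \<and>
     (\<forall>Y. (\<forall>n. Y n \<in> T) \<and> (\<forall>e>0. \<exists>N. \<forall>m\<ge>N. \<forall>n\<ge>N. nT (Y m - Y n) < e) \<longrightarrow>
            (\<exists>x\<in>T. (\<lambda>n. nT (Y n - x)) \<longlonglongrightarrow> 0))"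


section \<open>The rings \<open>\<O>\<^sub>a\<close> and \<open>\<C>\<close> and the algebra of rigid analytic functions over them\<close>

text \<open>The norm \<open>|\<Sum> b\<^sub>i \<pi>\<^sup>i|\<^sub>\<pi>\<^sub>,\<^sub>p\<close>; the supremum is attained for all series considered.\<close>

definition pinorm :: "('c::field \<Rightarrow> real) \<Rightarrow> nat \<Rightarrow> 'c fps \<Rightarrow> real" where
  "pinorm v p f = (SUP i. v (fps_nth f i) / real p ^ i)"

text \<open>\<open>\<int>\<^sub>q[[\<pi>]]\<close>, which is identified with \<open>\<O>\<^sub>a\<close> via \<open>b \<otimes> r \<mapsto> r b\<close>.\<close>

definition Oa :: "('c::field \<Rightarrow> real) \<Rightarrow> 'c set \<Rightarrow> 'c fps set" where
  "Oa v K = {f. \<forall>i. fps_nth f i \<in> Zq v K}"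

text \<open>
  The completed tensor products \<open>\<int>\<^sub>q[[\<pi>]] \<otimes> \<complex>\<^sub>p\<close> and \<open>\<int>\<^sub>q[[\<pi>]] \<otimes> \<H>\<^sub>1\<^sub>,\<^sub>1\<close> are realised as spaces
  of series in \<open>\<pi>\<close>; the theorems \<open>completed_tensor_Cser\<close> and \<open>completed_tensor_HT\<close> below show
  that these are completed tensor products. An element \<open>\<Sum> h\<^sub>i \<pi>\<^sup>i\<close> of the second is
  represented by the function \<open>x \<mapsto> \<Sum> h\<^sub>i(x) \<pi>\<^sup>i\<close>, so the ring operations are pointwise.
\<close>

definition Cser :: "('c::field \<Rightarrow> real) \<Rightarrow> nat \<Rightarrow> 'c fps set" where
  "Cser v p = {f. (\<lambda>i. v (fps_nth f i) / real p ^ i) \<longlonglongrightarrow> 0}"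

definition HT :: "('c::field \<Rightarrow> real) \<Rightarrow> nat \<Rightarrow> (nat \<Rightarrow> 'c set option) \<Rightarrow> nat \<Rightarrow> ('c \<Rightarrow> 'c fps) set" where
  "HT v p P l = {F. (\<forall>i. (\<lambda>x. fps_nth (F x) i) \<in> H11 v p P l) \<and>
                    (\<lambda>i. supnorm v (\<lambda>x. fps_nth (F x) i) / real p ^ i) \<longlonglongrightarrow> 0}"

definition HTnorm :: "('c::field \<Rightarrow> real) \<Rightarrow> nat \<Rightarrow> ('c \<Rightarrow> 'c fps) \<Rightarrow> real" where
  "HTnorm v p F = (SUP i. supnorm v (\<lambda>x. fps_nth (F x) i) / real p ^ i)"

definition tens :: "'c::field fps \<Rightarrow> ('c \<Rightarrow> 'c) \<Rightarrow> 'c \<Rightarrow> 'c fps" where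
  "tens b \<xi> = (\<lambda>x. b * fps_const (\<xi> x))"


section \<open>The module \<open>\<Z>\<^sup>\<pi>\<close>\<close>

text \<open>Unconditional summation in \<open>T\<close> with respect to the norm \<open>nT\<close>.\<close>

definition has_usum :: "'t::ab_group_add set \<Rightarrow> ('t \<Rightarrow> real) \<Rightarrow> ('i \<Rightarrow> 't) \<Rightarrow> 'i set \<Rightarrow> 't \<Rightarrow> bool" where
  "has_usum T nT f I s \<longleftrightarrow> s \<in> T \<and>
     (\<forall>e>0. \<exists>S0\<subseteq>I. finite S0 \<and> (\<forall>S. finite S \<and> S0 \<subseteq> S \<and> S \<subseteq> I \<longrightarrow> nT (s - sum f S) < e))"

definition usum :: "'t::ab_group_add set \<Rightarrow> ('t \<Rightarrow> real) \<Rightarrow> ('i \<Rightarrow> 't) \<Rightarrow> 'i set \<Rightarrow> 't" where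
  "usum T nT f I = (THE s. has_usum T nT f I s)"

text \<open>The element \<open>B\<^sub>0\<^sub>j = 1\<close> is counted once, with index \<open>(0, 1)\<close>.\<close>

definition idx :: "nat \<Rightarrow> (nat \<times> nat) set" where
  "idx l = insert (0, 1) ({1..} \<times> {1..l})"

definition basisB ::
  "('c::field \<Rightarrow> real) \<Rightarrow> nat \<Rightarrow> (nat \<Rightarrow> 'c set option) \<Rightarrow> nat \<Rightarrow> nat \<Rightarrow> nat \<Rightarrow> 'c \<Rightarrow> 'c" where
  "basisB v p P l i j x =
     (if x \<in> A11 v p P l then (if j = 1 then x ^ i else inverse (x - hat p P j) ^ i) else 0)"

definition basis ::
  "('c::field \<Rightarrow> real) \<Rightarrow> nat \<Rightarrow> (nat \<Rightarrow> 'c set option) \<Rightarrow> nat \<Rightarrow> nat \<times> nat \<Rightarrow> 'c \<Rightarrow> 'c fps" where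
  "basis v p P l = (\<lambda>(i, j). tens 1 (basisB v p P l i j))"

definition Zexpansion ::
  "('c::field \<Rightarrow> real) \<Rightarrow> nat \<Rightarrow> 'c set \<Rightarrow> (nat \<Rightarrow> 'c set option) \<Rightarrow> nat \<Rightarrow>
   (nat \<times> nat \<Rightarrow> 'c fps) \<Rightarrow> ('c \<Rightarrow> 'c fps) \<Rightarrow> bool" where
  "Zexpansion v p K P l c F \<longleftrightarrow>
     (\<forall>ij\<in>idx l. c ij \<in> Oa v K) \<and> (\<forall>ij. ij \<notin> idx l \<longrightarrow> c ij = 0) \<and>
     (\<forall>e>0. finite {ij \<in> idx l. e \<le> pinorm v p (c ij)}) \<and>
     has_usum (HT v p P l) (HTnorm v p) (\<lambda>ij x. c ij * basis v p P l ij x) (idx l) F"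

definition Zpi ::
  "('c::field \<Rightarrow> real) \<Rightarrow> nat \<Rightarrow> 'c set \<Rightarrow> (nat \<Rightarrow> 'c set option) \<Rightarrow> nat \<Rightarrow> ('c \<Rightarrow> 'c fps) set" where
  "Zpi v p K P l = {F. \<exists>c. Zexpansion v p K P l c F}"

text \<open>The coefficients of an element of \<open>\<Z>\<^sup>\<pi>\<close> with respect to the basis; they are unique.\<close>

definition Zcoeff ::
  "('c::field \<Rightarrow> real) \<Rightarrow> nat \<Rightarrow> 'c set \<Rightarrow> (nat \<Rightarrow> 'c set option) \<Rightarrow> nat \<Rightarrow>
   ('c \<Rightarrow> 'c fps) \<Rightarrow> nat \<times> nat \<Rightarrow> 'c fps" where
  "Zcoeff v p K P l F = (THE c. Zexpansion v p K P l c F)"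

definition rho ::
  "('c::field \<Rightarrow> real) \<Rightarrow> nat \<Rightarrow> 'c set \<Rightarrow> (nat \<Rightarrow> 'c set option) \<Rightarrow> nat \<Rightarrow>
   'c \<Rightarrow> ('c \<Rightarrow> 'c fps) \<Rightarrow> 'c fps" where
  "rho v p K P l x0 F =
     usum (Cser v p) (pinorm v p)
       (\<lambda>(i, j). Zcoeff v p K P l F (i, j) * fps_const (basisB v p P l i j x0)) (idx l)"


section \<open>Operators on \<open>\<Z>\<^sup>\<pi>\<close>\<close>

text \<open>
  \<open>Up\<close> maps functions on \<open>\<A>\<^sub>1\<^sub>,\<^sub>1\<close> to functions on its Frobenius twist, where each \<open>P\<^sub>j\<close> is
  replaced by \<open>P\<^sub>j\<^sup>p\<close>; the \<open>p\<close>-th roots of \<open>x\<close> lie in \<open>\<A>\<^sub>1\<^sub>,\<^sub>1\<close> iff \<open>x\<close> lies in the twist. Hence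
  the result is again extended by \<open>0\<close>, and it must not be cut off outside \<open>\<A>\<^sub>1\<^sub>,\<^sub>1\<close>, because
  the \<open>a\<close>-fold iterate comes back to \<open>\<A>\<^sub>1\<^sub>,\<^sub>1\<close>.
\<close>

definition Up :: "nat \<Rightarrow> ('c::field \<Rightarrow> 'c) \<Rightarrow> 'c \<Rightarrow> 'c" where
  "Up p \<xi> x = inverse (of_nat p) * (\<Sum>z | z ^ p = x. \<xi> z)"

text \<open>
  The extension \<open>b \<otimes> \<xi> \<mapsto> b \<otimes> u \<xi>\<close> of an operator \<open>u\<close> on functions acts on the
  coefficients of the powers of \<open>\<pi>\<close>.
\<close>

definition tens_ext :: "(('c::field \<Rightarrow> 'c) \<Rightarrow> 'c \<Rightarrow> 'c) \<Rightarrow> ('c \<Rightarrow> 'c fps) \<Rightarrow> 'c \<Rightarrow> 'c fps" where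
  "tens_ext u F = (\<lambda>x. Abs_fps (\<lambda>i. u (\<lambda>z. fps_nth (F z) i) x))"

definition Uop :: "nat \<Rightarrow> ('c::field \<Rightarrow> 'c fps) \<Rightarrow> 'c \<Rightarrow> 'c fps" where
  "Uop p = tens_ext (Up p)"

text \<open>
  \<open>mat_entry \<dots> \<phi> ij nm\<close> is the coefficient of the basis element \<open>nm\<close> in the image of the
  basis element \<open>ij\<close>.
\<close>

definition mat_entry ::
  "('c::field \<Rightarrow> real) \<Rightarrow> nat \<Rightarrow> 'c set \<Rightarrow> (nat \<Rightarrow> 'c set option) \<Rightarrow> nat \<Rightarrow>
   (('c \<Rightarrow> 'c fps) \<Rightarrow> ('c \<Rightarrow> 'c fps)) \<Rightarrow> nat \<times> nat \<Rightarrow> nat \<times> nat \<Rightarrow> 'c fps" where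
  "mat_entry v p K P l \<phi> ij nm = Zcoeff v p K P l (\<phi> (basis v p P l ij)) nm"

definition completely_continuous ::
  "('c::field \<Rightarrow> real) \<Rightarrow> nat \<Rightarrow> 'c set \<Rightarrow> (nat \<Rightarrow> 'c set option) \<Rightarrow> nat \<Rightarrow>
   (('c \<Rightarrow> 'c fps) \<Rightarrow> ('c \<Rightarrow> 'c fps)) \<Rightarrow> bool" where
  "completely_continuous v p K P l \<phi> \<longleftrightarrow>
     (\<forall>e>0. finite {nm \<in> idx l. e \<le> (SUP ij\<in>idx l. pinorm v p (mat_entry v p K P l \<phi> ij nm))})"

definition trace ::
  "('c::field \<Rightarrow> real) \<Rightarrow> nat \<Rightarrow> 'c set \<Rightarrow> (nat \<Rightarrow> 'c set option) \<Rightarrow> nat \<Rightarrow>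
   (('c \<Rightarrow> 'c fps) \<Rightarrow> ('c \<Rightarrow> 'c fps)) \<Rightarrow> 'c fps" where
  "trace v p K P l \<phi> =
     usum (Oa v K) (pinorm v p) (\<lambda>ij. mat_entry v p K P l \<phi> ij ij) (idx l)"

section \<open>The series spaces are completed tensor products\<close>

text \<open>
  The argument is uniform in the second factor \<open>N\<close>: series \<open>\<Sum> n\<^sub>i \<pi>\<^sup>i\<close> with coefficients in
  \<open>N\<close> and \<open>|n\<^sub>i| p\<^sup>-\<^sup>i \<rightarrow> 0\<close> form the completed tensor product of \<open>\<int>\<^sub>q[[\<pi>]]\<close> and \<open>N\<close>. Here
  \<open>cf x i\<close> is the coefficient of \<open>\<pi>\<^sup>i\<close> in \<open>x\<close>.
\<close>

definition Oa_module :: "('c::field \<Rightarrow> real) \<Rightarrow> nat \<Rightarrow> 'c set \<Rightarrow> ('c, 'c fps) normed_module" where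
  "Oa_module v p K = \<lparr>mcarrier = Oa v K, mscale = (\<lambda>r f. fps_const r * f), mnorm = pinorm v p\<rparr>"

definition fps_tail :: "nat \<Rightarrow> 'c::zero fps \<Rightarrow> 'c fps" where
  "fps_tail n b = Abs_fps (\<lambda>i. if i < n then 0 else fps_nth b i)"

locale pi_series =
  fixes v :: "'c::field \<Rightarrow> real" and p :: nat and K :: "'c set"
    and N :: "('c, 'n::ab_group_add) normed_module"
    and cf :: "'t::ab_group_add \<Rightarrow> nat \<Rightarrow> 'n"
    and \<tau> :: "'c fps \<Rightarrow> 'n \<Rightarrow> 't"
  assumes p_gt_1: "1 < p"
    and v_ge_0: "0 \<le> v r" and v_0: "v 0 = 0" and v_1: "v 1 = 1"
    and K_0: "0 \<in> K" and K_1: "1 \<in> K"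
    and N_0: "0 \<in> mcarrier N"
    and N_diff: "n \<in> mcarrier N \<Longrightarrow> n' \<in> mcarrier N \<Longrightarrow> n - n' \<in> mcarrier N"
    and N_scale: "r \<in> Zq v K \<Longrightarrow> n \<in> mcarrier N \<Longrightarrow> mscale N r n \<in> mcarrier N"
    and scale_add_left: "mscale N (r + r') n = mscale N r n + mscale N r' n"
    and scale_add_right: "mscale N r (n + n') = mscale N r n + mscale N r n'"
    and scale_scale: "mscale N r (mscale N r' n) = mscale N (r * r') n"
    and scale_1: "mscale N 1 n = n"
    and norm_nonneg: "n \<in> mcarrier N \<Longrightarrow> 0 \<le> mnorm N n"
    and norm_0: "mnorm N 0 = 0"
    and norm_eq_0: "n \<in> mcarrier N \<Longrightarrow> mnorm N n = 0 \<Longrightarrow> n = 0"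
    and norm_diff: "n \<in> mcarrier N \<Longrightarrow> n' \<in> mcarrier N \<Longrightarrow>
                      mnorm N (n - n') \<le> max (mnorm N n) (mnorm N n')"
    and norm_scale: "r \<in> Zq v K \<Longrightarrow> n \<in> mcarrier N \<Longrightarrow> mnorm N (mscale N r n) \<le> v r * mnorm N n"
    and N_complete: "(\<And>n. Y n \<in> mcarrier N) \<Longrightarrow>
          \<forall>e>0. \<exists>k. \<forall>m\<ge>k. \<forall>n\<ge>k. mnorm N (Y m - Y n) < e \<Longrightarrow>
          \<exists>x\<in>mcarrier N. (\<lambda>n. mnorm N (Y n - x)) \<longlonglongrightarrow> 0"
    and cf_add: "cf (x + y) i = cf x i + cf y i"
    and cf_inj: "(\<And>i. cf x i = cf y i) \<Longrightarrow> x = y"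
    and cf_surj: "\<exists>x. \<forall>i. cf x i = h i"
    and cf_tens: "cf (\<tau> b n) i = mscale N (fps_nth b i) n"
begin

definition T :: "'t set" where
  "T = {x. (\<forall>i. cf x i \<in> mcarrier N) \<and> (\<lambda>i. mnorm N (cf x i) / real p ^ i) \<longlonglongrightarrow> 0}"

definition nT :: "'t \<Rightarrow> real" where
  "nT x = (SUP i. mnorm N (cf x i) / real p ^ i)"

definition S :: "('c fps \<times> 'n) multiset \<Rightarrow> 't" where
  "S s = (\<Sum>(m, n)\<in>#s. \<tau> m n)"

abbreviation "R \<equiv> Zq v K"
abbreviation "M \<equiv> Oa_module v p K"
abbreviation "teq \<equiv> tensor_eq R M N"

lemma p_pos: "0 < real p ^ i"
  using p_gt_1 by simp

lemma cf_0: "cf 0 i = 0"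
  using cf_add[of 0 0 i] by simp

lemma cf_diff: "cf (x - y) i = cf x i - cf y i"
  using cf_add[of "x - y" y i] by (simp add: algebra_simps)

lemma scale_0_left: "mscale N 0 n = 0"
  using scale_add_left[of 0 0 n] by simp

lemma scale_0_right: "mscale N r 0 = 0"
  using scale_add_right[of r 0 0] by simp

lemma N_uminus: "n \<in> mcarrier N \<Longrightarrow> - n \<in> mcarrier N"
  using N_diff[OF N_0, of n] by simp

lemma N_add: "n \<in> mcarrier N \<Longrightarrow> n' \<in> mcarrier N \<Longrightarrow> n + n' \<in> mcarrier N"
  using N_diff[of n "- n'"] N_uminus[of n'] by simp

lemma norm_uminus_le: "n \<in> mcarrier N \<Longrightarrow> mnorm N (- n) \<le> mnorm N n"
  using norm_diff[OF N_0, of n] norm_nonneg[of n] by (simp add: norm_0 max_def split: if_splits)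

lemma norm_uminus: "n \<in> mcarrier N \<Longrightarrow> mnorm N (- n) = mnorm N n"
  using norm_uminus_le[of n] norm_uminus_le[of "- n"] N_uminus[of n] by simp

lemma norm_add:
  assumes "n \<in> mcarrier N" "n' \<in> mcarrier N"
  shows "mnorm N (n + n') \<le> max (mnorm N n) (mnorm N n')"
  using norm_diff[of n "- n'"] assms N_uminus[of n'] norm_uminus[of n'] by simp

lemma M_simps [simp]: "mcarrier M = Oa v K" "mscale M r f = fps_const r * f" "mnorm M = pinorm v p"
  by (simp_all add: Oa_module_def)

lemma Oa_nth: "b \<in> Oa v K \<Longrightarrow> fps_nth b i \<in> R"
  by (simp add: Oa_def)

lemma v_le_1: "r \<in> R \<Longrightarrow> v r \<le> 1"
  by (simp add: Zq_def)

lemma R_0: "0 \<in> R" and R_1: "1 \<in> R"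
  using K_0 K_1 v_0 v_1 by (simp_all add: Zq_def)

lemma T_coeff: "x \<in> T \<Longrightarrow> cf x i \<in> mcarrier N"
  by (simp add: T_def)

lemma term_nonneg: "n \<in> mcarrier N \<Longrightarrow> 0 \<le> mnorm N n / real p ^ i"
  using norm_nonneg p_pos by simp

lemma T_bdd:
  assumes "x \<in> T" shows "bdd_above (range (\<lambda>i. mnorm N (cf x i) / real p ^ i))"
proof -
  have "convergent (\<lambda>i. mnorm N (cf x i) / real p ^ i)"
    using assms by (auto simp: T_def convergent_def)
  then have "Bseq (\<lambda>i. mnorm N (cf x i) / real p ^ i)" by (rule convergent_imp_Bseq)
  then obtain B where "\<forall>i. norm (mnorm N (cf x i) / real p ^ i) \<le> B" unfolding Bseq_def by blast
  then have "mnorm N (cf x i) / real p ^ i \<le> B" for i by (metis abs_le_D1 real_norm_def)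
  then show ?thesis by (rule bdd_aboveI2)
qed

lemma nT_upper: "x \<in> T \<Longrightarrow> mnorm N (cf x i) / real p ^ i \<le> nT x"
  unfolding nT_def by (rule cSUP_upper[OF _ T_bdd]) auto

lemma nT_least: "(\<And>i. mnorm N (cf x i) / real p ^ i \<le> B) \<Longrightarrow> nT x \<le> B"
  unfolding nT_def by (rule cSUP_least) auto

lemma nT_nonneg: "x \<in> T \<Longrightarrow> 0 \<le> nT x"
  using nT_upper[of x 0] term_nonneg[OF T_coeff, of x 0 0] by linarith

lemma T_0: "0 \<in> T"
  by (simp add: T_def cf_0 norm_0 N_0)

lemma T_diff:
  assumes "x \<in> T" "y \<in> T" shows "x - y \<in> T"
proof -
  let ?f = "\<lambda>x i. mnorm N (cf x i) / real p ^ i"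
  have lim: "(\<lambda>i. max (?f x i) (?f y i)) \<longlonglongrightarrow> max 0 0"
    by (rule tendsto_max) (use assms in \<open>auto simp: T_def\<close>)
  have le: "?f (x - y) i \<le> max (?f x i) (?f y i)" for i
  proof -
    have "mnorm N (cf x i - cf y i) \<le> max (mnorm N (cf x i)) (mnorm N (cf y i))"
      using norm_diff assms T_coeff by blast
    then have "?f (x - y) i \<le> max (mnorm N (cf x i)) (mnorm N (cf y i)) / real p ^ i"
      using p_pos[of i] by (simp add: cf_diff divide_right_mono)
    then show ?thesis by (auto simp: max_def split: if_splits)
  qed
  have car: "cf (x - y) i \<in> mcarrier N" for i
    using assms T_coeff N_diff by (simp add: cf_diff)
  have "?f (x - y) \<longlonglongrightarrow> 0"
    by (rule tendsto_sandwich[of "\<lambda>_. 0" _ _ "\<lambda>i. max (?f x i) (?f y i)"])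
       (use lim le term_nonneg[OF car] in \<open>auto intro!: always_eventually\<close>)
  with car show ?thesis by (simp add: T_def)
qed

lemma nT_diff:
  assumes "x \<in> T" "y \<in> T" shows "nT (x - y) \<le> max (nT x) (nT y)"
proof (rule nT_least)
  fix i
  have "mnorm N (cf x i - cf y i) \<le> max (mnorm N (cf x i)) (mnorm N (cf y i))"
    using norm_diff assms T_coeff by blast
  then have "mnorm N (cf (x - y) i) / real p ^ i
      \<le> max (mnorm N (cf x i)) (mnorm N (cf y i)) / real p ^ i"
    using p_pos[of i] by (simp add: cf_diff divide_right_mono)
  also have "\<dots> \<le> max (nT x) (nT y)"
    using nT_upper[OF assms(1), of i] nT_upper[OF assms(2), of i]
    by (auto simp: max_def split: if_splits)
  finally show "mnorm N (cf (x - y) i) / real p ^ i \<le> max (nT x) (nT y)" .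
qed

lemma T_uminus: "x \<in> T \<Longrightarrow> - x \<in> T"
  using T_diff[OF T_0, of x] by simp

lemma T_add: "x \<in> T \<Longrightarrow> y \<in> T \<Longrightarrow> x + y \<in> T"
  using T_diff[of x "- y"] T_uminus[of y] by simp

lemma nT_0: "nT 0 = 0"
  by (simp add: nT_def cf_0 norm_0)

lemma nT_uminus: "x \<in> T \<Longrightarrow> nT (- x) \<le> nT x"
  using nT_diff[OF T_0, of x] nT_nonneg[of x] by (simp add: nT_0)

lemma nT_add: "x \<in> T \<Longrightarrow> y \<in> T \<Longrightarrow> nT (x + y) \<le> max (nT x) (nT y)"
  using nT_diff[of x "- y"] T_uminus[of y] nT_uminus[of y] by auto

lemma nT_eq_0:
  assumes "x \<in> T" "nT x = 0" shows "x = 0"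
proof (rule cf_inj)
  fix i
  have "mnorm N (cf x i) / real p ^ i = 0"
    using nT_upper[OF assms(1), of i] assms(2) term_nonneg[OF T_coeff[OF assms(1)], of i i] by simp
  then have "mnorm N (cf x i) = 0" using p_gt_1 by auto
  then show "cf x i = cf 0 i" using norm_eq_0 T_coeff[OF assms(1)] cf_0 by metis
qed

lemma Oa_term: "b \<in> Oa v K \<Longrightarrow> v (fps_nth b i) / real p ^ i \<le> 1 / real p ^ i"
  using v_le_1[OF Oa_nth, of b i] p_pos[of i] by (simp add: divide_right_mono)

lemma pow_lim: "(\<lambda>i. B / real p ^ i) \<longlonglongrightarrow> 0"
proof -
  have "(\<lambda>i. B * (1 / real p) ^ i) \<longlonglongrightarrow> B * 0"
    by (rule tendsto_mult_left, rule LIMSEQ_realpow_zero) (use p_gt_1 in auto)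
  then show ?thesis by (simp add: power_divide)
qed

lemma Oa_bdd:
  assumes "b \<in> Oa v K" shows "bdd_above (range (\<lambda>i. v (fps_nth b i) / real p ^ i))"
proof (rule bdd_aboveI2)
  fix i
  have "1 / real p ^ i \<le> 1 / 1" using p_gt_1 by (intro divide_left_mono) auto
  then show "v (fps_nth b i) / real p ^ i \<le> 1"
    using Oa_term[OF assms, of i] by simp
qed

lemma pinorm_upper: "b \<in> Oa v K \<Longrightarrow> v (fps_nth b i) / real p ^ i \<le> pinorm v p b"
  unfolding pinorm_def by (rule cSUP_upper[OF _ Oa_bdd]) auto

lemma pinorm_least: "(\<And>i. v (fps_nth b i) / real p ^ i \<le> B) \<Longrightarrow> pinorm v p b \<le> B"
  unfolding pinorm_def by (rule cSUP_least) auto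

lemma pinorm_nonneg: "b \<in> Oa v K \<Longrightarrow> 0 \<le> pinorm v p b"
  using pinorm_upper[of b 0] v_ge_0[of "fps_nth b 0"] by simp

lemma tens_car: 
  assumes "b \<in> Oa v K" "n \<in> mcarrier N" shows "\<tau> b n \<in> T"
proof -
  have car: "cf (\<tau> b n) i \<in> mcarrier N" for i
    using assms by (simp add: cf_tens N_scale Oa_nth)
  have le: "mnorm N (cf (\<tau> b n) i) / real p ^ i \<le> mnorm N n / real p ^ i" for i
  proof -
    have "mnorm N (cf (\<tau> b n) i) \<le> v (fps_nth b i) * mnorm N n"
      using assms by (simp add: cf_tens norm_scale Oa_nth)
    also have "\<dots> \<le> 1 * mnorm N n"
      by (rule mult_right_mono) (use assms v_le_1 Oa_nth norm_nonneg in auto)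
    finally show ?thesis using p_pos[of i] by (simp add: divide_right_mono)
  qed
  have "(\<lambda>i. mnorm N (cf (\<tau> b n) i) / real p ^ i) \<longlonglongrightarrow> 0"
    by (rule tendsto_sandwich[of "\<lambda>_. 0" _ _ "\<lambda>i. mnorm N n / real p ^ i"])
       (use pow_lim le term_nonneg[OF car] in \<open>auto intro!: always_eventually\<close>)
  with car show ?thesis by (simp add: T_def)
qed

lemma nT_tens:
  assumes "b \<in> Oa v K" "n \<in> mcarrier N" shows "nT (\<tau> b n) \<le> pinorm v p b * mnorm N n"
proof (rule nT_least)
  fix i
  have "mnorm N (cf (\<tau> b n) i) \<le> v (fps_nth b i) * mnorm N n"
    using assms by (simp add: cf_tens norm_scale Oa_nth)
  then have "mnorm N (cf (\<tau> b n) i) / real p ^ i \<le> (v (fps_nth b i) / real p ^ i) * mnorm N n"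
    using p_pos[of i] by (simp add: divide_right_mono)
  also have "\<dots> \<le> pinorm v p b * mnorm N n"
    by (rule mult_right_mono) (use assms pinorm_upper norm_nonneg in auto)
  finally show "mnorm N (cf (\<tau> b n) i) / real p ^ i \<le> pinorm v p b * mnorm N n" .
qed

lemma S_simps [simp]: "S {#} = 0" "S (s + u) = S s + S u" "S {#(m, n)#} = \<tau> m n"
  "S (add_mset (m, n) s) = \<tau> m n + S s"
  by (simp_all add: S_def)

lemma tens_add_left: "\<tau> (m + m') n = \<tau> m n + \<tau> m' n"
  by (rule cf_inj) (simp add: cf_tens cf_add scale_add_left)

lemma tens_add_right: "\<tau> m (n + n') = \<tau> m n + \<tau> m n'"
  by (rule cf_inj) (simp add: cf_tens cf_add scale_add_right)

lemma tens_0: "\<tau> 0 n = 0"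
  by (rule cf_inj) (simp add: cf_tens cf_0 scale_0_left)

lemma tens_scale: "\<tau> (fps_const r * m) n = \<tau> m (mscale N r n)"
  by (rule cf_inj) (simp add: cf_tens scale_scale mult.commute)

lemma teq_S: "teq s s' \<Longrightarrow> S s = S s'"
  by (induction rule: tensor_eq.induct)
     (simp_all add: tens_add_left tens_add_right tens_0 tens_scale)

lemma teq_car: "teq s s' \<Longrightarrow>
    set_mset s \<subseteq> Oa v K \<times> mcarrier N \<and> set_mset s' \<subseteq> Oa v K \<times> mcarrier N"
  if Oa_closed: "\<And>f g. f \<in> Oa v K \<Longrightarrow> g \<in> Oa v K \<Longrightarrow> f + g \<in> Oa v K"
    and Oa_scale: "\<And>r f. r \<in> R \<Longrightarrow> f \<in> Oa v K \<Longrightarrow> fps_const r * f \<in> Oa v K"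
proof (induction rule: tensor_eq.induct)
  case (zero n) then show ?case using R_0 by (simp add: Oa_def)
qed (auto simp: Oa_closed Oa_scale N_add N_scale)

lemma S_T:
  assumes "set_mset s \<subseteq> Oa v K \<times> mcarrier N" shows "S s \<in> T"
  using assms
proof (induction s)
  case empty then show ?case by (simp add: T_0)
next
  case (add x s) then show ?case by (cases x) (auto simp: T_add tens_car)
qed

definition maxnorm :: "('c fps \<times> 'n) multiset \<Rightarrow> real" where
  "maxnorm s = Max (insert 0 ((\<lambda>(m, n). pinorm v p m * mnorm N n) ` set_mset s))"

lemma maxnorm_ge: "(m, n) \<in># s \<Longrightarrow> pinorm v p m * mnorm N n \<le> maxnorm s"
  unfolding maxnorm_def by (rule Max_ge) auto

lemma maxnorm_nonneg: "0 \<le> maxnorm s"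
  unfolding maxnorm_def by (rule Max_ge) auto

lemma maxnorm_le:
  "0 \<le> B \<Longrightarrow> (\<And>m n. (m, n) \<in># s \<Longrightarrow> pinorm v p m * mnorm N n \<le> B) \<Longrightarrow> maxnorm s \<le> B"
  unfolding maxnorm_def by (subst Max_le_iff) auto

lemma nT_S_le:
  assumes "set_mset s \<subseteq> Oa v K \<times> mcarrier N" "0 \<le> B"
    "\<And>m n. (m, n) \<in># s \<Longrightarrow> pinorm v p m * mnorm N n \<le> B"
  shows "nT (S s) \<le> B"
  using assms
proof (induction s)
  case empty then show ?case by (simp add: nT_0)
next
  case (add x s)
  obtain m n where x: "x = (m, n)" by (cases x)
  have "nT (\<tau> m n + S s) \<le> max (nT (\<tau> m n)) (nT (S s))"
    by (rule nT_add) (use add.prems x in \<open>auto intro: S_T tens_car\<close>)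
  moreover have "nT (\<tau> m n) \<le> B"
    using nT_tens[of m n] add.prems x by fastforce
  moreover have "nT (S s) \<le> B" by (rule add.IH) (use add.prems in auto)
  ultimately show ?case by (simp add: x)
qed

lemma pow_Oa: "fps_X ^ i \<in> Oa v K"
  using R_0 R_1 by (simp add: Oa_def fps_X_power_iff)

lemma pinorm_pow: "pinorm v p (fps_X ^ i) \<le> 1 / real p ^ i"
  by (rule pinorm_least) (auto simp: fps_X_power_iff v_0 v_1)

lemma tail_Oa: "b \<in> Oa v K \<Longrightarrow> fps_tail n b \<in> Oa v K"
  using R_0 by (simp add: Oa_def fps_tail_def)

lemma pinorm_tail: "b \<in> Oa v K \<Longrightarrow> pinorm v p (fps_tail n b) \<le> 1 / real p ^ n"
proof (rule pinorm_least)
  fix i assume b: "b \<in> Oa v K"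
  show "v (fps_nth (fps_tail n b) i) / real p ^ i \<le> 1 / real p ^ n"
  proof (cases "i < n")
    case False
    then have "1 / real p ^ i \<le> 1 / real p ^ n"
      using p_gt_1 by (intro divide_left_mono power_increasing) auto
    then show ?thesis using Oa_term[OF b, of i] False by (simp add: fps_tail_def)
  qed (simp add: fps_tail_def v_0)
qed

lemma tail_0: "fps_tail 0 b = b"
  by (rule fps_ext) (simp add: fps_tail_def)

lemma tail_Suc: "fps_tail n b = fps_const (fps_nth b n) * fps_X ^ n + fps_tail (Suc n) b"
  by (rule fps_ext) (auto simp: fps_tail_def fps_X_power_iff less_Suc_eq)

lemma teq_sum:
  assumes "\<And>i. i < k \<Longrightarrow> teq (A i) (B i)"
  shows "teq (\<Sum>i<(k::nat). A i) (\<Sum>i<k. B i)"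
  using assms by (induction k) (auto intro: tensor_eq.refl tensor_eq.cong)

lemma pair_eq: "{#x#} + {#y#} = {#x, y#}"
  by (simp add: add_mset_commute)

lemma teq_split:
  assumes b: "b \<in> Oa v K" and m: "m \<in> mcarrier N"
  shows "teq {#(b, m)#}
    ((\<Sum>i<(k::nat). {#(fps_X ^ i, mscale N (fps_nth b i) m)#}) + {#(fps_tail k b, m)#})"
proof (induction k)
  case 0 show ?case using assms by (auto simp: tail_0 intro!: tensor_eq.refl)
next
  case (Suc k)
  let ?A = "\<Sum>i<k. {#(fps_X ^ i, mscale N (fps_nth b i) m)#}"
  let ?c = "fps_const (fps_nth b k) * fps_X ^ k"
  have cO: "?c \<in> Oa v K"
    using R_0 Oa_nth[OF b, of k] by (auto simp: Oa_def fps_X_power_iff)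
  have A: "set_mset ?A \<subseteq> mcarrier M \<times> mcarrier N"
    using assms pow_Oa N_scale Oa_nth by (auto simp: set_mset_sum)
  have 1: "teq {#(fps_tail k b, m)#} ({#(?c, m)#} + {#(fps_tail (Suc k) b, m)#})"
    unfolding tail_Suc[of k b] pair_eq
    by (rule tensor_eq.add_left) (use cO tail_Oa[OF b] m in auto)
  have "teq {#(?c, m)#} {#(fps_X ^ k, mscale N (fps_nth b k) m)#}"
    using tensor_eq.scale[of "fps_nth b k" R "fps_X ^ k" M m N] Oa_nth[OF b] pow_Oa m by simp
  then have 2: "teq ({#(?c, m)#} + {#(fps_tail (Suc k) b, m)#})
     ({#(fps_X ^ k, mscale N (fps_nth b k) m)#} + {#(fps_tail (Suc k) b, m)#})"
    by (rule tensor_eq.cong) (use tail_Oa[OF b] m in \<open>auto intro!: tensor_eq.refl\<close>)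
  have "teq {#(fps_tail k b, m)#}
     ({#(fps_X ^ k, mscale N (fps_nth b k) m)#} + {#(fps_tail (Suc k) b, m)#})"
    by (rule tensor_eq.trans[OF 1 2])
  then have "teq (?A + {#(fps_tail k b, m)#})
     (?A + ({#(fps_X ^ k, mscale N (fps_nth b k) m)#} + {#(fps_tail (Suc k) b, m)#}))"
    by (intro tensor_eq.cong tensor_eq.refl A)
  from tensor_eq.trans[OF Suc.IH this] show ?case by (simp add: add.assoc add_ac)
qed

lemma teq_zero_right: "m \<in> Oa v K \<Longrightarrow> teq {#(m, 0)#} {#}"
proof -
  assume m: "m \<in> Oa v K"
  have "teq {#(fps_const 0 * m, 0)#} {#(m, mscale N 0 0)#}"
    using tensor_eq.scale[of 0 R m M 0 N] R_0 m N_0 by simp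
  then have "teq {#(0, 0)#} {#(m, 0)#}" by (simp add: scale_0_left)
  with tensor_eq.zero[of 0 N R M] N_0 show ?thesis
    by (blast intro: tensor_eq.trans tensor_eq.sym)
qed

lemma teq_truncate:
  assumes "set_mset s \<subseteq> Oa v K \<times> mcarrier N"
  shows "teq s ((\<Sum>i<(k::nat). {#(fps_X ^ i, cf (S s) i)#})
                + image_mset (\<lambda>(b, m). (fps_tail k b, m)) s)"
  using assms
proof (induction s)
  case empty
  have "teq (\<Sum>i<k. {#(fps_X ^ i, 0)#}) (\<Sum>i<k. {#})"
    by (intro teq_sum teq_zero_right pow_Oa)
  then show ?case by (auto simp: cf_0 intro: tensor_eq.sym)
next
  case (add x s)
  obtain b m where x: "x = (b, m)" by (cases x)
  have b: "b \<in> Oa v K" and m: "m \<in> mcarrier N" and s: "set_mset s \<subseteq> Oa v K \<times> mcarrier N"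
    using add.prems x by auto
  let ?t = "image_mset (\<lambda>(b, m). (fps_tail k b, m)) s"
  let ?A = "\<lambda>i. {#(fps_X ^ i, mscale N (fps_nth b i) m)#} :: ('c fps \<times> 'n) multiset"
  let ?B = "\<lambda>i. {#(fps_X ^ i, cf (S s) i)#} :: ('c fps \<times> 'n) multiset"
  let ?C = "\<lambda>i. {#(fps_X ^ i, cf (S (add_mset x s)) i)#} :: ('c fps \<times> 'n) multiset"
  have "teq ({#(b, m)#} + s) (((\<Sum>i<k. ?A i) + {#(fps_tail k b, m)#}) + ((\<Sum>i<k. ?B i) + ?t))"
    by (rule tensor_eq.cong[OF teq_split[OF b m] add.IH[OF s]])
  also have "((\<Sum>i<k. ?A i) + {#(fps_tail k b, m)#}) + ((\<Sum>i<k. ?B i) + ?t)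
      = (\<Sum>i<k. ?A i + ?B i) + ({#(fps_tail k b, m)#} + ?t)"
    by (simp only: sum.distrib add_ac)
  finally have 1: "teq ({#(b, m)#} + s) ((\<Sum>i<k. ?A i + ?B i) + ({#(fps_tail k b, m)#} + ?t))" .
  have "teq (\<Sum>i<k. ?A i + ?B i) (\<Sum>i<k. ?C i)"
  proof (rule teq_sum)
    fix i
    have "teq {#(fps_X ^ i, mscale N (fps_nth b i) m + cf (S s) i)#}
            {#(fps_X ^ i, mscale N (fps_nth b i) m), (fps_X ^ i, cf (S s) i)#}"
      by (rule tensor_eq.add_right)
         (use pow_Oa N_scale[OF Oa_nth[OF b] m] T_coeff[OF S_T[OF s]] in auto)
    then show "teq (?A i + ?B i) (?C i)"
      unfolding pair_eq by (auto simp: x cf_add cf_tens intro: tensor_eq.sym)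
  qed
  then have 2: "teq ((\<Sum>i<k. ?A i + ?B i) + ({#(fps_tail k b, m)#} + ?t))
                    ((\<Sum>i<k. ?C i) + ({#(fps_tail k b, m)#} + ?t))"
    by (rule tensor_eq.cong, intro tensor_eq.refl) (use s b m tail_Oa in auto)
  from tensor_eq.trans[OF 1 2] show ?case by (simp add: x)
qed

lemma seminorm_eq:
  assumes s: "set_mset s \<subseteq> Oa v K \<times> mcarrier N"
    and car: "\<And>s'. teq s s' \<Longrightarrow> set_mset s' \<subseteq> Oa v K \<times> mcarrier N"
  shows "nT (S s) = tensor_seminorm R M N s"
proof -
  let ?I = "{maxnorm s' |s'. teq s s'}"
  have sem: "tensor_seminorm R M N s = Inf ?I"
    by (simp add: tensor_seminorm_def maxnorm_def)
  have bdd: "bdd_below ?I" by (rule bdd_belowI[of _ 0]) (auto simp: maxnorm_nonneg)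
  have "nT (S s) \<le> Inf ?I"
  proof (rule cInf_greatest)
    have "teq s s" using s by (intro tensor_eq.refl) simp
    then show "?I \<noteq> {}" by blast
    fix B assume "B \<in> ?I"
    then obtain s' where s': "teq s s'" and B: "B = maxnorm s'" by auto
    have "nT (S s') \<le> maxnorm s'"
      by (rule nT_S_le[OF car[OF s'] maxnorm_nonneg maxnorm_ge])
    then show "nT (S s) \<le> B" using teq_S[OF s'] B by simp
  qed
  moreover have "Inf ?I \<le> nT (S s) + e" if e: "0 < e" for e
  proof -
    define B where "B = Max (insert 0 ((\<lambda>(m, n). mnorm N n) ` set_mset s))"
    have B: "mnorm N n \<le> B" if "(m, n) \<in># s" for m n
      unfolding B_def by (rule Max_ge) (use that in force)+
    have "\<forall>\<^sub>F k in sequentially. B / real p ^ k < e"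
      using order_tendstoD(2)[OF pow_lim e] .
    then obtain k where k: "B / real p ^ k < e" by (auto simp: eventually_sequentially)
    let ?s' = "(\<Sum>i<k. {#(fps_X ^ i, cf (S s) i)#}) + image_mset (\<lambda>(b, m). (fps_tail k b, m)) s"
    have teq: "teq s ?s'" by (rule teq_truncate[OF s])
    have "maxnorm ?s' \<le> nT (S s) + e"
    proof (rule maxnorm_le)
      show "0 \<le> nT (S s) + e" using nT_nonneg[OF S_T[OF s]] e by simp
      fix m n assume "(m, n) \<in># ?s'"
      then consider i where "m = fps_X ^ i" "n = cf (S s) i"
        | b where "(b, n) \<in># s" "m = fps_tail k b"
        by (auto simp: set_mset_sum)
      then show "pinorm v p m * mnorm N n \<le> nT (S s) + e"
      proof cases
        case 1
        have "pinorm v p m * mnorm N n \<le> 1 / real p ^ i * mnorm N n"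
          by (rule mult_right_mono) (use 1 pinorm_pow norm_nonneg T_coeff[OF S_T[OF s]] in auto)
        also have "\<dots> \<le> nT (S s)" using nT_upper[OF S_T[OF s], of i] 1 by simp
        finally show ?thesis using e by simp
      next
        case 2
        have bn: "b \<in> Oa v K" "n \<in> mcarrier N" using 2 s by auto
        have "pinorm v p m * mnorm N n \<le> 1 / real p ^ k * mnorm N n"
          by (rule mult_right_mono) (use 2 bn pinorm_tail norm_nonneg in auto)
        also have "\<dots> \<le> 1 / real p ^ k * B"
          by (rule mult_left_mono) (use B 2 in auto)
        finally show ?thesis using k nT_nonneg[OF S_T[OF s]] by simp
      qed
    qed
    moreover have "Inf ?I \<le> maxnorm ?s'" using bdd teq by (auto intro!: cInf_lower)
    ultimately show ?thesis by simp
  qed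
  then have "Inf ?I \<le> nT (S s)" by (rule field_le_epsilon)
  ultimately show ?thesis using sem by simp
qed

lemma T_dense:
  assumes x: "x \<in> T" and e: "0 < e"
  shows "\<exists>s. set_mset s \<subseteq> Oa v K \<times> mcarrier N \<and> nT (x - S s) < e"
proof -
  have "\<forall>\<^sub>F k in sequentially. mnorm N (cf x k) / real p ^ k < e / 2"
    by (rule order_tendstoD(2)[of _ 0]) (use x e in \<open>auto simp: T_def\<close>)
  then obtain k where k: "\<And>i. i \<ge> k \<Longrightarrow> mnorm N (cf x i) / real p ^ i < e / 2"
    by (auto simp: eventually_sequentially)
  define s where "s = (\<Sum>i<k. {#(fps_X ^ i :: 'c fps, cf x i)#})"
  have s: "set_mset s \<subseteq> Oa v K \<times> mcarrier N"
    using pow_Oa T_coeff[OF x] by (auto simp: s_def set_mset_sum)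
  have cfS: "cf (S (\<Sum>i<k. {#(fps_X ^ i :: 'c fps, cf x i)#})) j = (if j < k then cf x j else 0)" for j k
    by (induction k)
       (auto simp: cf_0 cf_add cf_tens fps_X_power_iff scale_1 scale_0_left less_Suc_eq)
  have "nT (x - S s) \<le> e / 2"
  proof (rule nT_least)
    fix i show "mnorm N (cf (x - S s) i) / real p ^ i \<le> e / 2"
      using k[of i] e by (auto simp: cf_diff s_def cfS norm_0)
  qed
  with s e show ?thesis by (intro exI[of _ s]) simp
qed

lemma T_complete:
  assumes Y: "\<And>n. Y n \<in> T"
    and cau: "\<forall>e>0. \<exists>k. \<forall>m\<ge>k. \<forall>n\<ge>k. nT (Y m - Y n) < e"
  shows "\<exists>x\<in>T. (\<lambda>n. nT (Y n - x)) \<longlonglongrightarrow> 0"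
proof -
  have car: "cf (Y n) i \<in> mcarrier N" for n i by (rule T_coeff[OF Y])
  have le: "mnorm N (cf (Y m) i - cf (Y n) i) / real p ^ i \<le> nT (Y m - Y n)" for m n i
    using nT_upper[OF T_diff[OF Y Y], of m n i] by (simp add: cf_diff)
  have "\<exists>h\<in>mcarrier N. (\<lambda>n. mnorm N (cf (Y n) i - h)) \<longlonglongrightarrow> 0" for i
  proof (rule N_complete[OF car], intro allI impI)
    fix e :: real assume e: "0 < e"
    then have "0 < e / real p ^ i" using p_pos[of i] by (rule divide_pos_pos)
    then obtain k where k: "\<And>m n. m \<ge> k \<Longrightarrow> n \<ge> k \<Longrightarrow> nT (Y m - Y n) < e / real p ^ i"
      using cau by meson
    have "mnorm N (cf (Y m) i - cf (Y n) i) < e" if "m \<ge> k" "n \<ge> k" for m n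
    proof -
      have "mnorm N (cf (Y m) i - cf (Y n) i) / real p ^ i < e / real p ^ i"
        using le[where m = m and n = n and i = i] k[OF that] by linarith
      then show ?thesis using p_pos[of i] by (simp only: divide_less_cancel)
    qed
    then show "\<exists>k. \<forall>m\<ge>k. \<forall>n\<ge>k. mnorm N (cf (Y m) i - cf (Y n) i) < e" by blast
  qed
  then obtain h where h: "\<And>i. h i \<in> mcarrier N"
    and hlim: "\<And>i. (\<lambda>n. mnorm N (cf (Y n) i - h i)) \<longlonglongrightarrow> 0" by metis
  obtain x where x: "\<And>i. cf x i = h i" using cf_surj by meson
  have main: "\<exists>k. \<forall>m\<ge>k. \<forall>i. mnorm N (cf (Y m) i - h i) / real p ^ i \<le> e" if e: "0 < e" for e
  proof -
    obtain k where k: "\<And>m n. m \<ge> k \<Longrightarrow> n \<ge> k \<Longrightarrow> nT (Y m - Y n) < e"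
      using cau e by meson
    have "mnorm N (cf (Y m) i - h i) / real p ^ i \<le> e" if m: "m \<ge> k" for m i
    proof -
      have "0 < e * real p ^ i" using e p_pos[of i] by (rule mult_pos_pos)
      then have "\<forall>\<^sub>F n in sequentially. mnorm N (cf (Y n) i - h i) < e * real p ^ i"
        using order_tendstoD(2)[OF hlim] by blast
      then obtain k' where k': "\<And>n. n \<ge> k' \<Longrightarrow> mnorm N (cf (Y n) i - h i) < e * real p ^ i"
        by (auto simp: eventually_sequentially)
      define n where "n = max k k'"
      have 1: "mnorm N (cf (Y n) i - h i) \<le> e * real p ^ i" using k'[of n] by (simp add: n_def)
      have "mnorm N (cf (Y m) i - cf (Y n) i) / real p ^ i < e"
        using le[where m = m and n = n and i = i] k[of m n] m by (simp add: n_def)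
      then have 2: "mnorm N (cf (Y m) i - cf (Y n) i) \<le> e * real p ^ i"
        using p_pos[of i] by (simp only: pos_divide_less_eq less_imp_le)
      have "mnorm N ((cf (Y m) i - cf (Y n) i) + (cf (Y n) i - h i))
          \<le> max (mnorm N (cf (Y m) i - cf (Y n) i)) (mnorm N (cf (Y n) i - h i))"
        by (rule norm_add) (use car h N_diff in auto)
      then have "mnorm N (cf (Y m) i - h i) \<le> e * real p ^ i" using 1 2 by simp
      then show ?thesis using p_pos[of i] by (simp only: pos_divide_le_eq)
    qed
    then show ?thesis by blast
  qed
  have "(\<lambda>i. mnorm N (h i) / real p ^ i) \<longlonglongrightarrow> 0"
  proof (rule LIMSEQ_I)
    fix r :: real assume r: "0 < r"
    obtain k where k: "\<And>i. mnorm N (cf (Y k) i - h i) / real p ^ i \<le> r / 2"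
      using main[of "r / 2"] r by auto
    have "\<forall>\<^sub>F i in sequentially. mnorm N (cf (Y k) i) / real p ^ i < r"
      using Y[of k] order_tendstoD(2)[of _ 0 sequentially r] r by (auto simp: T_def)
    then obtain i0 where i0: "\<And>i. i \<ge> i0 \<Longrightarrow> mnorm N (cf (Y k) i) / real p ^ i < r"
      by (auto simp: eventually_sequentially)
    have "norm (mnorm N (h i) / real p ^ i - 0) < r" if "i \<ge> i0" for i
    proof -
      have "mnorm N (cf (Y k) i - (cf (Y k) i - h i))
          \<le> max (mnorm N (cf (Y k) i)) (mnorm N (cf (Y k) i - h i))"
        by (rule norm_diff) (use car h N_diff in auto)
      then have "mnorm N (h i) / real p ^ i
          \<le> max (mnorm N (cf (Y k) i)) (mnorm N (cf (Y k) i - h i)) / real p ^ i"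
        using p_pos[of i] by (simp add: divide_right_mono)
      also have "\<dots> < r"
      proof -
        have "mnorm N (cf (Y k) i - h i) / real p ^ i < r" using k[of i] r by linarith
        then show ?thesis using i0[OF that] by (simp add: max_def)
      qed
      finally show ?thesis using term_nonneg[OF h, of i i] by simp
    qed
    then show "\<exists>i0. \<forall>i\<ge>i0. norm (mnorm N (h i) / real p ^ i - 0) < r" by blast
  qed
  then have xT: "x \<in> T" by (simp add: T_def x h)
  have "(\<lambda>n. nT (Y n - x)) \<longlonglongrightarrow> 0"
  proof (rule LIMSEQ_I)
    fix r :: real assume r: "0 < r"
    obtain k where k: "\<And>m i. m \<ge> k \<Longrightarrow> mnorm N (cf (Y m) i - h i) / real p ^ i \<le> r / 2"
      using main[of "r / 2"] r by auto
    have "nT (Y n - x) \<le> r / 2" if "n \<ge> k" for n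
      by (rule nT_least) (use k[OF that] in \<open>simp add: cf_diff x\<close>)
    then show "\<exists>k. \<forall>n\<ge>k. norm (nT (Y n - x) - 0) < r"
      using r nT_nonneg[OF T_diff[OF Y xT]] by (intro exI[of _ k]) fastforce
  qed
  with xT show ?thesis by blast
qed

theorem completed_tensor_T:
  assumes Oa_closed: "\<And>f g. f \<in> Oa v K \<Longrightarrow> g \<in> Oa v K \<Longrightarrow> f + g \<in> Oa v K"
    and Oa_scale: "\<And>r f. r \<in> R \<Longrightarrow> f \<in> Oa v K \<Longrightarrow> fps_const r * f \<in> Oa v K"
  shows "completed_tensor R M N \<tau> T nT"
  unfolding completed_tensor_def S_def[symmetric] M_simps
  using T_0 T_diff nT_diff nT_nonneg nT_eq_0 nT_0 tens_car teq_S T_dense T_complete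
    seminorm_eq teq_car[OF Oa_closed Oa_scale]
  by (intro conjI ballI allI impI) (blast | metis)+

end

context padic_complex_field
begin

lemma p_gt_1: "1 < p"
  using prime_p by (rule prime_gt_1_nat)

lemma v_0: "v 0 = 0"
  by (simp add: v_eq_0_iff)

lemma v_1: "v 1 = 1"
  using v_mult[of 1 1] v_eq_0_iff[of 1] by simp

lemma v_uminus: "v (- x) = v x"
proof -
  have "v (- 1) * v (- 1) = 1" using v_mult[of "- 1" "- 1"] by (simp add: v_1)
  then have "v (- 1) = 1" using v_nonneg[of "- 1"] by (simp add: square_eq_1_iff)
  then show ?thesis using v_mult[of "- 1" x] by simp
qed

lemma v_diff: "v (x - y) \<le> max (v x) (v y)"
  using v_add[of x "- y"] by (simp add: v_uminus)

lemma poly_bounded: "\<exists>B\<ge>0. \<forall>x. v x \<le> 1 \<longrightarrow> v (poly N x) \<le> B"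
proof (induction N)
  case 0 show ?case by (auto simp: v_0)
next
  case (pCons c N)
  then obtain B where B: "0 \<le> B" "\<And>x. v x \<le> 1 \<Longrightarrow> v (poly N x) \<le> B" by blast
  have "v (poly (pCons c N) x) \<le> max (v c) B" if x: "v x \<le> 1" for x
  proof -
    have "v (x * poly N x) \<le> B"
      using mult_mono[OF x B(2)[OF x]] v_nonneg by (simp add: v_mult)
    then show ?thesis using v_add[of c "x * poly N x"] by simp
  qed
  then show ?case using B(1) by (intro exI[of _ "max (v c) B"]) auto
qed

lemma A11_dist:
  assumes x: "x \<in> A11 v p P l" and r: "r \<notin> A11 v p P l"
  shows "1 \<le> v (x - r)"
proof -
  consider "1 < v r" | j where "j \<in> {2..l}" "v (r - hat p P j) < 1"
    using r by (force simp: A11_def)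
  then show ?thesis
  proof cases
    case 1
    have "v (x - (x - r)) \<le> max (v x) (v (x - r))" by (rule v_diff)
    then show ?thesis using 1 x by (auto simp: A11_def)
  next
    case 2
    have "1 \<le> v (x - hat p P j)" using x 2 by (auto simp: A11_def)
    moreover have "v ((x - r) + (r - hat p P j)) \<le> max (v (x - r)) (v (r - hat p P j))"
      by (rule v_add)
    ultimately show ?thesis using 2 by auto
  qed
qed

lemma poly_away_from_0:
  assumes D: "\<forall>x\<in>A11 v p P l. poly D x \<noteq> 0"
  shows "\<exists>d>0. \<forall>x\<in>A11 v p P l. d \<le> v (poly D x)"
proof (cases "D = 0")
  case True then show ?thesis using D by (intro exI[of _ 1]) auto
next
  case False
  then obtain A where A: "D = smult (Polynomial.lead_coeff D) (\<Prod>x\<in>#A. [:-x, 1:])"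
    using alg_closed_imp_factorization by blast
  have root: "poly D r = 0" if "r \<in># A" for r
  proof -
    have "[:-r, 1:] dvd (\<Prod>x\<in>#A. [:-x, 1:])" using that by (intro dvd_prod_mset) auto
    then have "[:-r, 1:] dvd D" by (subst A) (rule dvd_smult)
    then show ?thesis by (simp add: poly_eq_0_iff_dvd)
  qed
  have prod: "1 \<le> v (poly (\<Prod>x\<in>#A'. [:-x, 1:]) x)"
    if "x \<in> A11 v p P l" "\<forall>r\<in>#A'. r \<notin> A11 v p P l" for x A'
    using that(2)
  proof (induction A')
    case empty then show ?case by (simp add: v_1)
  next
    case (add r A')
    have "1 * 1 \<le> v (x - r) * v (poly (\<Prod>x\<in>#A'. [:-x, 1:]) x)"
      using add A11_dist[OF that(1), of r] by (intro mult_mono v_nonneg) auto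
    then show ?case by (simp flip: v_mult) (simp add: algebra_simps)
  qed
  have "v (Polynomial.lead_coeff D) \<le> v (poly D x)" if x: "x \<in> A11 v p P l" for x
  proof -
    have "poly D x = Polynomial.lead_coeff D * poly (\<Prod>x\<in>#A. [:-x, 1:]) x"
      by (subst A) (simp only: poly_smult)
    moreover have "1 \<le> v (poly (\<Prod>x\<in>#A. [:-x, 1:]) x)"
      by (rule prod[OF x]) (use root D in blast)
    ultimately show ?thesis using v_nonneg[of "Polynomial.lead_coeff D"]
      by (simp add: v_mult mult_le_cancel_left1)
  qed
  moreover have "0 < v (Polynomial.lead_coeff D)"
    using v_nonneg[of "Polynomial.lead_coeff D"] v_eq_0_iff[of "Polynomial.lead_coeff D"] False
    by (simp add: less_le)
  ultimately show ?thesis by blast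
qed

lemma v_divide: "v (x / y) = v x / v y"
proof (cases "y = 0")
  case False
  then have "v (x / y) * v y = v x" using v_mult[of "x / y" y] by simp
  then show ?thesis using False v_eq_0_iff[of y] by (simp add: field_simps)
qed (simp add: v_0)

lemma H11_outside: "\<xi> \<in> H11 v p P l \<Longrightarrow> x \<notin> A11 v p P l \<Longrightarrow> \<xi> x = 0"
  by (simp add: H11_def)

lemma H11_bounded:
  assumes "\<xi> \<in> H11 v p P l"
  obtains B where "\<And>x. v (\<xi> x) \<le> B"
proof -
  obtain N D where D: "\<forall>x\<in>A11 v p P l. poly D x \<noteq> 0"
    and ND: "\<forall>x\<in>A11 v p P l. v (\<xi> x - poly N x / poly D x) < 1"
    using assms unfolding H11_def by (auto dest: spec[of _ "1::real"])
  obtain d where d: "0 < d" "\<forall>x\<in>A11 v p P l. d \<le> v (poly D x)"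
    using poly_away_from_0[OF D] by blast
  obtain C where C: "0 \<le> C" "\<forall>x. v x \<le> 1 \<longrightarrow> v (poly N x) \<le> C"
    using poly_bounded by blast
  have "v (\<xi> x) \<le> max 1 (C / d)" for x
  proof (cases "x \<in> A11 v p P l")
    case True
    have "v (\<xi> x - poly N x / poly D x + poly N x / poly D x)
        \<le> max (v (\<xi> x - poly N x / poly D x)) (v (poly N x / poly D x))" by (rule v_add)
    moreover have "v (\<xi> x - poly N x / poly D x) < 1" using ND True by blast
    moreover have "v (poly N x / poly D x) \<le> C / d"
      unfolding v_divide using True C d by (intro frac_le) (auto simp: A11_def)
    ultimately show ?thesis by auto
  qed (simp add: H11_outside[OF assms] v_0)
  then show ?thesis by (rule that)
qed

lemma supnorm_upper: "\<xi> \<in> H11 v p P l \<Longrightarrow> v (\<xi> x) \<le> supnorm v \<xi>"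
  unfolding supnorm_def by (rule cSUP_upper) (auto elim!: H11_bounded intro: bdd_aboveI2)

lemma supnorm_least: "(\<And>x. v (\<xi> x) \<le> B) \<Longrightarrow> supnorm v \<xi> \<le> B"
  unfolding supnorm_def by (rule cSUP_least) auto

lemma supnorm_nonneg: "\<xi> \<in> H11 v p P l \<Longrightarrow> 0 \<le> supnorm v \<xi>"
  using supnorm_upper[of \<xi> P l 0] v_nonneg[of "\<xi> 0"] by linarith

lemma H11_0: "0 \<in> H11 v p P l"
proof -
  have "\<forall>x\<in>A11 v p P l. poly 1 x \<noteq> 0" by simp
  moreover have "\<forall>x\<in>A11 v p P l. v (0 x - poly 0 x / poly 1 x) < e" if "0 < e" for e
    using that by (simp add: v_0)
  ultimately have "\<exists>N D. (\<forall>x\<in>A11 v p P l. poly D x \<noteq> 0) \<and>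
      (\<forall>x\<in>A11 v p P l. v (0 x - poly N x / poly D x) < e)" if "0 < e" for e
    using that by blast
  then show ?thesis by (simp add: H11_def)
qed

lemma H11_diff:
  assumes "\<xi> \<in> H11 v p P l" "\<eta> \<in> H11 v p P l" shows "\<xi> - \<eta> \<in> H11 v p P l"
  unfolding H11_def
proof (intro CollectI conjI allI impI)
  fix e :: real assume e: "0 < e"
  obtain N D where D: "\<forall>x\<in>A11 v p P l. poly D x \<noteq> 0"
    and ND: "\<forall>x\<in>A11 v p P l. v (\<xi> x - poly N x / poly D x) < e"
    using assms(1) e unfolding H11_def by blast
  obtain N' D' where D': "\<forall>x\<in>A11 v p P l. poly D' x \<noteq> 0"
    and ND': "\<forall>x\<in>A11 v p P l. v (\<eta> x - poly N' x / poly D' x) < e"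
    using assms(2) e unfolding H11_def by blast
  have "v ((\<xi> - \<eta>) x - poly (N * D' - N' * D) x / poly (D * D') x) < e"
    if x: "x \<in> A11 v p P l" for x
  proof -
    have eq: "(\<xi> - \<eta>) x - poly (N * D' - N' * D) x / poly (D * D') x
        = (\<xi> x - poly N x / poly D x) - (\<eta> x - poly N' x / poly D' x)"
      using D D' x by (simp add: field_simps)
    have "v (\<xi> x - poly N x / poly D x) < e" "v (\<eta> x - poly N' x / poly D' x) < e"
      using ND ND' x by blast+
    then show ?thesis unfolding eq
      using v_diff[of "\<xi> x - poly N x / poly D x" "\<eta> x - poly N' x / poly D' x"] by linarith
  qed
  then show "\<exists>N D. (\<forall>x\<in>A11 v p P l. poly D x \<noteq> 0) \<and>
      (\<forall>x\<in>A11 v p P l. v ((\<xi> - \<eta>) x - poly N x / poly D x) < e)"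
    using D D' by (intro exI[of _ "N * D' - N' * D"] exI[of _ "D * D'"]) auto
qed (use H11_outside[OF assms(1)] H11_outside[OF assms(2)] in auto)

lemma H11_scale:
  assumes "\<xi> \<in> H11 v p P l" "v r \<le> 1" shows "(\<lambda>x. r * \<xi> x) \<in> H11 v p P l"
  unfolding H11_def
proof (intro CollectI conjI allI impI)
  fix e :: real assume e: "0 < e"
  obtain N D where D: "\<forall>x\<in>A11 v p P l. poly D x \<noteq> 0"
    and ND: "\<forall>x\<in>A11 v p P l. v (\<xi> x - poly N x / poly D x) < e"
    using assms(1) e unfolding H11_def by blast
  have "v (r * \<xi> x - poly (Polynomial.smult r N) x / poly D x) < e" if x: "x \<in> A11 v p P l" for x
  proof -
    have "r * \<xi> x - poly (Polynomial.smult r N) x / poly D x = r * (\<xi> x - poly N x / poly D x)"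
      by (simp add: algebra_simps)
    moreover have "v (r * (\<xi> x - poly N x / poly D x)) \<le> 1 * v (\<xi> x - poly N x / poly D x)"
      unfolding v_mult by (rule mult_right_mono[OF assms(2) v_nonneg])
    ultimately show ?thesis using ND x by fastforce
  qed
  then show "\<exists>N D. (\<forall>x\<in>A11 v p P l. poly D x \<noteq> 0) \<and>
      (\<forall>x\<in>A11 v p P l. v (r * \<xi> x - poly N x / poly D x) < e)"
    using D by blast
qed (use assms H11_outside in auto)

lemma H11_complete:
  assumes Y: "\<And>n. Y n \<in> H11 v p P l"
    and cau: "\<forall>e>0. \<exists>k. \<forall>m\<ge>k. \<forall>n\<ge>k. supnorm v (Y m - Y n) < e"
  shows "\<exists>\<xi>\<in>H11 v p P l. (\<lambda>n. supnorm v (Y n - \<xi>)) \<longlonglongrightarrow> 0"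
proof -
  have up: "v (Y m x - Y n x) \<le> supnorm v (Y m - Y n)" for m n x
    using supnorm_upper[OF H11_diff[OF Y Y], of m n x] by simp
  have "\<exists>y. (\<lambda>n. v (Y n x - y)) \<longlonglongrightarrow> 0" for x
  proof (rule v_complete, intro allI impI)
    fix e :: real assume "0 < e"
    then obtain k where "\<forall>m\<ge>k. \<forall>n\<ge>k. supnorm v (Y m - Y n) < e" using cau by blast
    then show "\<exists>k. \<forall>m\<ge>k. \<forall>n\<ge>k. v (Y m x - Y n x) < e"
      using up order_le_less_trans by blast
  qed
  then obtain \<xi> where lim: "\<And>x. (\<lambda>n. v (Y n x - \<xi> x)) \<longlonglongrightarrow> 0" by metis
  have main: "\<exists>k. \<forall>m\<ge>k. \<forall>x. v (Y m x - \<xi> x) \<le> e" if e: "0 < e" for e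
  proof -
    obtain k where k: "\<forall>m\<ge>k. \<forall>n\<ge>k. supnorm v (Y m - Y n) < e" using cau e by blast
    have "v (Y m x - \<xi> x) \<le> e" if m: "m \<ge> k" for m x
    proof -
      have "\<forall>\<^sub>F n in sequentially. v (Y n x - \<xi> x) < e"
        by (rule order_tendstoD(2)[OF lim e])
      then obtain k' where k': "\<And>n. n \<ge> k' \<Longrightarrow> v (Y n x - \<xi> x) < e"
        by (auto simp: eventually_sequentially)
      define n where "n = max k k'"
      have "v (Y m x - Y n x) < e" 
        using order_le_less_trans[OF up[of m x n], of e] k m by (auto simp: n_def)
      moreover have "v (Y n x - \<xi> x) < e" using k'[of n] by (simp add: n_def)
      ultimately show ?thesis using v_add[of "Y m x - Y n x" "Y n x - \<xi> x"] by simp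
    qed
    then show ?thesis by blast
  qed
  have "\<xi> \<in> H11 v p P l"
    unfolding H11_def
  proof (intro CollectI conjI allI impI)
    fix x assume x: "x \<notin> A11 v p P l"
    have "(\<lambda>n::nat. v (0 - \<xi> x)) \<longlonglongrightarrow> 0" using lim[of x] H11_outside[OF Y x] by simp
    then show "\<xi> x = 0" by (simp add: LIMSEQ_const_iff v_eq_0_iff)
  next
    fix e :: real assume e: "0 < e"
    obtain k where k: "\<And>x. v (Y k x - \<xi> x) \<le> e / 2" using main[of "e / 2"] e by auto
    obtain N D where D: "\<forall>x\<in>A11 v p P l. poly D x \<noteq> 0"
      and ND: "\<forall>x\<in>A11 v p P l. v (Y k x - poly N x / poly D x) < e"
      using Y[of k] e unfolding H11_def by blast
    have "v (\<xi> x - poly N x / poly D x) < e" if x: "x \<in> A11 v p P l" for x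
    proof -
      have "v ((Y k x - poly N x / poly D x) - (Y k x - \<xi> x)) < e"
        using v_diff[of "Y k x - poly N x / poly D x" "Y k x - \<xi> x"] k[of x] ND x e by fastforce
      then show ?thesis by simp
    qed
    then show "\<exists>N D. (\<forall>x\<in>A11 v p P l. poly D x \<noteq> 0) \<and>
        (\<forall>x\<in>A11 v p P l. v (\<xi> x - poly N x / poly D x) < e)"
      using D by blast
  qed
  moreover have "(\<lambda>n. supnorm v (Y n - \<xi>)) \<longlonglongrightarrow> 0"
  proof (rule LIMSEQ_I)
    fix r :: real assume r: "0 < r"
    obtain k where k: "\<And>m x. m \<ge> k \<Longrightarrow> v (Y m x - \<xi> x) \<le> r / 2"
      using main[of "r / 2"] r by auto
    have "supnorm v (Y n - \<xi>) \<le> r / 2" if "n \<ge> k" for n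
      by (rule supnorm_least) (use k[OF that] in simp)
    then show "\<exists>k. \<forall>n\<ge>k. norm (supnorm v (Y n - \<xi>) - 0) < r"
      using r supnorm_nonneg[OF H11_diff[OF Y \<open>\<xi> \<in> H11 v p P l\<close>]]
      by (intro exI[of _ k]) fastforce
  qed
  ultimately show ?thesis by blast
qed

definition Cp_module :: "('c, 'c) normed_module" where
  "Cp_module = \<lparr>mcarrier = UNIV, mscale = (*), mnorm = v\<rparr>"

definition H11_module :: "(nat \<Rightarrow> 'c set option) \<Rightarrow> nat \<Rightarrow> ('c, 'c \<Rightarrow> 'c) normed_module" where
  "H11_module P l = \<lparr>mcarrier = H11 v p P l, mscale = (\<lambda>r \<xi> x. r * \<xi> x), mnorm = supnorm v\<rparr>"

context
  fixes a :: nat and K :: "'c set"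
  assumes K: "unramified_extension v a K"
begin

lemma subfield_K: "0 \<in> K" "1 \<in> K" "x \<in> K \<Longrightarrow> y \<in> K \<Longrightarrow> x + y \<in> K" "x \<in> K \<Longrightarrow> y \<in> K \<Longrightarrow> x * y \<in> K"
proof -
  have "subfield K (ring_of_type_algebra :: 'c ring)" using K by (simp add: unramified_extension_def)
  then have K': "subring K (ring_of_type_algebra :: 'c ring)"
    by (simp add: subfield_def subdomain_def subcring_def)
  show "0 \<in> K" "1 \<in> K" "x \<in> K \<Longrightarrow> y \<in> K \<Longrightarrow> x + y \<in> K" "x \<in> K \<Longrightarrow> y \<in> K \<Longrightarrow> x * y \<in> K"
    using subringE[OF K'] by (simp_all add: ring_of_type_algebra_def)
qed

lemma Zq_closed: "x \<in> Zq v K \<Longrightarrow> y \<in> Zq v K \<Longrightarrow> x + y \<in> Zq v K"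
    "x \<in> Zq v K \<Longrightarrow> y \<in> Zq v K \<Longrightarrow> x * y \<in> Zq v K"
  using v_add[of x y] by (auto simp: Zq_def subfield_K v_mult v_nonneg mult_le_one)

lemma Oa_closed: "f \<in> Oa v K \<Longrightarrow> g \<in> Oa v K \<Longrightarrow> f + g \<in> Oa v K"
    "r \<in> Zq v K \<Longrightarrow> f \<in> Oa v K \<Longrightarrow> fps_const r * f \<in> Oa v K"
  by (simp_all add: Oa_def Zq_closed)

theorem completed_tensor_Cser:
  "completed_tensor (Zq v K) (Oa_module v p K) Cp_module
     (\<lambda>b r. b * fps_const r) (Cser v p) (pinorm v p)"
proof -
  interpret C: pi_series v p K Cp_module "fps_nth" "\<lambda>b r. b * fps_const r"
  proof unfold_locales
    fix Y :: "nat \<Rightarrow> 'c" assume "\<forall>e>0. \<exists>k. \<forall>m\<ge>k. \<forall>n\<ge>k. mnorm Cp_module (Y m - Y n) < e"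
    then show "\<exists>x\<in>mcarrier Cp_module. (\<lambda>n. mnorm Cp_module (Y n - x)) \<longlonglongrightarrow> 0"
      using v_complete[of Y] by (simp add: Cp_module_def)
  next
    fix h :: "nat \<Rightarrow> 'c" show "\<exists>x. \<forall>i. fps_nth x i = h i" by (rule exI[of _ "Abs_fps h"]) simp
  qed (use p_gt_1 v_nonneg v_0 v_1 subfield_K v_eq_0_iff v_diff v_mult in
        \<open>auto simp: Cp_module_def algebra_simps intro: fps_ext\<close>)
  have "C.T = Cser v p" unfolding C.T_def Cser_def by (simp add: Cp_module_def)
  moreover have "C.nT = pinorm v p" by (rule ext) (simp add: C.nT_def pinorm_def, simp add: Cp_module_def)
  ultimately show ?thesis using C.completed_tensor_T Oa_closed by simp
qed

theorem completed_tensor_HT: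
  "completed_tensor (Zq v K) (Oa_module v p K) (H11_module P l) tens (HT v p P l) (HTnorm v p)"
proof -
  interpret H: pi_series v p K "H11_module P l" "\<lambda>F i x. fps_nth (F x) i" tens
  proof unfold_locales
    fix h :: "nat \<Rightarrow> 'c \<Rightarrow> 'c" show "\<exists>F. \<forall>i. (\<lambda>x. fps_nth (F x) i) = h i"
      by (rule exI[of _ "\<lambda>x. Abs_fps (\<lambda>i. h i x)"]) simp
  next
    fix F G :: "'c \<Rightarrow> 'c fps" assume "\<And>i. (\<lambda>x. fps_nth (F x) i) = (\<lambda>x. fps_nth (G x) i)"
    then show "F = G" by (intro ext fps_ext) metis
  next
    fix \<xi> \<eta> assume xe: "\<xi> \<in> mcarrier (H11_module P l)" "\<eta> \<in> mcarrier (H11_module P l)"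
    show "mnorm (H11_module P l) (\<xi> - \<eta>) \<le> max (mnorm (H11_module P l) \<xi>) (mnorm (H11_module P l) \<eta>)"
      unfolding H11_module_def normed_module.simps
    proof (rule supnorm_least)
      fix x
      show "v ((\<xi> - \<eta>) x) \<le> max (supnorm v \<xi>) (supnorm v \<eta>)"
        using v_diff[of "\<xi> x" "\<eta> x"] supnorm_upper[of \<xi> P l x] supnorm_upper[of \<eta> P l x] xe
        by (auto simp: H11_module_def)
    qed
  next
    fix r \<xi> assume r: "r \<in> Zq v K" and xi: "\<xi> \<in> mcarrier (H11_module P l)"
    then show "mscale (H11_module P l) r \<xi> \<in> mcarrier (H11_module P l)"
      by (simp add: H11_module_def H11_scale Zq_def)
    show "mnorm (H11_module P l) (mscale (H11_module P l) r \<xi>) \<le> v r * mnorm (H11_module P l) \<xi>"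
      unfolding H11_module_def normed_module.simps
      by (rule supnorm_least)
         (use xi supnorm_upper in \<open>auto simp: H11_module_def v_mult intro!: mult_left_mono v_nonneg\<close>)
  next
    fix \<xi> assume xi: "\<xi> \<in> mcarrier (H11_module P l)" "mnorm (H11_module P l) \<xi> = 0"
    show "\<xi> = 0"
    proof
      fix x have "v (\<xi> x) \<le> 0" using supnorm_upper[of \<xi> P l x] xi by (simp add: H11_module_def)
      then show "\<xi> x = 0 x" using v_nonneg[of "\<xi> x"] v_eq_0_iff[of "\<xi> x"] by simp
    qed
  next
    fix Y :: "nat \<Rightarrow> 'c \<Rightarrow> 'c" assume "\<And>n. Y n \<in> mcarrier (H11_module P l)"
      "\<forall>e>0. \<exists>k. \<forall>m\<ge>k. \<forall>n\<ge>k. mnorm (H11_module P l) (Y m - Y n) < e"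
    then show "\<exists>x\<in>mcarrier (H11_module P l). (\<lambda>n. mnorm (H11_module P l) (Y n - x)) \<longlonglongrightarrow> 0"
      using H11_complete[of Y P l] by (simp add: H11_module_def)
  qed (use p_gt_1 v_nonneg v_0 v_1 subfield_K H11_0 H11_diff supnorm_nonneg in
        \<open>auto simp: H11_module_def tens_def supnorm_def algebra_simps fun_eq_iff\<close>)
  have "H.T = HT v p P l" unfolding H.T_def HT_def by (simp add: H11_module_def)
  moreover have "H.nT = HTnorm v p" by (rule ext) (simp add: H.nT_def HTnorm_def, simp add: H11_module_def)
  ultimately show ?thesis using H.completed_tensor_T Oa_closed by simp
qed

end

end

text \<open>
  The pointwise product is the product of the tensor product of algebras, and \<open>Uop\<close> is the
  \<open>\<C>\<close>-linear map with \<open>b \<otimes> \<xi> \<mapsto> b \<otimes> U\<^sub>p \<xi>\<close>.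
\<close>

lemma tens_mult: "tens b \<xi> * tens b' \<xi>' = tens (b * b') (\<xi> * \<xi>')"
  by (rule ext) (simp add: tens_def mult_ac flip: fps_const_mult)

lemma tens_ext_tens:
  assumes "\<And>r \<xi> x. u (\<lambda>z. r * \<xi> z) x = r * u \<xi> x"
  shows "tens_ext u (tens b \<xi>) = tens b (u \<xi>)"
  by (rule ext, rule fps_ext) (simp add: tens_ext_def tens_def assms)

lemma Uop_eq: "Uop p F x = fps_const (inverse (of_nat p)) * (\<Sum>z | z ^ p = x. F z)"
  by (rule fps_ext) (simp add: Uop_def tens_ext_def Up_def fps_sum_nth)

lemma Uop_tens: "Uop p (tens b \<xi>) = tens b (Up p \<xi>)"
  unfolding Uop_def by (rule tens_ext_tens) (simp add: Up_def sum_distrib_left mult_ac)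

lemma Uop_linear: "Uop p (\<lambda>x. c * F x + G x) = (\<lambda>x. c * Uop p F x + Uop p G x)"
  by (rule ext) (simp add: Uop_eq sum.distrib sum_distrib_left distrib_left mult_ac)

end

theory Submission
  imports Defs
begin

text \<open>
  Multiplication by \<open>g\<close> can be moved past the roots: with \<open>Q = q ^ k\<close> the operator \<open>(U\<^sup>a \<circ> g)\<^sup>k\<close> is
  \<open>U \<circ> G\<close>, where \<open>(U f)(x) = 1/Q \<Sum> f(z)\<close> over \<open>z ^ Q = x\<close>, and \<open>G(x) = g(x) g(x ^ q) \<dots> g(x ^ q ^ (k - 1))\<close>.
  Everything acts separately on the coefficients of the powers of \<open>\<pi>\<close>, so \<open>G\<close> may be taken scalar.
  Both sides of the formula are additive and continuous in \<open>G\<close>, so \<open>G\<close> may be taken rational.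
  If \<open>G = (x ^ Q - x) H\<close>, the right-hand side is \<open>0\<close>, and so is the trace, because \<open>U \<circ> G\<close> is the
  commutator of \<open>x\<close> and \<open>U \<circ> H\<close>. Modulo such \<open>G\<close> every rational function with poles at Teichmueller
  points is a Laurent polynomial, and the diagonal of \<open>U \<circ> x ^ n\<close> is explicit.
\<close>

section \<open>Roots of unity in an algebraically closed field\<close>

text \<open>The right-hand side sums over all (Q - 1)-th roots of unity that are not poles. For a
  Laurent polynomial G, the diagonal in the column of a pole P \<noteq> 0 is G(P), G(P) Q, G(P) Q^2,
  ..., with p-adic sum -G(P) / (Q - 1). So each nonzero pole removes its own point, and what is left
  is the formula for the poles 0 and \<infinity> alone. Two obstacles shape the proof. Passing to
  the limit in G needs |U f| \<le> |f|, but U divides by Q, so its definition only gives |f| / |Q|;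
  the remedy is to compute U on every basis element and to see that the coefficients are integral.
  And a commutator has trace 0 only if the two diagonals can be compared: for rational H this is an
  explicit telescoping in each column, whose far end tends to 0 because, for f of high order, the
  coefficients of U f near that order are p-adically small. All coefficients must stay in Z_q, so
  the Teichmueller lifts have to be located there. As unramified extensions are given through their
  value group, this takes a proof that the residue degree equals the degree.\<close>

lemma squarefree_root_count:
  fixes f :: "'a::alg_closed_field poly"
  assumes f: "f \<noteq> 0" and sf: "\<And>x. poly f x = 0 \<Longrightarrow> poly (pderiv f) x \<noteq> 0"
  shows "card {x. poly f x = 0} = Polynomial.degree f"
    and "f = smult (Polynomial.lead_coeff f) (\<Prod>x | poly f x = 0. [:- x, 1:])"
proof -
  obtain A where A: "size A = Polynomial.degree f"
    "f = smult (Polynomial.lead_coeff f) (\<Prod>x\<in>#A. [:- x, 1:])"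
    using alg_closed_imp_factorization[OF f] by blast
  have roots: "poly f x = 0 \<longleftrightarrow> x \<in># A" for x
  proof -
    have "poly f x = Polynomial.lead_coeff f * (\<Prod>y\<in>#A. x - y)"
      by (subst A(2)) (simp add: poly_prod_mset)
    then show ?thesis using f by (auto simp: prod_mset_zero_iff)
  qed
  have "count A x \<le> 1" for x
  proof (rule ccontr)
    assume "\<not> count A x \<le> 1"
    then obtain B where B: "A = add_mset x (add_mset x B)"
      by (metis (no_types) count_add_mset count_eq_zero_iff multi_member_split One_nat_def le_Suc_eq
          zero_le_one le_numeral_extra(4))
    define g where "g = smult (Polynomial.lead_coeff f) (\<Prod>y\<in>#B. [:- y, 1:])"
    have fg: "f = [:- x, 1:] * ([:- x, 1:] * g)"
      by (subst A(2)) (simp add: B g_def mult_ac del: mult_pCons_left)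
    have "poly f x = 0" "poly (pderiv f) x = 0"
      unfolding fg by (simp_all add: pderiv_mult pderiv_pCons del: mult_pCons_left)
    then show False using sf by blast
  qed
  then have A': "A = mset_set {x. poly f x = 0}"
    using roots f poly_roots_finite[OF f]
    by (intro multiset_eqI) (auto simp: count_mset_set' not_in_iff[symmetric] le_antisym Suc_le_eq)
  show "card {x. poly f x = 0} = Polynomial.degree f"
    using A(1) by (simp add: A')
  show "f = smult (Polynomial.lead_coeff f) (\<Prod>x | poly f x = 0. [:- x, 1:])"
    using A(2) by (simp add: A' prod_unfold_prod_mset)
qed

lemma nth_roots:
  fixes c :: "'a::{alg_closed_field, field_char_0}"
  assumes n: "n > 0" and c: "c \<noteq> 0"
  shows "finite {z. z ^ n = c}" "card {z. z ^ n = c} = n"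
proof -
  define f where "f = Polynomial.monom 1 n + [:- c:]"
  have deg: "Polynomial.degree f = n"
    unfolding f_def using n degree_add_eq_left[of "[:- c:]" "Polynomial.monom 1 n"]
    by (simp add: Polynomial.degree_monom_eq)
  have f: "f \<noteq> 0" using deg n by auto
  have eval: "poly f z = z ^ n - c" for z
    by (simp add: f_def poly_monom)
  have "poly (pderiv f) z = of_nat n * z ^ (n - 1)" for z
    by (simp add: f_def pderiv_add pderiv_monom pderiv_pCons poly_monom)
  then have "poly (pderiv f) z \<noteq> 0" if "poly f z = 0" for z
    using that n c by (auto simp: eval)
  then show "card {z. z ^ n = c} = n" using squarefree_root_count(1)[OF f] deg by (simp add: eval)
  then show "finite {z. z ^ n = c}" using n by (intro card_ge_0_finite) simp
qed

text \<open>If n does not divide i, some n-th root of unity w has w^i \<noteq> 1, since otherwise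
  all n of them would be roots of unity of the smaller order i mod n. Rotating the roots by w
  multiplies the sum by w^i, so it vanishes.\<close>

lemma sum_root_powers:
  fixes c :: "'a::{alg_closed_field, field_char_0}"
  assumes n: "n > 0" and c: "c \<noteq> 0"
  shows "(\<Sum>z | z ^ n = c. z ^ i) = (if n dvd i then of_nat n * c ^ (i div n) else 0)"
proof (cases "n dvd i")
  case True
  then have "(\<Sum>z | z ^ n = c. z ^ i) = (\<Sum>z | z ^ n = c. c ^ (i div n))"
    by (intro sum.cong) (auto simp: power_mult[symmetric])
  then show ?thesis using True nth_roots[OF n c] by simp
next
  case False
  have "\<exists>w::'a. w ^ n = 1 \<and> w ^ i \<noteq> 1"
  proof (rule ccontr)
    assume H: "\<not> ?thesis"
    define r where "r = i mod n"
    have r: "0 < r" "r < n" using False n by (auto simp: r_def dvd_eq_mod_eq_0)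
    have "{z::'a. z ^ n = 1} \<subseteq> {z. z ^ r = 1}"
    proof safe
      fix z :: 'a assume z: "z ^ n = 1"
      have "z ^ i = (z ^ n) ^ (i div n) * z ^ r"
        by (simp add: r_def power_mult[symmetric] power_add[symmetric])
      then show "z ^ r = 1" using z H by auto
    qed
    then have "card {z::'a. z ^ n = 1} \<le> card {z::'a. z ^ r = 1}"
      using nth_roots[OF r(1), of 1] by (intro card_mono) auto
    then show False using nth_roots[OF n, of "1::'a"] nth_roots[OF r(1), of "1::'a"] r by simp
  qed
  then obtain w :: 'a where w: "w ^ n = 1" "w ^ i \<noteq> 1" by blast
  have w0: "w \<noteq> 0" using w n by (auto simp: power_0_left)
  have "(\<Sum>z | z ^ n = c. z ^ i) = (\<Sum>z | z ^ n = c. (w * z) ^ i)"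
    by (rule sum.reindex_bij_witness[of _ "\<lambda>z. w * z" "\<lambda>z. z / w"])
       (use w w0 in \<open>auto simp: power_mult_distrib power_divide\<close>)
  also have "\<dots> = w ^ i * (\<Sum>z | z ^ n = c. z ^ i)"
    by (simp add: power_mult_distrib sum_distrib_left)
  finally show ?thesis using w False by simp
qed

context padic_complex_field
begin

section \<open>Ultrametric estimates\<close>

lemma v_power: "v (x ^ n) = v x ^ n"
  by (induction n) (auto simp: v_1 v_mult)

lemma v_inverse: "v (inverse x) = inverse (v x)"
  using v_divide[of 1 x] by (simp add: v_1 inverse_eq_divide)

lemma v_prod: "v (prod f S) = (\<Prod>i\<in>S. v (f i))"
  by (induction S rule: infinite_finite_induct) (auto simp: v_1 v_mult)

lemma v_sum_le:
  assumes "\<And>i. i \<in> S \<Longrightarrow> v (f i) \<le> B" "0 \<le> B" shows "v (sum f S) \<le> B"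
  using assms(1)
proof (induction S rule: infinite_finite_induct)
  case (insert i S)
  then show ?case using v_add[of "f i" "sum f S"] by fastforce
qed (use assms(2) in \<open>auto simp: v_0\<close>)

lemma v_sum_less:
  assumes "\<And>i. i \<in> S \<Longrightarrow> v (f i) < e" "0 < e" shows "v (sum f S) < e"
  using assms(1)
proof (induction S rule: infinite_finite_induct)
  case (insert i S)
  then show ?case using v_add[of "f i" "sum f S"] by fastforce
qed (use assms(2) in \<open>auto simp: v_0\<close>)

lemma v_add_le: "v x \<le> B \<Longrightarrow> v y \<le> B \<Longrightarrow> v (x + y) \<le> B"
  using v_add[of x y] by simp

lemma v_add_less: "v x < B \<Longrightarrow> v y < B \<Longrightarrow> v (x + y) < B"
  using v_add[of x y] by simp

lemma v_diff_le: "v x \<le> B \<Longrightarrow> v y \<le> B \<Longrightarrow> v (x - y) \<le> B"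
  using v_diff[of x y] by simp

lemma v_diff_less: "v x < B \<Longrightarrow> v y < B \<Longrightarrow> v (x - y) < B"
  using v_diff[of x y] by simp

lemma v_minus_commute: "v (x - y) = v (y - x)"
  using v_uminus[of "x - y"] by simp

lemma v_mult_le_1: "v x \<le> 1 \<Longrightarrow> v y \<le> 1 \<Longrightarrow> v (x * y) \<le> 1"
  by (simp add: v_mult mult_le_one v_nonneg)

lemma v_power_le_1: "v x \<le> 1 \<Longrightarrow> v (x ^ n) \<le> 1"
  by (simp add: v_power power_le_one v_nonneg)

lemma v_of_nat: "v (of_nat n) \<le> 1"
  by (induction n) (auto simp: v_0 v_1 intro: v_add_le)

lemma v_of_int: "v (of_int n) \<le> 1"
  by (cases n rule: int_cases2) (use v_of_nat in \<open>auto simp: v_uminus\<close>)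

lemma v_add_eq: "v y < v x \<Longrightarrow> v (x + y) = v x"
  using v_add[of x y] v_diff[of "x + y" y] by auto

lemma v_eqI: "v (x - y) < v y \<Longrightarrow> v x = v y"
  using v_add_eq[of "x - y" y] by simp

lemma v_of_nat_dvd: "p dvd n \<Longrightarrow> v (of_nat n) \<le> 1 / p"
  using v_of_nat mult_left_mono[of _ 1 "1 / real p"] by (auto simp: v_mult v_p elim!: dvdE)

lemma v_of_int_unit:
  assumes "\<not> int p dvd n" shows "v (of_int n) = 1"
proof -
  have "coprime (int p) n"
    using prime_imp_coprime prime_p assms by (metis prime_nat_int_transfer)
  then obtain s t where "s * int p + t * n = 1" using bezout_int coprime_imp_gcd_eq_1 by metis
  then have "(of_int s * of_nat p + of_int t * of_int n :: 'c) = 1"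
    by (metis of_int_1 of_int_add of_int_mult of_int_of_nat_eq)
  then have "1 \<le> max (v (of_int s) * (1 / p)) (v (of_int t) * v (of_int n))"
    using v_add[of "of_int s * of_nat p" "of_int t * of_int n"] by (simp add: v_1 v_mult v_p)
  moreover have "v (of_int s) * (1 / p) \<le> 1 * (1 / p)"
    by (rule mult_right_mono) (auto simp: v_of_int)
  moreover have "1 / real p < 1" using p_gt_1 by simp
  moreover have "v (of_int t) * v (of_int n) \<le> 1 * v (of_int n)"
    by (rule mult_right_mono) (auto simp: v_of_int v_nonneg)
  ultimately show ?thesis using v_of_int[of n] by linarith
qed

lemma p_pow_gt_1: "m \<ge> 1 \<Longrightarrow> 1 < p ^ m"
  using p_gt_1 using one_less_power[of p m] by simp

text \<open>From k (n choose k) = n (n - 1 choose k - 1) with n = p^m: if p did not divide the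
  binomial coefficient, p^m would divide k.\<close>

lemma v_binomial:
  assumes "0 < k" "k < p ^ m" shows "v (of_nat (p ^ m choose k)) \<le> 1 / p"
proof (rule v_of_nat_dvd)
  have "p ^ m dvd k * (p ^ m choose k)"
    using times_binomial_minus1_eq[of k "p ^ m"] assms by simp
  moreover have "\<not> p ^ m dvd k" using assms by (auto dest: dvd_imp_le)
  ultimately show "p dvd (p ^ m choose k)"
    using prime_p by (metis coprime_dvd_mult_left_iff prime_imp_power_coprime coprime_commute)
qed

text \<open>Expand y = (y - x) + x. The middle terms have a binomial coefficient divisible by p and
  at least one factor y - x; the only other term in the difference is the full power of y -
  x.\<close>

lemma frobenius_diff:
  assumes x: "v x \<le> 1" and d: "v (x - y) \<le> 1"
  shows "v (x ^ (p ^ m) - y ^ (p ^ m)) \<le> max (v (x - y) / p) (v (x - y) ^ (p ^ m))"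
proof -
  let ?n = "p ^ m" and ?d = "y - x"
  have n: "?n > 0" using p_gt_1 by simp
  have dd: "v ?d = v (x - y)" by (rule v_minus_commute)
  have "y ^ ?n = (?d + x) ^ ?n" by simp
  also have "\<dots> = (\<Sum>k\<le>?n. of_nat (?n choose k) * ?d ^ k * x ^ (?n - k))" by (rule binomial_ring)
  also have "{..?n} = insert 0 (insert ?n {0<..<?n})" using n by auto
  finally have "y ^ ?n - x ^ ?n
      = ?d ^ ?n + (\<Sum>k\<in>{0<..<?n}. of_nat (?n choose k) * ?d ^ k * x ^ (?n - k))"
    using n by simp
  moreover have "v (\<Sum>k\<in>{0<..<?n}. of_nat (?n choose k) * ?d ^ k * x ^ (?n - k)) \<le> v (x - y) / p"
  proof (rule v_sum_le)
    fix k assume k: "k \<in> {0<..<?n}"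
    have "v (of_nat (?n choose k)) * v (?d ^ k) * v (x ^ (?n - k)) \<le> 1 / p * v ?d * 1"
    proof (intro mult_mono v_binomial v_power_le_1 x v_nonneg)
      show "v (?d ^ k) \<le> v ?d"
        using k d dd v_nonneg[of ?d] power_decreasing[of 1 k "v ?d"] by (simp add: v_power)
    qed (use k v_nonneg in auto)
    then show "v (of_nat (?n choose k) * ?d ^ k * x ^ (?n - k)) \<le> v (x - y) / p"
      by (simp add: v_mult dd)
  qed (use v_nonneg in auto)
  moreover have "v (?d ^ ?n) = v (x - y) ^ ?n" by (simp add: v_power dd)
  ultimately have "v (y ^ ?n - x ^ ?n) \<le> max (v (x - y) / p) (v (x - y) ^ ?n)"
    using v_add[of "?d ^ ?n" "\<Sum>k\<in>{0<..<?n}. of_nat (?n choose k) * ?d ^ k * x ^ (?n - k)"] by auto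
  then show ?thesis by (simp add: v_minus_commute)
qed

lemma frobenius_contract:
  assumes "v x \<le> 1" "v (x - y) < 1" "m \<ge> 1"
  shows "v (x ^ (p ^ m) - y ^ (p ^ m)) \<le> v (x - y) * max (1 / p) (v (x - y))"
proof -
  have "v (x - y) ^ (p ^ m) \<le> v (x - y) ^ 2"
    using p_pow_gt_1[OF assms(3)] assms(2) v_nonneg by (intro power_decreasing) auto
  then show ?thesis
    using frobenius_diff[of x y m] assms v_nonneg[of "x - y"]
    by (auto simp: max_mult_distrib_left power2_eq_square split: if_splits)
qed

section \<open>Teichmueller representatives\<close>

lemma v_teich_le_1: "z ^ (p ^ m) = z \<Longrightarrow> m \<ge> 1 \<Longrightarrow> v z \<le> 1"
  using p_pow_gt_1[of m] power_strict_increasing[of 1 "p ^ m" "v z"] v_power[of z "p ^ m"]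
  by fastforce

text \<open>Two distinct fixed points of the p^m-th power at distance below 1 would be brought
  strictly closer by it.\<close>

lemma v_teich_diff:
  assumes "m \<ge> 1" "x ^ (p ^ m) = x" "y ^ (p ^ m) = y" "x \<noteq> y"
  shows "v (x - y) = 1"
proof (rule ccontr)
  assume "v (x - y) \<noteq> 1"
  then have d: "v (x - y) < 1" using v_diff_le[of x 1 y] v_teich_le_1 assms by fastforce
  have "v (x - y) \<noteq> 0" using assms v_eq_0_iff by simp
  then have pos: "0 < v (x - y)" using v_nonneg[of "x - y"] by simp
  have "v (x - y) \<le> v (x - y) * max (1 / p) (v (x - y))"
    using frobenius_contract[of x y m] d assms v_teich_le_1[of x m] by simp
  then have "1 \<le> max (1 / p) (v (x - y))" using pos by simp
  moreover have "1 / real p < 1" using p_gt_1 by simp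
  ultimately show False using d by linarith
qed

lemma teich_roots:
  assumes "m \<ge> 1"
  shows "finite {z::'c. z ^ (p ^ m) = z}" "card {z::'c. z ^ (p ^ m) = z} = p ^ m"
proof -
  have "p ^ m \<noteq> 0" using p_gt_1 by simp
  then have pm: "p ^ m = Suc (p ^ m - 1)" by simp
  have "{z::'c. z ^ (p ^ m) = z} = insert 0 {z. z ^ (p ^ m - 1) = 1}"
    by (subst pm) auto
  moreover have n: "p ^ m - 1 > 0" using p_pow_gt_1[OF assms] by simp
  moreover have "0 \<notin> {z::'c. z ^ (p ^ m - 1) = 1}" using n by (simp add: power_0_left)
  ultimately show "finite {z::'c. z ^ (p ^ m) = z}" "card {z::'c. z ^ (p ^ m) = z} = p ^ m"
    using nth_roots[OF n, of "1::'c"] n by auto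
qed

text \<open>A substitute for Hensel's lemma that uses algebraic closedness: X^(p^m) - X splits into
  distinct linear factors, because its derivative at a root differs from -1 by something smaller
  than 1. The product of all |x - z| is then |x^(p^m) - x| < 1, so one factor is below 1.\<close>

lemma teich_exists:
  assumes m: "m \<ge> 1" and x: "v (x ^ (p ^ m) - x) < 1"
  shows "\<exists>z. z ^ (p ^ m) = z \<and> v (x - z) < 1"
proof -
  have n1: "p ^ m > 1" using p_pow_gt_1[OF m] .
  define f :: "'c poly" where "f = Polynomial.monom 1 (p ^ m) + [:0, - 1:]"
  have deg: "Polynomial.degree f = p ^ m"
    unfolding f_def using n1 m degree_add_eq_left[of "[:0, - 1:]" "Polynomial.monom (1::'c) (p ^ m)"]
    by (simp add: Polynomial.degree_monom_eq)
  then have f: "f \<noteq> 0" using n1 p_gt_1 m by auto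
  have eval: "poly f z = z ^ (p ^ m) - z" for z by (simp add: f_def poly_monom)
  have lead: "Polynomial.lead_coeff f = 1" unfolding deg using n1 m by (auto simp: f_def coeff_pCons split: nat.split)
  have "v (of_nat (p ^ m) * z ^ (p ^ m - 1)) < 1" if "z ^ (p ^ m) = z" for z
  proof -
    have "v (of_nat (p ^ m)) \<le> 1 / p" using m by (intro v_of_nat_dvd) simp
    then have "v (of_nat (p ^ m) * z ^ (p ^ m - 1)) \<le> 1 / p * 1"
      unfolding v_mult using v_teich_le_1[OF that m] by (intro mult_mono v_power_le_1 v_nonneg) auto
    then show ?thesis using p_gt_1 by (simp add: le_less_trans)
  qed
  then have "of_nat (p ^ m) * z ^ (p ^ m - 1) \<noteq> 1" if "z ^ (p ^ m) = z" for z :: 'c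
    using that v_1 by fastforce
  moreover have "poly (pderiv f) z = of_nat (p ^ m) * z ^ (p ^ m - 1) - 1" for z
    by (simp add: f_def pderiv_add pderiv_monom pderiv_pCons poly_monom)
  ultimately have sf: "poly (pderiv f) z \<noteq> 0" if "poly f z = 0" for z
    using that by (simp add: eval)
  have "f = smult 1 (\<Prod>x | poly f x = 0. [:- x, 1:])"
    using squarefree_root_count(2)[OF f sf] by (simp only: lead)
  then have "poly f x = poly (smult 1 (\<Prod>x | poly f x = 0. [:- x, 1:])) x" by (rule arg_cong)
  then have "poly f x = (\<Prod>z | poly f z = 0. x - z)" by (simp add: poly_prod)
  then have prod: "(\<Prod>z | poly f z = 0. v (x - z)) < 1" using x by (simp add: eval flip: v_prod)
  have "\<exists>z. poly f z = 0 \<and> v (x - z) < 1"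
  proof (rule ccontr)
    assume "\<not> ?thesis"
    then have "1 \<le> (\<Prod>z | poly f z = 0. v (x - z))" by (intro prod_ge_1) force
    then show False using prod by simp
  qed
  then show ?thesis by (simp add: eval)
qed

lemma teich_power: "z ^ n = z \<Longrightarrow> z ^ (n ^ k) = (z::'c)"
  by (induction k) (auto simp: power_mult)

text \<open>Both points are fixed by the common power p^(m n), so they cannot be distinct and closer
  than 1.\<close>

lemma teich_unique:
  assumes "m \<ge> 1" "x ^ (p ^ m) = x" "n \<ge> 1" "y ^ (p ^ n) = y" "v (x - y) < 1"
  shows "x = y"
proof (rule ccontr)
  assume "x \<noteq> y"
  moreover have "x ^ (p ^ (m * n)) = x"
    using teich_power[OF assms(2), of n] by (simp only: power_mult)
  moreover have "y ^ (p ^ (m * n)) = y"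
    using teich_power[OF assms(4), of m] by (simp only: power_mult mult.commute[of m n])
  ultimately show False using v_teich_diff[of "m * n" x y] assms by simp
qed

section \<open>Unramified extensions\<close>

lemma Qp_approx: "x \<in> Qp v \<Longrightarrow> 0 < e \<Longrightarrow> \<exists>r. v (x - of_rat r) < e"
  by (simp add: Qp_def)

lemma Qp_of_rat: "of_rat r \<in> Qp v"
  by (auto simp: Qp_def v_0 intro!: exI[of _ r])

lemma Qp_of_int: "of_int n \<in> Qp v"
  using Qp_of_rat[of "of_int n"] by simp

lemma Qp_closed:
  assumes "\<And>e. 0 < e \<Longrightarrow> \<exists>y\<in>Qp v. v (x - y) < e" shows "x \<in> Qp v"
  unfolding Qp_def
proof (intro CollectI allI impI)
  fix e :: real assume e: "0 < e"
  then obtain y where y: "y \<in> Qp v" "v (x - y) < e" using assms by blast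
  then obtain r where "v (y - of_rat r) < e" using Qp_approx e by blast
  with y have "v ((x - y) + (y - of_rat r)) < e" by (intro v_add_less)
  then show "\<exists>r. v (x - of_rat r) < e" by auto
qed

lemma Qp_add: "x \<in> Qp v \<Longrightarrow> y \<in> Qp v \<Longrightarrow> x + y \<in> Qp v"
proof (rule Qp_closed)
  fix e :: real assume xy: "x \<in> Qp v" "y \<in> Qp v" "0 < e"
  then obtain r s where "v (x - of_rat r) < e" "v (y - of_rat s) < e" using Qp_approx by meson
  then have "v ((x - of_rat r) + (y - of_rat s)) < e" by (rule v_add_less)
  then have "v (x + y - of_rat (r + s)) < e" by (simp add: of_rat_add algebra_simps)
  then show "\<exists>z\<in>Qp v. v (x + y - z) < e" using Qp_of_rat by blast
qed

lemma Qp_uminus: "x \<in> Qp v \<Longrightarrow> - x \<in> Qp v"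
proof (rule Qp_closed)
  fix e :: real assume "x \<in> Qp v" "0 < e"
  then obtain r where "v (x - of_rat r) < e" using Qp_approx by meson
  then have "v (- x - of_rat (- r)) < e" using v_uminus[of "x - of_rat r"] by (simp add: of_rat_minus)
  then show "\<exists>z\<in>Qp v. v (- x - z) < e" using Qp_of_rat by blast
qed

lemma Qp_mult:
  assumes "x \<in> Qp v" "y \<in> Qp v" shows "x * y \<in> Qp v"
proof (rule Qp_closed)
  fix e :: real assume e: "0 < e"
  define d where "d = min 1 (e / (max 1 (max (v x) (v y))))"
  have d: "0 < d" "d \<le> 1" using e by (auto simp: d_def)
  obtain r s where rs: "v (x - of_rat r) < d" "v (y - of_rat s) < d"
    using Qp_approx[OF _ d(1)] assms by meson
  have small: "d * max 1 (max (v x) (v y)) \<le> e"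
  proof -
    have "d * max 1 (max (v x) (v y)) \<le> e / max 1 (max (v x) (v y)) * max 1 (max (v x) (v y))"
      by (rule mult_right_mono) (auto simp: d_def)
    then show ?thesis by simp
  qed
  have vs: "v (of_rat s) \<le> max 1 (v y)"
    using v_diff[of y "y - of_rat s"] rs d by auto
  have "v ((x - of_rat r) * of_rat s) < e"
  proof (cases "v (of_rat s) = 0")
    case False
    then have "v (x - of_rat r) * v (of_rat s) < d * v (of_rat s)"
      using rs v_nonneg[of "of_rat s"] by (intro mult_strict_right_mono) auto
    also have "\<dots> \<le> d * max 1 (max (v x) (v y))"
      using vs d by (intro mult_left_mono) auto
    finally show ?thesis using small by (simp add: v_mult)
  qed (simp add: v_mult e)
  moreover have "v (x * (y - of_rat s)) < e"
  proof (cases "v x = 0")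
    case False
    then have "v x * v (y - of_rat s) < v x * d"
      using rs v_nonneg[of x] by (intro mult_strict_left_mono) auto
    also have "\<dots> \<le> max 1 (max (v x) (v y)) * d"
      using d by (intro mult_right_mono) auto
    finally show ?thesis using small by (simp add: v_mult mult.commute)
  qed (simp add: v_mult e)
  ultimately have "v ((x - of_rat r) * of_rat s + x * (y - of_rat s)) < e"
    by (rule v_add_less)
  moreover have "(x - of_rat r) * of_rat s + x * (y - of_rat s) = x * y - of_rat (r * s)"
    by (simp add: of_rat_mult algebra_simps)
  ultimately show "\<exists>z\<in>Qp v. v (x * y - z) < e" using Qp_of_rat by metis
qed

lemma Qp_inverse:
  assumes x: "x \<in> Qp v" shows "inverse x \<in> Qp v"
proof (cases "x = 0")
  case True then show ?thesis using Qp_of_int[of 0] by simp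
next
  case False
  then have vx: "0 < v x" using v_nonneg[of x] v_eq_0_iff[of x] by simp
  show ?thesis
  proof (rule Qp_closed)
    fix e :: real assume e: "0 < e"
    have "0 < min (v x) (e * (v x)\<^sup>2)" using vx e by simp
    then obtain r where r: "v (x - of_rat r) < min (v x) (e * (v x)\<^sup>2)"
      using Qp_approx[OF x] by blast
    have vr: "v (of_rat r) = v x"
      using v_eqI[of "of_rat r" x] r v_minus_commute by simp
    then have r0: "of_rat r \<noteq> (0::'c)" using vx by (auto simp: v_0)
    have "inverse x - of_rat (inverse r) = (of_rat r - x) * inverse x * inverse (of_rat r)"
      using False r0 by (simp add: of_rat_inverse) (simp add: field_simps)
    then have "v (inverse x - of_rat (inverse r)) = v (x - of_rat r) / (v x)\<^sup>2"
      by (simp add: v_mult v_inverse vr v_minus_commute[of x] power2_eq_square divide_inverse)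
    also have "\<dots> < e" using r vx by (simp add: divide_less_eq)
    finally show "\<exists>z\<in>Qp v. v (inverse x - z) < e" using Qp_of_rat by blast
  qed
qed

lemma Qp_rat_quotient:
  assumes x: "x \<in> Qp v" "x \<noteq> 0" and e: "0 < e"
  obtains a b where "coprime a b" "b \<noteq> 0" "v (x - of_int a / of_int b) < e"
    "v x = v (of_int a) / v (of_int b)"
proof -
  have "0 < min e (v x)" using e x v_nonneg[of x] v_eq_0_iff[of x] by simp
  then obtain r where r: "v (x - of_rat r) < min e (v x)" using Qp_approx[OF x(1)] by blast
  obtain a b where ab: "quotient_of r = (a, b)" by force
  have q: "of_rat r = (of_int a / of_int b :: 'c)"
    using quotient_of_div[OF ab] by (simp add: of_rat_divide)
  have "v x = v (of_rat r)" using v_eqI[of "of_rat r" x] r v_minus_commute by simp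
  then show ?thesis
    using that[of a b] r quotient_of_coprime[OF ab] quotient_of_denom_pos[OF ab]
    by (auto simp: q v_divide)
qed

lemma v_of_int_le: "int p dvd n \<Longrightarrow> v (of_int n) \<le> 1 / p"
proof -
  assume "int p dvd n"
  then obtain m where n: "n = int p * m" by auto
  have "v (of_nat p) * v (of_int m) \<le> v (of_nat p) * 1"
    by (rule mult_left_mono) (auto simp: v_of_int v_nonneg)
  then show ?thesis by (simp add: n v_mult v_p)
qed

lemma v_of_int_less_1_iff: "v (of_int n) < 1 \<longleftrightarrow> int p dvd n"
proof -
  have "1 / real p < 1" using p_gt_1 by simp
  then show ?thesis using v_of_int_le[of n] v_of_int_unit[of n] by linarith
qed

lemma coprime_not_both: "coprime a b \<Longrightarrow> int p dvd a \<Longrightarrow> \<not> int p dvd b"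
  using coprime_common_divisor[of a b "int p"] p_gt_1 by auto

text \<open>x has the absolute value of a nearby fraction in lowest terms; if that is below 1, then
  p divides the numerator and the denominator is a unit.\<close>

lemma Qp_value_gap:
  assumes "x \<in> Qp v" "v x < 1" shows "v x \<le> 1 / p"
proof (cases "x = 0")
  case False
  obtain a b where ab: "coprime a b" "b \<noteq> 0" "v x = v (of_int a) / v (of_int b)"
    using Qp_rat_quotient[OF assms(1) False zero_less_one] by metis
  have b0: "0 < v (of_int b)" using ab(2) v_nonneg[of "of_int b"] v_eq_0_iff[of "of_int b"] by simp
  have "v (of_int a) < 1"
    using ab(3) assms(2) b0 v_of_int[of b] by (simp add: divide_less_eq)
  then have pa: "int p dvd a" using v_of_int_less_1_iff by simp
  then have "v (of_int b) = 1" using coprime_not_both[OF ab(1)] v_of_int_unit by blast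
  then show ?thesis using v_of_int_le[OF pa] ab(3) by simp
qed (simp add: v_0)

text \<open>A fraction a / b in lowest terms close to x has b prime to p. If t inverts b modulo p,
  then a t is an integer in the residue class of x.\<close>

lemma Qp_digit:
  assumes "x \<in> Qp v" "v x \<le> 1" shows "\<exists>d. v (x - of_int d) < 1"
proof (cases "x = 0")
  case False
  obtain a b where ab: "coprime a b" "b \<noteq> 0" "v (x - of_int a / of_int b) < 1"
    "v x = v (of_int a) / v (of_int b)"
    using Qp_rat_quotient[OF assms(1) False zero_less_one] by metis
  have b0: "0 < v (of_int b)" using ab(2) v_nonneg[of "of_int b"] v_eq_0_iff[of "of_int b"] by simp
  have pb: "\<not> int p dvd b"
  proof
    assume pb: "int p dvd b"
    then have "v (of_int a) = 1" using coprime_not_both ab(1) v_of_int_unit by blast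
    moreover have "v (of_int b) < 1" using pb v_of_int_less_1_iff by simp
    ultimately show False using ab(4) assms(2) b0 by (simp add: divide_le_eq)
  qed
  then have "coprime (int p) b" using prime_imp_coprime prime_p prime_nat_int_transfer by metis
  then obtain s t where "s * int p + t * b = 1" using bezout_int coprime_imp_gcd_eq_1 by metis
  then have st: "of_int s * of_nat p + of_int t * of_int b = (1::'c)"
    by (metis of_int_1 of_int_add of_int_mult of_int_of_nat_eq)
  have "of_int a / of_int b - of_int (a * t)
      = of_int a / of_int b * (of_int s * of_nat p + of_int t * of_int b - of_int t * of_int b :: 'c)"
    using st ab(2) by (simp add: field_simps)
  then have "v (of_int a / of_int b - of_int (a * t)) = v x * (v (of_int s) * (1 / p))"
    by (simp add: v_mult v_p ab(4) v_divide)
  also have "\<dots> \<le> 1 * (1 * (1 / p))"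
    using assms(2) v_of_int v_nonneg by (intro mult_mono) auto
  also have "\<dots> < 1" using p_gt_1 by simp
  finally have "v ((x - of_int a / of_int b) + (of_int a / of_int b - of_int (a * t))) < 1"
    using ab(3) by (intro v_add_less)
  then show ?thesis by (auto simp: algebra_simps simp del: of_int_mult)
qed (auto intro: exI[of _ 0] simp: v_0)

section \<open>Linear algebra over Q_p inside C_p\<close>

interpretation Cf: field "ring_of_type_algebra :: 'c ring"
  by (rule field_from_type_algebra)

lemma rta_simps:
  "carrier (ring_of_type_algebra :: 'c ring) = UNIV" "x \<otimes>\<^bsub>ring_of_type_algebra\<^esub> y = x * (y::'c)"
  "x \<oplus>\<^bsub>ring_of_type_algebra\<^esub> y = x + (y::'c)" "\<one>\<^bsub>ring_of_type_algebra\<^esub> = (1::'c)"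
  "\<zero>\<^bsub>ring_of_type_algebra\<^esub> = (0::'c)"
  by (simp_all add: ring_of_type_algebra_def)

lemma rta_minus: "\<ominus>\<^bsub>ring_of_type_algebra\<^esub> x = - (x::'c)"
  using Cf.minus_equality[of "- x" x] by (simp add: rta_simps)

lemma rta_inv: "x \<noteq> 0 \<Longrightarrow> inv\<^bsub>ring_of_type_algebra\<^esub> x = inverse (x::'c)"
  using Cf.inv_char[of x "inverse x"] by (simp add: rta_simps)

lemma Qp_subfield: "subfield (Qp v) (ring_of_type_algebra :: 'c ring)"
proof (rule Cf.subfieldI')
  show "subring (Qp v) (ring_of_type_algebra :: 'c ring)"
    by (rule Cf.subringI)
       (use Qp_of_int[of 1] in \<open>auto simp: rta_simps rta_minus Qp_uminus Qp_mult Qp_add\<close>)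
qed (simp add: rta_simps rta_inv Qp_inverse)

lemma combine_sum:
  "length Ks = length Us \<Longrightarrow> Cf.combine Ks Us = (\<Sum>i<length Us. Ks ! i * Us ! i)"
  by (induction Ks Us rule: list_induct2) (auto simp: rta_simps sum.lessThan_Suc_shift simp del: sum.lessThan_Suc)

end

locale unramified = padic_complex_field p v for p and v :: "'c::{alg_closed_field, field_char_0} \<Rightarrow> real" +
  fixes a :: nat and K :: "'c set"
  assumes K: "unramified_extension v a K" and a_pos: "1 \<le> a"
begin

interpretation Cf: field "ring_of_type_algebra :: 'c ring"
  by (rule field_from_type_algebra)

lemma K_subfield: "subfield K (ring_of_type_algebra :: 'c ring)" and Qp_K: "Qp v \<subseteq> K"
  and K_dimension: "Cf.dimension a (Qp v) K" and K_values: "v ` K = v ` Qp v"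
  using K by (auto simp: unramified_extension_def)

lemma K_0: "0 \<in> K" and K_1: "1 \<in> K"
  and K_add: "x \<in> K \<Longrightarrow> y \<in> K \<Longrightarrow> x + y \<in> K"
  and K_mult: "x \<in> K \<Longrightarrow> y \<in> K \<Longrightarrow> x * y \<in> K"
  using subfield_K[OF K] by auto

lemma K_of_int: "of_int n \<in> K"
  using Qp_of_int Qp_K by blast

lemma K_uminus: "x \<in> K \<Longrightarrow> - x \<in> K"
  using K_mult[OF K_of_int[of "- 1"]] by simp

lemma K_diff: "x \<in> K \<Longrightarrow> y \<in> K \<Longrightarrow> x - y \<in> K"
  using K_add[OF _ K_uminus] by fastforce

lemma K_inverse: "x \<in> K \<Longrightarrow> inverse x \<in> K"
proof (cases "x = 0")
  case False
  assume "x \<in> K"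
  then have "inv\<^bsub>ring_of_type_algebra\<^esub> x \<in> K" using Cf.subfield_m_inv(1)[OF K_subfield] False
    by (simp add: rta_simps)
  then show ?thesis using rta_inv[OF False] by simp
qed (simp add: K_0)

lemma K_sum: "(\<And>i. i \<in> I \<Longrightarrow> f i \<in> K) \<Longrightarrow> sum f I \<in> K"
  by (induction I rule: infinite_finite_induct) (auto intro: K_0 K_add)

lemma K_value_gap: "x \<in> K \<Longrightarrow> v x < 1 \<Longrightarrow> v x \<le> 1 / p"
proof -
  assume "x \<in> K" "v x < 1"
  moreover from this(1) obtain y where "y \<in> Qp v" "v x = v y" using K_values by blast
  ultimately show ?thesis using Qp_value_gap[of y] by simp
qed

section \<open>Residue degree of K and completeness of Z_q\<close>

abbreviation "ZK \<equiv> Zq v K"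

lemma O_iff: "x \<in> ZK \<longleftrightarrow> x \<in> K \<and> v x \<le> 1"
  by (simp add: Zq_def)

text \<open>The residues of the e i are linearly independent over the field with p elements.
  Integers stand for their classes modulo p, which avoids working in the quotient.\<close>

definition res_indep :: "nat \<Rightarrow> (nat \<Rightarrow> 'c) \<Rightarrow> bool" where
  "res_indep n e \<longleftrightarrow> (\<forall>i<n. e i \<in> ZK) \<and>
     (\<forall>m. v (\<Sum>i<n. of_int (m i) * e i) < 1 \<longrightarrow> (\<forall>i<n. int p dvd m i))"

text \<open>If the sum is below 1, independence makes every m i divisible by p, and dividing by p
  lowers N by one. So a small combination forces each coefficient to be equally small.\<close>

lemma res_indep_digits:
  assumes e: "res_indep n e" and "v (\<Sum>i<n. of_int (m i) * e i) \<le> (1 / p) ^ N" and "i < n"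
  shows "v (of_int (m i)) \<le> (1 / p) ^ N"
  using assms(2)
proof (induction N arbitrary: m)
  case 0 show ?case using v_of_int by simp
next
  case (Suc N)
  have "(1 / real p) ^ Suc N < 1" using p_gt_1 by (intro power_Suc_less_one) auto
  then have "\<forall>i<n. int p dvd m i" using e Suc.prems unfolding res_indep_def by fastforce
  then have m: "m i = int p * (m i div int p)" if "i < n" for i using that by simp
  define m' where "m' = (\<lambda>i. m i div int p)"
  have m': "m i = int p * m' i" if "i < n" for i using m[OF that] by (simp add: m'_def)
  have "(\<Sum>i<n. of_int (m i) * e i) = of_nat p * (\<Sum>i<n. of_int (m' i) * e i)"
    by (simp add: sum_distrib_left m' mult.assoc)
  then have "1 / p * v (\<Sum>i<n. of_int (m' i) * e i) \<le> 1 / p * (1 / p) ^ N"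
    using Suc.prems by (simp add: v_mult v_p)
  then have "v (\<Sum>i<n. of_int (m' i) * e i) \<le> (1 / p) ^ N" using p_gt_1 by (simp add: divide_simps)
  then have "v (of_int (m' i)) \<le> (1 / p) ^ N" by (rule Suc.IH)
  then show ?case using m'[OF assms(3)] p_gt_1 by (simp add: v_mult v_p divide_simps)
qed

text \<open>Divide a relation by a coefficient of largest absolute value and replace the quotients
  by integer digits. The result is a relation between residues in which one digit is congruent to 1,
  against residual independence.\<close>

lemma res_indep_trivial:
  assumes e: "res_indep n e" and c: "\<And>i. i < n \<Longrightarrow> c i \<in> Qp v" and 0: "(\<Sum>i<n. c i * e i) = 0"
    and i: "i < n"
  shows "c i = 0"
proof (rule ccontr)
  assume ci: "c i \<noteq> 0"
  have "finite (v ` c ` {..<n})" "v ` c ` {..<n} \<noteq> {}" using i by auto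
  from Max_in[OF this] obtain k where k: "k < n" "v (c k) = Max (v ` c ` {..<n})" by auto
  have max: "v (c j) \<le> v (c k)" if "j < n" for j
    unfolding k(2) using that by (intro Max_ge) auto
  have ck: "c k \<noteq> 0" using max[OF i] ci v_eq_0_iff v_nonneg by (metis order_antisym)
  then have vck: "0 < v (c k)" using v_nonneg[of "c k"] v_eq_0_iff[of "c k"] by simp
  have "\<exists>d. v (c j / c k - of_int d) < 1" if "j < n" for j
  proof (rule Qp_digit)
    show "c j / c k \<in> Qp v" using c that k(1) Qp_mult Qp_inverse by (simp add: divide_inverse)
    show "v (c j / c k) \<le> 1" using max[OF that] vck by (simp add: v_divide)
  qed
  then obtain d where d: "\<And>j. j < n \<Longrightarrow> v (c j / c k - of_int (d j)) < 1" by metis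
  have "(\<Sum>j<n. c j / c k * e j) = 0" using 0 by (simp flip: sum_divide_distrib)
  then have "(\<Sum>j<n. of_int (d j) * e j) = - (\<Sum>j<n. (c j / c k - of_int (d j)) * e j)"
    by (simp add: sum_subtractf left_diff_distrib)
  moreover have "v (\<Sum>j<n. (c j / c k - of_int (d j)) * e j) < 1"
  proof (rule v_sum_less)
    fix j assume "j \<in> {..<n}"
    then have j: "j < n" by simp
    have "v (c j / c k - of_int (d j)) * v (e j) \<le> v (c j / c k - of_int (d j)) * 1"
      using e j by (intro mult_left_mono) (auto simp: res_indep_def O_iff v_nonneg)
    then show "v ((c j / c k - of_int (d j)) * e j) < 1" using d[OF j] by (simp add: v_mult)
  qed simp
  ultimately have "int p dvd d k" using e k(1) by (simp add: res_indep_def v_uminus)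
  then have "v (of_int (d k)) < 1" by (simp add: v_of_int_less_1_iff)
  then have "v (c k / c k - of_int (d k) + of_int (d k)) < 1" using d[OF k(1)] by (intro v_add_less)
  then show False using ck by (simp add: v_1)
qed

lemma res_indep_independent:
  assumes e: "res_indep n e" shows "Cf.independent (Qp v) (map e [0..<n])"
proof (rule ccontr)
  assume nt: "\<not> ?thesis"
  then obtain Ks where Ks: "length Ks = length (map e [0..<n])" "Cf.combine Ks (map e [0..<n]) = 0"
    "set Ks \<subseteq> Qp v" "set Ks \<noteq> {0}"
    using Cf.dependent_imp_non_trivial_combine[OF Qp_subfield, of "map e [0..<n]"]
    by (auto simp: rta_simps)
  have l: "length Ks = n" using Ks(1) by simp
  have "(\<Sum>i<n. Ks ! i * e i) = 0" using Ks(2) combine_sum[OF Ks(1)] by simp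
  moreover have "Ks ! i \<in> Qp v" if "i < n" for i using Ks(3) l that nth_mem by blast
  ultimately have "Ks ! i = 0" if "i < n" for i
    using res_indep_trivial[OF e, of "\<lambda>i. Ks ! i"] that by blast
  then have "set Ks \<subseteq> {0}" using l by (auto simp: in_set_conv_nth)
  then have "Ks = []" using Ks(4) by (cases Ks) auto
  then have "n = 0" using l by simp
  then have "Cf.independent (Qp v) (map e [0..<n])" by simp
  then show False using nt by blast
qed

lemma res_indep_le:
  assumes e: "res_indep n e" shows "n \<le> a"
proof -
  have "set (map e [0..<n]) \<subseteq> K" using e by (auto simp: res_indep_def O_iff)
  from Cf.independent_length_le_dimension[OF Qp_subfield K_dimension res_indep_independent[OF e] this]
  show ?thesis by simp
qed

lemma res_indep_maximal: "\<exists>n e. res_indep n e \<and> (\<forall>e'. \<not> res_indep (Suc n) e')"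
proof -
  have "res_indep 0 undefined" by (simp add: res_indep_def)
  then have ex: "\<exists>e. res_indep 0 e" by blast
  define n where "n = (GREATEST n. \<exists>e. res_indep n e)"
  have "\<exists>e. res_indep n e" unfolding n_def
    by (rule GreatestI_nat[where P = "\<lambda>n. \<exists>e. res_indep n e" and k = 0 and b = a])
       (use ex res_indep_le in blast)+
  moreover have "\<not> res_indep (Suc n) e" for e
  proof
    assume "res_indep (Suc n) e"
    then have "Suc n \<le> n" unfolding n_def
      by (intro Greatest_le_nat[where P = "\<lambda>n. \<exists>e. res_indep n e" and b = a]) (use res_indep_le in blast)+
    then show False by simp
  qed
  ultimately show ?thesis by blast
qed

lemma ZK_diff: "x \<in> ZK \<Longrightarrow> y \<in> ZK \<Longrightarrow> x - y \<in> ZK"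
  by (auto simp: O_iff intro: K_diff v_diff_le)

lemma ZK_mult: "x \<in> ZK \<Longrightarrow> y \<in> ZK \<Longrightarrow> x * y \<in> ZK"
  by (auto simp: O_iff intro: K_mult v_mult_le_1)

lemma ZK_power: "x \<in> ZK \<Longrightarrow> x ^ n \<in> ZK"
  by (induction n) (auto simp: ZK_mult, simp add: O_iff K_1 v_1)

lemma res_indep_sum_ZK: "res_indep n e \<Longrightarrow> (\<Sum>i<n. of_int (m i) * e i) \<in> ZK"
  by (auto simp: O_iff res_indep_def intro!: K_sum K_mult K_of_int v_sum_le v_mult_le_1 v_of_int)

lemma res_indepD:
  "res_indep n e \<Longrightarrow> v (\<Sum>i<n. of_int (m i) * e i) < 1 \<Longrightarrow> i < n \<Longrightarrow> int p dvd m i"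
  by (simp add: res_indep_def)

text \<open>By maximality, adjoining x creates a relation between residues. The coefficient of x in
  it is prime to p, as otherwise the relation would already concern the e i alone; inverting it
  modulo p solves for x.\<close>

lemma residue_combination:
  assumes e: "res_indep n e" and max: "\<And>e'. \<not> res_indep (Suc n) e'" and x: "x \<in> ZK"
  shows "\<exists>m. v (x - (\<Sum>i<n. of_int (m i) * e i)) < 1"
proof -
  have "\<not> res_indep (Suc n) (e(n := x))" by (rule max)
  moreover have "\<forall>i<Suc n. (e(n := x)) i \<in> ZK" using e x by (auto simp: res_indep_def less_Suc_eq)
  moreover have "(\<Sum>i<n. of_int (m i) * (if i = n then x else e i)) = (\<Sum>i<n. of_int (m i) * e i)" for m
    by (intro sum.cong) auto
  ultimately obtain m where m: "v ((\<Sum>i<n. of_int (m i) * e i) + of_int (m n) * x) < 1"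
    "\<not> (\<forall>i<Suc n. int p dvd m i)"
    by (auto simp: res_indep_def)
  have "\<not> int p dvd m n"
  proof
    assume d: "int p dvd m n"
    have "v (of_int (m n)) * v x \<le> v (of_int (m n)) * 1"
      using x by (intro mult_left_mono) (auto simp: O_iff v_nonneg)
    also have "\<dots> < 1" using d v_of_int_less_1_iff by simp
    finally have "v (((\<Sum>i<n. of_int (m i) * e i) + of_int (m n) * x) - of_int (m n) * x) < 1"
      using m(1) by (intro v_diff_less) (auto simp: v_mult)
    then have "\<forall>i<n. int p dvd m i" using e by (simp add: res_indep_def)
    with d m(2) show False by (simp add: less_Suc_eq)
  qed
  then have "coprime (int p) (m n)" using prime_imp_coprime prime_p prime_nat_int_transfer by metis
  then obtain s t where "s * int p + t * m n = 1" using bezout_int coprime_imp_gcd_eq_1 by metis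
  then have st: "of_int s * of_nat p + of_int t * of_int (m n) = (1::'c)"
    by (metis of_int_1 of_int_add of_int_mult of_int_of_nat_eq)
  let ?S = "\<Sum>i<n. of_int (m i) * e i"
  have "x - (\<Sum>i<n. of_int (- t * m i) * e i) = 1 * x + of_int t * ?S"
    by (simp add: sum_distrib_left sum_negf mult.assoc)
  also have "\<dots> = of_int t * (?S + of_int (m n) * x) + of_int s * of_nat p * x"
    unfolding st[symmetric] by (simp add: algebra_simps)
  also have "v \<dots> < 1"
  proof (rule v_add_less)
    have "v (of_int t) * v (?S + of_int (m n) * x) \<le> 1 * v (?S + of_int (m n) * x)"
      by (intro mult_right_mono v_of_int v_nonneg)
    then show "v (of_int t * (?S + of_int (m n) * x)) < 1" using m(1) by (simp add: v_mult)
    have "v (of_int s) * (1 / p) * v x \<le> 1 * (1 / p) * 1"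
      using x by (intro mult_mono v_of_int v_nonneg) (auto simp: O_iff v_nonneg)
    also have "\<dots> < 1" using p_gt_1 by simp
    finally show "v (of_int s * of_nat p * x) < 1" by (simp add: v_mult v_p)
  qed
  finally show ?thesis by (intro exI[of _ "\<lambda>i. - t * m i"])
qed

text \<open>This is the p-adic expansion with respect to the e i. An error below 1 is at most 1 / p,
  because K has the same absolute values as Q_p; so after division by p^N the remainder is integral
  and the next digits can be extracted.\<close>

lemma integral_approx:
  assumes e: "res_indep n e" and max: "\<And>e'. \<not> res_indep (Suc n) e'" and x: "x \<in> ZK"
  shows "\<exists>m. v (x - (\<Sum>i<n. of_int (m i) * e i)) \<le> (1 / p) ^ N"
proof (induction N)
  case 0
  show ?case using x by (intro exI[of _ "\<lambda>_. 0"]) (simp add: O_iff)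
next
  case (Suc N)
  then obtain m where m: "v (x - (\<Sum>i<n. of_int (m i) * e i)) \<le> (1 / p) ^ N" by blast
  define y where "y = (x - (\<Sum>i<n. of_int (m i) * e i)) / of_nat (p ^ N)"
  have p0: "of_nat p ^ N \<noteq> (0::'c)" using p_gt_1 by simp
  have "y \<in> K" unfolding y_def divide_inverse
    using x res_indep_sum_ZK[OF e] K_of_int[of "int (p ^ N)"]
    by (intro K_mult K_diff K_inverse) (auto simp: O_iff)
  moreover have "v y \<le> 1" using m p_gt_1
    by (simp add: y_def v_divide v_power v_p power_one_over divide_le_eq field_simps)
  ultimately have y: "y \<in> ZK" by (simp add: O_iff)
  obtain m' where m': "v (y - (\<Sum>i<n. of_int (m' i) * e i)) < 1"
    using residue_combination[OF e max y] by blast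
  have "y - (\<Sum>i<n. of_int (m' i) * e i) \<in> K"
    using y res_indep_sum_ZK[OF e] by (intro K_diff) (auto simp: O_iff)
  from K_value_gap[OF this m'] have g: "v (y - (\<Sum>i<n. of_int (m' i) * e i)) \<le> 1 / p" .
  have "x - (\<Sum>i<n. of_int (m i + int (p ^ N) * m' i) * e i)
      = of_nat p ^ N * (y - (\<Sum>i<n. of_int (m' i) * e i))"
  proof -
    have "of_nat p ^ N * y = x - (\<Sum>i<n. of_int (m i) * e i)" using p0 by (simp add: y_def)
    then show ?thesis by (simp add: sum.distrib distrib_right sum_distrib_left right_diff_distrib mult.assoc)
  qed
  then have "v (x - (\<Sum>i<n. of_int (m i + int (p ^ N) * m' i) * e i)) \<le> (1 / p) ^ N * (1 / p)"
    using g by (simp only: v_mult v_power v_p) (intro mult_left_mono, auto)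
  then have "v (x - (\<Sum>i<n. of_int (m i + int (p ^ N) * m' i) * e i)) \<le> (1 / p) ^ Suc N"
    by (simp add: mult.commute)
  then show ?case by (intro exI[of _ "\<lambda>i. m i + int (p ^ N) * m' i"])
qed

text \<open>By \<open>res_indep_digits\<close> the coefficients of successive approximations are
  Cauchy, each for itself. Their limits are in Q_p and give the coordinates of x.\<close>

lemma approx_in_span:
  assumes e: "res_indep n e"
    and x: "\<And>N. \<exists>m. v (x - (\<Sum>i<n. of_int (m i) * e i)) \<le> (1 / p) ^ N"
  shows "\<exists>c. (\<forall>i. c i \<in> Qp v) \<and> x = (\<Sum>i<n. c i * e i)"
proof -
  obtain m where m: "\<And>N. v (x - (\<Sum>i<n. of_int (m N i) * e i)) \<le> (1 / p) ^ N" using x by metis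
  have lim0: "(\<lambda>N. (1 / real p) ^ N) \<longlonglongrightarrow> 0" by (rule LIMSEQ_realpow_zero) (use p_gt_1 in auto)
  have diff: "v (of_int (m M i) - of_int (m N i)) \<le> (1 / p) ^ k" if "i < n" "k \<le> M" "k \<le> N" for M N i k
  proof -
    have mono: "(1 / real p) ^ M \<le> (1 / real p) ^ k" "(1 / real p) ^ N \<le> (1 / real p) ^ k"
      using that p_gt_1 by (auto intro!: power_decreasing)
    have "v ((x - (\<Sum>i<n. of_int (m N i) * e i)) - (x - (\<Sum>i<n. of_int (m M i) * e i))) \<le> (1 / p) ^ k"
      by (rule v_diff_le[OF order_trans[OF m mono(2)] order_trans[OF m mono(1)]])
    moreover have "(x - (\<Sum>i<n. of_int (m N i) * e i)) - (x - (\<Sum>i<n. of_int (m M i) * e i))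
        = (\<Sum>i<n. of_int (m M i - m N i) * e i)"
      by (simp add: sum_subtractf left_diff_distrib)
    ultimately have "v (\<Sum>i<n. of_int (m M i - m N i) * e i) \<le> (1 / p) ^ k" by simp
    from res_indep_digits[OF e this that(1)] show ?thesis by simp
  qed
  have "\<exists>c. (\<lambda>N. v (of_int (m N i) - c)) \<longlonglongrightarrow> 0" if i: "i < n" for i
  proof (rule v_complete, intro allI impI)
    fix d :: real assume "0 < d"
    then obtain k where "(1 / real p) ^ k < d"
      using order_tendstoD(2)[OF lim0] by (auto simp: eventually_sequentially)
    then show "\<exists>k. \<forall>M\<ge>k. \<forall>N\<ge>k. v (of_int (m M i) - of_int (m N i)) < d"
      using diff[OF i] by (meson order_le_less_trans)
  qed
  then obtain c where c: "\<And>i. i < n \<Longrightarrow> (\<lambda>N. v (of_int (m N i) - c i)) \<longlonglongrightarrow> 0" by metis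
  define c' where "c' = (\<lambda>i. if i < n then c i else 0)"
  have "c' i \<in> Qp v" for i
  proof (cases "i < n")
    case True
    show ?thesis
    proof (rule Qp_closed)
      fix d :: real assume "0 < d"
      then obtain N where "v (of_int (m N i) - c i) < d"
        using order_tendstoD(2)[OF c[OF True]] by (auto simp: eventually_sequentially)
      then show "\<exists>y\<in>Qp v. v (c' i - y) < d"
        using True by (intro bexI[OF _ Qp_of_int[of "m N i"]]) (simp add: c'_def v_minus_commute)
    qed
  qed (use Qp_of_int[of 0] in \<open>simp add: c'_def\<close>)
  moreover have "x = (\<Sum>i<n. c' i * e i)"
  proof (rule ccontr)
    assume "x \<noteq> (\<Sum>i<n. c' i * e i)"
    then have d: "0 < v (x - (\<Sum>i<n. c' i * e i))" (is "0 < ?d")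
      using v_nonneg v_eq_0_iff[of "x - (\<Sum>i<n. c' i * e i)"] by (simp add: order_less_le)
    have "\<forall>\<^sub>F N in sequentially. \<forall>i<n. v (of_int (m N i) - c i) < ?d"
      using eventually_ball_finite[of "{..<n}" "\<lambda>N i. v (of_int (m N i) - c i) < ?d" sequentially]
        order_tendstoD(2)[OF c d] by (simp add: Ball_def)
    moreover have "\<forall>\<^sub>F N in sequentially. (1 / real p) ^ N < ?d" by (rule order_tendstoD(2)[OF lim0 d])
    ultimately have "\<forall>\<^sub>F N in sequentially. (\<forall>i<n. v (of_int (m N i) - c i) < ?d) \<and> (1 / real p) ^ N < ?d"
      by (rule eventually_conj)
    then obtain N where N: "\<And>i. i < n \<Longrightarrow> v (of_int (m N i) - c i) < ?d" "(1 / real p) ^ N < ?d"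
      by (auto simp: eventually_sequentially)
    have "v (\<Sum>i<n. (of_int (m N i) - c' i) * e i) < ?d"
    proof (rule v_sum_less[OF _ d])
      fix i assume "i \<in> {..<n}"
      then have i: "i < n" by simp
      have "v (of_int (m N i) - c i) * v (e i) \<le> v (of_int (m N i) - c i) * 1"
        using e i by (intro mult_left_mono) (auto simp: res_indep_def O_iff v_nonneg)
      then show "v ((of_int (m N i) - c' i) * e i) < ?d" using N(1)[OF i] i by (simp add: v_mult c'_def)
    qed
    moreover have "v (x - (\<Sum>i<n. of_int (m N i) * e i)) < ?d" using m[of N] N(2) by linarith
    ultimately have "v ((x - (\<Sum>i<n. of_int (m N i) * e i)) + (\<Sum>i<n. (of_int (m N i) - c' i) * e i)) < ?d"
      by (intro v_add_less)
    then show False by (simp add: sum_subtractf left_diff_distrib)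
  qed
  ultimately show ?thesis by blast
qed

text \<open>The residue degree equals the degree because the value groups agree.\<close>

lemma res_indep_basis: "\<exists>e. res_indep a e \<and> (\<forall>e'. \<not> res_indep (Suc a) e')"
proof -
  obtain n e where e: "res_indep n e" and max: "\<And>e'. \<not> res_indep (Suc n) e'"
    using res_indep_maximal by blast
  have eK: "e i \<in> K" if "i < n" for i using e that by (simp add: res_indep_def O_iff)
  have "x \<in> Cf.Span (Qp v) (map e [0..<n])" if x: "x \<in> K" for x
  proof -
    obtain k where k: "v x < real p ^ k" using p_gt_1 real_arch_pow[of "real p"] by auto
    have "x * of_nat (p ^ k) \<in> ZK"
      using k x K_of_int[of "int (p ^ k)"] p_gt_1
      by (auto simp: O_iff K_mult v_mult v_power v_p divide_simps)
    then obtain c where c: "\<And>i. c i \<in> Qp v" "x * of_nat (p ^ k) = (\<Sum>i<n. c i * e i)"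
      using approx_in_span[OF e integral_approx[OF e max]] by blast
    define Ks where "Ks = map (\<lambda>i. c i * inverse (of_nat (p ^ k))) [0..<n]"
    have "of_nat (p ^ k) \<noteq> (0::'c)" using p_gt_1 by simp
    then have "x = (x * of_nat (p ^ k)) * inverse (of_nat (p ^ k))" by simp
    also have "\<dots> = (\<Sum>i<n. c i * inverse (of_nat (p ^ k)) * e i)"
      unfolding c(2) by (simp add: sum_distrib_left sum_distrib_right mult_ac)
    also have "\<dots> = Cf.combine Ks (map e [0..<n])"
      by (subst combine_sum) (auto simp: Ks_def)
    finally have "x = Cf.combine Ks (map e [0..<n])" .
    moreover have "set Ks \<subseteq> Qp v"
      using c(1) Qp_of_int[of "int (p ^ k)"] by (auto simp: Ks_def intro!: Qp_mult Qp_inverse)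
    ultimately show ?thesis
      using Cf.Span_eq_combine_set[OF Qp_subfield, of "map e [0..<n]"] by (auto simp: rta_simps)
  qed
  moreover have "Cf.Span (Qp v) (map e [0..<n]) \<subseteq> K"
  proof
    fix x assume "x \<in> Cf.Span (Qp v) (map e [0..<n])"
    then obtain Ks where Ks: "set Ks \<subseteq> Qp v" "length Ks = n" "x = Cf.combine Ks (map e [0..<n])"
      using Cf.Span_mem_iff_length_version[OF Qp_subfield, of "map e [0..<n]" x] by (auto simp: rta_simps)
    then have "x = (\<Sum>i<n. Ks ! i * e i)" by (simp add: combine_sum)
    moreover have "Ks ! i \<in> K" if "i < n" for i using Ks(1,2) that nth_mem Qp_K by blast
    ultimately show "x \<in> K" using eK by (auto intro!: K_sum K_mult)
  qed
  ultimately have "Cf.Span (Qp v) (map e [0..<n]) = K" by blast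
  then have "Cf.dimension n (Qp v) K"
    using Cf.dimensionI[OF Qp_subfield res_indep_independent[OF e]] by simp
  then have "n = a" using Cf.dimension_is_inj[OF Qp_subfield K_dimension] by simp
  then show ?thesis using e max by blast
qed

text \<open>Whatever can be approximated from Z_q inherits approximations by integer combinations of
  a residual basis, and thereby lies in its span over Q_p. This makes Z_q closed in the ambient
  field.\<close>

lemma closure_ZK:
  assumes "\<And>d. 0 < d \<Longrightarrow> \<exists>y\<in>ZK. v (x - y) < d" shows "x \<in> ZK"
proof -
  obtain e where e: "res_indep a e" and max: "\<And>e'. \<not> res_indep (Suc a) e'"
    using res_indep_basis by blast
  have "\<exists>m. v (x - (\<Sum>i<a. of_int (m i) * e i)) \<le> (1 / p) ^ N" for N
  proof -
    have "0 < (1 / real p) ^ N" using p_gt_1 by simp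
    then obtain y where y: "y \<in> ZK" "v (x - y) < (1 / p) ^ N" using assms by blast
    obtain m where "v (y - (\<Sum>i<a. of_int (m i) * e i)) \<le> (1 / p) ^ N"
      using integral_approx[OF e max y(1)] by blast
    then have "v ((x - y) + (y - (\<Sum>i<a. of_int (m i) * e i))) \<le> (1 / p) ^ N"
      using y(2) by (intro v_add_le) auto
    then show ?thesis by auto
  qed
  from approx_in_span[OF e this] obtain c where c: "\<And>i. c i \<in> Qp v" "x = (\<Sum>i<a. c i * e i)" by blast
  have "x \<in> K" unfolding c(2)
    using c(1) Qp_K e by (auto intro!: K_sum K_mult simp: res_indep_def O_iff)
  moreover obtain y where "y \<in> ZK" "v (x - y) < 1" using assms[OF zero_less_one] by blast
  then have "v ((x - y) + y) \<le> 1" by (intro v_add_le) (auto simp: O_iff)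
  ultimately show ?thesis by (simp add: O_iff)
qed

text \<open>Combinations of a residual basis with digits 0, ..., p - 1 meet each residue class of
  Z_q once, so the residue field of K has p^a elements.\<close>

lemma residue_representatives:
  obtains S where "S \<subseteq> ZK" "finite S" "card S = p ^ a"
    "\<forall>r\<in>S. \<forall>s\<in>S. v (r - s) < 1 \<longrightarrow> r = s" "\<forall>x\<in>ZK. \<exists>r\<in>S. v (x - r) < 1"
proof -
  obtain e where e: "res_indep a e" and max: "\<And>e'. \<not> res_indep (Suc a) e'"
    using res_indep_basis by blast
  define D where "D = {..<a} \<rightarrow>\<^sub>E {0..<int p}"
  define f where "f = (\<lambda>m. \<Sum>i<a. of_int (m i) * e i)"
  have key: "m = m'" if m: "m \<in> D" "m' \<in> D" and less: "v (f m - f m') < 1" for m m'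
  proof -
    have "f m - f m' = (\<Sum>i<a. of_int (m i - m' i) * e i)"
      by (simp add: f_def sum_subtractf left_diff_distrib)
    then have dvd: "int p dvd m i - m' i" if "i < a" for i
      using less res_indepD[OF e, of "\<lambda>i. m i - m' i"] that by simp
    have "m i = m' i" if "i < a" for i
    proof -
      have "m i mod int p = m' i mod int p" using dvd[OF that] by (simp add: mod_eq_dvd_iff)
      moreover have "m i \<in> {0..<int p}" "m' i \<in> {0..<int p}" using m that by (auto simp: D_def PiE_iff)
      ultimately show ?thesis by simp
    qed
    then show ?thesis using m by (intro PiE_ext[of m "{..<a}"]) (auto simp: D_def)
  qed
  then have inj: "inj_on f D" by (intro inj_onI) (auto simp: v_0)
  have card: "card D = p ^ a" by (simp add: D_def card_PiE)
  have cover: "\<exists>r\<in>f ` D. v (x - r) < 1" if x: "x \<in> ZK" for x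
  proof -
    obtain m where m: "v (x - f m) < 1"
      using residue_combination[OF e max x] by (auto simp: f_def)
    define m' where "m' = (\<lambda>i\<in>{..<a}. m i mod int p)"
    have m': "m' \<in> D" using p_gt_1 by (auto simp: m'_def D_def)
    have "f m - f m' = (\<Sum>i<a. of_int (m i - m' i) * e i)"
      by (simp add: f_def sum_subtractf left_diff_distrib)
    moreover have "v \<dots> < 1"
    proof (rule v_sum_less)
      fix i assume i: "i \<in> {..<a}"
      then have "int p dvd m i - m' i" by (simp add: m'_def)
      then have "v (of_int (m i - m' i)) < 1" using v_of_int_less_1_iff by blast
      moreover have "v (of_int (m i - m' i)) * v (e i) \<le> v (of_int (m i - m' i)) * 1"
        using e i by (intro mult_left_mono) (auto simp: res_indep_def O_iff v_nonneg)
      ultimately show "v (of_int (m i - m' i) * e i) < 1" by (simp add: v_mult)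
    qed simp
    ultimately have "v ((x - f m) + (f m - f m')) < 1" using m by (intro v_add_less) auto
    then show ?thesis using m' by auto
  qed
  show ?thesis
  proof (rule that[of "f ` D"])
    show "f ` D \<subseteq> ZK" using res_indep_sum_ZK[OF e] by (auto simp: f_def)
    show "finite (f ` D)" by (simp add: D_def finite_PiE)
    show "card (f ` D) = p ^ a" using card card_image[OF inj] by simp
    show "\<forall>r\<in>f ` D. \<forall>s\<in>f ` D. v (r - s) < 1 \<longrightarrow> r = s" using key by blast
    show "\<forall>x\<in>ZK. \<exists>r\<in>f ` D. v (x - r) < 1" using cover by blast
  qed
qed

section \<open>Teichmueller points of Z_q\<close>

lemma v_prod_diff:
  assumes "\<And>i. i \<in> I \<Longrightarrow> v (f i) \<le> 1" "\<And>i. i \<in> I \<Longrightarrow> v (g i) \<le> 1"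
    "\<And>i. i \<in> I \<Longrightarrow> v (f i - g i) < 1"
  shows "v (prod f I - prod g I) < 1"
  using assms
proof (induction I rule: infinite_finite_induct)
  case (insert i I)
  have "f i * prod f I - g i * prod g I = f i * (prod f I - prod g I) + (f i - g i) * prod g I"
    by (simp add: algebra_simps)
  moreover have "v (f i * (prod f I - prod g I)) < 1"
    using insert mult_right_mono[of "v (f i)" 1 "v (prod f I - prod g I)"] v_nonneg
    by (fastforce simp: v_mult)
  moreover have "v (prod g I) \<le> 1" using insert.prems by (auto simp: v_prod v_nonneg intro!: prod_le_1)
  then have "v ((f i - g i) * prod g I) < 1"
    using insert.prems(3)[of i] mult_left_mono[of "v (prod g I)" 1 "v (f i - g i)"] v_nonneg
    by (fastforce simp: v_mult)
  ultimately show ?case using insert by (simp add: v_add_less)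
qed (auto simp: v_0)

text \<open>The classical argument: multiplication by a unit x permutes the nonzero residue classes,
  so comparing the product of all of them before and after shows x^(p^a - 1) congruent to 1. Here z
  represents the class of 0.\<close>

lemma fermat:
  assumes x: "x \<in> ZK" shows "v (x ^ (p ^ a) - x) < 1"
proof -
  have q: "1 < p ^ a" using p_pow_gt_1[OF a_pos] .
  show ?thesis
  proof (cases "v x < 1")
    case True
    have "v (x ^ (p ^ a)) < 1" using True q v_nonneg[of x] p_gt_1 by (simp add: v_power power_less_one_iff)
    then show ?thesis using True by (rule v_diff_less)
  next
    case False
    then have vx: "v x = 1" using x by (simp add: O_iff)
    obtain S where S: "S \<subseteq> ZK" "finite S" "card S = p ^ a"
      and sep: "\<forall>r\<in>S. \<forall>s\<in>S. v (r - s) < 1 \<longrightarrow> r = s"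
      and cover: "\<forall>x\<in>ZK. \<exists>r\<in>S. v (x - r) < 1"
      by (rule residue_representatives)
    obtain rep where rep: "\<And>x. x \<in> ZK \<Longrightarrow> rep x \<in> S \<and> v (x - rep x) < 1" using cover by metis
    obtain z where z: "z \<in> S" "v z < 1" using bspec[OF cover, of 0] K_0 by (auto simp: O_iff v_0 v_uminus)
    define U where "U = S - {z}"
    have vU: "v r = 1" if "r \<in> U" for r
    proof (rule ccontr)
      assume "v r \<noteq> 1"
      then have "v r < 1" using that S(1) by (fastforce simp: U_def O_iff)
      then have "v (r - z) < 1" using z(2) by (rule v_diff_less)
      then show False using sep z that by (auto simp: U_def)
    qed
    have xr: "x * r \<in> ZK" if "r \<in> U" for r using that S(1) x by (auto simp: U_def intro: ZK_mult)
    have fU: "rep (x * r) \<in> U" if r: "r \<in> U" for r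
    proof -
      have "v (x * r - rep (x * r)) < 1" using rep[OF xr[OF r]] by simp
      moreover have "v (x * r) = 1" using vx vU[OF r] by (simp add: v_mult)
      ultimately have "v (rep (x * r)) = 1" using v_eqI[of "rep (x * r)" "x * r"] v_minus_commute by simp
      then show ?thesis using rep[OF xr[OF r]] z by (auto simp: U_def)
    qed
    have inj: "inj_on (\<lambda>r. rep (x * r)) U"
    proof (rule inj_onI)
      fix r s assume rs: "r \<in> U" "s \<in> U" "rep (x * r) = rep (x * s)"
      have "v ((x * r - rep (x * r)) - (x * s - rep (x * s))) < 1"
        by (rule v_diff_less) (use rep xr rs in blast)+
      then have "v (x * (r - s)) < 1" using rs(3) by (simp add: right_diff_distrib)
      then show "r = s" using sep rs vx by (simp add: v_mult U_def)
    qed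
    have fin: "finite U" using S(2) by (simp add: U_def)
    have "(\<lambda>r. rep (x * r)) ` U = U"
      using fU inj fin by (intro endo_inj_surj) auto
    then have perm: "(\<Prod>r\<in>U. rep (x * r)) = \<Prod>U"
      using prod.reindex[OF inj, of "\<lambda>r. r"] by simp
    have "v ((\<Prod>r\<in>U. x * r) - (\<Prod>r\<in>U. rep (x * r))) < 1"
    proof (rule v_prod_diff)
      fix r assume r: "r \<in> U"
      show "v (x * r) \<le> 1" "v (x * r - rep (x * r)) < 1" "v (rep (x * r)) \<le> 1"
        using xr[OF r] rep[OF xr[OF r]] S(1) by (auto simp: O_iff)
    qed
    moreover have "(\<Prod>r\<in>U. x * r) = x ^ (p ^ a - 1) * \<Prod>U"
      using S(2,3) z by (simp add: prod.distrib U_def)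
    ultimately have "v ((x ^ (p ^ a - 1) - 1) * \<Prod>U) < 1" by (simp add: perm left_diff_distrib)
    moreover have "v (\<Prod>U) = 1" using vU by (simp add: v_prod)
    ultimately have "v (x * (x ^ (p ^ a - 1) - 1)) < 1" by (simp add: v_mult vx)
    moreover have "Suc (p ^ a - 1) = p ^ a" using q by linarith
    then have "x * x ^ (p ^ a - 1) = x ^ (p ^ a)" by (metis power_Suc)
    ultimately show ?thesis by (simp add: right_diff_distrib)
  qed
qed

text \<open>The p^a residue representatives lift to p^a distinct Teichmueller points, which are
  therefore all of them. Each is the limit of the powers r^(q^n) of its representative r, where q =
  p^a: the q-th power shrinks the distance by a factor \<theta> < 1. Z_q is closed.\<close>

theorem teich_ZK:
  assumes z: "z ^ (p ^ a) = z" shows "z \<in> ZK"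
proof -
  obtain S where S: "S \<subseteq> ZK" "finite S" "card S = p ^ a"
    and sep: "\<forall>r\<in>S. \<forall>s\<in>S. v (r - s) < 1 \<longrightarrow> r = s"
    and "\<forall>x\<in>ZK. \<exists>r\<in>S. v (x - r) < 1"
    by (rule residue_representatives)
  have "\<exists>t. t ^ (p ^ a) = t \<and> v (r - t) < 1" if "r \<in> S" for r
    by (rule teich_exists[OF a_pos fermat]) (use that S(1) in blast)
  then obtain t where t: "\<And>r. r \<in> S \<Longrightarrow> t r ^ (p ^ a) = t r \<and> v (r - t r) < 1" by metis
  have "inj_on t S"
  proof (rule inj_onI)
    fix r s assume rs: "r \<in> S" "s \<in> S" "t r = t s"
    have "v ((r - t r) - (s - t s)) < 1" by (rule v_diff_less[OF conjunct2[OF t[OF rs(1)]] conjunct2[OF t[OF rs(2)]]])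
    then show "r = s" using rs sep by simp
  qed
  then have "card (t ` S) = p ^ a" using S(3) card_image by metis
  moreover have "t ` S \<subseteq> {z. z ^ (p ^ a) = z}" using t by auto
  ultimately have "t ` S = {z. z ^ (p ^ a) = z}"
    using teich_roots[OF a_pos] by (intro card_subset_eq) auto
  then obtain r where r: "r \<in> S" "z = t r" using z by blast
  define d where "d = v (r - z)"
  have rz: "d < 1" "0 \<le> d" "v r \<le> 1" using t[OF r(1)] r S(1) by (auto simp: d_def O_iff v_nonneg)
  define \<theta> where "\<theta> = max (1 / real p) d"
  have th: "0 \<le> \<theta>" "\<theta> < 1" using rz p_gt_1 by (auto simp: \<theta>_def)
  have dn: "v (r ^ ((p ^ a) ^ n) - z) \<le> d * \<theta> ^ n" for n
  proof (induction n)
    case 0 then show ?case by (simp add: d_def)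
  next
    case (Suc n)
    let ?y = "r ^ ((p ^ a) ^ n)"
    have le: "d * \<theta> ^ n \<le> d" using th rz by (intro mult_left_le power_le_one) auto
    have "v (?y ^ (p ^ a) - z ^ (p ^ a)) \<le> v (?y - z) * max (1 / p) (v (?y - z))"
      using Suc le rz a_pos by (intro frobenius_contract v_power_le_1) auto
    also have "\<dots> \<le> (d * \<theta> ^ n) * \<theta>"
      using Suc le rz th by (intro mult_mono) (auto simp: \<theta>_def le_max_iff_disj v_nonneg)
    finally show ?case using z by (simp add: mult_ac flip: power_mult)
  qed
  show ?thesis
  proof (rule closure_ZK)
    fix e :: real assume "0 < e"
    moreover have "(\<lambda>n. d * \<theta> ^ n) \<longlonglongrightarrow> 0"
      using tendsto_mult_right_zero[OF LIMSEQ_realpow_zero[OF th]] by simp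
    ultimately obtain n where "d * \<theta> ^ n < e"
      using order_tendstoD(2) by (fastforce simp: eventually_sequentially)
    then have "v (z - r ^ ((p ^ a) ^ n)) < e" using dn[of n] by (simp add: v_minus_commute)
    then show "\<exists>y\<in>ZK. v (z - y) < e" using r S(1) ZK_power by blast
  qed
qed

end

section \<open>Expansions on a punctured disc\<close>

text \<open>The scalar setting, in which the coefficient of a single power of \<pi> lives.
  \<open>R\<close> plays the part of Z_q: inverses of units are used for partial fractions,
  topological closedness for limits. The index 1 belongs to \<infinity>, and \<open>pt 2 = 0\<close>
  puts all of \<open>A\<close> on the unit circle.\<close>

locale punctured_disc = padic_complex_field p v
  for p and v :: "'c::{alg_closed_field, field_char_0} \<Rightarrow> real" +
  fixes a l :: nat and pt :: "nat \<Rightarrow> 'c" and R :: "'c set"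
  assumes a_pos: "1 \<le> a" and l_ge_2: "2 \<le> l"
    and pt_2: "pt 2 = 0"
    and pt_teich: "j \<in> {2..l} \<Longrightarrow> pt j ^ (p ^ a) = pt j"
    and pt_inj: "inj_on pt {2..l}"
    and R_pt: "j \<in> {2..l} \<Longrightarrow> pt j \<in> R"
    and R_le: "r \<in> R \<Longrightarrow> v r \<le> 1"
    and R_1: "1 \<in> R"
    and R_diff: "r \<in> R \<Longrightarrow> s \<in> R \<Longrightarrow> r - s \<in> R"
    and R_mult: "r \<in> R \<Longrightarrow> s \<in> R \<Longrightarrow> r * s \<in> R"
    and R_inverse: "r \<in> R \<Longrightarrow> v r = 1 \<Longrightarrow> inverse r \<in> R"
    and R_closed: "(\<And>e. 0 < e \<Longrightarrow> \<exists>s\<in>R. v (r - s) < e) \<Longrightarrow> r \<in> R"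
begin

lemma R_0: "0 \<in> R"
  using R_diff[OF R_1 R_1] by simp

lemma R_uminus: "r \<in> R \<Longrightarrow> - r \<in> R"
  using R_diff[OF R_0, of r] by simp

lemma R_add: "r \<in> R \<Longrightarrow> s \<in> R \<Longrightarrow> r + s \<in> R"
  using R_diff[of r "- s"] R_uminus[of s] by simp

lemma R_sum: "(\<And>i. i \<in> S \<Longrightarrow> f i \<in> R) \<Longrightarrow> sum f S \<in> R"
  by (induction S rule: infinite_finite_induct) (auto intro: R_0 R_add)

lemma R_power: "r \<in> R \<Longrightarrow> r ^ n \<in> R"
  by (induction n) (auto intro: R_1 R_mult)

lemma R_of_nat: "of_nat n \<in> R"
  by (induction n) (auto intro: R_0 R_1 R_add)

lemma v_pt: "j \<in> {2..l} \<Longrightarrow> v (pt j) \<le> 1"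
  using R_pt R_le by blast

lemma v_pt_diff: "i \<in> {2..l} \<Longrightarrow> j \<in> {2..l} \<Longrightarrow> i \<noteq> j \<Longrightarrow> v (pt i - pt j) = 1"
  using pt_inj by (intro v_teich_diff[OF a_pos] pt_teich) (auto dest: inj_onD)

definition A :: "'c set" where
  "A = {x. v x \<le> 1 \<and> (\<forall>j\<in>{2..l}. 1 \<le> v (x - pt j))}"

definition B :: "nat \<times> nat \<Rightarrow> 'c \<Rightarrow> 'c" where
  "B ij x = (if x \<in> A then (if snd ij = 1 then x ^ fst ij else inverse (x - pt (snd ij)) ^ fst ij) else 0)"

abbreviation "I \<equiv> idx l"

lemma idx_iff: "(i, j) \<in> I \<longleftrightarrow> 1 \<le> j \<and> j \<le> l \<and> (i = 0 \<longrightarrow> j = 1)"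
  using l_ge_2 by (cases i) (auto simp: idx_def)

lemma A_pt: "x \<in> A \<Longrightarrow> j \<in> {2..l} \<Longrightarrow> v (x - pt j) = 1"
  by (rule antisym) (auto simp: A_def intro!: v_diff_le v_pt)

lemma A_pt_0: "x \<in> A \<Longrightarrow> j \<in> {2..l} \<Longrightarrow> x - pt j \<noteq> 0"
  using A_pt[of x j] by (auto simp: v_0)

lemma A_1: "x \<in> A \<Longrightarrow> v x = 1"
  using A_pt[of x 2] l_ge_2 by (simp add: pt_2)

lemma A_0: "x \<in> A \<Longrightarrow> x \<noteq> 0"
  using A_1[of x] by (auto simp: v_0)

lemma v_B: "ij \<in> I \<Longrightarrow> v (B ij x) \<le> 1"
  using A_1[of x] A_pt[of x "snd ij"]
  by (cases ij) (auto simp: B_def idx_iff v_0 v_power v_inverse)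

lemma B_outside: "x \<notin> A \<Longrightarrow> B ij x = 0"
  by (simp add: B_def)

section \<open>Bounding coefficients by values\<close>

text \<open>Divide by X - x for one of the points x. At the other points the divisor has absolute
  value 1, so the quotient satisfies the same bound C, has smaller degree and needs one point
  less.\<close>

lemma poly_coeff_bound:
  assumes "finite Y" "\<And>x. x \<in> Y \<Longrightarrow> v x \<le> 1"
    "\<And>x y. x \<in> Y \<Longrightarrow> y \<in> Y \<Longrightarrow> x \<noteq> y \<Longrightarrow> v (x - y) = 1"
    "Polynomial.degree f < card Y" "\<And>x. x \<in> Y \<Longrightarrow> v (poly f x) \<le> C"
  shows "v (Polynomial.coeff f i) \<le> C"
  using assms
proof (induction Y arbitrary: f i rule: finite_induct)
  case (insert x Y)
  have C: "0 \<le> C" using insert.prems(4)[of x] v_nonneg[of "poly f x"] by simp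
  show ?case
  proof (cases "Polynomial.degree f = 0")
    case True
    then obtain c where "f = [:c:]" by (elim degree_eq_zeroE)
    then show ?thesis using insert.prems(4)[of x] C by (cases i) (auto simp: v_0)
  next
    case False
    define g where "g = synthetic_div f x"
    have f: "f = [:- x, 1:] * g + [:poly f x:]" by (simp only: g_def synthetic_div_correct')
    have g: "v (Polynomial.coeff g i) \<le> C" for i
    proof (rule insert.IH)
      show "Polynomial.degree g < card Y"
        using insert.prems(3) insert.hyps False by (simp add: g_def degree_synthetic_div)
      fix y assume y: "y \<in> Y"
      then have "v (y - x) = 1" using insert.prems(2)[of y x] insert.hyps by auto
      moreover have "poly f y - poly f x = (y - x) * poly g y" by (subst f) (simp add: algebra_simps)
      ultimately have "v (poly g y) = v (poly f y - poly f x)" by (simp add: v_mult)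
      also have "\<dots> \<le> C" by (rule v_diff_le) (use insert.prems(4) y in auto)
      finally show "v (poly g y) \<le> C" .
    qed (use insert.prems in auto)
    have "Polynomial.coeff f i = (Polynomial.coeff (pCons (poly f x) g) i - x * Polynomial.coeff g i)"
      by (subst f) (simp add: coeff_pCons split: nat.split)
    moreover have "v (Polynomial.coeff (pCons (poly f x) g) i) \<le> C"
      using g insert.prems(4)[of x] by (auto simp: coeff_pCons split: nat.split)
    moreover have "v (x * Polynomial.coeff g i) \<le> 1 * C"
      unfolding v_mult using insert.prems(1)[of x] g by (intro mult_mono v_nonneg) auto
    ultimately show ?thesis by (simp add: v_diff_le)
  qed
qed simp

text \<open>The Teichmueller points of high degree that are not poles lie in \<open>A\<close>, are
  at mutual distance 1, and there are arbitrarily many of them.\<close>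

lemma separated_points:
  "\<exists>Y\<subseteq>A. finite Y \<and> n < card Y \<and> (\<forall>x\<in>Y. \<forall>y\<in>Y. x \<noteq> y \<longrightarrow> v (x - y) = 1)"
proof -
  \<comment> \<open>A multiple of a, so that the poles are among the points fixed by the p^m-th
    power; and p^m > m > n + l leaves more than n points when the poles are removed.\<close>
  define m where "m = a * (n + l + 1)"
  have m: "1 \<le> m" "n + l < m" using a_pos mult_le_mono1[of 1 a "n + l + 1"] by (auto simp: m_def)
  define T where "T = {z::'c. z ^ (p ^ m) = z}"
  have T: "finite T" "card T = p ^ m" using teich_roots[OF m(1)] by (auto simp: T_def)
  have ptT: "pt j \<in> T" if "j \<in> {2..l}" for j
    using teich_power[OF pt_teich[OF that], of "n + l + 1"] by (simp only: T_def m_def power_mult mem_Collect_eq)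
  have dist: "v (x - y) = 1" if "x \<in> T" "y \<in> T" "x \<noteq> y" for x y
    using v_teich_diff[OF m(1)] that by (auto simp: T_def)
  define Y where "Y = T - pt ` {2..l}"
  have "Y \<subseteq> A"
    using dist ptT m(1) by (fastforce simp: Y_def A_def T_def intro: v_teich_le_1)
  moreover have "n < card Y"
  proof -
    have "2 ^ m \<le> p ^ m" using p_gt_1 by (intro power_mono) auto
    then have "m < p ^ m" by (rule order_less_le_trans[OF less_exp])
    moreover have "card T - card (pt ` {2..l}) \<le> card Y" unfolding Y_def by (rule diff_card_le_card_Diff) simp
    moreover have "card (pt ` {2..l}) \<le> l" using card_image_le[of "{2..l}" pt] by simp
    ultimately show ?thesis using T(2) m(2) by linarith
  qed
  ultimately show ?thesis using dist T(1) by (intro exI[of _ Y]) (auto simp: Y_def)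
qed

lemma poly_bound_A:
  assumes "\<And>x. x \<in> A \<Longrightarrow> v (poly f x) \<le> C" shows "v (Polynomial.coeff f i) \<le> C"
proof -
  obtain Y where "Y \<subseteq> A" "finite Y" "Polynomial.degree f < card Y"
    "\<forall>x\<in>Y. \<forall>y\<in>Y. x \<noteq> y \<longrightarrow> v (x - y) = 1"
    using separated_points by blast
  then show ?thesis using assms by (intro poly_coeff_bound[of Y f C]) (auto simp: A_def)
qed

text \<open>A bound on \<open>A\<close> bounds the coefficients and hence the values on the whole
  closed unit disc. It serves to evaluate at the poles, which are outside \<open>A\<close>.\<close>

lemma poly_bound_disc:
  assumes "\<And>x. x \<in> A \<Longrightarrow> v (poly f x) \<le> C" "v y \<le> 1" shows "v (poly f y) \<le> C"
proof -
  have C: "0 \<le> C" using poly_bound_A[OF assms(1), of 0] v_nonneg order_trans by blast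
  have "v (Polynomial.coeff f i * y ^ i) \<le> C * 1" for i
    unfolding v_mult using poly_bound_A[OF assms(1), of i] assms(2) C
    by (intro mult_mono v_power_le_1 v_nonneg) auto
  then show ?thesis unfolding poly_altdef using C by (intro v_sum_le) auto
qed

text \<open>
  Multiplying by powers of the \<open>x - pt m\<close> turns the combination into a polynomial, whose value at
  a pole of highest order is, up to a unit, the coefficient there.
\<close>

lemma finite_combination_bound:
  assumes "finite S" "S \<subseteq> I" "\<And>x. x \<in> A \<Longrightarrow> v (\<Sum>ij\<in>S. c ij * B ij x) \<le> C" "ij \<in> S"
  shows "v (c ij) \<le> C"
  using assms
proof (induction "card S" arbitrary: S ij rule: less_induct)
  case less
  obtain x0 where "x0 \<in> A" using separated_points[of 0] by (metis card_gt_0_iff ex_in_conv subsetD)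
  then have C: "0 \<le> C" using less.prems(3) v_nonneg order_trans by blast
  show ?case
  proof (cases "\<exists>ij\<in>S. snd ij \<noteq> 1")
    case True
    then obtain i1 j where j: "(i1, j) \<in> S" "j \<noteq> 1" by auto
    then have jl: "j \<in> {2..l}" using less.prems(2) by (fastforce simp: idx_iff)
    define i0 where "i0 = Max (fst ` {ij\<in>S. snd ij = j})"
    have fin: "finite (fst ` {ij\<in>S. snd ij = j})" using less.prems(1) by simp
    have "i0 \<in> fst ` {ij\<in>S. snd ij = j}" unfolding i0_def by (rule Max_in[OF fin]) (use j in force)
    then have i0: "(i0, j) \<in> S" by force
    have i0_max: "i \<le> i0" if "(i, j) \<in> S" for i
      unfolding i0_def by (rule Max_ge[OF fin]) (use that in force)
    define N where "N = Max (fst ` S)"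
    have N: "i \<le> N" if "(i, j) \<in> S" for i j
      unfolding N_def by (rule Max_ge) (use that less.prems(1) in force)+
    define W where "W = (\<Prod>m\<in>{2..l} - {j}. [:- pt m, 1:])"
    have Wev: "poly W x = (\<Prod>m\<in>{2..l} - {j}. x - pt m)" for x by (simp add: W_def poly_prod)
    have vW: "v (poly W (pt j)) = 1"
      using v_pt_diff jl by (simp add: Wev v_prod)
    have vWA: "v (poly W x) = 1" if "x \<in> A" for x
      using A_pt[OF that] by (simp add: Wev v_prod)
    \<comment> \<open>The power W^N clears the poles other than \<open>pt j\<close>, and (x - pt
      j)^i0 clears the highest order at \<open>pt j\<close>. Except for the term (i0, j), a positive
      power of x - pt j is left over, so that term alone survives at \<open>pt j\<close>.\<close>
    have "\<exists>r. (\<forall>x\<in>A. poly r x = B ij x * (x - pt j) ^ i0 * poly W x ^ N) \<and>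
              poly r (pt j) = (if ij = (i0, j) then poly W (pt j) ^ N else 0)" if ij: "ij \<in> S" for ij
    proof -
      obtain i j' where ij': "ij = (i, j')" by force
      have I: "(i, j') \<in> I" using ij ij' less.prems(2) by blast
      have i0_pos: "i0 > 0" using i0 less.prems(2) j(2) by (cases i0) (auto simp: idx_iff)
      consider "j' = 1" | "j' = j" | "j' \<noteq> 1" "j' \<noteq> j" by blast
      then show ?thesis
      proof cases
        case 1
        show ?thesis using 1 j(2) i0_pos
          by (intro exI[of _ "[:0, 1:] ^ i * [:- pt j, 1:] ^ i0 * W ^ N"])
             (auto simp: ij' B_def poly_power power_0_left)
      next
        case 2
        have "i \<le> i0" using i0_max ij ij' 2 by blast
        then have eq: "inverse y ^ i * y ^ i0 = y ^ (i0 - i)" if "y \<noteq> 0" for y :: 'c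
          using that by (simp add: power_diff power_inverse field_simps)
        show ?thesis using 2 j(2) \<open>i \<le> i0\<close> A_pt_0[OF _ jl]
          by (intro exI[of _ "[:- pt j, 1:] ^ (i0 - i) * W ^ N"])
             (auto simp: ij' B_def poly_power power_0_left eq)
      next
        case 3
        have jl': "j' \<in> {2..l}" using I 3 by (auto simp: idx_iff)
        define W' where "W' = (\<Prod>m\<in>{2..l} - {j} - {j'}. [:- pt m, 1:])"
        have WW: "W = [:- pt j', 1:] * W'"
          unfolding W_def W'_def by (rule prod.remove) (use jl' 3 in auto)
        have Wx: "poly W x = (x - pt j') * poly W' x" for x unfolding WW by (simp add: algebra_simps)
        have "i \<le> N" using N ij ij' by blast
        then have eq: "inverse y ^ i * y ^ N = y ^ (N - i)" if "y \<noteq> 0" for y :: 'c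
          using that by (simp add: power_diff power_inverse field_simps)
        have "poly ([:- pt j, 1:] ^ i0 * [:- pt j', 1:] ^ (N - i) * W' ^ N) x
            = B ij x * (x - pt j) ^ i0 * poly W x ^ N" if x: "x \<in> A" for x
        proof -
          have "B ij x * (x - pt j) ^ i0 * poly W x ^ N
              = (x - pt j) ^ i0 * (inverse (x - pt j') ^ i * (x - pt j') ^ N) * poly W' x ^ N"
            using x 3 by (simp add: ij' B_def Wx power_mult_distrib mult_ac)
          then show ?thesis using eq[OF A_pt_0[OF x jl']] by (auto simp: poly_power mult_ac)
        qed
        then show ?thesis using 3 i0_pos
          by (intro exI[of _ "[:- pt j, 1:] ^ i0 * [:- pt j', 1:] ^ (N - i) * W' ^ N"])
             (auto simp: ij' poly_power power_0_left)
      qed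
    qed
    then obtain r where r: "\<And>ij x. ij \<in> S \<Longrightarrow> x \<in> A \<Longrightarrow> poly (r ij) x = B ij x * (x - pt j) ^ i0 * poly W x ^ N"
      and rj: "\<And>ij. ij \<in> S \<Longrightarrow> poly (r ij) (pt j) = (if ij = (i0, j) then poly W (pt j) ^ N else 0)"
      by metis
    define f where "f = (\<Sum>ij\<in>S. Polynomial.smult (c ij) (r ij))"
    have "v (poly f x) \<le> C" if x: "x \<in> A" for x
    proof -
      have "poly f x = (\<Sum>ij\<in>S. c ij * B ij x) * (x - pt j) ^ i0 * poly W x ^ N"
        using x by (simp add: f_def poly_sum r sum_distrib_right mult.assoc)
      then show ?thesis using less.prems(3)[OF x] x by (simp add: v_mult v_power A_pt[OF x jl] vWA)
    qed
    then have "v (poly f (pt j)) \<le> C" using v_pt[OF jl] by (rule poly_bound_disc)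
    moreover have "poly f (pt j) = c (i0, j) * poly W (pt j) ^ N"
    proof -
      have "poly f (pt j) = (\<Sum>ij\<in>S. if ij = (i0, j) then c (i0, j) * poly W (pt j) ^ N else 0)"
        by (auto simp: f_def poly_sum rj intro!: sum.cong)
      then show ?thesis using i0 less.prems(1) by simp
    qed
    ultimately have c0: "v (c (i0, j)) \<le> C" by (simp add: v_mult v_power vW)
    show ?thesis
    proof (cases "ij = (i0, j)")
      case False
      show ?thesis
      proof (rule less.hyps[of "S - {(i0, j)}"])
        show "card (S - {(i0, j)}) < card S" using less.prems(1) i0 by (rule card_Diff1_less)
        fix x assume x: "x \<in> A"
        have "(\<Sum>ij\<in>S - {(i0, j)}. c ij * B ij x) = (\<Sum>ij\<in>S. c ij * B ij x) - c (i0, j) * B (i0, j) x"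
          using less.prems(1) i0 by (simp add: sum_diff1)
        moreover have "v (c (i0, j) * B (i0, j) x) \<le> C * 1" unfolding v_mult
          using c0 v_B i0 less.prems(2) C by (intro mult_mono v_nonneg) auto
        ultimately show "v (\<Sum>ij\<in>S - {(i0, j)}. c ij * B ij x) \<le> C"
          using less.prems(3)[OF x] by (simp add: v_diff_le)
      qed (use less.prems False in auto)
    qed (use c0 in simp)
  next
    case False
    define f where "f = (\<Sum>ij\<in>S. Polynomial.monom (c ij) (fst ij))"
    have "poly f x = (\<Sum>ij\<in>S. c ij * B ij x)" if "x \<in> A" for x
      using False that by (auto simp: f_def poly_sum poly_monom B_def intro!: sum.cong)
    then have "v (Polynomial.coeff f (fst ij)) \<le> C" using less.prems(3) by (intro poly_bound_A) auto
    moreover have "Polynomial.coeff f (fst ij) = (\<Sum>kl\<in>S. if kl = ij then c ij else 0)"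
      unfolding f_def coeff_sum
    proof (rule sum.cong)
      fix kl assume "kl \<in> S"
      then have "fst kl = fst ij \<longleftrightarrow> kl = ij" using False less.prems(4) by (metis prod_eqI)
      then show "Polynomial.coeff (Polynomial.monom (c kl) (fst kl)) (fst ij) = (if kl = ij then c ij else 0)"
        by simp
    qed simp
    ultimately show ?thesis using less.prems(1,4) by simp
  qed
qed

section \<open>Orthonormal expansions of scalar functions\<close>

declare split_paired_All [simp del] split_paired_Ex [simp del]

text \<open>The scalar counterpart of \<open>Zexpansion\<close>. The coefficients may be anywhere in
  the field; membership in \<open>R\<close> is added in \<open>Z\<close>.\<close>

definition expands :: "(nat \<times> nat \<Rightarrow> 'c) \<Rightarrow> ('c \<Rightarrow> 'c) \<Rightarrow> bool" where
  "expands c f \<longleftrightarrow> (\<forall>ij. ij \<notin> I \<longrightarrow> c ij = 0) \<and> (\<forall>e>0. finite {ij\<in>I. e \<le> v (c ij)}) \<and>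
     (\<forall>e>0. \<exists>S0. finite S0 \<and> S0 \<subseteq> I \<and> (\<forall>S. finite S \<longrightarrow> S0 \<subseteq> S \<longrightarrow> S \<subseteq> I \<longrightarrow>
        (\<forall>x. v (f x - (\<Sum>ij\<in>S. c ij * B ij x)) < e)))"

lemma expands_outside: "expands c f \<Longrightarrow> ij \<notin> I \<Longrightarrow> c ij = 0"
  and expands_null: "expands c f \<Longrightarrow> 0 < e \<Longrightarrow> finite {ij\<in>I. e \<le> v (c ij)}"
  by (auto simp: expands_def)

lemma expands_approx:
  assumes "expands c f" "0 < e"
  obtains S0 where "finite S0" "S0 \<subseteq> I"
    "\<And>S x. finite S \<Longrightarrow> S0 \<subseteq> S \<Longrightarrow> S \<subseteq> I \<Longrightarrow> v (f x - (\<Sum>ij\<in>S. c ij * B ij x)) < e"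
  using assms unfolding expands_def by meson

lemma v_term: "ij \<in> I \<Longrightarrow> v (c * B ij x) \<le> v c"
  using mult_left_mono[OF v_B, of ij "v c" x] v_nonneg by (simp add: v_mult)

text \<open>In an ultrametric sum the terms below e stay below e together, so any finite set that
  contains the large coefficients is a good truncation. This gives an explicit choice of the
  set.\<close>

lemma expands_tail:
  assumes c: "expands c f" and e: "0 < e" and S: "finite S" "S \<subseteq> I" "{ij\<in>I. e \<le> v (c ij)} \<subseteq> S"
  shows "v (f x - (\<Sum>ij\<in>S. c ij * B ij x)) < e"
proof -
  obtain S0 where S0: "finite S0" "S0 \<subseteq> I"
    "\<And>S x. finite S \<Longrightarrow> S0 \<subseteq> S \<Longrightarrow> S \<subseteq> I \<Longrightarrow> v (f x - (\<Sum>ij\<in>S. c ij * B ij x)) < e"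
    using expands_approx[OF c e] by blast
  have "v (f x - (\<Sum>ij\<in>S \<union> S0. c ij * B ij x)) < e" using S S0 by (intro S0(3)) auto
  moreover have "v (\<Sum>ij\<in>S0 - S. c ij * B ij x) < e"
  proof (rule v_sum_less[OF _ e])
    fix ij assume ij: "ij \<in> S0 - S"
    then have "v (c ij) < e" using S S0(2) by force
    then show "v (c ij * B ij x) < e" using v_term[of ij "c ij" x] ij S0(2) by auto
  qed
  moreover have "(\<Sum>ij\<in>S \<union> S0. c ij * B ij x) = (\<Sum>ij\<in>S. c ij * B ij x) + (\<Sum>ij\<in>S0 - S. c ij * B ij x)"
    using S S0 sum.union_disjoint[of S "S0 - S" "\<lambda>ij. c ij * B ij x"] by simp
  ultimately have "v ((f x - (\<Sum>ij\<in>S \<union> S0. c ij * B ij x)) + (\<Sum>ij\<in>S0 - S. c ij * B ij x)) < e"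
    by (intro v_add_less)
  then show ?thesis using \<open>(\<Sum>ij\<in>S \<union> S0. _) = _\<close> by simp
qed

lemma expands_A: "expands c f \<Longrightarrow> x \<notin> A \<Longrightarrow> f x = 0"
proof (rule ccontr)
  assume c: "expands c f" and x: "x \<notin> A" and "f x \<noteq> 0"
  then have "0 < v (f x)" using v_nonneg[of "f x"] v_eq_0_iff[of "f x"] by simp
  from expands_approx[OF c this] obtain S0 where "finite S0" "S0 \<subseteq> I"
    "\<And>S y. finite S \<Longrightarrow> S0 \<subseteq> S \<Longrightarrow> S \<subseteq> I \<Longrightarrow> v (f y - (\<Sum>ij\<in>S. c ij * B ij y)) < v (f x)" by blast
  then have "v (f x - (\<Sum>ij\<in>S0. c ij * B ij x)) < v (f x)" by blast
  then show False using x by (simp add: B_outside)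
qed

text \<open>Half of orthonormality. Truncation at level e changes the function by less than e, and
  finite combinations are known to obey the bound. With e half of the offending coefficient, that
  coefficient survives the truncation and still exceeds max C e.\<close>

theorem expands_bound:
  assumes c: "expands c f" and f: "\<And>x. v (f x) \<le> C" shows "v (c ij) \<le> C"
proof (rule ccontr)
  assume "\<not> ?thesis"
  then have ij: "C < v (c ij)" by simp
  have C: "0 \<le> C" using f[of 0] v_nonneg order_trans by blast
  define e where "e = v (c ij) / 2"
  have e: "0 < e" "e < v (c ij)" using ij C by (auto simp: e_def)
  define S where "S = {ij\<in>I. e \<le> v (c ij)}"
  have S: "finite S" "S \<subseteq> I" using expands_null[OF c e(1)] by (auto simp: S_def)
  have I: "ij \<in> I" using expands_outside[OF c, of ij] ij C by (cases "ij \<in> I") (auto simp: v_0)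
  have "v (c ij) \<le> max C e"
  proof (rule finite_combination_bound[OF S])
    fix x
    have small: "v (f x - (\<Sum>ij\<in>S. c ij * B ij x)) < e"
      by (rule expands_tail[OF c e(1) S]) (simp add: S_def)
    have "v (f x - (f x - (\<Sum>ij\<in>S. c ij * B ij x))) \<le> max C e"
      by (rule v_diff_le) (use f[of x] small in auto)
    then show "v (\<Sum>ij\<in>S. c ij * B ij x) \<le> max C e" by simp
  qed (use I e in \<open>simp add: S_def\<close>)
  then show False using ij e by simp
qed

lemma expands_v_le:
  assumes c: "expands c f" "\<And>ij. v (c ij) \<le> C" shows "v (f x) \<le> C"
proof -
  have C: "0 \<le> C" using assms(2)[of undefined] v_nonneg order_trans by blast
  have "v (f x) \<le> C + e" if e: "0 < e" for e
  proof -
    define S0 where "S0 = {ij\<in>I. e \<le> v (c ij)}"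
    have S0: "finite S0" "S0 \<subseteq> I" using expands_null[OF c(1) e] by (auto simp: S0_def)
    have S0': "v (f x - (\<Sum>ij\<in>S0. c ij * B ij x)) < e"
      by (rule expands_tail[OF c(1) e S0]) (simp add: S0_def)
    have "v (\<Sum>ij\<in>S0. c ij * B ij x) \<le> C"
      using S0(2) C by (intro v_sum_le order_trans[OF v_term c(2)]) auto
    then have "v ((f x - (\<Sum>ij\<in>S0. c ij * B ij x)) + (\<Sum>ij\<in>S0. c ij * B ij x)) \<le> C + e"
      using S0' C e by (intro v_add_le) auto
    then show ?thesis by simp
  qed
  then show ?thesis by (rule field_le_epsilon)
qed

lemma expands_add:
  assumes c: "expands c f" and d: "expands d g"
  shows "expands (\<lambda>ij. c ij + d ij) (\<lambda>x. f x + g x)"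
  unfolding expands_def
proof (intro conjI allI impI)
  fix e :: real assume e: "0 < e"
  have "{ij \<in> I. e \<le> v (c ij + d ij)} \<subseteq> {ij \<in> I. e \<le> v (c ij)} \<union> {ij \<in> I. e \<le> v (d ij)}"
    using v_add_less by (fastforce simp: not_less[symmetric])
  then show "finite {ij \<in> I. e \<le> v (c ij + d ij)}"
    using expands_null[OF c e] expands_null[OF d e] by (meson finite_Un finite_subset)
  let ?S0 = "{ij \<in> I. e \<le> v (c ij)} \<union> {ij \<in> I. e \<le> v (d ij)}"
  have "v (f x + g x - (\<Sum>ij\<in>S. (c ij + d ij) * B ij x)) < e" if S: "finite S" "?S0 \<subseteq> S" "S \<subseteq> I" for S x
  proof -
    have "v ((f x - (\<Sum>ij\<in>S. c ij * B ij x)) + (g x - (\<Sum>ij\<in>S. d ij * B ij x))) < e"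
      by (intro v_add_less expands_tail[OF c e] expands_tail[OF d e]) (use S in auto)
    then show ?thesis by (simp add: sum.distrib distrib_right algebra_simps)
  qed
  then show "\<exists>S0. finite S0 \<and> S0 \<subseteq> I \<and> (\<forall>S. finite S \<longrightarrow> S0 \<subseteq> S \<longrightarrow> S \<subseteq> I \<longrightarrow>
      (\<forall>x. v (f x + g x - (\<Sum>ij\<in>S. (c ij + d ij) * B ij x)) < e))"
    using expands_null[OF c e] expands_null[OF d e] by (intro exI[of _ ?S0]) auto
qed (use expands_outside[OF c] expands_outside[OF d] in auto)

lemma expands_scale:
  assumes c: "expands c f" and r: "v r \<le> 1"
  shows "expands (\<lambda>ij. r * c ij) (\<lambda>x. r * f x)"
  unfolding expands_def
proof (intro conjI allI impI)
  fix e :: real assume e: "0 < e"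
  have le: "v (r * y) \<le> v y" for y
    using mult_right_mono[OF r v_nonneg[of y]] by (simp add: v_mult)
  have sub: "{ij \<in> I. e \<le> v (r * c ij)} \<subseteq> {ij \<in> I. e \<le> v (c ij)}"
    using le order_trans by blast
  then show "finite {ij \<in> I. e \<le> v (r * c ij)}" using expands_null[OF c e] finite_subset by blast
  have "v (r * f x - (\<Sum>ij\<in>S. r * c ij * B ij x)) < e"
    if S: "finite S" "{ij \<in> I. e \<le> v (c ij)} \<subseteq> S" "S \<subseteq> I" for S x
    using expands_tail[OF c e S(1,3,2), of x] le[of "f x - (\<Sum>ij\<in>S. c ij * B ij x)"]
    by (simp add: sum_distrib_left right_diff_distrib mult.assoc)
  then show "\<exists>S0. finite S0 \<and> S0 \<subseteq> I \<and> (\<forall>S. finite S \<longrightarrow> S0 \<subseteq> S \<longrightarrow> S \<subseteq> I \<longrightarrow>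
      (\<forall>x. v (r * f x - (\<Sum>ij\<in>S. r * c ij * B ij x)) < e))"
    using expands_null[OF c e] by (intro exI[of _ "{ij \<in> I. e \<le> v (c ij)}"]) auto
qed (use expands_outside[OF c] in auto)

lemma expands_zero: "expands (\<lambda>_. 0) (\<lambda>_. 0)"
  by (auto simp: expands_def v_0)

lemma expands_diff:
  "expands c f \<Longrightarrow> expands d g \<Longrightarrow> expands (\<lambda>ij. c ij - d ij) (\<lambda>x. f x - g x)"
  using expands_add[OF _ expands_scale[of d g "- 1"]] by (simp add: v_uminus v_1)

lemma expands_unique: "expands c f \<Longrightarrow> expands d f \<Longrightarrow> c = d"
proof
  fix ij assume cd: "expands c f" "expands d f"
  have "v (c ij - d ij) \<le> 0" using expands_bound[OF expands_diff[OF cd], of 0] by (simp add: v_0)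
  then show "c ij = d ij" using v_nonneg[of "c ij - d ij"] v_eq_0_iff[of "c ij - d ij"] by simp
qed

lemma expands_B: "ij \<in> I \<Longrightarrow> expands (\<lambda>kl. if kl = ij then 1 else 0) (B ij)"
  unfolding expands_def
proof (intro conjI allI impI)
  fix e :: real assume ij: "ij \<in> I" and e: "0 < e"
  have "{kl \<in> I. e \<le> v (if kl = ij then 1 else 0)} \<subseteq> {ij}" using e by (auto simp: v_0)
  then show "finite {kl \<in> I. e \<le> v (if kl = ij then 1 else 0)}" by (rule finite_subset) simp
  have "v (B ij x - (\<Sum>kl\<in>S. (if kl = ij then 1 else 0) * B kl x)) < e" if "finite S" "{ij} \<subseteq> S" for S x
    using that e sum.remove[of S ij "\<lambda>kl. (if kl = ij then 1 else 0) * B kl x"] by (simp add: v_0)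
  then show "\<exists>S0. finite S0 \<and> S0 \<subseteq> I \<and> (\<forall>S. finite S \<longrightarrow> S0 \<subseteq> S \<longrightarrow> S \<subseteq> I \<longrightarrow>
      (\<forall>x. v (B ij x - (\<Sum>kl\<in>S. (if kl = ij then 1 else 0) * B kl x)) < e))"
    using ij by (intro exI[of _ "{ij}"]) auto
qed auto

lemma expands_sum:
  assumes "finite S" "\<And>i. i \<in> S \<Longrightarrow> expands (c i) (f i)"
  shows "expands (\<lambda>ij. \<Sum>i\<in>S. c i ij) (\<lambda>x. \<Sum>i\<in>S. f i x)"
  using assms by (induction S rule: finite_induct) (auto intro: expands_zero expands_add)

text \<open>Pointwise convergence of the coefficients is enough: by \<open>expands_bound\<close> the
  uniform convergence of the functions makes it uniform over all indices.\<close>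

lemma expands_uniform_limit:
  assumes c: "\<And>n. expands (c n) (f n)" and lim: "\<And>ij. (\<lambda>n. v (c n ij - d ij)) \<longlonglongrightarrow> 0"
    and f: "\<And>e. 0 < e \<Longrightarrow> \<exists>N. \<forall>n\<ge>N. \<forall>x. v (g x - f n x) < e"
  shows "expands d g"
proof -
  have unif: "\<exists>n. (\<forall>x. v (g x - f n x) < e) \<and> (\<forall>ij. v (c n ij - d ij) < e)" if e: "0 < e" for e
  proof -
    obtain N where N: "\<And>n x. n \<ge> N \<Longrightarrow> v (g x - f n x) < e / 2" using f[of "e / 2"] e by auto
    have "v (c N ij - d ij) < e" for ij
    proof -
      obtain M where M: "\<And>n. n \<ge> M \<Longrightarrow> v (c n ij - d ij) < e"
        using order_tendstoD(2)[OF lim[of ij] e] by (auto simp: eventually_sequentially)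
      define n where "n = max M N"
      have "v (c N ij - c n ij) \<le> e / 2"
      proof (rule expands_bound[OF expands_diff[OF c c]])
        fix x
        have "v ((g x - f n x) - (g x - f N x)) \<le> e / 2"
          by (rule v_diff_le) (use N[of n x] N[of N x] in \<open>auto simp: n_def intro: less_imp_le\<close>)
        then show "v (f N x - f n x) \<le> e / 2" by simp
      qed
      then have "v ((c N ij - c n ij) + (c n ij - d ij)) < e"
        using M[of n] e by (intro v_add_less) (auto simp: n_def)
      then show ?thesis by simp
    qed
    moreover have "v (g x - f N x) < e" for x using N[of N x] e by simp
    ultimately show ?thesis by blast
  qed
  show ?thesis unfolding expands_def
  proof (intro conjI allI impI)
    fix ij assume "ij \<notin> I"
    then have "(\<lambda>n::nat. v (d ij)) \<longlonglongrightarrow> 0" using lim[of ij] expands_outside[OF c] by (simp add: v_uminus)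
    then show "d ij = 0" by (simp add: LIMSEQ_const_iff v_eq_0_iff)
  next
    fix e :: real assume e: "0 < e"
    then obtain n where n: "\<And>x. v (g x - f n x) < e" "\<And>ij. v (c n ij - d ij) < e" using unif by blast
    have "v (d ij) < e" if "v (c n ij) < e" for ij
      using v_diff_less[OF that n(2)[of ij]] by simp
    then have "{ij \<in> I. e \<le> v (d ij)} \<subseteq> {ij \<in> I. e \<le> v (c n ij)}" by (auto simp: not_less[symmetric])
    then show "finite {ij \<in> I. e \<le> v (d ij)}" using expands_null[OF c e] finite_subset by blast
    have "v (g x - (\<Sum>ij\<in>S. d ij * B ij x)) < e"
      if S: "finite S" "{ij \<in> I. e \<le> v (c n ij)} \<subseteq> S" "S \<subseteq> I" for S x
    proof -
      have 1: "v (f n x - (\<Sum>ij\<in>S. c n ij * B ij x)) < e" by (rule expands_tail[OF c e S(1,3,2)])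
      have 2: "v (\<Sum>ij\<in>S. (c n ij - d ij) * B ij x) < e"
        by (rule v_sum_less[OF _ e]) (use S n(2) v_term order_le_less_trans in blast)
      have "v ((g x - f n x) + ((f n x - (\<Sum>ij\<in>S. c n ij * B ij x)) + (\<Sum>ij\<in>S. (c n ij - d ij) * B ij x))) < e"
        by (intro v_add_less n 1 2)
      then show ?thesis by (simp add: left_diff_distrib sum_subtractf)
    qed
    then show "\<exists>S0. finite S0 \<and> S0 \<subseteq> I \<and> (\<forall>S. finite S \<longrightarrow> S0 \<subseteq> S \<longrightarrow> S \<subseteq> I \<longrightarrow>
        (\<forall>x. v (g x - (\<Sum>ij\<in>S. d ij * B ij x)) < e))"
      using expands_null[OF c e] by (intro exI[of _ "{ij \<in> I. e \<le> v (c n ij)}"]) auto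
  qed
qed

section \<open>The scalar module over R\<close>

definition Z :: "('c \<Rightarrow> 'c) set" where
  "Z = {f. \<exists>c. expands c f \<and> (\<forall>ij. c ij \<in> R)}"

definition coef :: "('c \<Rightarrow> 'c) \<Rightarrow> nat \<times> nat \<Rightarrow> 'c" where
  "coef f = (THE c. expands c f)"

lemma coef_eqI: "expands c f \<Longrightarrow> coef f = c"
  unfolding coef_def using expands_unique by blast

lemma Z_I: "expands c f \<Longrightarrow> (\<And>ij. c ij \<in> R) \<Longrightarrow> f \<in> Z"
  by (auto simp: Z_def)

lemma Z_expands: "f \<in> Z \<Longrightarrow> expands (coef f) f"
  using coef_eqI by (auto simp: Z_def)

lemma Z_coef: "f \<in> Z \<Longrightarrow> coef f ij \<in> R"
  using coef_eqI by (auto simp: Z_def)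

lemma Z_v_le: "f \<in> Z \<Longrightarrow> v (f x) \<le> 1"
  using expands_v_le[OF Z_expands] Z_coef R_le by blast

lemma Z_outside: "f \<in> Z \<Longrightarrow> x \<notin> A \<Longrightarrow> f x = 0"
  using expands_A Z_expands by blast

lemma coef_bound: "f \<in> Z \<Longrightarrow> (\<And>x. v (f x) \<le> C) \<Longrightarrow> v (coef f ij) \<le> C"
  using expands_bound[OF Z_expands] by blast

lemma Z_B: "ij \<in> I \<Longrightarrow> B ij \<in> Z"
  and coef_B: "ij \<in> I \<Longrightarrow> coef (B ij) kl = (if kl = ij then 1 else 0)"
  using expands_B[of ij] coef_eqI[OF expands_B[of ij]] R_0 R_1 by (auto intro!: Z_I)

lemma Z_add: "f \<in> Z \<Longrightarrow> g \<in> Z \<Longrightarrow> (\<lambda>x. f x + g x) \<in> Z"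
  and coef_add: "f \<in> Z \<Longrightarrow> g \<in> Z \<Longrightarrow> coef (\<lambda>x. f x + g x) ij = coef f ij + coef g ij"
  using expands_add[OF Z_expands Z_expands, of f g] coef_eqI[OF expands_add[OF Z_expands Z_expands, of f g]]
  by (auto intro!: Z_I R_add Z_coef)

lemma Z_diff: "f \<in> Z \<Longrightarrow> g \<in> Z \<Longrightarrow> (\<lambda>x. f x - g x) \<in> Z"
  and coef_diff: "f \<in> Z \<Longrightarrow> g \<in> Z \<Longrightarrow> coef (\<lambda>x. f x - g x) ij = coef f ij - coef g ij"
  using expands_diff[OF Z_expands Z_expands, of f g] coef_eqI[OF expands_diff[OF Z_expands Z_expands, of f g]]
  by (auto intro!: Z_I R_diff Z_coef)

lemma Z_scale: "r \<in> R \<Longrightarrow> f \<in> Z \<Longrightarrow> (\<lambda>x. r * f x) \<in> Z"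
  and coef_scale: "r \<in> R \<Longrightarrow> f \<in> Z \<Longrightarrow> coef (\<lambda>x. r * f x) ij = r * coef f ij"
  using expands_scale[OF Z_expands R_le, of f r] coef_eqI[OF expands_scale[OF Z_expands R_le, of f r]]
  by (auto intro!: Z_I R_mult Z_coef)

lemma Z_zero: "(\<lambda>_. 0) \<in> Z" and coef_zero: "coef (\<lambda>_. 0) ij = 0"
  using expands_zero coef_eqI[OF expands_zero] R_0 by (auto intro!: Z_I)

lemma Z_sum:
  assumes "finite S" "\<And>i. i \<in> S \<Longrightarrow> f i \<in> Z"
  shows "(\<lambda>x. \<Sum>i\<in>S. f i x) \<in> Z" "coef (\<lambda>x. \<Sum>i\<in>S. f i x) ij = (\<Sum>i\<in>S. coef (f i) ij)"
proof -
  have e: "expands (\<lambda>ij. \<Sum>i\<in>S. coef (f i) ij) (\<lambda>x. \<Sum>i\<in>S. f i x)"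
    using assms by (intro expands_sum Z_expands)
  then show "(\<lambda>x. \<Sum>i\<in>S. f i x) \<in> Z" by (rule Z_I) (use assms in \<open>auto intro!: R_sum Z_coef\<close>)
  show "coef (\<lambda>x. \<Sum>i\<in>S. f i x) ij = (\<Sum>i\<in>S. coef (f i) ij)" using coef_eqI[OF e] by simp
qed

text \<open>The coefficients of better and better approximants are Cauchy by orthonormality; their
  limits exist by completeness of the field and are in \<open>R\<close> because \<open>R\<close> is
  closed.\<close>

theorem Z_closed:
  assumes "\<And>e. 0 < e \<Longrightarrow> \<exists>g\<in>Z. \<forall>x. v (f x - g x) < e" shows "f \<in> Z"
proof -
  have lim0: "(\<lambda>n. (1 / real p) ^ n) \<longlonglongrightarrow> 0" by (rule LIMSEQ_realpow_zero) (use p_gt_1 in auto)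
  have "\<exists>g. g \<in> Z \<and> (\<forall>x. v (f x - g x) < (1 / p) ^ n)" for n
    using assms[of "(1 / p) ^ n"] p_gt_1 by auto
  then obtain g where g: "\<And>n. g n \<in> Z" "\<And>n x. v (f x - g n x) < (1 / p) ^ n" by metis
  have gf: "\<exists>N. \<forall>n\<ge>N. \<forall>x. v (f x - g n x) < e" if e: "0 < e" for e
  proof -
    obtain N where N: "\<And>n. n \<ge> N \<Longrightarrow> (1 / real p) ^ n < e"
      using order_tendstoD(2)[OF lim0 e] by (auto simp: eventually_sequentially)
    have "v (f x - g n x) < e" if "n \<ge> N" for n x
      using order_less_trans[OF g(2)[of x n] N[OF that]] .
    then show ?thesis by blast
  qed
  have cau: "v (coef (g m) ij - coef (g n) ij) \<le> e"
    if "\<forall>x. v (f x - g m x) < e" "\<forall>x. v (f x - g n x) < e" for m n ij e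
  proof (rule expands_bound[OF expands_diff[OF Z_expands[OF g(1)] Z_expands[OF g(1)]]])
    fix x have "v ((f x - g n x) - (f x - g m x)) < e" by (rule v_diff_less) (use that in auto)
    then show "v (g m x - g n x) \<le> e" by simp
  qed
  have "\<exists>d. (\<lambda>n. v (coef (g n) ij - d)) \<longlonglongrightarrow> 0" for ij
  proof (rule v_complete, intro allI impI)
    fix e :: real assume e: "0 < e"
    then obtain N where "\<forall>n\<ge>N. \<forall>x. v (f x - g n x) < e / 2" using gf[of "e / 2"] by auto
    then have "v (coef (g m) ij - coef (g n) ij) < e" if "m \<ge> N" "n \<ge> N" for m n
      using cau[of m "e / 2" n ij] that e by fastforce
    then show "\<exists>N. \<forall>m\<ge>N. \<forall>n\<ge>N. v (coef (g m) ij - coef (g n) ij) < e" by blast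
  qed
  then obtain d where d: "\<And>ij. (\<lambda>n. v (coef (g n) ij - d ij)) \<longlonglongrightarrow> 0" by metis
  have "expands d f" by (rule expands_uniform_limit[OF Z_expands[OF g(1)] d gf])
  moreover have "d ij \<in> R" for ij
  proof (rule R_closed)
    fix e :: real assume "0 < e"
    then obtain n where "v (coef (g n) ij - d ij) < e"
      using order_tendstoD(2)[OF d] by (fastforce simp: eventually_sequentially)
    then show "\<exists>s\<in>R. v (d ij - s) < e" using Z_coef[OF g(1)] v_minus_commute by metis
  qed
  ultimately show ?thesis by (rule Z_I)
qed

text \<open>To see that an operator maps into \<open>Z\<close> it suffices to test finite
  combinations of basis elements, if the operator is Lipschitz. The constant C may be large, which
  admits U with its crude bound 1 / |Q|.\<close>

lemma Z_extend:
  assumes f: "f \<in> Z" and C: "0 < C"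
    and bd: "\<And>g e. 0 < e \<Longrightarrow> (\<And>x. v (f x - g x) < e) \<Longrightarrow> \<forall>x. v (\<Phi> f x - \<Phi> g x) \<le> C * e"
    and fin: "\<And>S. finite S \<Longrightarrow> S \<subseteq> I \<Longrightarrow> \<Phi> (\<lambda>x. \<Sum>ij\<in>S. coef f ij * B ij x) \<in> Z"
  shows "\<Phi> f \<in> Z"
proof (rule Z_closed)
  fix e :: real assume e: "0 < e"
  define d where "d = e / (2 * C)"
  have d: "0 < d" "C * d < e" using e C by (auto simp: d_def)
  define S where "S = {ij\<in>I. d \<le> v (coef f ij)}"
  have S: "finite S" "S \<subseteq> I" using expands_null[OF Z_expands[OF f] d(1)] by (auto simp: S_def)
  have S': "v (f x - (\<Sum>ij\<in>S. coef f ij * B ij x)) < d" for x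
    by (rule expands_tail[OF Z_expands[OF f] d(1) S]) (simp add: S_def)
  have "\<forall>x. v (\<Phi> f x - \<Phi> (\<lambda>x. \<Sum>ij\<in>S. coef f ij * B ij x) x) \<le> C * d"
    by (rule bd[OF d(1) S'])
  then have "\<forall>x. v (\<Phi> f x - \<Phi> (\<lambda>x. \<Sum>ij\<in>S. coef f ij * B ij x) x) < e"
    using d(2) by (auto intro: order_le_less_trans)
  then show "\<exists>g\<in>Z. \<forall>x. v (\<Phi> f x - g x) < e" using fin[OF S] by blast
qed

section \<open>Multiplication by rational functions\<close>

lemma B_0: "B (0, j) = B (0, 1)"
  by (rule ext) (simp add: B_def)

lemma B_Z: "1 \<le> j \<Longrightarrow> j \<le> l \<Longrightarrow> B (i, j) \<in> Z"
  by (cases "i = 0") (auto simp: idx_iff B_0[of j] intro!: Z_B)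

lemma coef_B': "1 \<le> j \<Longrightarrow> j \<le> l \<Longrightarrow>
    coef (B (i, j)) ij = (if ij = (i, if i = 0 then 1 else j) then 1 else 0)"
  using coef_B[of "(i, if i = 0 then 1 else j)" ij] l_ge_2
  by (cases "i = 0") (auto simp: idx_iff B_0[of j])

text \<open>d 1 bounds the degree and d j the order of the pole at \<open>pt j\<close>. The bounds
  are kept apart so that a factor with poles at some points visibly leaves the orders at the others
  alone.\<close>

definition Pol :: "(nat \<Rightarrow> nat) \<Rightarrow> ('c \<Rightarrow> 'c) set" where
  "Pol d = {f\<in>Z. \<forall>i j. d j < i \<longrightarrow> coef f (i, j) = 0}"

lemma Pol_Z: "f \<in> Pol d \<Longrightarrow> f \<in> Z"
  by (simp add: Pol_def)

lemma Pol_mono: "f \<in> Pol d \<Longrightarrow> (\<And>j. d j \<le> d' j) \<Longrightarrow> f \<in> Pol d'"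
  unfolding Pol_def using order_le_less_trans by blast

lemma Pol_add: "f \<in> Pol d \<Longrightarrow> g \<in> Pol d \<Longrightarrow> (\<lambda>x. f x + g x) \<in> Pol d"
  by (auto simp: Pol_def Z_add coef_add)

lemma Pol_diff: "f \<in> Pol d \<Longrightarrow> g \<in> Pol d \<Longrightarrow> (\<lambda>x. f x - g x) \<in> Pol d"
  by (auto simp: Pol_def Z_diff coef_diff)

lemma Pol_scale: "r \<in> R \<Longrightarrow> f \<in> Pol d \<Longrightarrow> (\<lambda>x. r * f x) \<in> Pol d"
  by (auto simp: Pol_def Z_scale coef_scale)

lemma Pol_sum: "finite S \<Longrightarrow> (\<And>i. i \<in> S \<Longrightarrow> f i \<in> Pol d) \<Longrightarrow> (\<lambda>x. \<Sum>i\<in>S. f i x) \<in> Pol d"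
  by (auto simp: Pol_def Z_sum)

lemma Pol_B: "1 \<le> j \<Longrightarrow> j \<le> l \<Longrightarrow> i \<le> d j \<Longrightarrow> B (i, j) \<in> Pol d"
  by (auto simp: Pol_def B_Z coef_B')

definition Pidx :: "(nat \<Rightarrow> nat) \<Rightarrow> (nat \<times> nat) set" where
  "Pidx d = {(i, j) \<in> I. i \<le> d j}"

lemma Pidx_finite: "finite (Pidx d)"
proof (rule finite_subset)
  show "Pidx d \<subseteq> (\<Union>j\<in>{1..l}. {..d j} \<times> {j})" by (auto simp: Pidx_def idx_iff)
qed simp

lemma Pol_expand:
  assumes f: "f \<in> Pol d" shows "f x = (\<Sum>ij\<in>Pidx d. coef f ij * B ij x)"
proof (rule ccontr)
  assume ne: "f x \<noteq> (\<Sum>ij\<in>Pidx d. coef f ij * B ij x)"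
  define e where "e = v (f x - (\<Sum>ij\<in>Pidx d. coef f ij * B ij x))"
  have e: "0 < e" using ne v_nonneg v_eq_0_iff by (simp add: e_def order_less_le)
  have "{ij \<in> I. e \<le> v (coef f ij)} \<subseteq> Pidx d"
  proof
    fix ij assume ij: "ij \<in> {ij \<in> I. e \<le> v (coef f ij)}"
    then have "coef f ij \<noteq> 0" using e by (auto simp: v_0)
    then show "ij \<in> Pidx d" using ij f by (cases ij) (auto simp: Pol_def Pidx_def not_less[symmetric])
  qed
  then have "v (f x - (\<Sum>ij\<in>Pidx d. coef f ij * B ij x)) < e"
    by (intro expands_tail[OF Z_expands[OF Pol_Z[OF f]] e Pidx_finite]) (auto simp: Pidx_def)
  then show False by (simp add: e_def)
qed

lemma mult_Pol:
  assumes H: "\<And>i j. (i, j) \<in> I \<Longrightarrow> i \<le> d j \<Longrightarrow> (\<lambda>x. H x * B (i, j) x) \<in> Pol d'"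
    and f: "f \<in> Pol d"
  shows "(\<lambda>x. H x * f x) \<in> Pol d'"
proof -
  have "(\<lambda>x. H x * f x) = (\<lambda>x. \<Sum>ij\<in>Pidx d. coef f ij * (H x * B ij x))"
    using Pol_expand[OF f] by (simp add: sum_distrib_left mult_ac)
  moreover have "(\<lambda>x. \<Sum>ij\<in>Pidx d. coef f ij * (H x * B ij x)) \<in> Pol d'"
    using H by (intro Pol_sum Pidx_finite Pol_scale Z_coef Pol_Z[OF f]) (auto simp: Pidx_def)
  ultimately show ?thesis by simp
qed

lemma x_times_B_1: "x * B (i, 1) x = B (Suc i, 1) x"
  by (simp add: B_def)

lemma x_times_B: "j \<in> {2..l} \<Longrightarrow> x * B (Suc i, j) x = B (i, j) x + pt j * B (Suc i, j) x"
  using A_pt_0[of x j] by (simp add: B_def field_simps)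

lemma inverse_times_B: "j \<in> {2..l} \<Longrightarrow> inverse (x - pt j) * B (i, j) x = B (Suc i, j) x"
  by (simp add: B_def)

lemma inverse_times_B_1:
  "j \<in> {2..l} \<Longrightarrow> inverse (x - pt j) * B (Suc i, 1) x
     = B (i, 1) x + pt j * (inverse (x - pt j) * B (i, 1) x)"
  using A_pt_0[of x j] by (simp add: B_def field_simps)

lemma inverse_times_B_other:
  assumes "j \<in> {2..l}" "j' \<in> {2..l}" "j \<noteq> j'"
  shows "inverse (x - pt j) * B (Suc i, j') x
     = inverse (pt j - pt j') * (inverse (x - pt j) * B (i, j') x - B (Suc i, j') x)"
proof (cases "x \<in> A")
  case True
  have "v (pt j - pt j') = 1" using v_pt_diff assms by blast
  then have "pt j - pt j' \<noteq> 0" by (auto simp: v_0)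
  then have "inverse (x - pt j) * inverse (x - pt j')
      = inverse (pt j - pt j') * (inverse (x - pt j) - inverse (x - pt j'))"
    using A_pt_0[OF True assms(1)] A_pt_0[OF True assms(2)] by (simp add: field_simps)
  then have "inverse (x - pt j) * inverse (x - pt j') * inverse (x - pt j') ^ i
      = inverse (pt j - pt j') * (inverse (x - pt j) - inverse (x - pt j')) * inverse (x - pt j') ^ i"
    by simp
  then show ?thesis using True assms by (simp add: B_def algebra_simps)
qed (simp add: B_def)

lemma x_times_Pol: "f \<in> Pol d \<Longrightarrow> (\<lambda>x. x * f x) \<in> Pol (d(1 := Suc (d 1)))"
proof (erule mult_Pol[rotated])
  fix i j assume ij: "(i, j) \<in> I" "i \<le> d j"
  show "(\<lambda>x. x * B (i, j) x) \<in> Pol (d(1 := Suc (d 1)))"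
  proof (cases "j = 1")
    case True
    then show ?thesis using ij l_ge_2 by (simp only: x_times_B_1) (auto intro!: Pol_B)
  next
    case False
    then obtain i' where i': "i = Suc i'" using ij by (cases i) (auto simp: idx_iff)
    have j: "j \<in> {2..l}" using ij False by (auto simp: idx_iff)
    show ?thesis unfolding i' x_times_B[OF j]
      using ij j i' by (intro Pol_add Pol_scale Pol_B R_pt) auto
  qed
qed

text \<open>Partial fractions, by induction on the order. The denominators pt j - pt j' are units of
  \<open>R\<close>, since distinct Teichmueller points are at distance 1.\<close>

lemma inverse_times_Pol:
  assumes j: "j \<in> {2..l}" and f: "f \<in> Pol d"
  shows "(\<lambda>x. inverse (x - pt j) * f x) \<in> Pol (d(j := Suc (d j)))"
proof (rule mult_Pol[OF _ f])
  fix i j' assume ij: "(i, j') \<in> I" "i \<le> d j'"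
  have base: "(\<lambda>x. inverse (x - pt j) * B (0, j') x) \<in> Pol (d(j := Suc (d j)))" for j'
    unfolding B_0[of j'] B_0[of j, symmetric] inverse_times_B[OF j] using j by (intro Pol_B) auto
  consider "j' = 1" | "j' = j" | "j' \<in> {2..l}" "j' \<noteq> j" using ij by (fastforce simp: idx_iff)
  then show "(\<lambda>x. inverse (x - pt j) * B (i, j') x) \<in> Pol (d(j := Suc (d j)))"
  proof cases
    case 1
    have "i \<le> d 1 \<Longrightarrow> (\<lambda>x. inverse (x - pt j) * B (i, 1) x) \<in> Pol (d(j := Suc (d j)))"
    proof (induction i)
      case (Suc i)
      show ?case unfolding inverse_times_B_1[OF j]
        by (intro Pol_add Pol_scale Pol_B R_pt j Suc.IH) (use Suc.prems l_ge_2 in auto)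
    qed (rule base)
    then show ?thesis using 1 ij by simp
  next
    case 2
    show ?thesis unfolding 2 inverse_times_B[OF j] using ij 2 j by (intro Pol_B) auto
  next
    case 3
    have r: "inverse (pt j - pt j') \<in> R"
      using 3 j v_pt_diff by (intro R_inverse R_diff R_pt) auto
    have "i \<le> d j' \<Longrightarrow> (\<lambda>x. inverse (x - pt j) * B (i, j') x) \<in> Pol (d(j := Suc (d j)))"
    proof (induction i)
      case (Suc i)
      show ?case unfolding inverse_times_B_other[OF j 3(1) 3(2)[symmetric]]
        by (intro Pol_scale r Pol_diff Pol_B Suc.IH) (use Suc.prems 3 in auto)
    qed (rule base)
    then show ?thesis using ij by simp
  qed
qed

lemma mult_Z:
  assumes H: "\<And>x. x \<in> A \<Longrightarrow> v (H x) \<le> 1" "\<And>ij. ij \<in> I \<Longrightarrow> (\<lambda>x. H x * B ij x) \<in> Z"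
    and f: "f \<in> Z"
  shows "(\<lambda>x. H x * f x) \<in> Z"
proof -
  \<comment> \<open>The cut-off makes the operator Lipschitz everywhere: H is bounded on
    \<open>A\<close> only. On functions that vanish outside \<open>A\<close> it changes
    nothing.\<close>
  define \<Phi> where "\<Phi> f = (\<lambda>x. if x \<in> A then H x * f x else 0)" for f :: "'c \<Rightarrow> 'c"
  have "\<Phi> f \<in> Z"
  proof (rule Z_extend[OF f, where C = 1])
    fix g e assume e: "0 < (e::real)" "\<And>x. v (f x - g x) < e"
    show "\<forall>x. v (\<Phi> f x - \<Phi> g x) \<le> 1 * e"
    proof
      fix x
      have "v (H x) * v (f x - g x) \<le> 1 * e" if "x \<in> A"
        using H(1)[OF that] e(2)[of x] by (intro mult_mono v_nonneg) auto
      then show "v (\<Phi> f x - \<Phi> g x) \<le> 1 * e"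
        using e(1) by (auto simp: \<Phi>_def v_0 v_mult simp flip: right_diff_distrib)
    qed
  next
    fix S assume S: "finite S" "S \<subseteq> I"
    have "\<Phi> (\<lambda>x. \<Sum>ij\<in>S. coef f ij * B ij x) = (\<lambda>x. \<Sum>ij\<in>S. coef f ij * (H x * B ij x))"
      by (rule ext) (simp add: \<Phi>_def B_outside sum_distrib_left mult_ac)
    then show "\<Phi> (\<lambda>x. \<Sum>ij\<in>S. coef f ij * B ij x) \<in> Z"
      using S H(2) Z_coef[OF f] by (auto intro!: Z_sum Z_scale)
  qed simp
  moreover have "\<Phi> f = (\<lambda>x. H x * f x)"
    using Z_outside[OF f] by (auto simp: \<Phi>_def)
  ultimately show ?thesis by simp
qed

lemma B_in_Pol: "ij \<in> I \<Longrightarrow> B ij \<in> Pol (\<lambda>_. fst ij)"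
  by (cases ij) (auto simp: idx_iff intro!: Pol_B)

lemma x_times_Z:
  assumes f: "f \<in> Z" shows "(\<lambda>x. x * f x) \<in> Z"
proof (rule mult_Z[OF _ _ f])
  show "(\<lambda>x. x * B ij x) \<in> Z" if "ij \<in> I" for ij
    by (rule Pol_Z[OF x_times_Pol[OF B_in_Pol[OF that]]])
qed (simp add: A_1)

lemma inverse_times_Z:
  assumes j: "j \<in> {2..l}" and f: "f \<in> Z" shows "(\<lambda>x. inverse (x - pt j) * f x) \<in> Z"
proof (rule mult_Z[OF _ _ f])
  show "v (inverse (x - pt j)) \<le> 1" if "x \<in> A" for x using A_pt[OF that j] by (simp add: v_inverse)
  show "(\<lambda>x. inverse (x - pt j) * B ij x) \<in> Z" if "ij \<in> I" for ij
    by (rule Pol_Z[OF inverse_times_Pol[OF j B_in_Pol[OF that]]])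
qed

text \<open>Rational functions over \<open>R\<close> with poles at most at \<infinity> and the
  \<open>pt j\<close> with j in J, not cut off outside \<open>A\<close>. J = {} gives polynomials
  and J = {2} Laurent polynomials.\<close>

inductive_set alg :: "nat set \<Rightarrow> ('c \<Rightarrow> 'c) set" for J where
  const: "r \<in> R \<Longrightarrow> (\<lambda>x. r) \<in> alg J"
| var: "(\<lambda>x. x) \<in> alg J"
| inv: "j \<in> J \<Longrightarrow> (\<lambda>x. inverse (x - pt j)) \<in> alg J"
| add: "f \<in> alg J \<Longrightarrow> g \<in> alg J \<Longrightarrow> (\<lambda>x. f x + g x) \<in> alg J"
| mult: "f \<in> alg J \<Longrightarrow> g \<in> alg J \<Longrightarrow> (\<lambda>x. f x * g x) \<in> alg J"

lemma alg_power: "f \<in> alg J \<Longrightarrow> (\<lambda>x. f x ^ n) \<in> alg J"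
  by (induction n) (auto intro: alg.const alg.mult R_1)

lemma alg_sum: "(\<And>i. i \<in> S \<Longrightarrow> f i \<in> alg J) \<Longrightarrow> (\<lambda>x. \<Sum>i\<in>S. f i x) \<in> alg J"
  by (induction S rule: infinite_finite_induct) (auto intro: alg.const alg.add R_0)

lemma alg_diff: "f \<in> alg J \<Longrightarrow> g \<in> alg J \<Longrightarrow> (\<lambda>x. f x - g x) \<in> alg J"
  using alg.add[of f J "\<lambda>x. - 1 * g x"] alg.mult[OF alg.const[of "- 1"], of g J] R_uminus[OF R_1]
  by simp

lemma alg_mono: "f \<in> alg J \<Longrightarrow> J \<subseteq> J' \<Longrightarrow> f \<in> alg J'"
  by (induction rule: alg.induct) (auto intro: alg.intros)

lemma alg_times_Z: "H \<in> alg J \<Longrightarrow> J \<subseteq> {2..l} \<Longrightarrow> f \<in> Z \<Longrightarrow> (\<lambda>x. H x * f x) \<in> Z"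
proof (induction arbitrary: f rule: alg.induct)
  case (inv j) then show ?case by (intro inverse_times_Z) auto
next
  case (add g h) then show ?case using Z_add[OF add.IH(1) add.IH(2), of f f] by (simp add: distrib_right)
next
  case (mult g h) then show ?case using mult.IH(1)[OF _ mult.IH(2)[of f]] by (simp add: mult.assoc)
qed (auto intro: Z_scale x_times_Z)

lemma v_alg: "H \<in> alg J \<Longrightarrow> J \<subseteq> {2..l} \<Longrightarrow> x \<in> A \<Longrightarrow> v (H x) \<le> 1"
  by (induction rule: alg.induct) (auto simp: A_1 R_le v_inverse A_pt subset_iff intro: v_add_le v_mult_le_1)

text \<open>The growth n of the orders depends on H alone and occurs only at \<infinity> and in J.
  The telescoping argument uses the uniformity, and the diagonal of a Laurent polynomial uses that
  the orders at its non-poles do not grow.\<close>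

lemma alg_times_Pol:
  "H \<in> alg J \<Longrightarrow> J \<subseteq> {2..l} \<Longrightarrow>
     \<exists>n. \<forall>d f. f \<in> Pol d \<longrightarrow> (\<lambda>x. H x * f x) \<in> Pol (\<lambda>j. if j = 1 \<or> j \<in> J then d j + n else d j)"
proof (induction rule: alg.induct)
  case (const r)
  show ?case by (intro exI[of _ 0] allI impI, erule Pol_mono[OF Pol_scale[OF const(1)]]) auto
next
  case var
  show ?case by (intro exI[of _ 1] allI impI, erule Pol_mono[OF x_times_Pol]) auto
next
  case (inv j)
  show ?case by (intro exI[of _ 1] allI impI, erule Pol_mono[OF inverse_times_Pol, rotated]) (use inv in auto)
next
  case (add g h)
  then obtain m n where m: "\<And>d f. f \<in> Pol d \<Longrightarrow> (\<lambda>x. g x * f x) \<in> Pol (\<lambda>j. if j = 1 \<or> j \<in> J then d j + m else d j)"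
    and n: "\<And>d f. f \<in> Pol d \<Longrightarrow> (\<lambda>x. h x * f x) \<in> Pol (\<lambda>j. if j = 1 \<or> j \<in> J then d j + n else d j)" by blast
  show ?case unfolding distrib_right
    by (intro exI[of _ "m + n"] allI impI Pol_add Pol_mono[OF m] Pol_mono[OF n]) auto
next
  case (mult g h)
  then obtain m n where m: "\<And>d f. f \<in> Pol d \<Longrightarrow> (\<lambda>x. g x * f x) \<in> Pol (\<lambda>j. if j = 1 \<or> j \<in> J then d j + m else d j)"
    and n: "\<And>d f. f \<in> Pol d \<Longrightarrow> (\<lambda>x. h x * f x) \<in> Pol (\<lambda>j. if j = 1 \<or> j \<in> J then d j + n else d j)" by blast
  show ?case unfolding mult.assoc
    by (intro exI[of _ "m + n"] allI impI, erule Pol_mono[OF m[OF n]]) auto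
qed

lemma B_times_Z:
  assumes ij: "ij \<in> I" and f: "f \<in> Z" shows "(\<lambda>x. B ij x * f x) \<in> Z"
proof -
  obtain i j where ij': "ij = (i, j)" by force
  define H where "H = (if j = 1 then (\<lambda>x. x ^ i) else (\<lambda>x. inverse (x - pt j) ^ i))"
  have "H \<in> alg {2..l}" using ij unfolding H_def ij'
    by (cases "j = 1") (auto simp: idx_iff intro!: alg_power alg.var alg.inv)
  then have "(\<lambda>x. H x * f x) \<in> Z" using f by (intro alg_times_Z) auto
  moreover have "H x * f x = B ij x * f x" for x
    using Z_outside[OF f, of x] by (auto simp: H_def B_def ij')
  ultimately show ?thesis by simp
qed

theorem Z_mult:
  assumes f: "f \<in> Z" and g: "g \<in> Z" shows "(\<lambda>x. f x * g x) \<in> Z"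
proof (rule mult_Z[OF _ _ g])
  show "(\<lambda>x. f x * B ij x) \<in> Z" if "ij \<in> I" for ij
    using B_times_Z[OF that f] by (simp add: mult.commute)
qed (rule Z_v_le[OF f])

lemma one_Z: "B (0, 1) \<in> Z"
  using B_Z[of 1 0] l_ge_2 by simp

end

section \<open>Substitution of x^Q\<close>

locale frobenius_disc = punctured_disc p v a l pt R
  for p and v :: "'c::{alg_closed_field, field_char_0} \<Rightarrow> real" and a l pt R +
  fixes k Q :: nat
  assumes k_pos: "1 \<le> k" and Q_def: "Q = (p ^ a) ^ k"
begin

lemma Q_power: "Q = p ^ (a * k)"
  by (simp add: Q_def power_mult)

lemma ak_pos: "1 \<le> a * k"
  using a_pos k_pos by simp

lemma Q_gt_1: "1 < Q"
  unfolding Q_power using p_pow_gt_1[OF ak_pos] .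

lemma pt_Q: "j \<in> {2..l} \<Longrightarrow> pt j ^ Q = pt j"
  unfolding Q_def by (intro teich_power pt_teich)

lemma binomial_Q:
  assumes j: "j \<in> {2..l}"
  shows "x ^ Q - pt j = (x - pt j) ^ Q + (\<Sum>i\<in>{0<..<Q}. of_nat (Q choose i) * pt j ^ (Q - i) * (x - pt j) ^ i)"
proof -
  have "x ^ Q = ((x - pt j) + pt j) ^ Q" by simp
  also have "\<dots> = (\<Sum>i\<le>Q. of_nat (Q choose i) * (x - pt j) ^ i * pt j ^ (Q - i))" by (rule binomial_ring)
  also have "{..Q} = insert 0 (insert Q {0<..<Q})" using Q_gt_1 by auto
  finally show ?thesis using Q_gt_1 by (simp add: pt_Q[OF j] mult_ac)
qed

lemma v_choose: "i \<in> {0<..<Q} \<Longrightarrow> v (of_nat (Q choose i)) \<le> 1 / p"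
  unfolding Q_power by (intro v_binomial) auto

text \<open>As \<open>pt j\<close> is fixed by the Q-th power, x^Q - pt j is congruent to (x - pt
  j)^Q modulo p, so one is below 1 exactly when the other is.\<close>

lemma A_Q_iff: "x ^ Q \<in> A \<longleftrightarrow> x \<in> A"
proof -
  have le: "v (x ^ Q) \<le> 1 \<longleftrightarrow> v x \<le> 1"
    using power_le_one_iff[of "v x" Q] Q_gt_1 v_nonneg by (simp add: v_power)
  have "v (x ^ Q - pt j) < 1 \<longleftrightarrow> v (x - pt j) < 1" if x: "v x \<le> 1" and j: "j \<in> {2..l}" for j
  proof -
    let ?S = "\<Sum>i\<in>{0<..<Q}. of_nat (Q choose i) * pt j ^ (Q - i) * (x - pt j) ^ i"
    have "v ?S < 1"
    proof (rule v_sum_less)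
      fix i assume i: "i \<in> {0<..<Q}"
      have "v (of_nat (Q choose i)) * v (pt j ^ (Q - i)) * v ((x - pt j) ^ i) \<le> 1 / p * 1 * 1"
        using i by (intro mult_mono v_choose v_power_le_1 v_pt j v_diff_le x v_nonneg mult_nonneg_nonneg) auto
      also have "\<dots> < 1" using p_gt_1 by simp
      finally show "v (of_nat (Q choose i) * pt j ^ (Q - i) * (x - pt j) ^ i) < 1" by (simp add: v_mult)
    qed simp
    then have "v (x ^ Q - pt j) < 1 \<longleftrightarrow> v ((x - pt j) ^ Q) < 1"
      using binomial_Q[OF j, of x] v_add_less[of "(x - pt j) ^ Q" 1 ?S] v_diff_less[of "x ^ Q - pt j" 1 ?S]
      by auto
    then show ?thesis using Q_gt_1 v_nonneg by (simp add: v_power power_less_one_iff)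
  qed
  then have "\<forall>j\<in>{2..l}. 1 \<le> v (x ^ Q - pt j) \<longleftrightarrow> 1 \<le> v (x - pt j)" if "v x \<le> 1"
    using that by (simp add: not_less[symmetric])
  then show ?thesis by (cases "v x \<le> 1") (auto simp: A_def le)
qed

definition E :: "nat \<Rightarrow> 'c \<Rightarrow> 'c" where
  "E j x = (\<Sum>i\<in>{0<..<Q}. of_nat ((Q choose i) div p) * pt j ^ (Q - i) * (x - pt j) ^ i)"

lemma binomial_E:
  assumes j: "j \<in> {2..l}" shows "x ^ Q - pt j = (x - pt j) ^ Q + of_nat p * E j x"
proof -
  have "of_nat (Q choose i) = of_nat p * (of_nat ((Q choose i) div p) :: 'c)" if "i \<in> {0<..<Q}" for i
  proof -
    have "\<not> v (of_int (int (Q choose i))) = 1" using v_choose[OF that] p_gt_1 by auto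
    then have "int p dvd int (Q choose i)" using v_of_int_unit by blast
    then have "Q choose i = p * ((Q choose i) div p)" by simp
    then show ?thesis by (metis of_nat_mult)
  qed
  then show ?thesis by (simp add: binomial_Q[OF j] E_def sum_distrib_left mult.assoc)
qed

lemma E_alg: "j \<in> {2..l} \<Longrightarrow> E j \<in> alg {}"
  unfolding E_def by (intro alg_sum alg.mult alg.const R_of_nat R_power R_pt alg_power alg_diff alg.var)

text \<open>The zeros of x^Q - pt j need not be permitted poles, but they all lie in the residue
  disc of \<open>pt j\<close>. A geometric series therefore expresses the inverse through powers of
  1 / (x - pt j).\<close>

lemma inverse_frobenius_Z:
  assumes j: "j \<in> {2..l}" shows "(\<lambda>x. B (1, j) (x ^ Q)) \<in> Z"
proof (rule Z_closed)
  fix e :: real assume e: "0 < e"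
  have lim0: "(\<lambda>n. (1 / real p) ^ n) \<longlonglongrightarrow> 0" by (rule LIMSEQ_realpow_zero) (use p_gt_1 in auto)
  obtain n where n: "(1 / real p) ^ n < e"
    using order_tendstoD(2)[OF lim0 e] by (auto simp: eventually_sequentially)
  \<comment> \<open>Chosen so that x^Q - pt j = (x - pt j)^Q (1 - H); the factor p makes |H| \<le> 1
    / p on \<open>A\<close>.\<close>
  define H where "H = (\<lambda>x. - of_nat p * (E j x * inverse (x - pt j) ^ Q))"
  have EH: "(\<lambda>x. E j x * inverse (x - pt j) ^ Q) \<in> alg {2..l}"
    using E_alg[OF j] j by (intro alg.mult alg_power alg.inv) (auto intro: alg_mono)
  then have H: "H \<in> alg {2..l}" unfolding H_def
    by (intro alg.mult[OF alg.const]) (intro R_uminus R_of_nat)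
  define g where "g = (\<lambda>x. inverse (x - pt j) ^ Q * ((\<Sum>m<n. H x ^ m) * B (0, 1) x))"
  have "g \<in> Z" unfolding g_def using j
    by (intro alg_times_Z[OF alg_power[OF alg.inv[of j "{2..l}"]]] alg_times_Z[OF alg_sum[OF alg_power[OF H]]] one_Z)
       auto
  moreover have "v (B (1, j) (x ^ Q) - g x) < e" for x
  proof (cases "x \<in> A")
    case True
    define y where "y = x - pt j"
    have y: "v y = 1" "y \<noteq> 0" using A_pt[OF True j] A_pt_0[OF True j] by (auto simp: y_def)
    have vH: "v (H x) \<le> 1 / p"
    proof -
      have "1 / p * v (E j x * inverse (x - pt j) ^ Q) \<le> 1 / p * 1"
        using v_alg[OF EH subset_refl True] by (intro mult_left_mono) auto
      then show ?thesis unfolding H_def v_mult[of "- of_nat p"] by (simp add: v_uminus v_p)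
    qed
    then have vH1: "v (H x) < 1" using p_gt_1 by (simp add: order_le_less_trans)
    have v1: "v (1 - H x) = 1" using v_add_eq[of "- H x" 1] vH1 by (simp add: v_uminus v_1)
    then have H1: "1 - H x \<noteq> 0" by (auto simp: v_0)
    have xQ: "x ^ Q - pt j = y ^ Q * (1 - H x)"
      unfolding binomial_E[OF j] using y(2) by (simp add: H_def y_def[symmetric] power_inverse field_simps)
    have "B (1, j) (x ^ Q) = inverse (y ^ Q * (1 - H x))"
      using True j by (simp add: B_def A_Q_iff xQ)
    moreover have "g x = inverse (y ^ Q) * ((1 - H x ^ n) / (1 - H x))"
      using True H1 by (simp add: g_def B_def y_def sum_gp_strict power_inverse)
    ultimately have "B (1, j) (x ^ Q) - g x = inverse (y ^ Q) * (H x ^ n / (1 - H x))"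
      using H1 y(2) by (simp add: field_simps)
    then have "v (B (1, j) (x ^ Q) - g x) = v (H x) ^ n"
      by (simp add: v_mult v_inverse v_divide v_power y(1) v1)
    also have "\<dots> \<le> (1 / p) ^ n" using vH v_nonneg by (intro power_mono) auto
    finally show ?thesis using n by simp
  next
    case False
    then show ?thesis using e by (simp add: B_def A_Q_iff g_def v_0)
  qed
  ultimately show "\<exists>g\<in>Z. \<forall>x. v (B (1, j) (x ^ Q) - g x) < e" by blast
qed

theorem frobenius_Z:
  assumes f: "f \<in> Z" shows "(\<lambda>x. f (x ^ Q)) \<in> Z"
proof (rule Z_extend[OF f, where C = 1 and \<Phi> = "\<lambda>f x. f (x ^ Q)"])
  fix S assume S: "finite S" "S \<subseteq> I"
  have "(\<lambda>x. B ij (x ^ Q)) \<in> Z" if ij: "ij \<in> I" for ij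
  proof -
    obtain i j where ij': "ij = (i, j)" by force
    show ?thesis
    proof (cases "j = 1")
      case True
      then have "(\<lambda>x. B ij (x ^ Q)) = B (Q * i, 1)"
        by (auto simp: ij' B_def A_Q_iff power_mult)
      then show ?thesis using B_Z[of 1] l_ge_2 by simp
    next
      case False
      then have j: "j \<in> {2..l}" using ij ij' by (auto simp: idx_iff)
      have "(\<lambda>x. B (i, j) (x ^ Q)) \<in> Z"
      proof (induction i)
        case 0
        have "(\<lambda>x. B (0, j) (x ^ Q)) = B (0, 1)" by (auto simp: B_def A_Q_iff)
        then show ?case using one_Z by simp
      next
        case (Suc i)
        have "(\<lambda>x. B (Suc i, j) (x ^ Q)) = (\<lambda>x. B (1, j) (x ^ Q) * B (i, j) (x ^ Q))"
          using False by (auto simp: B_def)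
        then show ?case using Z_mult[OF inverse_frobenius_Z[OF j] Suc.IH] by simp
      qed
      then show ?thesis by (simp add: ij')
    qed
  qed
  then show "(\<lambda>x. \<Sum>ij\<in>S. coef f ij * B ij (x ^ Q)) \<in> Z"
    using S Z_coef[OF f] by (intro Z_sum Z_scale) auto
qed (auto intro: less_imp_le)

section \<open>The operator \<open>U\<close>\<close>

definition U :: "('c \<Rightarrow> 'c) \<Rightarrow> 'c \<Rightarrow> 'c" where
  "U f x = inverse (of_nat Q) * (\<Sum>z | z ^ Q = x. f z)"

lemma Q_0: "of_nat Q \<noteq> (0::'c)"
  using Q_gt_1 by simp

lemma U_pull_out: "U (\<lambda>z. h (z ^ Q) * f z) x = h x * U f x"
  by (simp add: U_def sum_distrib_left mult_ac)

lemma U_scale: "U (\<lambda>z. c * f z) x = c * U f x"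
  using U_pull_out[of "\<lambda>_. c"] by simp

lemma U_add: "U (\<lambda>z. f z + g z) x = U f x + U g x"
  by (simp add: U_def sum.distrib distrib_left)

lemma U_diff: "U (\<lambda>z. f z - g z) x = U f x - U g x"
  by (simp add: U_def sum_subtractf right_diff_distrib)

lemma U_sum: "U (\<lambda>z. \<Sum>i\<in>S. f i z) x = (\<Sum>i\<in>S. U (f i) x)"
  by (simp add: U_def sum_distrib_left) (rule sum.swap)

lemma U_cong: "(\<And>z. z ^ Q = x \<Longrightarrow> f z = g z) \<Longrightarrow> U f x = U g x"
  by (simp add: U_def)

lemma U_outside:
  assumes "\<And>z. z \<notin> A \<Longrightarrow> f z = 0" "x \<notin> A" shows "U f x = 0"
proof -
  have "U f x = U (\<lambda>_. 0) x" by (rule U_cong) (use assms A_Q_iff in auto)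
  then show ?thesis by (simp add: U_def)
qed

lemma U_power: "x \<in> A \<Longrightarrow> U (\<lambda>z. z ^ i) x = (if Q dvd i then x ^ (i div Q) else 0)"
  using sum_root_powers[of Q x i] Q_gt_1 A_0[of x] Q_0 by (simp add: U_def)

text \<open>For exponents below Q, only the constant term of the binomial expansion in z survives
  under U. These are the initial values of the recursion for U at a pole.\<close>

lemma U_shifted_power:
  assumes x: "x \<in> A" and m: "m < Q" shows "U (\<lambda>z. (z - P) ^ m) x = (- P) ^ m"
proof -
  have "(\<lambda>z. (z - P) ^ m) = (\<lambda>z. \<Sum>i\<le>m. (of_nat (m choose i) * (- P) ^ (m - i)) * z ^ i)"
    using binomial_ring[of _ "- P" m] by (auto simp: mult_ac)
  then have "U (\<lambda>z. (z - P) ^ m) x = (\<Sum>i\<le>m. (of_nat (m choose i) * (- P) ^ (m - i)) * U (\<lambda>z. z ^ i) x)"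
    by (simp only: U_sum U_scale)
  also have "\<dots> = (\<Sum>i\<le>m. if i = 0 then (- P) ^ m else 0)"
    using m by (intro sum.cong) (auto simp: U_power[OF x] dest: dvd_imp_le)
  finally show ?thesis by simp
qed

text \<open>
  Coefficients of \<open>U ((z - P) ^ (Q - 1 - t))\<close> with respect to the powers of \<open>1 / (x - P)\<close>. The
  recursion comes from \<open>x - P = z ^ Q - P ^ Q = (\<Sum>k = 1..Q. (Q choose k) P ^ (Q - k) (z - P) ^ k)\<close>.
  The exponent is shifted by \<open>Q - 1\<close> so that all starting values are constants.
\<close>

primrec uc :: "'c \<Rightarrow> nat \<Rightarrow> nat \<Rightarrow> 'c" where
  "uc P 0 t = (if t < Q then (- P) ^ (Q - 1 - t) else 0)"
| "uc P (Suc i) t = (if t < Q then 0 else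
     (\<Sum>k\<in>{1..Q}. of_nat (Q choose k) * P ^ (Q - k) * uc P i (t - k)))"

lemma uc_R: "P \<in> R \<Longrightarrow> uc P i t \<in> R"
  by (induction i arbitrary: t) (auto intro!: R_0 R_power R_uminus R_sum R_mult R_of_nat)

lemma uc_eq_0: "1 \<le> i \<Longrightarrow> t < i + Q - 1 \<Longrightarrow> uc P i t = 0"
proof (induction i arbitrary: t)
  case (Suc i)
  show ?case
  proof (cases "t < Q")
    case False
    then have "1 \<le> i" using Suc.prems by (cases i) auto
    then have "uc P i (t - k) = 0" if "k \<in> {1..Q}" for k
      using Suc.IH[of "t - k"] Suc.prems that False by auto
    then show ?thesis by simp
  qed simp
qed simp

lemma uc_gt: "t < i \<Longrightarrow> uc P i t = 0"
  using uc_eq_0[of i t] Q_gt_1 by simp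

text \<open>A step with k = Q has coefficient 1 but uses up Q units of t; a step with k < Q gains a
  factor 1 / p and uses at least one unit. The inequality in the hypothesis is preserved by both
  kinds of step, with e lowered by one in the second, so if t is small against Q i then at least e
  steps must be of the second kind.\<close>

lemma v_uc:
  assumes P: "P \<in> R" and i: "(Q - 1) * e + t + 1 \<le> Q * i"
  shows "v (uc P i t) \<le> (1 / p) ^ e"
  using i
proof (induction i arbitrary: e t)
  case (Suc i)
  show ?case
  proof (cases "e = 0 \<or> t < Q")
    case True
    then show ?thesis
    proof
      assume "e = 0" then show ?thesis using R_le[OF uc_R[OF P, of "Suc i" t]] by simp
    qed (simp add: v_0)
  next
    case False
    then obtain e' where e': "e = Suc e'" by (cases e) auto
    have step: "v (of_nat (Q choose k) * P ^ (Q - k) * uc P i (t - k)) \<le> (1 / p) ^ e" if k: "k \<in> {1..Q}" for k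
    proof (cases "k = Q")
      case True
      obtain t' where "t = Q + t'" using False by (meson le_Suc_ex not_less)
      then have "(Q - 1) * e + (t - Q) + 1 \<le> Q * i" using Suc.prems by simp
      then show ?thesis using True Suc.IH by simp
    next
      case kQ: False
      have "(Q - 1) * e = (Q - 1) * e' + (Q - 1)" by (simp add: e')
      moreover obtain t' where "t = k + t'" using False k by (metis atLeastAtMost_iff le_Suc_ex le_trans not_less)
      ultimately have "(Q - 1) * e' + (t - k) + 1 \<le> Q * i" using Suc.prems k by simp
      then have "v (uc P i (t - k)) \<le> (1 / p) ^ e'" by (rule Suc.IH)
      then have "v (of_nat (Q choose k)) * v (P ^ (Q - k)) * v (uc P i (t - k)) \<le> 1 / p * 1 * (1 / p) ^ e'"
        using k kQ by (intro mult_mono v_choose v_power_le_1 R_le[OF P] v_nonneg mult_nonneg_nonneg) auto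
      then show ?thesis by (simp add: v_mult e')
    qed
    have "v (\<Sum>k\<in>{1..Q}. of_nat (Q choose k) * P ^ (Q - k) * uc P i (t - k)) \<le> (1 / p) ^ e"
      by (rule v_sum_le[OF step]) auto
    then show ?thesis using False by simp
  qed
qed simp

text \<open>These are the diagonal entries of U at a nonzero pole. At this smallest t only k = 1
  survives in the recursion, contributing Q P^(Q - 1) = Q per step; the starting value 1 comes from
  (-P + P)^Q = 0.\<close>

lemma uc_leading:
  assumes P: "P ^ (Q - 1) = 1" shows "uc P (Suc i) (Suc i + Q - 1) = of_nat Q ^ i"
proof (induction i)
  case 0
  have P0: "P \<noteq> 0" using P Q_gt_1 by (auto simp: power_0_left)
  have PQ: "P ^ Q = P" using P Q_gt_1 by (metis Suc_diff_1 less_trans power_Suc mult.right_neutral zero_less_one)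
  have "uc P 1 Q = (\<Sum>k\<in>{1..Q}. of_nat (Q choose k) * P ^ (Q - k) * (- P) ^ (k - 1))"
    using Q_gt_1 by (auto intro!: sum.cong)
  \<comment> \<open>The factor -P raises the exponent k - 1 to k and turns the sum into the binomial
    expansion without its term k = 0.\<close>
  then have "(- P) * uc P 1 Q = (\<Sum>k\<in>{1..Q}. of_nat (Q choose k) * P ^ (Q - k) * (- P) ^ k)"
    unfolding sum_distrib_left by (auto simp: sum_distrib_left mult_ac power_eq_if intro!: sum.cong)
  also have "\<dots> = (\<Sum>k\<le>Q. of_nat (Q choose k) * (- P) ^ k * P ^ (Q - k)) - P ^ Q"
    by (simp add: atMost_atLeast0 sum.atLeast_Suc_atMost mult_ac)
  also have "\<dots> = (- P + P) ^ Q - P ^ Q" by (simp only: binomial_ring)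
  also have "\<dots> = (- P) * 1" using Q_gt_1 PQ by (simp add: power_0_left)
  finally have "uc P 1 Q = 1" using P0 by (simp only: mult_cancel_left) simp
  then show ?case by simp
next
  case (Suc i)
  define t where "t = Suc (Suc i) + Q - 1"
  have z: "uc P (Suc i) (t - k) = 0" if "k \<in> {2..Q}" for k
    by (rule uc_eq_0) (use that in \<open>auto simp: t_def\<close>)
  have t1: "t - 1 = Suc i + Q - 1" by (simp add: t_def)
  have "{1..Q} = insert 1 {2..Q}" using Q_gt_1 by auto
  moreover have "uc P (Suc (Suc i)) t = (\<Sum>k\<in>{1..Q}. of_nat (Q choose k) * P ^ (Q - k) * uc P (Suc i) (t - k))"
    by (subst uc.simps(2)) (simp add: t_def)
  moreover have "(\<Sum>k\<in>{2..Q}. of_nat (Q choose k) * P ^ (Q - k) * uc P (Suc i) (t - k)) = 0"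
    by (intro sum.neutral ballI) (simp only: z mult_zero_right)
  ultimately have "uc P (Suc (Suc i)) t = of_nat (Q choose 1) * P ^ (Q - 1) * uc P (Suc i) (t - 1)"
    by (simp del: uc.simps)
  then show ?case unfolding t1 Suc.IH P by (simp add: t_def del: uc.simps)
qed

lemma uc_zero: "uc 0 i t = (if t = Q * i + Q - 1 then 1 else 0)"
proof (induction i arbitrary: t)
  case 0 show ?case using Q_gt_1 by (auto simp: power_0_left)
next
  case (Suc i)
  have "(\<Sum>k\<in>{1..Q}. of_nat (Q choose k) * 0 ^ (Q - k) * uc 0 i (t - k))
      = (\<Sum>k\<in>{1..Q}. if k = Q then uc 0 i (t - Q) else 0)"
    by (intro sum.cong) (auto simp: power_0_left)
  also have "\<dots> = uc 0 i (t - Q)" using Q_gt_1 by simp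
  finally show ?case using Q_gt_1 by (auto simp: Suc.IH)
qed

lemma U_expansion:
  assumes j: "j \<in> {2..l}" and x: "x \<in> A"
  shows "U (\<lambda>z. (z - pt j) ^ (Q - 1) * inverse (z - pt j) ^ t) x = (\<Sum>i\<le>t. uc (pt j) i t * inverse (x - pt j) ^ i)"
proof (induction t rule: less_induct)
  case (less t)
  let ?P = "pt j"
  have root: "z \<in> A" "z - ?P \<noteq> 0" if "z ^ Q = x" for z
    using that x A_Q_iff A_pt_0[of z j] j by auto
  show ?case
  proof (cases "t < Q")
    case True
    have "U (\<lambda>z. (z - ?P) ^ (Q - 1) * inverse (z - ?P) ^ t) x = U (\<lambda>z. (z - ?P) ^ (Q - 1 - t)) x"
      using True root by (intro U_cong) (simp add: power_diff power_inverse divide_inverse)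
    also have "\<dots> = (- ?P) ^ (Q - 1 - t)" using Q_gt_1 by (intro U_shifted_power[OF x]) simp
    also have "\<dots> = (\<Sum>i\<le>t. if i = 0 then (- ?P) ^ (Q - 1 - t) else 0)" by simp
    also have "\<dots> = (\<Sum>i\<le>t. uc ?P i t * inverse (x - ?P) ^ i)"
    proof (rule sum.cong)
      fix i show "(if i = 0 then (- ?P) ^ (Q - 1 - t) else 0) = uc ?P i t * inverse (x - ?P) ^ i"
        using True by (cases i) auto
    qed simp
    finally show ?thesis .
  next
    case False
    have Y: "x - ?P \<noteq> 0" by (rule A_pt_0[OF x j])
    let ?c = "\<lambda>k. of_nat (Q choose k) * ?P ^ (Q - k)"
    \<comment> \<open>Insert the factor 1 written as the expansion of x - P in powers of z - P,
      divided by x - P. Since x is the same for all roots z, the factor 1 / (x - P) leaves U, and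
      the exponents t - k that remain are smaller.\<close>
    have "U (\<lambda>z. (z - ?P) ^ (Q - 1) * inverse (z - ?P) ^ t) x
        = U (\<lambda>z. \<Sum>k\<in>{1..Q}. (inverse (x - ?P) * ?c k) * ((z - ?P) ^ (Q - 1) * inverse (z - ?P) ^ (t - k))) x"
    proof (rule U_cong)
      fix z assume z: "z ^ Q = x"
      define y where "y = z - ?P"
      have y: "y \<noteq> 0" using root[OF z] by (simp add: y_def)
      have "{1..Q} = insert Q {0<..<Q}" using Q_gt_1 by auto
      then have xP: "x - ?P = (\<Sum>k\<in>{1..Q}. ?c k * y ^ k)"
        using binomial_Q[OF j, of z] z by (simp add: y_def)
      have "inverse y ^ (t - k) = y ^ k * inverse y ^ t" if "k \<in> {1..Q}" for k
        using that False y by (simp add: power_diff power_inverse field_simps)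
      then have "(\<Sum>k\<in>{1..Q}. (inverse (x - ?P) * ?c k) * (y ^ (Q - 1) * inverse y ^ (t - k)))
          = (\<Sum>k\<in>{1..Q}. (?c k * y ^ k) * (inverse (x - ?P) * (y ^ (Q - 1) * inverse y ^ t)))"
        by (intro sum.cong) (auto simp: mult_ac)
      also have "\<dots> = (x - ?P) * (inverse (x - ?P) * (y ^ (Q - 1) * inverse y ^ t))"
        by (simp only: sum_distrib_right xP)
      also have "\<dots> = y ^ (Q - 1) * inverse y ^ t" using Y by simp
      finally show "(z - ?P) ^ (Q - 1) * inverse (z - ?P) ^ t
          = (\<Sum>k\<in>{1..Q}. (inverse (x - ?P) * ?c k) * ((z - ?P) ^ (Q - 1) * inverse (z - ?P) ^ (t - k)))"
        by (simp add: y_def)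
    qed
    also have "\<dots> = (\<Sum>k\<in>{1..Q}. inverse (x - ?P) * ?c k * (\<Sum>i\<le>t - k. uc ?P i (t - k) * inverse (x - ?P) ^ i))"
      unfolding U_sum U_scale using less.IH False Q_gt_1 by (intro sum.cong) auto
    also have "\<dots> = (\<Sum>k\<in>{1..Q}. inverse (x - ?P) * ?c k * (\<Sum>i<t. uc ?P i (t - k) * inverse (x - ?P) ^ i))"
    proof (rule sum.cong)
      fix k assume k: "k \<in> {1..Q}"
      have "(\<Sum>i\<le>t - k. uc ?P i (t - k) * inverse (x - ?P) ^ i) = (\<Sum>i<t. uc ?P i (t - k) * inverse (x - ?P) ^ i)"
        using k False by (intro sum.mono_neutral_left) (auto simp: uc_gt)
      then show "inverse (x - ?P) * ?c k * (\<Sum>i\<le>t - k. uc ?P i (t - k) * inverse (x - ?P) ^ i)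
          = inverse (x - ?P) * ?c k * (\<Sum>i<t. uc ?P i (t - k) * inverse (x - ?P) ^ i)" by simp
    qed simp
    also have "\<dots> = (\<Sum>i<t. (\<Sum>k\<in>{1..Q}. ?c k * uc ?P i (t - k)) * inverse (x - ?P) ^ Suc i)"
      unfolding sum_distrib_left sum_distrib_right by (subst sum.swap) (simp add: mult_ac)
    also have "\<dots> = (\<Sum>i<t. uc ?P (Suc i) t * inverse (x - ?P) ^ Suc i)"
      using False by (intro sum.cong) auto
    also have "\<dots> = (\<Sum>i<Suc t. uc ?P i t * inverse (x - ?P) ^ i)"
      using False by (simp add: sum.lessThan_Suc_shift del: sum.lessThan_Suc)
    finally show ?thesis by (simp add: lessThan_Suc_atMost)
  qed
qed

lemma U_B:
  assumes j: "j \<in> {2..l}"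
  shows "U (B (s, j)) = (\<lambda>x. \<Sum>i\<le>s + Q - 1. uc (pt j) i (s + Q - 1) * B (i, j) x)"
proof
  fix x
  show "U (B (s, j)) x = (\<Sum>i\<le>s + Q - 1. uc (pt j) i (s + Q - 1) * B (i, j) x)"
  proof (cases "x \<in> A")
    case True
    have "U (B (s, j)) x = U (\<lambda>z. (z - pt j) ^ (Q - 1) * inverse (z - pt j) ^ (s + Q - 1)) x"
    proof (rule U_cong)
      fix z assume "z ^ Q = x"
      then have z: "z \<in> A" using True A_Q_iff by auto
      then have "(z - pt j) ^ (Q - 1) * inverse (z - pt j) ^ (Q - 1) = 1"
        using A_pt_0[OF z j] by (simp add: power_mult_distrib[symmetric])
      moreover have "s + Q - 1 = s + (Q - 1)" using Q_gt_1 by simp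
      ultimately have "(z - pt j) ^ (Q - 1) * inverse (z - pt j) ^ (s + Q - 1) = inverse (z - pt j) ^ s"
        by (simp only: power_add mult_ac) simp
      then show "B (s, j) z = (z - pt j) ^ (Q - 1) * inverse (z - pt j) ^ (s + Q - 1)"
        using z j by (simp add: B_def)
    qed
    also have "\<dots> = (\<Sum>i\<le>s + Q - 1. uc (pt j) i (s + Q - 1) * inverse (x - pt j) ^ i)"
      by (rule U_expansion[OF j True])
    finally show ?thesis using True j by (simp add: B_def)
  qed (simp add: U_outside B_outside)
qed

lemma U_B_1: "U (B (s, 1)) = (if Q dvd s then B (s div Q, 1) else (\<lambda>_. 0))"
proof
  fix x
  show "U (B (s, 1)) x = (if Q dvd s then B (s div Q, 1) else (\<lambda>_. 0)) x"
  proof (cases "x \<in> A")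
    case True
    have "U (B (s, 1)) x = U (\<lambda>z. z ^ s) x" by (rule U_cong) (use True A_Q_iff in \<open>auto simp: B_def\<close>)
    then show ?thesis using True by (simp add: U_power B_def)
  qed (simp add: U_outside B_outside)
qed

lemma U_B_Z: "ij \<in> I \<Longrightarrow> U (B ij) \<in> Z"
proof -
  assume ij: "ij \<in> I"
  obtain s j where ij': "ij = (s, j)" by force
  show ?thesis
  proof (cases "j = 1")
    case True
    then show ?thesis using l_ge_2 unfolding ij' True U_B_1 by (auto intro: B_Z Z_zero)
  next
    case False
    then have j: "j \<in> {2..l}" using ij ij' by (auto simp: idx_iff)
    show ?thesis unfolding ij' U_B[OF j] using j
      by (intro Z_sum Z_scale uc_R R_pt B_Z) auto
  qed
qed

lemma coef_U_B:
  assumes j: "j \<in> {2..l}" and i: "(i, j') \<in> I" "1 \<le> i"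
  shows "coef (U (B (s, j))) (i, j') = (if j' = j then uc (pt j) i (s + Q - 1) else 0)"
proof -
  have "coef (U (B (s, j))) (i, j') = (\<Sum>n\<le>s + Q - 1. uc (pt j) n (s + Q - 1) * coef (B (n, j)) (i, j'))"
    unfolding U_B[OF j] using j
    by (subst Z_sum) (auto intro!: Z_scale uc_R R_pt B_Z sum.cong coef_scale)
  also have "\<dots> = (\<Sum>n\<le>s + Q - 1. if n = i then (if j' = j then uc (pt j) i (s + Q - 1) else 0) else 0)"
    using j i by (intro sum.cong) (auto simp: coef_B')
  also have "\<dots> = (if i \<le> s + Q - 1 then (if j' = j then uc (pt j) i (s + Q - 1) else 0) else 0)" by simp
  finally show ?thesis by (auto simp: uc_gt)
qed

lemma coef_U_B_1: "ij \<in> I \<Longrightarrow> coef (U (B (s, 1))) ij = (if snd ij = 1 \<and> s = Q * fst ij then 1 else 0)"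
  using l_ge_2 Q_gt_1 unfolding U_B_1
  by (cases ij) (auto simp: coef_B' coef_zero idx_iff)

lemma U_Pol_expand:
  assumes f: "f \<in> Pol d"
  shows "U f \<in> Z" "coef (U f) kl = (\<Sum>ij\<in>Pidx d. coef f ij * coef (U (B ij)) kl)"
proof -
  have "U f = (\<lambda>x. \<Sum>ij\<in>Pidx d. coef f ij * U (B ij) x)"
    using Pol_expand[OF f] by (subst ext[of f]) (auto simp: U_sum U_scale)
  moreover have "(\<lambda>x. coef f ij * U (B ij) x) \<in> Z" if "ij \<in> Pidx d" for ij
    using that by (intro Z_scale Z_coef Pol_Z[OF f] U_B_Z) (auto simp: Pidx_def)
  ultimately show "U f \<in> Z" "coef (U f) kl = (\<Sum>ij\<in>Pidx d. coef f ij * coef (U (B ij)) kl)"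
    using Z_sum[OF Pidx_finite, of d "\<lambda>ij x. coef f ij * U (B ij) x"]
    by (auto simp: Pidx_def intro!: sum.cong coef_scale Z_coef Pol_Z[OF f] U_B_Z)
qed

text \<open>U does not raise orders: on powers of x it divides the exponent by Q or gives 0, and at
  a pole the coefficients of higher order vanish by \<open>uc_eq_0\<close>.\<close>

lemma U_Pol:
  assumes f: "f \<in> Pol d" shows "U f \<in> Pol d"
  unfolding Pol_def
proof (intro CollectI conjI allI impI)
  fix i j assume i: "d j < i"
  show "coef (U f) (i, j) = 0"
  proof (cases "(i, j) \<in> I")
    case True
    have "coef f nm * coef (U (B nm)) (i, j) = 0" if nm: "nm \<in> Pidx d" for nm
    proof -
      obtain n m where nm': "nm = (n, m)" by force
      have n: "(n, m) \<in> I" "n \<le> d m" using nm nm' by (auto simp: Pidx_def)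
      show ?thesis
      proof (cases "m = 1")
        case True
        have "n \<noteq> Q * i" if "j = 1"
        proof -
          have "n < i" using i n True that by simp
          also have "i \<le> Q * i" using Q_gt_1 by simp
          finally show ?thesis by simp
        qed
        then show ?thesis using coef_U_B_1[OF \<open>(i, j) \<in> I\<close>, of n] nm' True by auto
      next
        case False
        then have m: "m \<in> {2..l}" using n by (auto simp: idx_iff)
        have "uc (pt m) i (n + Q - 1) = 0" if "j = m"
        proof (rule uc_eq_0)
          have "n < i" using i n that by simp
          then show "1 \<le> i" "n + Q - 1 < i + Q - 1" using Q_gt_1 by auto
        qed
        then show ?thesis using coef_U_B[OF m True, of n] i nm' by auto
      qed
    qed
    then show ?thesis unfolding U_Pol_expand(2)[OF f] by (intro sum.neutral ballI)
  qed (rule expands_outside[OF Z_expands[OF U_Pol_expand(1)[OF f]]])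
qed (rule U_Pol_expand(1)[OF f])

text \<open>For f of order d j, the coefficients of U f beyond order about d j / Q fall off
  p-adically, at a rate that grows with i. At nonzero poles this takes the place of an exact
  division of the order by Q.\<close>

lemma U_decay:
  assumes f: "f \<in> Pol d" and i: "1 \<le> i" and e: "(Q - 1) * e + d j + Q \<le> Q * i"
  shows "v (coef (U f) (i, j)) \<le> (1 / p) ^ e"
proof (cases "(i, j) \<in> I")
  case True
  show ?thesis unfolding U_Pol_expand(2)[OF f]
  proof (rule v_sum_le)
    fix nm assume nm: "nm \<in> Pidx d"
    obtain n m where nm': "nm = (n, m)" by force
    have n: "(n, m) \<in> I" "n \<le> d m" using nm nm' by (auto simp: Pidx_def)
    have "v (coef (U (B nm)) (i, j)) \<le> (1 / p) ^ e"
    proof (cases "m = 1")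
      case True
      have "n \<noteq> Q * i" if "j = 1" using e n that True Q_gt_1 by auto
      then show ?thesis using coef_U_B_1[OF \<open>(i, j) \<in> I\<close>, of n] nm' True by (auto simp: v_0)
    next
      case False
      then have m: "m \<in> {2..l}" using n by (auto simp: idx_iff)
      have "v (uc (pt m) i (n + Q - 1)) \<le> (1 / p) ^ e" if "m = j"
        using e n that Q_gt_1 by (intro v_uc R_pt m) auto
      then show ?thesis using coef_U_B[OF m True i, of n] nm' by (auto simp: v_0)
    qed
    then have "v (coef f nm) * v (coef (U (B nm)) (i, j)) \<le> 1 * (1 / p) ^ e"
      by (intro mult_mono R_le Z_coef Pol_Z[OF f] v_nonneg) auto
    then show "v (coef f nm * coef (U (B nm)) (i, j)) \<le> (1 / p) ^ e" by (simp add: v_mult)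
  qed simp
qed (use expands_outside[OF Z_expands[OF U_Pol_expand(1)[OF f]]] in \<open>simp add: v_0\<close>)

lemma U_crude_bound:
  assumes "\<And>x. v (f x - g x) < e" shows "v (U f x - U g x) \<le> inverse (v (of_nat Q)) * e"
proof -
  have e: "0 < e" using assms[of 0] v_nonneg[of "f 0 - g 0"] by linarith
  have "v (\<Sum>z | z ^ Q = x. f z - g z) \<le> e"
    using assms e by (intro v_sum_le) (auto intro: less_imp_le)
  then have "inverse (v (of_nat Q)) * v (\<Sum>z | z ^ Q = x. f z - g z) \<le> inverse (v (of_nat Q)) * e"
    by (intro mult_left_mono) (auto simp: v_nonneg)
  then show ?thesis unfolding U_diff[symmetric] by (simp add: U_def v_mult v_inverse)
qed

lemma v_Q_pos: "0 < inverse (v (of_nat Q))"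
  using Q_0 v_eq_0_iff[of "of_nat Q"] v_nonneg[of "of_nat Q"] by simp

theorem U_Z:
  assumes f: "f \<in> Z" shows "U f \<in> Z"
proof (rule Z_extend[OF f v_Q_pos])
  fix g e assume "\<And>x. v (f x - g x) < (e::real)"
  then show "\<forall>x. v (U f x - U g x) \<le> inverse (v (of_nat Q)) * e" using U_crude_bound by blast
next
  fix S assume S: "finite S" "S \<subseteq> I"
  have "U (\<lambda>x. \<Sum>ij\<in>S. coef f ij * B ij x) = (\<lambda>x. \<Sum>ij\<in>S. coef f ij * U (B ij) x)"
    by (rule ext) (simp only: U_sum U_scale)
  then show "U (\<lambda>x. \<Sum>ij\<in>S. coef f ij * B ij x) \<in> Z"
    using S by (auto intro!: Z_sum Z_scale Z_coef[OF f] U_B_Z)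
qed

text \<open>The crude bound loses 1 / |Q|, but a truncation at level e |Q| absorbs this loss. On the
  finite part, U acts on basis elements with integral coefficients and loses nothing.\<close>

theorem U_contraction:
  assumes f: "f \<in> Z" and C: "\<And>x. v (f x) \<le> C" shows "v (U f x) \<le> C"
proof (rule field_le_epsilon)
  fix e :: real assume e: "0 < e"
  have C0: "0 \<le> C" using C[of 0] v_nonneg order_trans by blast
  define d where "d = e * v (of_nat Q)"
  have d: "0 < d" "inverse (v (of_nat Q)) * d = e" using e v_Q_pos by (auto simp: d_def)
  define S where "S = {ij\<in>I. d \<le> v (coef f ij)}"
  have S: "finite S" "S \<subseteq> I" using expands_null[OF Z_expands[OF f] d(1)] by (auto simp: S_def)
  have S': "v (f x - (\<Sum>ij\<in>S. coef f ij * B ij x)) < d" for x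
    by (rule expands_tail[OF Z_expands[OF f] d(1) S]) (simp add: S_def)
  have 1: "v (U f x - U (\<lambda>x. \<Sum>ij\<in>S. coef f ij * B ij x) x) \<le> e"
    using U_crude_bound[OF S'] d(2) by simp
  have "v (\<Sum>ij\<in>S. coef f ij * U (B ij) x) \<le> C"
  proof (rule v_sum_le[OF _ C0])
    fix ij assume "ij \<in> S"
    then have "v (coef f ij) * v (U (B ij) x) \<le> C * 1"
      using S C0 by (intro mult_mono coef_bound[OF f C] Z_v_le U_B_Z v_nonneg) auto
    then show "v (coef f ij * U (B ij) x) \<le> C" by (simp add: v_mult)
  qed
  then have 2: "v (U (\<lambda>x. \<Sum>ij\<in>S. coef f ij * B ij x) x) \<le> C" by (simp only: U_sum U_scale)
  have "v ((U f x - U (\<lambda>x. \<Sum>ij\<in>S. coef f ij * B ij x) x) + U (\<lambda>x. \<Sum>ij\<in>S. coef f ij * B ij x) x) \<le> C + e"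
    using 1 2 e C0 by (intro v_add_le) auto
  then show "v (U f x) \<le> C + e" by simp
qed

end

section \<open>The trace formula on the punctured disc\<close>

context punctured_disc
begin

abbreviation summable_to :: "(nat \<times> nat \<Rightarrow> 'c) \<Rightarrow> 'c \<Rightarrow> bool" where
  "summable_to f s \<equiv> has_usum UNIV v f I s"

lemma summable_to_add:
  assumes "summable_to f s" "summable_to g t" shows "summable_to (\<lambda>ij. f ij + g ij) (s + t)"
  unfolding has_usum_def
proof (intro conjI allI impI)
  fix e :: real assume e: "0 < e"
  obtain S T where S: "S \<subseteq> I" "finite S" "\<And>S'. finite S' \<and> S \<subseteq> S' \<and> S' \<subseteq> I \<Longrightarrow> v (s - sum f S') < e"
    and T: "T \<subseteq> I" "finite T" "\<And>S'. finite S' \<and> T \<subseteq> S' \<and> S' \<subseteq> I \<Longrightarrow> v (t - sum g S') < e"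
    using assms e unfolding has_usum_def by meson
  have "v (s + t - (\<Sum>ij\<in>S'. f ij + g ij)) < e" if "finite S' \<and> S \<union> T \<subseteq> S' \<and> S' \<subseteq> I" for S'
    using v_add_less[OF S(3) T(3), of S' S'] that by (simp add: sum.distrib algebra_simps)
  then show "\<exists>S0\<subseteq>I. finite S0 \<and> (\<forall>S. finite S \<and> S0 \<subseteq> S \<and> S \<subseteq> I \<longrightarrow> v (s + t - (\<Sum>ij\<in>S. f ij + g ij)) < e)"
    using S T by (intro exI[of _ "S \<union> T"]) auto
qed simp

lemma summable_to_scale:
  assumes "summable_to f s" "v r \<le> 1" shows "summable_to (\<lambda>ij. r * f ij) (r * s)"
  unfolding has_usum_def
proof (intro conjI allI impI)
  fix e :: real assume e: "0 < e"
  obtain S where S: "S \<subseteq> I" "finite S" "\<And>S'. finite S' \<and> S \<subseteq> S' \<and> S' \<subseteq> I \<Longrightarrow> v (s - sum f S') < e"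
    using assms e unfolding has_usum_def by meson
  have "v (r * s - (\<Sum>ij\<in>S'. r * f ij)) < e" if "finite S' \<and> S \<subseteq> S' \<and> S' \<subseteq> I" for S'
  proof -
    have "v r * v (s - sum f S') \<le> 1 * v (s - sum f S')" by (intro mult_right_mono assms v_nonneg)
    then show ?thesis using S(3)[OF that] by (simp add: v_mult flip: sum_distrib_left right_diff_distrib)
  qed
  then show "\<exists>S0\<subseteq>I. finite S0 \<and> (\<forall>S. finite S \<and> S0 \<subseteq> S \<and> S \<subseteq> I \<longrightarrow> v (r * s - (\<Sum>ij\<in>S. r * f ij)) < e)"
    using S by (intro exI[of _ S]) auto
qed simp

text \<open>In an ultrametric field a convergent series converges unconditionally, so it suffices to sum by columns.\<close>

lemma summable_to_columns:
  assumes "\<And>j. j \<in> {1..l} \<Longrightarrow> (\<lambda>n. v (s j - (\<Sum>i<n. f (Suc i, j)))) \<longlonglongrightarrow> 0"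
  shows "summable_to f (f (0, 1) + (\<Sum>j\<in>{1..l}. s j))"
  unfolding has_usum_def
proof (intro conjI allI impI)
  fix e :: real assume e: "0 < e"
  have "\<forall>\<^sub>F n in sequentially. \<forall>j\<in>{1..l}. v (s j - (\<Sum>i<n. f (Suc i, j))) < e"
    by (intro eventually_ball_finite ballI order_tendstoD(2)[OF assms e]) auto
  then obtain N where N: "\<And>n j. N \<le> n \<Longrightarrow> j \<in> {1..l} \<Longrightarrow> v (s j - (\<Sum>i<n. f (Suc i, j))) < e"
    unfolding eventually_sequentially by blast
  have small: "v (f (Suc i, j)) < e" if "N \<le> i" "j \<in> {1..l}" for i j
  proof -
    have "v ((s j - (\<Sum>i<i. f (Suc i, j))) - (s j - (\<Sum>i<Suc i. f (Suc i, j)))) < e"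
      by (rule v_diff_less[OF N[of i j] N[of "Suc i" j]]) (use that in auto)
    then show ?thesis by simp
  qed
  define S0 where "S0 = insert (0, 1) ({1..N} \<times> {1..l})"
  have S0: "S0 \<subseteq> I" "finite S0" by (auto simp: S0_def idx_def)
  have sum0: "sum f S0 = f (0, 1) + (\<Sum>j\<in>{1..l}. \<Sum>i<N. f (Suc i, j))"
  proof -
    have "(\<Sum>ij\<in>{1..N} \<times> {1..l}. f ij) = (\<Sum>i\<in>{1..N}. \<Sum>j\<in>{1..l}. f (i, j))"
      by (simp add: sum.cartesian_product)
    also have "\<dots> = (\<Sum>i<N. \<Sum>j\<in>{1..l}. f (Suc i, j))"
      by (rule sum.reindex_bij_witness[of _ Suc "\<lambda>i. i - 1"]) auto
    also have "\<dots> = (\<Sum>j\<in>{1..l}. \<Sum>i<N. f (Suc i, j))" by (rule sum.swap)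
    finally show ?thesis by (simp add: S0_def)
  qed
  have "v (f (0, 1) + (\<Sum>j\<in>{1..l}. s j) - sum f S) < e" if S: "finite S \<and> S0 \<subseteq> S \<and> S \<subseteq> I" for S
  proof -
    have "sum f S = sum f S0 + sum f (S - S0)" using S by (metis add.commute sum.subset_diff)
    then have eq: "f (0, 1) + (\<Sum>j\<in>{1..l}. s j) - sum f S
        = (\<Sum>j\<in>{1..l}. s j - (\<Sum>i<N. f (Suc i, j))) - sum f (S - S0)"
      by (simp add: sum0 sum_subtractf)
    have "v (sum f (S - S0)) < e"
    proof (rule v_sum_less[OF _ e])
      fix ij assume ij: "ij \<in> S - S0"
      obtain i j where ij': "ij = (i, j)" by force
      have "(i, j) \<in> I" "(i, j) \<notin> S0" using S ij ij' by auto
      then have "N < i" "j \<in> {1..l}" by (auto simp: idx_def S0_def)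
      then show "v (f ij) < e" using small[of "i - 1" j] ij' by auto
    qed
    moreover have "v (\<Sum>j\<in>{1..l}. s j - (\<Sum>i<N. f (Suc i, j))) < e"
      by (rule v_sum_less[OF _ e]) (use N in auto)
    ultimately show ?thesis unfolding eq by (intro v_diff_less)
  qed
  then show "\<exists>S0\<subseteq>I. finite S0 \<and> (\<forall>S. finite S \<and> S0 \<subseteq> S \<and> S \<subseteq> I \<longrightarrow>
      v (f (0, 1) + (\<Sum>j\<in>{1..l}. s j) - sum f S) < e)"
    using S0 by blast
qed simp

lemma coef_x_times_B:
  assumes "1 \<le> j" "j \<le> l"
  shows "coef (\<lambda>x. x * B (Suc i, j) x) kl =
     (if j = 1 then (if kl = (Suc (Suc i), 1) then 1 else 0)
      else (if kl = (i, if i = 0 then 1 else j) then 1 else 0) + (if kl = (Suc i, j) then pt j else 0))"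
proof (cases "j = 1")
  case True
  then show ?thesis using l_ge_2 by (simp only: x_times_B_1) (simp add: coef_B')
next
  case False
  then have j: "j \<in> {2..l}" using assms by auto
  show ?thesis unfolding x_times_B[OF j] using j False
    by (subst coef_add) (auto intro!: B_Z Z_scale R_pt simp: coef_scale R_pt B_Z coef_B')
qed

text \<open>Multiplication by x moves the first column up; since x / (x - P) = 1 + P / (x - P), it
  moves part of every other column down. The lowest entries of those columns all land on the
  constant, which the columns share.\<close>

lemma coef_x_times:
  assumes f: "f \<in> Pol d"
  shows "coef (\<lambda>x. x * f x) (0, 1) = (\<Sum>j\<in>{2..l}. coef f (1, j))"
    "coef (\<lambda>x. x * f x) (Suc i, 1) = coef f (i, 1)"
    "j \<in> {2..l} \<Longrightarrow> coef (\<lambda>x. x * f x) (Suc i, j) = coef f (Suc (Suc i), j) + pt j * coef f (Suc i, j)"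
proof -
  \<comment> \<open>A larger bound, uniform in j, under which every index up to order i + 2 is
    available; each single coefficient can then be picked out of the sum without a case
    distinction.\<close>
  define D where "D = (\<lambda>j::nat. Max (d ` {1..l}) + i + 2)"
  have dD: "d j \<le> D j" if "j \<in> {1..l}" for j
  proof -
    have "d j \<le> Max (d ` {1..l})" using that by (intro Max_ge) auto
    then show ?thesis by (simp add: D_def)
  qed
  have D: "f x = (\<Sum>nm\<in>Pidx D. coef f nm * B nm x)" for x
  proof -
    have "(\<Sum>nm\<in>Pidx d. coef f nm * B nm x) = (\<Sum>nm\<in>Pidx D. coef f nm * B nm x)"
    proof (rule sum.mono_neutral_left[OF Pidx_finite])
      show "Pidx d \<subseteq> Pidx D"
      proof
        fix nm assume "nm \<in> Pidx d"
        then obtain n m where "nm = (n, m)" "(n, m) \<in> I" "n \<le> d m" by (auto simp: Pidx_def)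
        then show "nm \<in> Pidx D" using dD[of m] by (auto simp: Pidx_def idx_iff)
      qed
      show "\<forall>nm\<in>Pidx D - Pidx d. coef f nm * B nm x = 0"
      proof
        fix nm assume "nm \<in> Pidx D - Pidx d"
        then obtain n m where "nm = (n, m)" "d m < n" by (cases nm) (auto simp: Pidx_def)
        then show "coef f nm * B nm x = 0" using f by (simp add: Pol_def)
      qed
    qed
    then show ?thesis using Pol_expand[OF f] by simp
  qed
  have fZ: "f \<in> Z" by (rule Pol_Z[OF f])
  have xB: "(\<lambda>x. x * B nm x) \<in> Z" if "nm \<in> I" for nm by (rule x_times_Z[OF Z_B[OF that]])
  have xf: "(\<lambda>x. x * f x) = (\<lambda>x. \<Sum>nm\<in>Pidx D. coef f nm * (x * B nm x))"
    by (rule ext, subst D) (simp add: sum_distrib_left mult_ac)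
  have exp: "coef (\<lambda>x. x * f x) kl = (\<Sum>nm\<in>Pidx D. coef f nm * coef (\<lambda>x. x * B nm x) kl)" for kl
  proof -
    have PI: "nm \<in> I" if "nm \<in> Pidx D" for nm using that by (auto simp: Pidx_def)
    have "coef (\<lambda>x. \<Sum>nm\<in>Pidx D. coef f nm * (x * B nm x)) kl
        = (\<Sum>nm\<in>Pidx D. coef (\<lambda>x. coef f nm * (x * B nm x)) kl)"
      by (rule Z_sum(2)[OF Pidx_finite]) (rule Z_scale[OF Z_coef[OF fZ] xB[OF PI]])
    moreover have "\<dots> = (\<Sum>nm\<in>Pidx D. coef f nm * coef (\<lambda>x. x * B nm x) kl)"
      by (rule sum.cong[OF HOL.refl]) (rule coef_scale[OF Z_coef[OF fZ] xB[OF PI]])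
    ultimately show ?thesis by (simp only: xf)
  qed
  have x0: "coef (\<lambda>x. x * B (0, 1) x) kl = (if kl = (1, 1) then 1 else 0)" for kl
    unfolding x_times_B_1 using l_ge_2 by (simp add: coef_B')
  have c: "coef (\<lambda>x. x * B (n, m) x) kl =
     (if m = 1 then (if kl = (Suc n, 1) then 1 else 0)
      else (if kl = (n - 1, if n = 1 then 1 else m) then 1 else 0) + (if kl = (n, m) then pt m else 0))"
    if "(n, m) \<in> I" for n m kl
    using that coef_x_times_B[of m "n - 1" kl] x0[of kl] by (cases n) (auto simp: idx_iff)
  have delta: "(\<Sum>nm\<in>Pidx D. coef f nm * (if nm = ij then r else 0)) = coef f ij * r"
    if "ij \<in> I" "fst ij \<le> i + 2" for ij r
  proof -
    have "ij \<in> Pidx D" using that by (auto simp: Pidx_def D_def)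
    then show ?thesis using Pidx_finite[of D] by (simp add: if_distrib[of "(*) _"] cong: if_cong)
  qed
  show "coef (\<lambda>x. x * f x) (0, 1) = (\<Sum>j\<in>{2..l}. coef f (1, j))"
  proof -
    have "coef (\<lambda>x. x * f x) (0, 1) = (\<Sum>nm\<in>Pidx D. \<Sum>j\<in>{2..l}. coef f nm * (if nm = (1, j) then 1 else 0))"
      unfolding exp
    proof (rule sum.cong)
      fix nm assume nm: "nm \<in> Pidx D"
      obtain n m where nm': "nm = (n, m)" by force
      have I: "(n, m) \<in> I" using nm nm' by (auto simp: Pidx_def)
      have "coef (\<lambda>x. x * B (n, m) x) (0, 1) = (if n = 1 \<and> m \<in> {2..l} then 1 else 0)"
      proof (cases "m = 1")
        case False
        then have "(0, 1) = (n - 1, if n = 1 then 1 else m) \<longleftrightarrow> n = 1" "m \<in> {2..l}" "(0, 1) \<noteq> (n, m)"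
          using I by (auto simp: idx_iff)
        then show ?thesis unfolding c[OF I] using False by simp
      next
        case True
        then show ?thesis unfolding c[OF I] by simp
      qed
      moreover have "(\<Sum>j\<in>{2..l}. if (n, m) = (1, j) then 1 else 0 :: 'c) = (if n = 1 \<and> m \<in> {2..l} then 1 else 0)"
        by (cases "n = 1") auto
      ultimately show "coef f nm * coef (\<lambda>x. x * B nm x) (0, 1) = (\<Sum>j\<in>{2..l}. coef f nm * (if nm = (1, j) then 1 else 0))"
        unfolding nm' by (simp only: sum_distrib_left[symmetric])
    qed simp
    also have "\<dots> = (\<Sum>j\<in>{2..l}. \<Sum>nm\<in>Pidx D. coef f nm * (if nm = (1, j) then 1 else 0))" by (rule sum.swap)
    also have "\<dots> = (\<Sum>j\<in>{2..l}. coef f (1, j) * 1)" by (intro sum.cong delta) (auto simp: idx_iff)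
    finally show ?thesis by simp
  qed
  show "coef (\<lambda>x. x * f x) (Suc i, 1) = coef f (i, 1)"
  proof -
    have "coef (\<lambda>x. x * f x) (Suc i, 1) = (\<Sum>nm\<in>Pidx D. coef f nm * (if nm = (i, 1) then 1 else 0))"
      unfolding exp
    proof (rule sum.cong)
      fix nm assume nm: "nm \<in> Pidx D"
      obtain n m where nm': "nm = (n, m)" by force
      have I: "(n, m) \<in> I" using nm nm' by (auto simp: Pidx_def)
      show "coef f nm * coef (\<lambda>x. x * B nm x) (Suc i, 1) = coef f nm * (if nm = (i, 1) then 1 else 0)"
      proof (cases "m = 1")
        case False
        then have "(Suc i, 1) \<noteq> (n - 1, if n = 1 then 1 else m)" by auto
        then show ?thesis unfolding nm' c[OF I] using False by auto
      next
        case True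
        then show ?thesis unfolding nm' c[OF I] by auto
      qed
    qed simp
    then show ?thesis using delta[of "(i, 1)" 1] l_ge_2 by (simp add: idx_iff)
  qed
  show "coef (\<lambda>x. x * f x) (Suc i, j) = coef f (Suc (Suc i), j) + pt j * coef f (Suc i, j)" if j: "j \<in> {2..l}"
  proof -
    have "coef (\<lambda>x. x * f x) (Suc i, j) = (\<Sum>nm\<in>Pidx D. coef f nm * (if nm = (Suc (Suc i), j) then 1 else 0)
        + coef f nm * (if nm = (Suc i, j) then pt j else 0))"
      unfolding exp
    proof (rule sum.cong)
      fix nm assume nm: "nm \<in> Pidx D"
      obtain n m where nm': "nm = (n, m)" by force
      have I: "(n, m) \<in> I" using nm nm' by (auto simp: Pidx_def)
      show "coef f nm * coef (\<lambda>x. x * B nm x) (Suc i, j) = coef f nm * (if nm = (Suc (Suc i), j) then 1 else 0)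
        + coef f nm * (if nm = (Suc i, j) then pt j else 0)"
      proof (cases "m = 1")
        case True
        then show ?thesis unfolding nm' c[OF I] using j by auto
      next
        case False
        then have "(Suc i, j) = (n - 1, if n = 1 then 1 else m) \<longleftrightarrow> (n, m) = (Suc (Suc i), j)" by auto
        then show ?thesis unfolding nm' c[OF I] using False by (auto simp: distrib_left)
      qed
    qed simp
    then show ?thesis using j delta[of "(Suc (Suc i), j)" 1] delta[of "(Suc i, j)" "pt j"]
      by (simp add: sum.distrib idx_iff mult.commute)
  qed
qed

end

section \<open>Diagonals, fixed points and continuity in the multiplier\<close>

context frobenius_disc
begin

definition X0 :: "'c set" where
  "X0 = {x \<in> A. x ^ (Q - 1) = 1}"

definition diag :: "('c \<Rightarrow> 'c) \<Rightarrow> nat \<times> nat \<Rightarrow> 'c" where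
  "diag G ij = coef (U (\<lambda>x. G x * B ij x)) ij"

definition fixed_sum :: "('c \<Rightarrow> 'c) \<Rightarrow> 'c" where
  "fixed_sum G = inverse (of_nat (Q - 1)) * (\<Sum>x\<in>X0. G x)"

definition trace_holds :: "('c \<Rightarrow> 'c) \<Rightarrow> bool" where
  "trace_holds G \<longleftrightarrow> summable_to (diag G) (fixed_sum G)"

text \<open>Covers both elements of \<open>Z\<close> and rational functions, which are not cut off
  and so need not be in \<open>Z\<close>. It is what makes the entries of U \<circ> G additive in
  G.\<close>

definition multiplier :: "('c \<Rightarrow> 'c) \<Rightarrow> bool" where
  "multiplier G \<longleftrightarrow> (\<forall>ij\<in>I. (\<lambda>x. G x * B ij x) \<in> Z)"

lemma multiplier_alg: "G \<in> alg {2..l} \<Longrightarrow> multiplier G"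
  unfolding multiplier_def by (intro ballI alg_times_Z[OF _ subset_refl Z_B])

lemma multiplier_Z: "G \<in> Z \<Longrightarrow> multiplier G"
  unfolding multiplier_def by (intro ballI Z_mult[OF _ Z_B])

lemma multiplier_cong:
  assumes "multiplier G" "\<And>x. x \<in> A \<Longrightarrow> G x = H x" shows "multiplier H"
proof -
  have "(\<lambda>x. G x * B ij x) = (\<lambda>x. H x * B ij x)" for ij
  proof
    fix x show "G x * B ij x = H x * B ij x" by (cases "x \<in> A") (simp_all add: assms(2) B_outside)
  qed
  then show ?thesis using assms(1) by (simp add: multiplier_def)
qed

lemma trace_holds_cong:
  assumes "trace_holds G" "\<And>x. x \<in> A \<Longrightarrow> G x = H x" shows "trace_holds H"
proof -
  have eq: "(\<lambda>x. G x * B ij x) = (\<lambda>x. H x * B ij x)" for ij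
  proof
    fix x show "G x * B ij x = H x * B ij x" by (cases "x \<in> A") (simp_all add: assms(2) B_outside)
  qed
  have "diag G = diag H" by (rule ext) (simp only: diag_def eq)
  moreover have "fixed_sum G = fixed_sum H" using assms(2) by (simp add: fixed_sum_def X0_def)
  ultimately show ?thesis using assms(1) by (simp add: trace_holds_def)
qed

lemma summable_to_cong:
  assumes f: "summable_to f s" and eq: "\<And>ij. ij \<in> I \<Longrightarrow> g ij = f ij" shows "summable_to g s"
proof -
  have "sum g S = sum f S" if "S \<subseteq> I" for S using that eq by (intro sum.cong) auto
  then have "(\<forall>S. finite S \<and> S0 \<subseteq> S \<and> S \<subseteq> I \<longrightarrow> v (s - sum g S) < e) \<longleftrightarrow>
      (\<forall>S. finite S \<and> S0 \<subseteq> S \<and> S \<subseteq> I \<longrightarrow> v (s - sum f S) < e)" for S0 e by auto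
  then show ?thesis using f unfolding has_usum_def by simp
qed

lemma trace_holds_add:
  assumes "multiplier G" "multiplier H" "trace_holds G" "trace_holds H"
  shows "trace_holds (\<lambda>x. G x + H x)"
proof -
  have "diag (\<lambda>x. G x + H x) ij = diag G ij + diag H ij" if "ij \<in> I" for ij
  proof -
    have "U (\<lambda>x. (G x + H x) * B ij x) = (\<lambda>x. U (\<lambda>x. G x * B ij x) x + U (\<lambda>x. H x * B ij x) x)"
      by (rule ext) (simp add: distrib_right U_add)
    then show ?thesis using that assms(1,2)
      by (simp add: diag_def multiplier_def coef_add U_Z)
  qed
  moreover have "fixed_sum (\<lambda>x. G x + H x) = fixed_sum G + fixed_sum H"
    by (simp add: fixed_sum_def sum.distrib distrib_left)
  ultimately show ?thesis
    using summable_to_cong[OF summable_to_add[of "diag G" _ "diag H"]] assms(3,4) by (simp add: trace_holds_def)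
qed

lemma trace_holds_scale:
  assumes "multiplier G" "trace_holds G" "r \<in> R" shows "trace_holds (\<lambda>x. r * G x)"
proof -
  have "diag (\<lambda>x. r * G x) ij = r * diag G ij" if "ij \<in> I" for ij
  proof -
    have "U (\<lambda>x. r * G x * B ij x) = (\<lambda>x. r * U (\<lambda>x. G x * B ij x) x)"
      by (rule ext) (simp add: mult.assoc U_scale)
    then show ?thesis using that assms(1,3)
      by (simp add: diag_def multiplier_def coef_scale U_Z)
  qed
  moreover have "fixed_sum (\<lambda>x. r * G x) = r * fixed_sum G"
    by (simp add: fixed_sum_def sum_distrib_left mult_ac)
  ultimately show ?thesis
    using summable_to_cong[OF summable_to_scale[OF _ R_le[OF assms(3)]], of "diag G"] assms(2)
    by (simp add: trace_holds_def)
qed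

lemma v_Q_minus_1: "v (of_nat (Q - 1)) = 1"
proof -
  have "p dvd Q" using ak_pos by (simp add: Q_power)
  moreover have "Q - (Q - 1) = 1" using Q_gt_1 by simp
  ultimately have "\<not> p dvd Q - 1" using dvd_diff_nat[of p Q "Q - 1"] p_gt_1 by auto
  then have "\<not> int p dvd int (Q - 1)" by (simp only: int_dvd_int_iff not_False_eq_True)
  from v_of_int_unit[OF this] show ?thesis by (simp only: of_int_of_nat_eq)
qed

text \<open>By orthonormality and \<open>U_contraction\<close>, a small change of G on
  \<open>A\<close> changes all diagonal entries by as little, and in an ultrametric field so do
  their sums over finite sets of any size. The fixed-point sum is equally stable because |Q - 1| =
  1.\<close>

lemma trace_holds_limit:
  assumes G: "multiplier G"
    and approx: "\<And>e. 0 < e \<Longrightarrow> \<exists>H. multiplier H \<and> trace_holds H \<and> (\<forall>x\<in>A. v (G x - H x) < e)"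
  shows "trace_holds G"
  unfolding trace_holds_def has_usum_def
proof (intro conjI allI impI)
  fix e :: real assume e: "0 < e"
  obtain H where H: "multiplier H" "trace_holds H" "\<forall>x\<in>A. v (G x - H x) < e / 2"
    using approx[of "e / 2"] e by auto
  have diff: "v (diag G ij - diag H ij) \<le> e / 2" if ij: "ij \<in> I" for ij
  proof -
    have Z: "(\<lambda>x. G x * B ij x) \<in> Z" "(\<lambda>x. H x * B ij x) \<in> Z" using G H(1) ij by (auto simp: multiplier_def)
    let ?f = "\<lambda>x. G x * B ij x - H x * B ij x"
    have "v (?f x) \<le> e / 2" for x
    proof (cases "x \<in> A")
      case True
      then have "v (G x - H x) * v (B ij x) \<le> e / 2 * 1"
        using H(3) e by (intro mult_mono v_B ij v_nonneg) (auto intro: less_imp_le)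
      then show ?thesis by (simp flip: v_mult left_diff_distrib)
    qed (use e in \<open>simp add: B_outside v_0\<close>)
    then have "v (coef (U ?f) ij) \<le> e / 2"
      by (intro coef_bound U_Z U_contraction Z_diff Z)
    moreover have "U ?f = (\<lambda>x. U (\<lambda>x. G x * B ij x) x - U (\<lambda>x. H x * B ij x) x)"
      by (rule ext) (rule U_diff)
    ultimately show ?thesis by (simp add: diag_def coef_diff U_Z Z)
  qed
  have fs: "v (fixed_sum G - fixed_sum H) < e"
  proof -
    have "fixed_sum G - fixed_sum H = inverse (of_nat (Q - 1)) * (\<Sum>x\<in>X0. G x - H x)"
      by (simp only: fixed_sum_def sum_subtractf right_diff_distrib)
    then have "v (fixed_sum G - fixed_sum H) = v (\<Sum>x\<in>X0. G x - H x)"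
      by (simp only: v_mult v_inverse v_Q_minus_1) simp
    also have "\<dots> < e" by (rule v_sum_less[OF _ e]) (use H(3) e in \<open>fastforce simp: X0_def\<close>)
    finally show ?thesis .
  qed
  obtain S0 where S0: "S0 \<subseteq> I" "finite S0"
    "\<And>S. finite S \<and> S0 \<subseteq> S \<and> S \<subseteq> I \<Longrightarrow> v (fixed_sum H - sum (diag H) S) < e"
    using H(2) e unfolding trace_holds_def has_usum_def by meson
  have "v (fixed_sum G - sum (diag G) S) < e" if S: "finite S \<and> S0 \<subseteq> S \<and> S \<subseteq> I" for S
  proof -
    have "v (\<Sum>ij\<in>S. diag G ij - diag H ij) \<le> e / 2"
      by (rule v_sum_le) (use diff S e in auto)
    then have "v (\<Sum>ij\<in>S. diag G ij - diag H ij) < e" using e by simp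
    then have "v ((fixed_sum G - fixed_sum H) + ((fixed_sum H - sum (diag H) S) - (\<Sum>ij\<in>S. diag G ij - diag H ij))) < e"
      by (intro v_add_less[OF fs v_diff_less[OF S0(3)[OF S]]])
    then show ?thesis by (simp add: sum_subtractf)
  qed
  then show "\<exists>S0\<subseteq>I. finite S0 \<and> (\<forall>S. finite S \<and> S0 \<subseteq> S \<and> S \<subseteq> I \<longrightarrow> v (fixed_sum G - sum (diag G) S) < e)"
    using S0 by blast
qed simp

lemma U_decay_limit:
  assumes f: "\<And>i. f i \<in> Pol (\<lambda>_. i + n)" and g: "\<And>i. i \<le> g i"
  shows "(\<lambda>i. v (coef (U (f i)) (g i, j))) \<longlonglongrightarrow> 0"
proof (rule tendsto_sandwich[of "\<lambda>_. 0"])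
  \<comment> \<open>With e = i - m, the condition of \<open>U_decay\<close> reduces to (Q - 1) m
    \<ge> n + Q, and Q - 1 \<ge> 1.\<close>
  define m where "m = n + Q + 1"
  have "v (coef (U (f i)) (g i, j)) \<le> (1 / p) ^ (i - m)" if i: "m \<le> i" for i
  proof (rule U_decay[OF f])
    show "1 \<le> g i" using g[of i] i by (simp add: m_def)
    have Q: "Q = Suc (Q - 1)" using Q_gt_1 by simp
    have "1 \<le> Q - 1" using Q_gt_1 by linarith
    then have "1 * m \<le> (Q - 1) * m" by (rule mult_le_mono1)
    moreover have "(Q - 1) * (i - m) + (Q - 1) * m = (Q - 1) * i" using i by (simp flip: distrib_left)
    ultimately have "(Q - 1) * (i - m) + m \<le> (Q - 1) * i" by linarith
    then have "(Q - 1) * (i - m) + (i + n) + Q \<le> (Q - 1) * i + i" by (simp add: m_def)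
    also have "\<dots> = Q * i" by (subst (2) Q) simp
    also have "\<dots> \<le> Q * g i" using g by simp
    finally show "(Q - 1) * (i - m) + (i + n) + Q \<le> Q * g i" .
  qed
  then show "\<forall>\<^sub>F i in sequentially. v (coef (U (f i)) (g i, j)) \<le> (1 / p) ^ (i - m)"
    by (auto simp: eventually_sequentially)
  have "(\<lambda>i. (1 / real p) ^ i) \<longlonglongrightarrow> 0" by (rule LIMSEQ_realpow_zero) (use p_gt_1 in auto)
  then have "(\<lambda>i. (1 / real p) ^ (i + m - m)) \<longlonglongrightarrow> 0" by simp
  then show "(\<lambda>i. (1 / real p) ^ (i - m)) \<longlonglongrightarrow> 0" by (rule LIMSEQ_offset)
qed (auto simp: v_nonneg)

text \<open>
  The trace of \<open>U \<circ> H\<close> does not change under conjugation by \<open>x\<close>: with \<open>\<psi>\<close>, \<open>\<chi>\<close> the entries next to the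
  diagonal, the difference of the two diagonals telescopes in every column.
\<close>

lemma trace_holds_conjugation:
  assumes H: "H \<in> alg {2..l}" shows "trace_holds (\<lambda>x. (x ^ Q - x) * H x)"
proof -
  define F where "F = (\<lambda>ij x. H x * B ij x)"
  obtain n where n: "\<And>d f. f \<in> Pol d \<Longrightarrow> (\<lambda>x. H x * f x) \<in> Pol (\<lambda>j. if j = 1 \<or> j \<in> {2..l} then d j + n else d j)"
    using alg_times_Pol[OF H subset_refl] by blast
  have FP: "F (i, j) \<in> Pol (\<lambda>_. i + n)" if "1 \<le> j" "j \<le> l" for i j
    unfolding F_def by (rule Pol_mono[OF n[OF Pol_B[of j i "\<lambda>_. i"]]]) (use that in auto)
  define \<psi> where "\<psi> = (\<lambda>i. coef (U (F (Suc i, 1))) (i, 1))"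
  define \<chi> where "\<chi> = (\<lambda>j i. coef (U (F (i, j))) (Suc i, j))"
  let ?G = "\<lambda>x. (x ^ Q - x) * H x"
  have FZ: "F (i, j) \<in> Z" if "1 \<le> j" "j \<le> l" for i j
    by (rule Pol_Z[OF FP[OF that]])
  \<comment> \<open>Along the roots of z^Q = x the factor z^Q is the constant x and leaves
    U.\<close>
  have UG: "U (\<lambda>x. ?G x * B ij x) = (\<lambda>x. x * U (F ij) x - U (\<lambda>x. x * F ij x) x)" for ij
  proof
    fix x
    have "(\<lambda>x. ?G x * B ij x) = (\<lambda>z. z ^ Q * F ij z - z * F ij z)" by (auto simp: F_def algebra_simps)
    then show "U (\<lambda>x. ?G x * B ij x) x = x * U (F ij) x - U (\<lambda>x. x * F ij x) x"
      using U_pull_out[of "\<lambda>y. y" "F ij" x] by (simp add: U_diff)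
  qed
  have dG: "diag ?G (i, j) = coef (\<lambda>x. x * U (F (i, j)) x) (i, j) - coef (U (\<lambda>x. x * F (i, j) x)) (i, j)"
    if "1 \<le> j" "j \<le> l" for i j
    unfolding diag_def UG by (intro coef_diff x_times_Z U_Z FZ that)
  have d1: "diag ?G (Suc i, 1) = \<psi> i - \<psi> (Suc i)" for i
  proof -
    have "(\<lambda>x. x * F (Suc i, 1) x) = F (Suc (Suc i), 1)"
      using x_times_B_1 by (auto simp: F_def mult.left_commute)
    then show ?thesis using dG[of 1 "Suc i"] coef_x_times(2)[OF U_Pol[OF FP[of 1 "Suc i"]], of i] l_ge_2
      by (simp add: \<psi>_def)
  qed
  have dj: "diag ?G (Suc i, j) = \<chi> j (Suc i) - \<chi> j i" if j: "j \<in> {2..l}" for i j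
  proof -
    have j': "1 \<le> j" "j \<le> l" using j by auto
    have "(\<lambda>x. x * F (Suc i, j) x) = (\<lambda>x. F (i, j) x + pt j * F (Suc i, j) x)"
    proof
      fix x
      have "x * F (Suc i, j) x = H x * (x * B (Suc i, j) x)" by (simp add: F_def)
      also have "\<dots> = H x * (B (i, j) x + pt j * B (Suc i, j) x)" by (simp only: x_times_B[OF j])
      finally show "x * F (Suc i, j) x = F (i, j) x + pt j * F (Suc i, j) x" by (simp add: F_def algebra_simps)
    qed
    then have "U (\<lambda>x. x * F (Suc i, j) x) = (\<lambda>x. U (F (i, j)) x + pt j * U (F (Suc i, j)) x)"
      by (simp add: U_add U_scale fun_eq_iff)
    then have "coef (U (\<lambda>x. x * F (Suc i, j) x)) (Suc i, j) = coef (U (F (i, j))) (Suc i, j) + pt j * coef (U (F (Suc i, j))) (Suc i, j)"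
      using j j' by (simp add: coef_add coef_scale Z_scale U_Z FZ R_pt)
    then show ?thesis
      using dG[OF j', of "Suc i"] coef_x_times(3)[OF U_Pol[OF FP[OF j', of "Suc i"]] j, of i]
      by (simp add: \<chi>_def)
  qed
  \<comment> \<open>Because F (0, j) does not depend on j, the entry of the shared constant collects
    one boundary term from each column.\<close>
  have d0: "diag ?G (0, 1) = (\<Sum>j\<in>{2..l}. \<chi> j 0) - \<psi> 0"
  proof -
    have "(\<lambda>x. x * F (0, 1) x) = F (1, 1)"
      using x_times_B_1[of _ 0] by (auto simp: F_def mult.left_commute)
    moreover have F0: "F (0, j) = F (0, 1)" for j unfolding F_def B_0[of j] ..
    have "\<chi> j 0 = coef (U (F (0, 1))) (1, j)" for j by (simp only: \<chi>_def F0[of j] One_nat_def)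
    ultimately show ?thesis
      using dG[of 1 0] coef_x_times(1)[OF U_Pol[OF FP[of 1 0]]] l_ge_2
      by (simp add: \<psi>_def)
  qed
  \<comment> \<open>The values to which the columns telescope; together they cancel the entry at (0,
    1).\<close>
  define s where "s = (\<lambda>j. if j = 1 then \<psi> 0 else - \<chi> j 0)"
  have "summable_to (diag ?G) (diag ?G (0, 1) + (\<Sum>j\<in>{1..l}. s j))"
  proof (rule summable_to_columns)
    fix j assume j: "j \<in> {1..l}"
    show "(\<lambda>n. v (s j - (\<Sum>i<n. diag ?G (Suc i, j)))) \<longlonglongrightarrow> 0"
    proof (cases "j = 1")
      case True
      have "(\<Sum>i<m. diag ?G (Suc i, 1)) = \<psi> 0 - \<psi> m" for m
        unfolding d1 by (induction m) auto
      moreover have "F (Suc i, 1) \<in> Pol (\<lambda>_. i + Suc n)" for i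
        using FP[of 1 "Suc i"] l_ge_2 by simp
      then have "(\<lambda>i. v (\<psi> i)) \<longlonglongrightarrow> 0" unfolding \<psi>_def by (rule U_decay_limit) simp
      ultimately show ?thesis using True by (simp add: s_def)
    next
      case False
      then have j': "j \<in> {2..l}" using j by auto
      have "(\<Sum>i<m. diag ?G (Suc i, j)) = \<chi> j m - \<chi> j 0" for m
        unfolding dj[OF j'] by (induction m) auto
      moreover have "(\<lambda>i. v (\<chi> j i)) \<longlonglongrightarrow> 0" unfolding \<chi>_def
        by (rule U_decay_limit[OF FP]) (use j in auto)
      ultimately show ?thesis using False by (simp add: s_def v_uminus)
    qed
  qed
  moreover have "(\<Sum>j\<in>{1..l}. s j) = \<psi> 0 - (\<Sum>j\<in>{2..l}. \<chi> j 0)"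
  proof -
    have "{1..l} = insert 1 {2..l}" using l_ge_2 by auto
    then show ?thesis by (simp add: s_def sum_negf)
  qed
  moreover have "fixed_sum ?G = 0"
  proof -
    have "x ^ Q - x = 0" if "x \<in> X0" for x
      using that Q_gt_1 power_Suc[of x "Q - 1"] by (simp add: X0_def)
    then show ?thesis by (simp add: fixed_sum_def)
  qed
  ultimately show ?thesis unfolding trace_holds_def d0 by simp
qed

section \<open>Laurent polynomials\<close>

lemma v_pt_1: "j \<in> {3..l} \<Longrightarrow> v (pt j) = 1"
  using v_pt_diff[of j 2] l_ge_2 by (simp add: pt_2)

lemma pt_Q_minus_1:
  assumes j: "j \<in> {3..l}" shows "pt j ^ (Q - 1) = 1"
proof -
  have "pt j * pt j ^ (Q - 1) = pt j ^ Q" using Q_gt_1 by (simp flip: power_Suc)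
  also have "\<dots> = pt j * 1" using pt_Q[of j] j by simp
  finally have "pt j = 0 \<or> pt j ^ (Q - 1) = 1" by (simp only: mult_cancel_left)
  then show ?thesis using v_pt_1[OF j] by (auto simp: v_0)
qed

lemma Laurent_value_R:
  assumes j: "j \<in> {3..l}" and G: "G \<in> alg {2}" shows "G (pt j) \<in> R"
  using G
proof (induction rule: alg.induct)
  case (inv i)
  then show ?case using j v_pt_1[OF j] by (simp add: pt_2 R_inverse R_pt)
qed (use j in \<open>simp_all add: R_pt R_add R_mult\<close>)

text \<open>The quotient again has poles only at 0 and \<infinity> and coefficients in
  \<open>R\<close>, because \<open>pt j\<close> is a unit for j \<ge> 3. Products follow the product
  rule for difference quotients.\<close>

lemma Laurent_synthetic_division:
  assumes j: "j \<in> {3..l}" and G: "G \<in> alg {2}"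
  shows "\<exists>r\<in>alg {2}. \<forall>x\<in>A. G x - G (pt j) = (x - pt j) * r x"
  using G
proof (induction rule: alg.induct)
  case (const r)
  show ?case by (intro bexI[of _ "\<lambda>x. 0"] alg.const R_0) simp
next
  case var
  show ?case by (intro bexI[of _ "\<lambda>x. 1"] alg.const R_1) simp
next
  case (inv i)
  have r: "- inverse (pt j) \<in> R" "pt j \<noteq> 0"
    using j v_pt_1[OF j] by (auto intro!: R_uminus R_inverse R_pt simp: v_0)
  show ?case
  proof (rule bexI[of _ "\<lambda>x. - inverse (pt j) * inverse (x - pt 2)"])
    show "(\<lambda>x. - inverse (pt j) * inverse (x - pt 2)) \<in> alg {2}"
      by (intro alg.mult alg.const alg.inv r) simp
  qed (use inv r A_0 in \<open>auto simp: pt_2 field_simps\<close>)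
next
  case (add f g)
  then obtain r s where rs: "r \<in> alg {2}" "s \<in> alg {2}"
    "\<forall>x\<in>A. f x - f (pt j) = (x - pt j) * r x" "\<forall>x\<in>A. g x - g (pt j) = (x - pt j) * s x" by blast
  have "f x + g x - (f (pt j) + g (pt j)) = (x - pt j) * (r x + s x)" if "x \<in> A" for x
  proof -
    have "f x + g x - (f (pt j) + g (pt j)) = (f x - f (pt j)) + (g x - g (pt j))" by simp
    then show ?thesis using rs that by (simp add: distrib_left)
  qed
  then show ?case by (intro bexI[OF _ alg.add[OF rs(1,2)]] ballI)
next
  case (mult f g)
  then obtain r s where rs: "r \<in> alg {2}" "s \<in> alg {2}"
    "\<forall>x\<in>A. f x - f (pt j) = (x - pt j) * r x" "\<forall>x\<in>A. g x - g (pt j) = (x - pt j) * s x" by blast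
  have gR: "g (pt j) \<in> R" by (rule Laurent_value_R[OF j mult.hyps(2)])
  have "f x * g x - f (pt j) * g (pt j) = (x - pt j) * (f x * s x + r x * g (pt j))" if "x \<in> A" for x
  proof -
    have "f x * g x - f (pt j) * g (pt j) = f x * (g x - g (pt j)) + (f x - f (pt j)) * g (pt j)"
      by (simp add: algebra_simps)
    then show ?thesis using rs that by (simp add: algebra_simps)
  qed
  moreover have "(\<lambda>x. f x * s x + r x * g (pt j)) \<in> alg {2}"
    by (intro alg.add alg.mult mult.hyps rs alg.const gR)
  ultimately show ?case by (intro bexI[of _ "\<lambda>x. f x * s x + r x * g (pt j)"] ballI)
qed

text \<open>Write G = G(pt j) + (x - pt j) r. The factor x - pt j lowers the order at
  \<open>pt j\<close> by one, neither r nor U raises it again, and so the second part misses the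
  diagonal. The first part is a multiple of the diagonal of U itself.\<close>

lemma diag_Laurent:
  assumes j: "j \<in> {3..l}" and G: "G \<in> alg {2}"
  shows "diag G (Suc i, j) = G (pt j) * of_nat Q ^ i"
proof -
  have j2: "j \<in> {2..l}" "1 \<le> j" "j \<le> l" using j by auto
  have gR: "G (pt j) \<in> R" by (rule Laurent_value_R[OF j G])
  obtain r where r: "r \<in> alg {2}" "\<forall>x\<in>A. G x - G (pt j) = (x - pt j) * r x"
    using Laurent_synthetic_division[OF j G] by blast
  obtain n where n: "\<And>d f. f \<in> Pol d \<Longrightarrow> (\<lambda>x. r x * f x) \<in> Pol (\<lambda>k. if k = 1 \<or> k \<in> {2} then d k + n else d k)"
    using alg_times_Pol[OF r(1)] l_ge_2 by auto
  have rB: "(\<lambda>x. r x * B (i, j) x) \<in> Pol (\<lambda>k. if k = 1 \<or> k \<in> {2} then i + n else i)"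
    by (rule n) (rule Pol_B, use j2 in auto)
  have "(\<lambda>x. G x * B (Suc i, j) x) = (\<lambda>x. G (pt j) * B (Suc i, j) x + r x * B (i, j) x)"
  proof
    fix x show "G x * B (Suc i, j) x = G (pt j) * B (Suc i, j) x + r x * B (i, j) x"
    proof (cases "x \<in> A")
      case True
      then have "G x = G (pt j) + (x - pt j) * r x" using r(2) by (simp add: algebra_simps)
      then have "G x * B (Suc i, j) x = (G (pt j) + (x - pt j) * r x) * B (Suc i, j) x" by (rule arg_cong)
      also have "\<dots> = G (pt j) * B (Suc i, j) x + r x * ((x - pt j) * B (Suc i, j) x)"
        by (simp only: distrib_right distrib_left mult_ac)
      finally have "G x * B (Suc i, j) x = G (pt j) * B (Suc i, j) x + r x * ((x - pt j) * B (Suc i, j) x)" .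
      moreover have "(x - pt j) * B (Suc i, j) x = B (i, j) x"
        using True j A_pt_0[OF True j2(1)] by (simp add: B_def)
      ultimately show ?thesis by simp
    qed (simp add: B_outside)
  qed
  then have "U (\<lambda>x. G x * B (Suc i, j) x) = (\<lambda>x. G (pt j) * U (B (Suc i, j)) x + U (\<lambda>x. r x * B (i, j) x) x)"
    by (simp add: U_add U_scale fun_eq_iff)
  then have "diag G (Suc i, j) = G (pt j) * coef (U (B (Suc i, j))) (Suc i, j) + coef (U (\<lambda>x. r x * B (i, j) x)) (Suc i, j)"
    using gR j2 by (simp add: diag_def coef_add coef_scale Z_scale U_Z B_Z Pol_Z[OF rB])
  moreover have "coef (U (\<lambda>x. r x * B (i, j) x)) (Suc i, j) = 0"
    using U_Pol[OF rB] j by (auto simp: Pol_def)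
  moreover have "coef (U (B (Suc i, j))) (Suc i, j) = of_nat Q ^ i"
  proof -
    show ?thesis using pt_Q_minus_1[OF j] coef_U_B[OF j2(1), of "Suc i" j "Suc i"] uc_leading[of "pt j" i] j2
      by (simp add: idx_iff del: uc.simps)
  qed
  ultimately show "diag G (Suc i, j) = G (pt j) * of_nat Q ^ i" by simp
qed

text \<open>The p-adic geometric series in Q sums to 1 / (1 - Q). Here the factor 1 / (Q - 1) enters
  for the poles other than 0 and \<infinity>.\<close>

lemma geometric_column:
  assumes r: "r \<in> R"
  shows "(\<lambda>n. v (- r * inverse (of_nat (Q - 1)) - (\<Sum>i<n. r * of_nat Q ^ i))) \<longlonglongrightarrow> 0"
proof (rule tendsto_sandwich[of "\<lambda>_. 0"])
  have Q1: "of_nat (Q - 1) = (of_nat Q - 1 :: 'c)" using Q_gt_1 by (simp add: of_nat_diff)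
  have ne: "of_nat Q - (1::'c) \<noteq> 0" using v_Q_minus_1 unfolding Q1 by (auto simp: v_0)
  have vQ: "v (of_nat Q) \<le> 1 / p" unfolding Q_power using ak_pos by (intro v_of_nat_dvd) simp
  have "v (- r * inverse (of_nat (Q - 1)) - (\<Sum>i<n. r * of_nat Q ^ i)) \<le> (1 / p) ^ n" for n
  proof -
    have S: "(\<Sum>i<n. r * of_nat Q ^ i) = r * ((of_nat Q ^ n - 1) / (of_nat Q - 1))"
      using ne geometric_sum[of "of_nat Q :: 'c" n] by (simp add: sum_distrib_left[symmetric])
    have "- r * inverse (of_nat (Q - 1)) - (\<Sum>i<n. r * of_nat Q ^ i) = - (r * of_nat Q ^ n * inverse (of_nat (Q - 1)))"
      unfolding S Q1 by (simp add: divide_inverse algebra_simps)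
    then have "v (- r * inverse (of_nat (Q - 1)) - (\<Sum>i<n. r * of_nat Q ^ i)) = v r * v (of_nat Q) ^ n"
      by (simp only: v_uminus v_mult v_inverse v_Q_minus_1 v_power) simp
    also have "\<dots> \<le> 1 * (1 / p) ^ n"
      using vQ by (intro mult_mono R_le[OF r] power_mono v_nonneg) (auto simp: v_nonneg)
    finally show ?thesis by simp
  qed
  then show "\<forall>\<^sub>F n in sequentially. v (- r * inverse (of_nat (Q - 1)) - (\<Sum>i<n. r * of_nat Q ^ i)) \<le> (1 / p) ^ n"
    by simp
  show "(\<lambda>n. (1 / real p) ^ n) \<longlonglongrightarrow> 0" by (rule LIMSEQ_realpow_zero) (use p_gt_1 in auto)
qed (auto simp: v_nonneg)

lemma roots_of_1: "finite {x::'c. x ^ (Q - 1) = 1}"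
  using nth_roots(1)[of "Q - 1" 1] Q_gt_1 by simp

lemma X0_roots: "X0 = {x. x ^ (Q - 1) = 1} - pt ` {3..l}"
proof -
  have "x \<in> A \<longleftrightarrow> x \<notin> pt ` {3..l}" if x: "x ^ (Q - 1) = 1" for x
  proof -
    have xQ: "x ^ Q = x" using x Q_gt_1 power_Suc[of x "Q - 1"] by simp
    have vx: "v x \<le> 1" using v_teich_le_1[of x "a * k"] xQ ak_pos by (simp add: Q_power)
    have d: "v (x - pt j) = 1" if "x \<noteq> pt j" "j \<in> {2..l}" for j
      using v_teich_diff[of "a * k" x "pt j"] xQ pt_Q[OF that(2)] that(1) ak_pos by (simp add: Q_power)
    have "x \<noteq> 0" using x Q_gt_1 by (auto simp: power_0_left)
    then have "x \<noteq> pt 2" by (simp add: pt_2)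
    show ?thesis
    proof
      assume xA: "x \<in> A"
      show "x \<notin> pt ` {3..l}"
      proof
        assume "x \<in> pt ` {3..l}"
        then obtain j where "j \<in> {3..l}" "x = pt j" by blast
        then show False using A_pt_0[OF xA, of j] by simp
      qed
    next
      assume x3: "x \<notin> pt ` {3..l}"
      have "x \<noteq> pt j" if "j \<in> {2..l}" for j
        using x3 \<open>x \<noteq> pt 2\<close> that by (cases "j = 2") auto
      then show "x \<in> A" using vx d by (simp add: A_def)
    qed
  qed
  then show ?thesis by (auto simp: X0_def)
qed

text \<open>The roots of unity missing from \<open>X0\<close> are the nonzero poles; they enter as
  corrections of exactly the size of the geometric columns.\<close>

lemma fixed_sum_Laurent:
  "fixed_sum G = inverse (of_nat (Q - 1)) * (\<Sum>x | x ^ (Q - 1) = 1. G x)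
     + (\<Sum>j\<in>{3..l}. - G (pt j) * inverse (of_nat (Q - 1)))"
proof -
  have sub: "pt ` {3..l} \<subseteq> {x. x ^ (Q - 1) = 1}"
    by (auto simp: pt_Q_minus_1 simp del: One_nat_def)
  have inj: "inj_on pt {3..l}" by (rule inj_on_subset[OF pt_inj]) auto
  have "(\<Sum>x\<in>X0. G x) = (\<Sum>x | x ^ (Q - 1) = 1. G x) - (\<Sum>j\<in>{3..l}. G (pt j))"
    unfolding X0_roots using sum_diff[OF roots_of_1 sub, of G] by (simp add: sum.reindex[OF inj])
  then show ?thesis
    by (simp add: fixed_sum_def right_diff_distrib sum_negf sum_distrib_left mult.commute)
qed

lemma sum_roots_of_1:
  "inverse (of_nat (Q - 1)) * (\<Sum>x | x ^ (Q - 1) = 1. x ^ n) = (if Q - 1 dvd n then 1 else 0 :: 'c)"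
proof -
  have "of_nat (Q - 1) \<noteq> (0::'c)" using v_Q_minus_1 by (auto simp: v_0)
  then show ?thesis using sum_root_powers[of "Q - 1" "1::'c" n] Q_gt_1 by simp
qed

text \<open>Once the columns of the nonzero poles have been matched with the missing roots of unity,
  only the constant and the columns of \<infinity> and 0 have to be compared with the sum over all
  roots of unity.\<close>

lemma trace_holds_LaurentI:
  assumes G: "G \<in> alg {2}"
    and s: "\<And>j. j \<in> {1, 2} \<Longrightarrow> (\<lambda>n. v (s j - (\<Sum>i<n. diag G (Suc i, j)))) \<longlonglongrightarrow> 0"
    and total: "diag G (0, 1) + s 1 + s 2 = inverse (of_nat (Q - 1)) * (\<Sum>x | x ^ (Q - 1) = 1. G x)"
  shows "trace_holds G"
proof -
  define s' where "s' = (\<lambda>j. if j \<in> {1, 2} then s j else - G (pt j) * inverse (of_nat (Q - 1)))"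
  have "summable_to (diag G) (diag G (0, 1) + (\<Sum>j\<in>{1..l}. s' j))"
  proof (rule summable_to_columns)
    fix j assume j: "j \<in> {1..l}"
    show "(\<lambda>n. v (s' j - (\<Sum>i<n. diag G (Suc i, j)))) \<longlonglongrightarrow> 0"
    proof (cases "j \<in> {1, 2}")
      case True
      then show ?thesis using s[OF True] by (simp only: s'_def if_True)
    next
      case False
      then have j3: "j \<in> {3..l}" using j by auto
      then show ?thesis using geometric_column[OF Laurent_value_R[OF j3 G]] False
        by (simp add: s'_def diag_Laurent[OF j3 G])
    qed
  qed
  moreover have "{1..l} = insert 1 (insert 2 {3..l})" using l_ge_2 by auto
  then have "diag G (0, 1) + (\<Sum>j\<in>{1..l}. s' j) = (diag G (0, 1) + s 1 + s 2) + (\<Sum>j\<in>{3..l}. - G (pt j) * inverse (of_nat (Q - 1)))"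
    by (simp add: s'_def)
  ultimately show ?thesis unfolding trace_holds_def fixed_sum_Laurent by (simp only: total)
qed

lemma single_term_limit:
  fixes t :: "nat \<Rightarrow> 'c"
  assumes "\<And>i. i \<noteq> m \<Longrightarrow> t i = 0" shows "(\<lambda>n. v (t m - (\<Sum>i<n. t i))) \<longlonglongrightarrow> 0"
proof (rule tendsto_eventually)
  have "(\<Sum>i<n. t i) = t m" if "n > m" for n
    using sum.mono_neutral_right[of "{..<n}" "{m}" t] assms that by auto
  then show "\<forall>\<^sub>F n in sequentially. v (t m - (\<Sum>i<n. t i)) = 0"
    by (auto simp: eventually_sequentially v_0 intro!: exI[of _ "Suc m"])
qed

lemma delta_column:
  "(\<lambda>n. v ((if Q - 1 dvd m \<and> 0 < m then 1 else 0) - (\<Sum>i<n. if m = (Q - 1) * Suc i then 1 else 0))) \<longlonglongrightarrow> 0"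
proof (cases "Q - 1 dvd m \<and> 0 < m")
  case True
  then obtain i where i: "m = (Q - 1) * Suc i" by (metis dvdE mult_0_right not0_implies_Suc neq0_conv)
  have "m = (Q - 1) * Suc i' \<longleftrightarrow> i' = i" for i'
    unfolding i mult_cancel1 using Q_gt_1 by auto
  then show ?thesis using single_term_limit[of i "\<lambda>i. if m = (Q - 1) * Suc i then 1 else 0"] True by simp
next
  case False
  moreover have "Q - 1 dvd (Q - 1) * Suc i" "0 < (Q - 1) * Suc i" for i
    using Q_gt_1 by (simp_all only: dvd_triv_left) simp
  ultimately have "m \<noteq> (Q - 1) * Suc i" for i by metis
  then have "(if m = (Q - 1) * Suc i then 1 else 0) = (0::'c)" for i by (rule if_not_P)
  then show ?thesis unfolding if_not_P[OF False] by (simp only:) (simp add: v_0)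
qed

lemma Q_mult_eq: "n + i = Q * i \<longleftrightarrow> n = (Q - 1) * i"
proof -
  have "Q * i = (Q - 1) * i + i" using Q_gt_1 by (cases Q) auto
  then show ?thesis by auto
qed

text \<open>U \<circ> x^n sends x^i to x^((n + i) / Q) or to 0, so the diagonal has a 1 exactly
  where n = (Q - 1) i. Such an i exists if and only if Q - 1 divides n, which is also when the
  average of x^n over the (Q - 1)-th roots of unity is 1 and not 0.\<close>

lemma trace_holds_power: "trace_holds (\<lambda>x. x ^ n)"
proof -
  let ?G = "\<lambda>x. x ^ n"
  have G: "?G \<in> alg {2}" by (intro alg_power alg.var)
  have prod1: "(\<lambda>x. x ^ n * B (i, 1) x) = B (n + i, 1)" for i by (auto simp: B_def power_add)
  have d1: "diag ?G (i, 1) = (if n = (Q - 1) * i then 1 else 0)" if "(i, 1) \<in> I" for i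
    unfolding diag_def prod1 using coef_U_B_1[OF that] by (simp add: Q_mult_eq)
  have d2: "diag ?G (Suc i, 2) = 0" for i
  proof -
    have I: "(Suc i, 2) \<in> I" using l_ge_2 by (simp add: idx_iff)
    show ?thesis
    proof (cases "Suc i \<le> n")
      case True
      have "(\<lambda>x. x ^ n * B (Suc i, 2) x) = B (n - Suc i, 1)"
        using True A_0 by (auto simp: B_def pt_2 power_diff power_inverse divide_inverse)
      then show ?thesis unfolding diag_def using coef_U_B_1[OF I] by simp
    next
      case False
      have "(\<lambda>x. x ^ n * B (Suc i, 2) x) = B (Suc i - n, 2)"
        using False A_0 by (auto simp: B_def pt_2 power_diff power_inverse field_simps)
      moreover have "Suc i - n \<noteq> Q * Suc i"
        using Q_gt_1 mult_le_mono1[of 2 Q "Suc i"] by simp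
      then have "Suc i - n + Q - 1 \<noteq> Q * Suc i + Q - 1" using Q_gt_1 by linarith
      ultimately show ?thesis unfolding diag_def using coef_U_B[OF _ I, of 2 "Suc i - n"] l_ge_2
        by (simp add: pt_2 uc_zero del: uc.simps)
    qed
  qed
  define s where "s = (\<lambda>j::nat. if j = 1 then (if Q - 1 dvd n \<and> 0 < n then 1 else 0) else 0 :: 'c)"
  show ?thesis
  proof (rule trace_holds_LaurentI[OF G, of s])
    fix j :: nat assume "j \<in> {1, 2}"
    then consider "j = 1" | "j = 2" by auto
    then show "(\<lambda>m. v (s j - (\<Sum>i<m. diag ?G (Suc i, j)))) \<longlonglongrightarrow> 0"
    proof cases
      case 1
      have "diag ?G (Suc i, 1) = (if n = (Q - 1) * Suc i then 1 else 0)" for i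
        using l_ge_2 by (intro d1) (simp add: idx_iff)
      then show ?thesis using delta_column[of n] by (simp only: s_def 1 simp_thms if_True)
    next
      case 2
      then show ?thesis by (simp add: s_def v_0 d2)
    qed
  next
    have "diag ?G (0, 1) = (if n = 0 then 1 else 0)" using d1[of 0] l_ge_2 by (simp add: idx_iff)
    then show "diag ?G (0, 1) + s 1 + s 2 = inverse (of_nat (Q - 1)) * (\<Sum>x | x ^ (Q - 1) = 1. x ^ n)"
      unfolding sum_roots_of_1 by (auto simp: s_def)
  qed
qed

text \<open>Supplies the order 0, which \<open>coef_U_B\<close> leaves out because the constants of
  all columns share the index (0, 1).\<close>

lemma coef_U_B_0:
  assumes j: "j \<in> {2..l}" shows "coef (U (B (s, j))) (0, 1) = uc (pt j) 0 (s + Q - 1)"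
proof -
  let ?c = "\<lambda>n. uc (pt j) n (s + Q - 1)"
  have R: "?c n \<in> R" for n by (rule uc_R[OF R_pt[OF j]])
  have Z: "B (n, j) \<in> Z" for n using j by (intro B_Z) auto
  have "coef (U (B (s, j))) (0, 1) = (\<Sum>n\<le>s + Q - 1. coef (\<lambda>x. ?c n * B (n, j) x) (0, 1))"
    unfolding U_B[OF j] by (rule Z_sum(2)) (simp, rule Z_scale[OF R Z])
  also have "\<dots> = (\<Sum>n\<le>s + Q - 1. if n = 0 then ?c 0 else 0)"
  proof (rule sum.cong)
    fix n
    have "coef (B (n, j)) (0, 1) = (if n = 0 then 1 else 0)" using j by (subst coef_B') auto
    then show "coef (\<lambda>x. ?c n * B (n, j) x) (0, 1) = (if n = 0 then ?c 0 else 0)"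
      unfolding coef_scale[OF R Z] by simp
  qed simp
  finally show ?thesis by (simp del: uc.simps)
qed

text \<open>The roles of 0 and \<infinity> are exchanged. The constant belongs to the first column
  and breaks the symmetry, so n = 0 is taken from the nonnegative powers.\<close>

lemma trace_holds_inverse_power: "trace_holds (\<lambda>x. inverse x ^ n)"
proof (cases "n = 0")
  case True then show ?thesis using trace_holds_power[of 0] by simp
next
  case n0: False
  let ?G = "\<lambda>x. inverse x ^ n"
  have "(\<lambda>x. inverse (x - pt 2) ^ n) \<in> alg {2}" by (intro alg_power alg.inv) simp
  then have G: "?G \<in> alg {2}" by (simp add: pt_2)
  have prod2: "(\<lambda>x. inverse x ^ n * B (i, 2) x) = B (n + i, 2)" for i
    by (auto simp: B_def pt_2 power_add)
  have d2: "diag ?G (Suc i, 2) = (if n = (Q - 1) * Suc i then 1 else 0)" for i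
  proof -
    have I: "(Suc i, 2) \<in> I" using l_ge_2 by (simp add: idx_iff)
    have "n + Suc i + Q - 1 = Q * Suc i + Q - 1 \<longleftrightarrow> n + Suc i = Q * Suc i" using Q_gt_1 by linarith
    then show ?thesis unfolding diag_def prod2 using coef_U_B[OF _ I, of 2 "n + Suc i"] l_ge_2 Q_mult_eq[of n "Suc i"]
      by (simp add: pt_2 uc_zero del: uc.simps)
  qed
  have d1: "diag ?G (i, 1) = 0" if I: "(i, 1) \<in> I" for i
  proof (cases "n \<le> i")
    case True
    have "(\<lambda>x. inverse x ^ n * B (i, 1) x) = B (i - n, 1)"
      using True A_0 by (auto simp: B_def power_diff power_inverse field_simps)
    moreover have "i - n \<noteq> Q * i"
    proof -
      have "i - n < i" using True n0 by simp
      also have "i \<le> Q * i" using Q_gt_1 by simp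
      finally show ?thesis by simp
    qed
    ultimately show ?thesis unfolding diag_def using coef_U_B_1[OF I] by simp
  next
    case False
    have eq: "(\<lambda>x. inverse x ^ n * B (i, 1) x) = B (n - i, 2)"
      using False A_0 by (auto simp: B_def pt_2 power_diff power_inverse field_simps)
    show ?thesis
    proof (cases "i = 0")
      case True
      have j2: "2 \<in> {2..l}" using l_ge_2 by simp
      have "n + Q - 1 \<noteq> Q * 0 + Q - 1" using n0 Q_gt_1 by simp
      then have "coef (U (B (n, 2))) (0, 1) = 0" unfolding coef_U_B_0[OF j2] pt_2 uc_zero by (rule if_not_P)
      then show ?thesis unfolding diag_def eq using True by simp
    next
      case i0: False
      then show ?thesis unfolding diag_def eq using coef_U_B[of 2 i 1 "n - i"] I l_ge_2 by simp
    qed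
  qed
  define s where "s = (\<lambda>j::nat. if j = 2 then (if Q - 1 dvd n \<and> 0 < n then 1 else 0) else 0 :: 'c)"
  show ?thesis
  proof (rule trace_holds_LaurentI[OF G, of s])
    fix j :: nat assume "j \<in> {1, 2}"
    then consider "j = 1" | "j = 2" by auto
    then show "(\<lambda>m. v (s j - (\<Sum>i<m. diag ?G (Suc i, j)))) \<longlonglongrightarrow> 0"
    proof cases
      case 1
      have "diag ?G (Suc i, 1) = 0" for i using l_ge_2 by (intro d1) (simp add: idx_iff)
      then show ?thesis by (simp add: s_def v_0 1)
    next
      case 2
      then show ?thesis using delta_column[of n] by (simp only: s_def simp_thms if_True d2)
    qed
  next
    have "diag ?G (0, 1) = 0" using d1[of 0] l_ge_2 by (simp add: idx_iff)
    moreover have "(\<Sum>x | x ^ (Q - 1) = 1. inverse x ^ n) = (\<Sum>x | x ^ (Q - 1) = 1. x ^ n :: 'c)"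
      by (rule sum.reindex_bij_witness[of _ inverse inverse]) (auto simp: power_inverse)
    ultimately show "diag ?G (0, 1) + s 1 + s 2 = inverse (of_nat (Q - 1)) * (\<Sum>x | x ^ (Q - 1) = 1. inverse x ^ n)"
      using sum_roots_of_1[of n] n0 by (simp add: s_def)
  qed
qed

text \<open>
  Modulo the ideal generated by \<open>x ^ Q - x\<close>, on which the trace formula holds by conjugation, every
  rational function with poles at the \<open>pt j\<close> is a Laurent polynomial, since \<open>x - pt j\<close> divides
  \<open>x ^ (Q - 1) - 1\<close> exactly once.
\<close>

inductive_set V :: "('c \<Rightarrow> 'c) set" where
  power: "(\<lambda>x. x ^ n) \<in> V"
| inverse_power: "(\<lambda>x. inverse x ^ n) \<in> V"
| ideal: "H \<in> alg {2..l} \<Longrightarrow> (\<lambda>x. (x ^ Q - x) * H x) \<in> V"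
| scale: "r \<in> R \<Longrightarrow> f \<in> V \<Longrightarrow> (\<lambda>x. r * f x) \<in> V"
| add: "f \<in> V \<Longrightarrow> g \<in> V \<Longrightarrow> (\<lambda>x. f x + g x) \<in> V"
| eq_on: "f \<in> V \<Longrightarrow> (\<And>x. x \<in> A \<Longrightarrow> f x = g x) \<Longrightarrow> g \<in> V"

lemma alg_inverse: "(\<lambda>x. inverse x) \<in> alg {2..l}"
  using alg.inv[of 2 "{2..l}"] l_ge_2 by (simp add: pt_2)

text \<open>Lets an element of \<open>V\<close> serve as a factor in a generator of the ideal, as
  \<open>pole_times_V\<close> requires; it also makes elements of \<open>V\<close>
  multipliers.\<close>

lemma V_alg: "f \<in> V \<Longrightarrow> \<exists>h\<in>alg {2..l}. \<forall>x\<in>A. h x = f x"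
proof (induction rule: V.induct)
  case (power n) show ?case by (intro bexI[of _ "\<lambda>x. x ^ n"] alg_power alg.var) simp
next
  case (inverse_power n)
  show ?case by (intro bexI[of _ "\<lambda>x. inverse x ^ n"] alg_power alg_inverse) simp
next
  case (ideal H)
  show ?case by (intro bexI[of _ "\<lambda>x. (x ^ Q - x) * H x"] alg.mult alg_diff alg_power alg.var ideal) simp
next
  case (scale r f)
  then obtain h where "h \<in> alg {2..l}" "\<forall>x\<in>A. h x = f x" by blast
  then show ?case by (intro bexI[of _ "\<lambda>x. r * h x"] alg.mult alg.const scale) auto
next
  case (add f g)
  then obtain h h' where "h \<in> alg {2..l}" "\<forall>x\<in>A. h x = f x" "h' \<in> alg {2..l}" "\<forall>x\<in>A. h' x = g x" by blast
  then show ?case by (intro bexI[of _ "\<lambda>x. h x + h' x"] alg.add) auto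
next
  case (eq_on f g) then show ?case by auto
qed

lemma V_multiplier: "f \<in> V \<Longrightarrow> multiplier f"
proof -
  assume "f \<in> V"
  then obtain h where h: "h \<in> alg {2..l}" "\<forall>x\<in>A. h x = f x" using V_alg[of f] by blast
  show ?thesis by (rule multiplier_cong[OF multiplier_alg[OF h(1)]]) (use h(2) in simp)
qed

lemma V_trace_holds: "f \<in> V \<Longrightarrow> trace_holds f"
proof (induction rule: V.induct)
  case (ideal H) then show ?case by (rule trace_holds_conjugation)
next
  case (eq_on f g)
  show ?case by (rule trace_holds_cong[OF eq_on.IH eq_on.hyps(2)])
next
  case (scale r f)
  show ?case by (rule trace_holds_scale[OF V_multiplier[OF scale.hyps(2)] scale.IH scale.hyps(1)])
next
  case (add f g)
  show ?case by (rule trace_holds_add[OF V_multiplier[OF add.hyps(1)] V_multiplier[OF add.hyps(2)] add.IH])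
qed (rule trace_holds_power trace_holds_inverse_power)+

lemma var_times_V: "f \<in> V \<Longrightarrow> (\<lambda>x. x * f x) \<in> V"
proof (induction rule: V.induct)
  case (power n) show ?case using V.power[of "Suc n"] by simp
next
  case (inverse_power n)
  show ?case
  proof (cases n)
    case 0 then show ?thesis using V.power[of 1] by simp
  next
    case (Suc m) then show ?thesis by (intro V.eq_on[OF V.inverse_power[of m]]) (auto dest: A_0)
  qed
next
  case (ideal H)
  show ?case using V.ideal[OF alg.mult[OF alg.var ideal]] by (simp add: mult.left_commute)
next
  case (scale r f) then show ?case using V.scale[OF scale(1) scale.IH] by (simp add: mult.left_commute)
next
  case (add f g) then show ?case using V.add[OF add.IH] by (simp add: distrib_left)
next
  case (eq_on f g) show ?case by (rule V.eq_on[OF eq_on.IH]) (simp add: eq_on.hyps)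
qed

lemma inverse_times_V: "f \<in> V \<Longrightarrow> (\<lambda>x. inverse x * f x) \<in> V"
proof (induction rule: V.induct)
  case (inverse_power n) show ?case using V.inverse_power[of "Suc n"] by simp
next
  case (power n)
  show ?case
  proof (cases n)
    case 0 then show ?thesis using V.inverse_power[of 1] by simp
  next
    case (Suc m) then show ?thesis by (intro V.eq_on[OF V.power[of m]]) (auto dest: A_0)
  qed
next
  case (ideal H)
  show ?case using V.ideal[OF alg.mult[OF alg_inverse ideal]] by (simp add: mult.left_commute)
next
  case (scale r f) then show ?case using V.scale[OF scale(1) scale.IH] by (simp add: mult.left_commute)
next
  case (add f g) then show ?case using V.add[OF add.IH] by (simp add: distrib_left)
next
  case (eq_on f g) show ?case by (rule V.eq_on[OF eq_on.IH]) (simp add: eq_on.hyps)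
qed

lemma Laurent_times_V: "H \<in> alg {2} \<Longrightarrow> f \<in> V \<Longrightarrow> (\<lambda>x. H x * f x) \<in> V"
proof (induction arbitrary: f rule: alg.induct)
  case (inv j) then show ?case using inverse_times_V[of f] by (simp add: pt_2)
next
  case (add g h) then show ?case using V.add[OF add.IH(1) add.IH(2), of f f] by (simp add: distrib_right)
next
  case (mult g h) then show ?case using mult.IH(1)[OF mult.IH(2)[of f]] by (simp add: mult.assoc)
next
  case (const r) then show ?case by (intro V.scale)
next
  case var then show ?case by (rule var_times_V)
qed

text \<open>Let w = (x^(Q - 1) - 1) / (x - pt j) and w = w(pt j) + (x - pt j) r. With u = 1 / w(pt
  j) this gives f / (x - pt j) = u w f / (x - pt j) - u r f, where the first term is in the ideal
  and the second is a Laurent polynomial times f. The value w(pt j) = (Q - 1) pt j^(Q - 2) is a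
  unit, so u is in \<open>R\<close>.\<close>

lemma pole_times_V:
  assumes j: "j \<in> {3..l}" and f: "f \<in> V" shows "(\<lambda>x. inverse (x - pt j) * f x) \<in> V"
proof -
  have j2: "j \<in> {2..l}" using j by auto
  have v1: "v (pt j) = 1" by (rule v_pt_1[OF j])
  define w where "w = (\<lambda>x. \<Sum>i<Q - 1. x ^ i * pt j ^ (Q - 1 - Suc i))"
  have w: "w \<in> alg {2}" unfolding w_def using j2
    by (intro alg_sum alg.mult alg_power alg.var alg.const R_power R_pt)
  obtain r where r: "r \<in> alg {2}" "\<And>x. x \<in> A \<Longrightarrow> w x - w (pt j) = (x - pt j) * r x"
    using Laurent_synthetic_division[OF j w] by blast
  note ptQ = pt_Q_minus_1[OF j]
  have wx: "(x - pt j) * w x = x ^ (Q - 1) - 1" for x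
    using power_diff_sumr2[of x "Q - 1" "pt j"] unfolding ptQ w_def by (simp add: mult.commute)
  have "w (pt j) = (\<Sum>i<Q - 1. pt j ^ (Q - 2))"
    unfolding w_def by (intro sum.cong) (auto simp flip: power_add intro: arg_cong2[where f = power])
  then have wp: "w (pt j) = of_nat (Q - 1) * pt j ^ (Q - 2)" by simp
  then have vw: "v (w (pt j)) = 1" by (simp only: v_mult v_Q_minus_1 v_power v1) simp
  then have w0: "w (pt j) \<noteq> 0" by (auto simp: v_0)
  define u where "u = inverse (w (pt j))"
  have u: "u \<in> R" unfolding u_def
  proof (rule R_inverse[OF _ vw])
    show "w (pt j) \<in> R" unfolding wp by (intro R_mult R_of_nat R_power R_pt j2)
  qed
  obtain h where h: "h \<in> alg {2..l}" "\<forall>x\<in>A. h x = f x" using V_alg[OF f] by blast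
  \<comment> \<open>The factor 1 / x and one factor 1 / (x - pt j) are absorbed by the zeros of x^Q
    - x, which leaves w f / (x - pt j).\<close>
  let ?H = "\<lambda>x. inverse x * (inverse (x - pt j) * (inverse (x - pt j) * h x))"
  have H: "?H \<in> alg {2..l}" using j2 h by (intro alg.mult alg_inverse alg.inv)
  have "(\<lambda>x. u * ((x ^ Q - x) * ?H x) + (- u) * (r x * f x)) \<in> V"
    by (intro V.add V.scale u R_uminus V.ideal[OF H] Laurent_times_V[OF r(1) f])
  then show ?thesis
  proof (rule V.eq_on)
    fix x assume x: "x \<in> A"
    define y where "y = x - pt j"
    have y: "y \<noteq> 0" "x \<noteq> 0" using A_pt_0[OF x j2] A_0[OF x] by (auto simp: y_def)
    have "x ^ Q - x = x * (x ^ (Q - 1) - 1)" using Q_gt_1 by (simp add: right_diff_distrib flip: power_Suc)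
    also have "\<dots> = x * (y * w x)" by (simp add: wx y_def)
    finally have "(x ^ Q - x) * ?H x = w x * inverse y * f x"
      using y h(2) x by (simp add: y_def[symmetric] field_simps)
    moreover have "w x = w (pt j) + y * r x" using r(2)[OF x] by (simp add: y_def algebra_simps)
    ultimately have "u * ((x ^ Q - x) * ?H x) + (- u) * (r x * f x) = u * w (pt j) * inverse y * f x"
      using y by (simp add: algebra_simps)
    then show "u * ((x ^ Q - x) * ?H x) + (- u) * (r x * f x) = inverse (x - pt j) * f x"
      using w0 by (simp add: u_def y_def)
  qed
qed

lemma alg_times_V: "H \<in> alg {2..l} \<Longrightarrow> f \<in> V \<Longrightarrow> (\<lambda>x. H x * f x) \<in> V"
proof (induction arbitrary: f rule: alg.induct)
  case (inv j)
  then show ?case using inverse_times_V[of f] pole_times_V[of j f] by (cases "j = 2") (auto simp: pt_2)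
next
  case (add g h) then show ?case using V.add[OF add.IH(1) add.IH(2), of f f] by (simp add: distrib_right)
next
  case (mult g h) then show ?case using mult.IH(1)[OF mult.IH(2)[of f]] by (simp add: mult.assoc)
next
  case (const r) then show ?case by (intro V.scale)
next
  case var then show ?case by (rule var_times_V)
qed

text \<open>\<open>V\<close> contains 1 and is stable under multiplication by rational functions, so
  it contains them all.\<close>

lemma trace_holds_alg: "H \<in> alg {2..l} \<Longrightarrow> trace_holds H"
  using V_trace_holds[OF alg_times_V[OF _ V.power[of 0]]] by simp

lemma trace_holds_B:
  assumes "ij \<in> I" shows "trace_holds (B ij)"
proof -
  obtain i j where ij: "ij = (i, j)" by force
  define H where "H = (if j = 1 then (\<lambda>x. x ^ i) else (\<lambda>x. inverse (x - pt j) ^ i))"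
  have "H \<in> alg {2..l}" using assms unfolding H_def ij
    by (cases "j = 1") (auto simp: idx_iff intro!: alg_power alg.var alg.inv)
  then show ?thesis
    by (rule trace_holds_cong[OF trace_holds_alg]) (simp add: H_def B_def ij)
qed

theorem trace_holds_Z:
  assumes G: "G \<in> Z" shows "trace_holds G"
proof (rule trace_holds_limit[OF multiplier_Z[OF G]])
  fix e :: real assume e: "0 < e"
  define S where "S = {ij\<in>I. e \<le> v (coef G ij)}"
  have S: "finite S" "S \<subseteq> I" using expands_null[OF Z_expands[OF G] e] by (auto simp: S_def)
  define H where "H = (\<lambda>x. \<Sum>ij\<in>S. coef G ij * B ij x)"
  have "H \<in> Z \<and> trace_holds H" unfolding H_def using S
  proof (induction S rule: finite_induct)
    case empty
    then show ?case using trace_holds_alg[OF alg.const[OF R_0]] Z_zero by simp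
  next
    case (insert ij S)
    have 1: "(\<lambda>x. coef G ij * B ij x) \<in> Z" "trace_holds (\<lambda>x. coef G ij * B ij x)"
      using insert.prems by (auto intro!: Z_scale Z_coef[OF G] Z_B trace_holds_scale multiplier_Z trace_holds_B)
    have 2: "(\<lambda>x. \<Sum>ij\<in>S. coef G ij * B ij x) \<in> Z" "trace_holds (\<lambda>x. \<Sum>ij\<in>S. coef G ij * B ij x)"
      using insert by auto
    show ?case using insert.hyps Z_add[OF 1(1) 2(1)]
        trace_holds_add[OF multiplier_Z[OF 1(1)] multiplier_Z[OF 2(1)] 1(2) 2(2)] by simp
  qed
  moreover have "v (G x - H x) < e" for x
    unfolding H_def by (rule expands_tail[OF Z_expands[OF G] e S]) (simp add: S_def)
  ultimately show "\<exists>H. multiplier H \<and> trace_holds H \<and> (\<forall>x\<in>A. v (G x - H x) < e)"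
    using multiplier_Z by blast
qed

end

section \<open>The residue field\<close>

context padic_complex_field
begin

interpretation Cf: field "ring_of_type_algebra :: 'c ring"
  by (rule field_from_type_algebra)

abbreviation valuation_ring :: "'c ring" where
  "valuation_ring \<equiv> ring_of_type_algebra \<lparr>carrier := {x. v x \<le> 1}\<rparr>"

lemma ring_valuation_ring: "ring valuation_ring"
proof (rule Cf.subring_is_ring, rule Cf.subringI)
  fix x y assume "x \<in> {x. v x \<le> 1}" "y \<in> {x. v x \<le> 1}"
  then show "x \<oplus>\<^bsub>ring_of_type_algebra\<^esub> y \<in> {x. v x \<le> 1}"
    using v_add[of x y] by (auto simp: rta_simps)
qed (auto simp: rta_simps rta_minus v_uminus v_1 intro: v_mult_le_1)

lemma maximal_ideal: "ideal {x. v x < 1} valuation_ring"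
proof (rule idealI[OF ring_valuation_ring])
  interpret V: ring valuation_ring by (rule ring_valuation_ring)
  have "inv\<^bsub>add_monoid valuation_ring\<^esub> x = - x" if "v x < 1" for x
    using V.minus_equality[of "- x" x] that by (simp add: rta_simps v_uminus a_inv_def)
  then show "subgroup {x. v x < 1} (add_monoid valuation_ring)"
    by unfold_locales (auto simp: rta_simps v_uminus v_0 intro: v_add_less)
  fix x y assume "x \<in> {x. v x < 1}" "y \<in> carrier valuation_ring"
  then have "v x * v y < 1"
    using mult_left_mono[of "v y" 1 "v x"] v_nonneg[of x] by simp
  then show "y \<otimes>\<^bsub>valuation_ring\<^esub> x \<in> {x. v x < 1}" "x \<otimes>\<^bsub>valuation_ring\<^esub> y \<in> {x. v x < 1}"
    by (simp_all add: rta_simps v_mult mult.commute)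
qed

definition residue :: "'c \<Rightarrow> 'c set" where
  "residue x = {y. v (y - x) < 1}"

lemma residue_coset: "residue x = {x. v x < 1} +>\<^bsub>valuation_ring\<^esub> x"
proof -
  have "y \<in> (\<Union>h\<in>{x. v x < 1}. {h + x})" if "v (y - x) < 1" for y
    using that by (intro UN_I[of "y - x"]) auto
  then show ?thesis by (auto simp: residue_def a_r_coset_def' rta_simps)
qed

lemma residue_eq_iff: "residue x = residue y \<longleftrightarrow> v (x - y) < 1"
proof
  assume "residue x = residue y"
  moreover have "x \<in> residue x" by (simp add: residue_def v_0)
  ultimately show "v (x - y) < 1" by (auto simp: residue_def)
next
  assume xy: "v (x - y) < 1"
  have "v (z - y) < 1" if "v (z - x) < 1" for z using v_add_less[OF that xy] by simp
  moreover have "v (z - x) < 1" if "v (z - y) < 1" for z using v_diff_less[OF that xy] by simp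
  ultimately show "residue x = residue y" by (auto simp: residue_def)
qed

lemma residue_field_carrier: "carrier (residue_field v) = residue ` {x. v x \<le> 1}"
  by (auto simp: residue_field_def FactRing_def A_RCOSETS_def' residue_coset)

lemma residue_field_zero: "\<zero>\<^bsub>residue_field v\<^esub> = residue 0"
  by (simp add: residue_field_def FactRing_def residue_def)

lemma residue_field_mult:
  "v x \<le> 1 \<Longrightarrow> v y \<le> 1 \<Longrightarrow> residue x \<otimes>\<^bsub>residue_field v\<^esub> residue y = residue (x * y)"
  using ideal.rcoset_mult_add[OF maximal_ideal, of x y]
  by (simp add: residue_field_def FactRing_def residue_coset rta_simps)

lemma residue_field_power:
  assumes x: "v x \<le> 1" shows "residue x [^]\<^bsub>residue_field v\<^esub> n = residue (x ^ n)"
proof -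
  have "ring (residue_field v)"
    unfolding residue_field_def by (rule ideal.quotient_is_ring[OF maximal_ideal])
  then interpret F: ring "residue_field v" .
  have "\<one>\<^bsub>residue_field v\<^esub> = residue 1"
    by (simp add: residue_field_def FactRing_def residue_coset rta_simps)
  then show ?thesis
    by (induction n) (simp_all add: residue_field_mult x v_power_le_1 mult.commute)
qed

text \<open>A coset fixed by the p^m-th power consists of x with |x^(p^m) - x| < 1, the situation of
  \<open>teich_exists\<close>.\<close>

lemma GFq_eq:
  assumes m: "1 \<le> m" shows "GFq v (p ^ m) = residue ` {z. z ^ (p ^ m) = z}"
proof (intro equalityI subsetI)
  fix c assume "c \<in> GFq v (p ^ m)"
  then have c: "c \<in> residue ` {x. v x \<le> 1}" "c [^]\<^bsub>residue_field v\<^esub> (p ^ m) = c"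
    by (simp_all add: GFq_def residue_field_carrier)
  then obtain x where x: "c = residue x" "v x \<le> 1" by blast
  then have "v (x ^ (p ^ m) - x) < 1" using c(2) by (simp add: residue_field_power residue_eq_iff)
  then obtain z where "z ^ (p ^ m) = z" "v (x - z) < 1" using teich_exists[OF m] by blast
  then show "c \<in> residue ` {z. z ^ (p ^ m) = z}"
    using x(1) residue_eq_iff by blast
next
  fix c assume "c \<in> residue ` {z. z ^ (p ^ m) = z}"
  then obtain z where z: "c = residue z" "z ^ (p ^ m) = z" by blast
  moreover have "v z \<le> 1" using v_teich_le_1[OF z(2) m] .
  ultimately show "c \<in> GFq v (p ^ m)"
    by (auto simp: GFq_def residue_field_carrier residue_field_power)
qed

lemma teich_residue:
  assumes m: "1 \<le> m" and z: "z ^ (p ^ m) = z" shows "teich p (residue z) = z"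
  unfolding teich_def
proof (rule the_equality)
  show "z \<in> residue z \<and> (\<exists>n\<ge>1. z ^ (p ^ n) = z)" using m z by (auto simp: residue_def v_0)
next
  fix y assume "y \<in> residue z \<and> (\<exists>n\<ge>1. y ^ (p ^ n) = y)"
  then obtain n where "v (y - z) < 1" "n \<ge> 1" "y ^ (p ^ n) = y" by (auto simp: residue_def)
  then show "y = z" by (intro teich_unique[OF _ _ m z])
qed

lemma teich_GFq:
  assumes m: "1 \<le> m" and c: "c \<in> GFq v (p ^ m)"
  shows "teich p c ^ (p ^ m) = teich p c" "residue (teich p c) = c"
  using c teich_residue[OF m] unfolding GFq_eq[OF m] by auto

lemma teich_GFq_units:
  assumes m: "1 \<le> m"
  shows "teich p ` (GFq v (p ^ m) - {\<zero>\<^bsub>residue_field v\<^esub>}) = {z. z ^ (p ^ m - 1) = 1}"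
proof (intro equalityI subsetI)
  have pm: "p ^ m = Suc (p ^ m - 1)" using p_gt_1 by simp
  {
    fix z assume "z \<in> teich p ` (GFq v (p ^ m) - {\<zero>\<^bsub>residue_field v\<^esub>})"
    then obtain c where c: "c \<in> GFq v (p ^ m)" "c \<noteq> \<zero>\<^bsub>residue_field v\<^esub>" "z = teich p c" by blast
    have "z ^ (p ^ m) = z" "residue z = c" unfolding c(3) by (rule teich_GFq[OF m c(1)])+
    then have "z * z ^ (p ^ m - 1) = z * 1" "z \<noteq> 0"
      using c(2) pm residue_field_zero by (metis mult_1_right power_Suc, metis)
    then show "z \<in> {z. z ^ (p ^ m - 1) = 1}" using mult_left_cancel[of z "z ^ (p ^ m - 1)" 1] by blast
  }
  fix z assume "z \<in> {z::'c. z ^ (p ^ m - 1) = 1}"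
  then have z: "z ^ (p ^ m - 1) = 1" by blast
  then have 1: "z ^ (p ^ m) = z" by (subst pm) simp
  have 0: "(0::'c) ^ (p ^ m) = 0" by (subst pm) simp
  have "z \<noteq> 0" using z p_pow_gt_1[OF m] by (auto simp: zero_power)
  then have "residue z \<noteq> residue 0"
    using teich_unique[OF m 1 m 0] residue_eq_iff by blast
  then have "residue z \<in> GFq v (p ^ m) - {\<zero>\<^bsub>residue_field v\<^esub>}"
    using 1 unfolding GFq_eq[OF m] residue_field_zero by blast
  from imageI[OF this, of "teich p"]
  show "z \<in> teich p ` (GFq v (p ^ m) - {\<zero>\<^bsub>residue_field v\<^esub>})"
    using teich_residue[OF m 1] by simp
qed

end

section \<open>Series in \<open>\<pi>\<close>\<close>

lemma sum_fun_apply: "sum f S x = (\<Sum>i\<in>S. f i x)"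
  by (induction S rule: infinite_finite_induct) auto

lemma null_sequence_bounded:
  assumes "s \<longlonglongrightarrow> (0::real)" shows "\<exists>C. \<forall>n. s n \<le> C"
proof -
  have "Bseq s" by (rule convergent_imp_Bseq[OF convergentI[OF assms]])
  then obtain C where "\<forall>n. norm (s n) \<le> C" by (rule BseqE)
  then have "\<forall>n. s n \<le> C" by (simp add: abs_le_iff)
  then show ?thesis ..
qed

context padic_complex_field
begin

lemma inverse_p_power_le: "1 / real p ^ n \<le> 1"
  using p_gt_1 by (simp add: one_le_power)

lemma inverse_p_power_small: "0 < e \<Longrightarrow> \<exists>N. \<forall>n\<ge>N. 1 / real p ^ n < e"
proof -
  assume "0 < e"
  moreover have "(\<lambda>n. (1 / real p) ^ n) \<longlonglongrightarrow> 0" by (rule LIMSEQ_realpow_zero) (use p_gt_1 in auto)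
  ultimately have "\<forall>\<^sub>F n in sequentially. (1 / real p) ^ n < e" by (intro order_tendstoD(2))
  then show ?thesis by (simp add: eventually_sequentially power_divide)
qed

lemma scaled_bound_null:
  assumes "\<And>n. 0 \<le> s n" "\<And>n. s n \<le> 1" shows "(\<lambda>n. s n / real p ^ n) \<longlonglongrightarrow> 0"
proof (rule LIMSEQ_I)
  fix r :: real assume "0 < r"
  then obtain N where N: "\<And>n. n \<ge> N \<Longrightarrow> 1 / real p ^ n < r" using inverse_p_power_small by blast
  have "s n / real p ^ n < r" if "n \<ge> N" for n
    using N[OF that] divide_right_mono[OF assms(2)[of n], of "real p ^ n"] by simp
  then show "\<exists>N. \<forall>n\<ge>N. norm (s n / real p ^ n - 0) < r" using assms(1) by auto
qed

lemma pinorm_upper: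
  assumes "\<And>n. v (fps_nth f n) / real p ^ n \<le> C" shows "v (fps_nth f n) / real p ^ n \<le> pinorm v p f"
  unfolding pinorm_def by (rule cSUP_upper[OF UNIV_I]) (rule bdd_aboveI2, rule assms)

lemma pinorm_least: "(\<And>n. v (fps_nth f n) / real p ^ n \<le> C) \<Longrightarrow> pinorm v p f \<le> C"
  unfolding pinorm_def by (rule cSUP_least) auto

lemma scaled_le_1: "v x \<le> 1 \<Longrightarrow> v x / real p ^ n \<le> 1"
  using divide_right_mono[of "v x" 1 "real p ^ n"] inverse_p_power_le[of n] by simp

text \<open>The weight p^-n makes the coefficients from N on small as soon as they are integral, so
  only finitely many powers of \<pi> need an estimate of their own.\<close>

lemma split_bound:
  assumes N: "\<And>n. n \<ge> N \<Longrightarrow> 1 / real p ^ n < d" and n: "v x \<le> 1" "n < N \<Longrightarrow> v x \<le> d"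
  shows "v x / real p ^ n \<le> d"
proof (cases "n < N")
  case True
  have "1 \<le> real p ^ n" using p_gt_1 by (simp add: one_le_power)
  then have "v x / real p ^ n \<le> v x" using v_nonneg[of x] by (simp add: divide_le_eq mult_le_cancel_left1)
  then show ?thesis using n(2)[OF True] by linarith
next
  case False
  then show ?thesis using N[of n] divide_right_mono[OF n(1), of "real p ^ n"] by simp
qed

text \<open>For integral series, sums may be computed coefficient by coefficient: at a given
  precision only finitely many powers of \<pi> matter, and finitely many finite index sets have a
  finite union. The boundedness of the elements of T ensures that \<open>pinorm\<close> is a genuine
  supremum in the proof of uniqueness.\<close>

lemma usum_eqI:
  fixes t :: "'i \<Rightarrow> 'c fps"
  assumes T: "\<And>f. f \<in> T \<Longrightarrow> \<exists>C. \<forall>n. v (fps_nth f n) / real p ^ n \<le> C"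
    and t: "\<And>i n. i \<in> J \<Longrightarrow> v (fps_nth (t i) n) \<le> 1"
    and s: "s \<in> T" "\<And>n. v (fps_nth s n) \<le> 1"
    and lim: "\<And>n. has_usum UNIV v (\<lambda>i. fps_nth (t i) n) J (fps_nth s n)"
  shows "usum T (pinorm v p) t J = s"
  unfolding usum_def
proof (rule the_equality)
  show "has_usum T (pinorm v p) t J s" unfolding has_usum_def
  proof (intro conjI allI impI)
    fix e :: real assume e: "0 < e"
    then obtain N where N: "\<And>n. n \<ge> N \<Longrightarrow> 1 / real p ^ n < e / 2"
      using inverse_p_power_small[of "e / 2"] by auto
    have "\<exists>S0\<subseteq>J. finite S0 \<and> (\<forall>S. finite S \<and> S0 \<subseteq> S \<and> S \<subseteq> J \<longrightarrow>
        v (fps_nth s n - (\<Sum>i\<in>S. fps_nth (t i) n)) < e / 2)" for n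
      using lim[of n] half_gt_zero[OF e] unfolding has_usum_def by blast
    then obtain S0 where S0: "\<And>n. S0 n \<subseteq> J" "\<And>n. finite (S0 n)"
      "\<And>n S. finite S \<Longrightarrow> S0 n \<subseteq> S \<Longrightarrow> S \<subseteq> J \<Longrightarrow> v (fps_nth s n - (\<Sum>i\<in>S. fps_nth (t i) n)) < e / 2"
      by metis
    have "pinorm v p (s - sum t S) < e" if S: "finite S \<and> (\<Union>n<N. S0 n) \<subseteq> S \<and> S \<subseteq> J" for S
    proof -
      have "v (fps_nth (s - sum t S) n) / real p ^ n \<le> e / 2" for n
      proof (rule split_bound[OF N])
        have "v (\<Sum>i\<in>S. fps_nth (t i) n) \<le> 1" using S t by (intro v_sum_le) auto
        then show "v (fps_nth (s - sum t S) n) \<le> 1"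
          using v_diff_le[OF s(2)] by (simp add: fps_sum_nth)
        assume "n < N"
        then have "S0 n \<subseteq> S" using S by blast
        then show "v (fps_nth (s - sum t S) n) \<le> e / 2"
          using S0(3)[of S n] S by (simp add: fps_sum_nth)
      qed
      then have "pinorm v p (s - sum t S) \<le> e / 2" by (rule pinorm_least)
      then show ?thesis using e by simp
    qed
    moreover have "(\<Union>n<N. S0 n) \<subseteq> J" "finite (\<Union>n<N. S0 n)" using S0 by auto
    ultimately show "\<exists>S0\<subseteq>J. finite S0 \<and> (\<forall>S. finite S \<and> S0 \<subseteq> S \<and> S \<subseteq> J \<longrightarrow> pinorm v p (s - sum t S) < e)"
      by blast
  qed (rule s)
next
  fix s' assume s': "has_usum T (pinorm v p) t J s'"
  then have "s' \<in> T" by (simp add: has_usum_def)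
  then obtain C where C: "\<And>n. v (fps_nth s' n) / real p ^ n \<le> C" using T by blast
  show "s' = s"
  proof (rule fps_ext)
    fix n
    have pn: "0 < real p ^ n" using p_gt_1 by simp
    have "v (fps_nth s n - fps_nth s' n) < e" if e: "0 < e" for e
    proof -
      have e': "0 < e / real p ^ n" using e pn by simp
      obtain S0 where S0: "S0 \<subseteq> J" "finite S0"
        "\<And>S. finite S \<and> S0 \<subseteq> S \<and> S \<subseteq> J \<Longrightarrow> pinorm v p (s' - sum t S) < e / real p ^ n"
        using s' e' unfolding has_usum_def by meson
      obtain S1 where S1: "S1 \<subseteq> J" "finite S1"
        "\<And>S. finite S \<and> S1 \<subseteq> S \<and> S \<subseteq> J \<Longrightarrow> v (fps_nth s n - (\<Sum>i\<in>S. fps_nth (t i) n)) < e"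
        using lim[of n] e unfolding has_usum_def by meson
      have "v (fps_nth (s' - sum t (S0 \<union> S1)) m) / real p ^ m \<le> max C 1" for m
      proof -
        have "v (\<Sum>i\<in>S0 \<union> S1. fps_nth (t i) m) \<le> 1" using S0 S1 t by (intro v_sum_le) auto
        from scaled_le_1[OF this, of m]
        have 1: "v (\<Sum>i\<in>S0 \<union> S1. fps_nth (t i) m) \<le> max C 1 * real p ^ m"
          using p_gt_1 by (simp add: divide_le_eq max_mult_distrib_right)
        have 2: "v (fps_nth s' m) \<le> max C 1 * real p ^ m"
          using C[of m] p_gt_1 by (simp add: divide_le_eq max_mult_distrib_right)
        show ?thesis using v_diff_le[OF 2 1] p_gt_1 by (simp add: divide_le_eq fps_sum_nth)
      qed
      from pinorm_upper[OF this, of n]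
      have "v (fps_nth (s' - sum t (S0 \<union> S1)) n) / real p ^ n < e / real p ^ n"
        using S0(3)[of "S0 \<union> S1"] S0(1,2) S1(1,2) by fastforce
      then have "v (fps_nth s' n - (\<Sum>i\<in>S0 \<union> S1. fps_nth (t i) n)) < e"
        using p_gt_1 by (simp add: divide_less_cancel fps_sum_nth)
      moreover have "v (fps_nth s n - (\<Sum>i\<in>S0 \<union> S1. fps_nth (t i) n)) < e"
        using S1 S0 by (intro S1(3)) auto
      ultimately show ?thesis
        using v_diff_less[of "fps_nth s n - (\<Sum>i\<in>S0 \<union> S1. fps_nth (t i) n)" e] by fastforce
    qed
    then have "v (fps_nth s n - fps_nth s' n) \<le> 0" by (meson not_le less_irrefl)
    then show "fps_nth s' n = fps_nth s n"
      using v_nonneg[of "fps_nth s n - fps_nth s' n"] v_eq_0_iff[of "fps_nth s n - fps_nth s' n"] by simp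
  qed
qed

lemma H11_add: "\<xi> \<in> H11 v p P l \<Longrightarrow> \<eta> \<in> H11 v p P l \<Longrightarrow> \<xi> + \<eta> \<in> H11 v p P l"
  using H11_diff[OF _ H11_diff[OF H11_0], of \<xi> P l \<eta>] by simp

lemma H11_sum:
  "(\<And>i. i \<in> S \<Longrightarrow> f i \<in> H11 v p P l) \<Longrightarrow> (\<lambda>x. \<Sum>i\<in>S. f i x) \<in> H11 v p P l"
proof -
  assume f: "\<And>i. i \<in> S \<Longrightarrow> f i \<in> H11 v p P l"
  have "sum f S \<in> H11 v p P l" using f
    by (induction S rule: infinite_finite_induct) (auto simp: H11_0[unfolded zero_fun_def] intro: H11_add H11_0)
  moreover have "sum f S = (\<lambda>x. \<Sum>i\<in>S. f i x)" by (rule ext) (rule sum_fun_apply)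
  ultimately show ?thesis by simp
qed

lemma H11_limit:
  assumes "\<And>x. x \<notin> A11 v p P l \<Longrightarrow> f x = 0"
    and approx: "\<And>e. 0 < e \<Longrightarrow> \<exists>h\<in>H11 v p P l. \<forall>x. v (f x - h x) < e"
  shows "f \<in> H11 v p P l"
  unfolding H11_def
proof (intro CollectI conjI allI impI)
  fix e :: real assume e: "0 < e"
  obtain h where h: "h \<in> H11 v p P l" "\<And>x. v (f x - h x) < e" using approx[OF e] by blast
  obtain N D where D: "\<forall>x\<in>A11 v p P l. poly D x \<noteq> 0"
    and ND: "\<forall>x\<in>A11 v p P l. v (h x - poly N x / poly D x) < e"
    using h(1) e unfolding H11_def by blast
  have "v (f x - poly N x / poly D x) < e" if x: "x \<in> A11 v p P l" for x
    using v_add_less[OF h(2)[of x] ND[rule_format, OF x]] by simp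
  then show "\<exists>N D. (\<forall>x\<in>A11 v p P l. poly D x \<noteq> 0) \<and>
      (\<forall>x\<in>A11 v p P l. v (f x - poly N x / poly D x) < e)" using D by blast
qed (rule assms)

end

section \<open>The module \<open>\<Z>\<^sup>\<pi>\<close>\<close>

lemma finite_roots: "0 < n \<Longrightarrow> finite {z. z ^ n = (c::'a::{alg_closed_field, field_char_0})}"
  using nth_roots(1)[of n c] by (cases "c = 0") auto

lemma sum_iterated_roots:
  fixes f :: "'a::{alg_closed_field, field_char_0} \<Rightarrow> 'b::comm_monoid_add"
  assumes "0 < m" "0 < n"
  shows "(\<Sum>w | w ^ m = x. \<Sum>z | z ^ n = w. f z) = (\<Sum>z | z ^ (n * m) = x. f z)"
proof -
  have "(\<Union>w\<in>{w. w ^ m = x}. {z. z ^ n = w}) = {z. z ^ (n * m) = x}" by (auto simp: power_mult)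
  moreover have "(\<Sum>z\<in>(\<Union>w\<in>{w. w ^ m = x}. {z. z ^ n = w}). f z) = (\<Sum>w | w ^ m = x. \<Sum>z | z ^ n = w. f z)"
    by (rule sum.UNION_disjoint) (use finite_roots assms in auto)
  ultimately show ?thesis by simp
qed

lemma fps_const_inverse_mult:
  "fps_const (inverse (of_nat m)) * (fps_const (inverse (of_nat n)) * f) =
   fps_const (inverse (of_nat (m * n) :: 'a::field_char_0)) * f"
  by (simp only: mult.assoc[symmetric] fps_const_mult inverse_mult_distrib of_nat_mult)

lemma Uop_iterate:
  fixes F :: "'c::{alg_closed_field, field_char_0} \<Rightarrow> 'c fps"
  assumes p: "0 < p"
  shows "(Uop p ^^ m) F x = fps_const (inverse (of_nat (p ^ m))) * (\<Sum>z | z ^ (p ^ m) = x. F z)"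
proof (induction m arbitrary: x)
  case (Suc m)
  have "(Uop p ^^ Suc m) F x = fps_const (inverse (of_nat p)) * (\<Sum>w | w ^ p = x. (Uop p ^^ m) F w)"
    by (simp add: Uop_eq)
  also have "\<dots> = fps_const (inverse (of_nat p)) * (fps_const (inverse (of_nat (p ^ m))) *
      (\<Sum>w | w ^ p = x. \<Sum>z | z ^ (p ^ m) = w. F z))"
    by (simp only: Suc.IH sum_distrib_left)
  also have "\<dots> = fps_const (inverse (of_nat (p ^ Suc m))) * (\<Sum>z | z ^ (p ^ Suc m) = x. F z)"
    using p by (simp only: fps_const_inverse_mult sum_iterated_roots zero_less_power power_Suc mult.commute)
  finally show ?case .
qed simp

text \<open>In the double sum w = z^(q^k), so the outer factor g(w) moves inside as g(z^(q^k)). Each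
  iteration thus appends one Frobenius twist of g to the product.\<close>

lemma Uop_product_iterate:
  fixes F g :: "'c::{alg_closed_field, field_char_0} \<Rightarrow> 'c fps"
  assumes p: "0 < p" and q: "q = p ^ a"
  shows "((\<lambda>F. (Uop p ^^ a) (\<lambda>x. g x * F x)) ^^ k) F x =
    fps_const (inverse (of_nat (q ^ k))) * (\<Sum>z | z ^ (q ^ k) = x. (\<Prod>m<k. g (z ^ (q ^ m))) * F z)"
proof (induction k arbitrary: x)
  case (Suc k)
  have q0: "0 < q" using p q by simp
  let ?\<phi> = "\<lambda>F. (Uop p ^^ a) (\<lambda>x. g x * F x)"
  let ?h = "\<lambda>z. (\<Prod>m<k. g (z ^ (q ^ m))) * F z"
  have "(?\<phi> ^^ Suc k) F x = ?\<phi> ((?\<phi> ^^ k) F) x" by simp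
  also have "\<dots> = fps_const (inverse (of_nat q)) * (\<Sum>w | w ^ q = x. g w * (?\<phi> ^^ k) F w)"
    by (simp only: Uop_iterate[OF p] q)
  also have "\<dots> = fps_const (inverse (of_nat q)) * (fps_const (inverse (of_nat (q ^ k))) *
      (\<Sum>w | w ^ q = x. \<Sum>z | z ^ (q ^ k) = w. g w * ?h z))"
    by (simp only: Suc.IH sum_distrib_left mult.left_commute[of "g _"])
  also have "(\<Sum>w | w ^ q = x. \<Sum>z | z ^ (q ^ k) = w. g w * ?h z) =
      (\<Sum>w | w ^ q = x. \<Sum>z | z ^ (q ^ k) = w. (\<Prod>m<Suc k. g (z ^ (q ^ m))) * F z)"
    by (intro sum.cong HOL.refl) (auto simp: mult_ac)
  also have "fps_const (inverse (of_nat q)) * (fps_const (inverse (of_nat (q ^ k))) * \<dots>) =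
      fps_const (inverse (of_nat (q ^ Suc k))) *
      (\<Sum>z | z ^ (q ^ Suc k) = x. (\<Prod>m<Suc k. g (z ^ (q ^ m))) * F z)"
    using q0 by (simp only: fps_const_inverse_mult sum_iterated_roots zero_less_power power_Suc mult.commute)
  finally show ?case .
qed simp

section \<open>Reduction of series in \<pi> to their coefficients\<close>

locale pi_module = unramified p v a K + frobenius_disc p v a l "hat p P" "Zq v K" k Q
  for p and v :: "'c::{alg_closed_field, field_char_0} \<Rightarrow> real" and a K l P k Q
begin

lemma A11_eq: "A11 v p P l = A"
  by (simp add: A11_def A_def)

lemma basisB_eq: "basisB v p P l i j = B (i, j)"
  by (rule ext) (simp add: basisB_def B_def A11_eq)

lemma basis_eq: "basis v p P l ij = tens 1 (B ij)"
  by (cases ij) (simp add: basis_def basisB_eq)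

lemma coeff_term: "fps_nth (c * basis v p P l ij x) n = fps_nth c n * B ij x"
  by (simp add: basis_eq tens_def)

lemma B_H11: assumes ij: "ij \<in> I" shows "B ij \<in> H11 v p P l"
  unfolding H11_def
proof (intro CollectI conjI allI impI)
  fix x assume "x \<notin> A11 v p P l" then show "B ij x = 0" by (simp add: A11_eq B_outside)
next
  fix e :: real assume e: "0 < e"
  obtain i j where ij': "ij = (i, j)" by force
  define N where "N = (if j = 1 then Polynomial.monom 1 i else 1 :: 'c poly)"
  define D where "D = (if j = 1 then 1 else [:- hat p P j, 1:] ^ i :: 'c poly)"
  have "poly D x \<noteq> 0 \<and> B ij x - poly N x / poly D x = 0" if x: "x \<in> A" for x
  proof (cases "j = 1")
    case False
    then have "j \<in> {2..l}" using ij unfolding ij' idx_iff by simp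
    then have "x - hat p P j \<noteq> 0" by (rule A_pt_0[OF x])
    moreover have "poly D x = (x - hat p P j) ^ i" using False by (simp add: D_def poly_power)
    ultimately show ?thesis using False x by (simp add: N_def B_def ij' power_inverse divide_inverse)
  qed (simp add: N_def D_def B_def ij' x Polynomial.poly_monom)
  then show "\<exists>N D. (\<forall>x\<in>A11 v p P l. poly D x \<noteq> 0) \<and>
      (\<forall>x\<in>A11 v p P l. v (B ij x - poly N x / poly D x) < e)"
    using e unfolding A11_eq by (intro exI[of _ N] exI[of _ D]) (simp add: v_0)
qed

lemma Z_H11: assumes f: "f \<in> Z" shows "f \<in> H11 v p P l"
proof (rule H11_limit)
  fix x assume "x \<notin> A11 v p P l" then show "f x = 0" using Z_outside[OF f] by (simp add: A11_eq)
next
  fix e :: real assume e: "0 < e"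
  obtain S where S: "finite S" "S \<subseteq> I"
    "\<And>S' x. finite S' \<Longrightarrow> S \<subseteq> S' \<Longrightarrow> S' \<subseteq> I \<Longrightarrow> v (f x - (\<Sum>ij\<in>S'. coef f ij * B ij x)) < e"
    using expands_approx[OF Z_expands[OF f] e] by blast
  have "(\<lambda>x. \<Sum>ij\<in>S. coef f ij * B ij x) \<in> H11 v p P l"
    using S(2) by (intro H11_sum H11_scale B_H11 R_le Z_coef[OF f]) blast
  then show "\<exists>h\<in>H11 v p P l. \<forall>x. v (f x - h x) < e"
    by (rule bexI[rotated]) (rule allI, rule S(3)[OF S(1) subset_refl S(2)])
qed

lemma HT_diff: "F \<in> HT v p P l \<Longrightarrow> G \<in> HT v p P l \<Longrightarrow> F - G \<in> HT v p P l"
  and HT_0: "0 \<in> HT v p P l"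
  and HT_tens: "b \<in> Oa v K \<Longrightarrow> \<xi> \<in> H11 v p P l \<Longrightarrow> tens b \<xi> \<in> HT v p P l"
  using completed_tensor_HT[OF K, of P l]
  by (simp_all add: completed_tensor_def Oa_module_def H11_module_def)

lemma HT_sum:
  assumes "\<And>i. i \<in> S \<Longrightarrow> f i \<in> HT v p P l" shows "sum f S \<in> HT v p P l"
  using assms
proof (induction S rule: infinite_finite_induct)
  case (insert i S)
  then have "f i - (0 - sum f S) \<in> HT v p P l" by (intro HT_diff HT_0) auto
  then show ?case unfolding sum.insert[OF insert.hyps] by (simp only: diff_0 diff_minus_eq_add)
next
  case (infinite S)
  then show ?case using HT_0 by (simp only: sum.infinite not_False_eq_True)
qed (simp only: sum.empty HT_0)

lemma v_HT_le:
  assumes F: "F \<in> HT v p P l" shows "v (fps_nth (F x) n) \<le> HTnorm v p F * real p ^ n"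
proof -
  have H: "\<And>n. (\<lambda>x. fps_nth (F x) n) \<in> H11 v p P l"
    and lim: "(\<lambda>n. supnorm v (\<lambda>x. fps_nth (F x) n) / real p ^ n) \<longlonglongrightarrow> 0"
    using F by (auto simp: HT_def)
  have "supnorm v (\<lambda>x. fps_nth (F x) n) / real p ^ n \<le> HTnorm v p F"
    unfolding HTnorm_def using null_sequence_bounded[OF lim]
    by (intro cSUP_upper[OF UNIV_I]) (auto simp: bdd_above_def)
  moreover have "v (fps_nth (F x) n) \<le> supnorm v (\<lambda>x. fps_nth (F x) n)" by (rule supnorm_upper[OF H])
  moreover have "0 < real p ^ n" using p_gt_1 by simp
  ultimately show ?thesis by (simp add: divide_le_eq)
qed

lemma HTnorm_least:
  assumes "\<And>n x. v (fps_nth (F x) n) / real p ^ n \<le> C" shows "HTnorm v p F \<le> C"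
  unfolding HTnorm_def
proof (rule cSUP_least)
  fix n
  have pn: "0 < real p ^ n" using p_gt_1 by simp
  have "supnorm v (\<lambda>x. fps_nth (F x) n) \<le> C * real p ^ n"
    using assms[of _ n] pn by (intro supnorm_least) (simp add: divide_le_eq)
  then show "supnorm v (\<lambda>x. fps_nth (F x) n) / real p ^ n \<le> C" using pn by (simp add: divide_le_eq)
qed simp

lemma Oa_le_pinorm: "c \<in> Oa v K \<Longrightarrow> v (fps_nth c n) / real p ^ n \<le> pinorm v p c"
  by (rule pinorm_upper[where C = 1], rule scaled_le_1, rule R_le) (simp add: Oa_def)

lemma partial_sum_HT:
  assumes "S \<subseteq> I" "\<And>ij. ij \<in> I \<Longrightarrow> c ij \<in> Oa v K"
  shows "(\<Sum>ij\<in>S. (\<lambda>x. c ij * basis v p P l ij x)) \<in> HT v p P l"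
proof (rule HT_sum)
  fix ij assume "ij \<in> S"
  then have ij: "ij \<in> I" using assms(1) by blast
  have "tens (c ij) (B ij) \<in> HT v p P l" by (rule HT_tens[OF assms(2)[OF ij] B_H11[OF ij]])
  moreover have "tens (c ij) (B ij) = (\<lambda>x. c ij * basis v p P l ij x)"
    by (rule ext) (simp add: tens_def basis_eq)
  ultimately show "(\<lambda>x. c ij * basis v p P l ij x) \<in> HT v p P l" by simp
qed

lemma coeff_remainder:
  "fps_nth ((F - (\<Sum>ij\<in>S. (\<lambda>x. c ij * basis v p P l ij x))) x) n =
   fps_nth (F x) n - (\<Sum>ij\<in>S. fps_nth (c ij) n * B ij x)"
  by (simp add: sum_fun_apply fps_sum_nth coeff_term)

text \<open>The norm controls the coefficient of the n-th power of \<pi> up to the factor p^n. As n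
  is fixed, the tolerance e / p^n compensates for it.\<close>

lemma Zexpansion_expands:
  assumes c: "Zexpansion v p K P l c F"
  shows "expands (\<lambda>ij. fps_nth (c ij) n) (\<lambda>x. fps_nth (F x) n)"
  unfolding expands_def
proof (intro conjI allI impI)
  have Oa: "\<And>ij. ij \<in> I \<Longrightarrow> c ij \<in> Oa v K" and out: "\<And>ij. ij \<notin> I \<Longrightarrow> c ij = 0"
    and null: "\<And>e. 0 < e \<Longrightarrow> finite {ij \<in> I. e \<le> pinorm v p (c ij)}"
    and sum: "has_usum (HT v p P l) (HTnorm v p) (\<lambda>ij x. c ij * basis v p P l ij x) I F"
    using c unfolding Zexpansion_def by blast+
  have F: "F \<in> HT v p P l" using sum by (simp add: has_usum_def)
  have pn: "0 < real p ^ n" using p_gt_1 by simp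
  show "fps_nth (c ij) n = 0" if "ij \<notin> I" for ij using out[OF that] by simp
  fix e :: real assume "0 < e"
  then have e: "0 < e / real p ^ n" using pn by simp
  have "{ij \<in> I. e \<le> v (fps_nth (c ij) n)} \<subseteq> {ij \<in> I. e / real p ^ n \<le> pinorm v p (c ij)}"
  proof (intro Collect_mono impI conjI; elim conjE)
    fix ij assume ij: "ij \<in> I" "e \<le> v (fps_nth (c ij) n)"
    then show "e / real p ^ n \<le> pinorm v p (c ij)"
      using Oa_le_pinorm[OF Oa[OF ij(1)], of n] divide_right_mono[OF ij(2), of "real p ^ n"] pn by simp
  qed
  then show "finite {ij \<in> I. e \<le> v (fps_nth (c ij) n)}" using null[OF e] finite_subset by blast
  obtain S0 where S0: "S0 \<subseteq> I" "finite S0"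
    "\<And>S. finite S \<and> S0 \<subseteq> S \<and> S \<subseteq> I \<Longrightarrow> HTnorm v p (F - (\<Sum>ij\<in>S. (\<lambda>x. c ij * basis v p P l ij x))) < e / real p ^ n"
    using sum e unfolding has_usum_def by meson
  have "v (fps_nth (F x) n - (\<Sum>ij\<in>S. fps_nth (c ij) n * B ij x)) < e"
    if S: "finite S" "S0 \<subseteq> S" "S \<subseteq> I" for S x
  proof -
    have "v (fps_nth ((F - (\<Sum>ij\<in>S. (\<lambda>x. c ij * basis v p P l ij x))) x) n)
        \<le> HTnorm v p (F - (\<Sum>ij\<in>S. (\<lambda>x. c ij * basis v p P l ij x))) * real p ^ n"
      by (intro v_HT_le HT_diff F partial_sum_HT S Oa)
    also have "\<dots> < e / real p ^ n * real p ^ n"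
      using S0(3)[of S] S by (intro mult_strict_right_mono[OF _ pn]) blast
    finally show ?thesis using p_gt_1 unfolding coeff_remainder by simp
  qed
  then show "\<exists>S0. finite S0 \<and> S0 \<subseteq> I \<and> (\<forall>S. finite S \<longrightarrow> S0 \<subseteq> S \<longrightarrow> S \<subseteq> I \<longrightarrow>
      (\<forall>x. v (fps_nth (F x) n - (\<Sum>ij\<in>S. fps_nth (c ij) n * B ij x)) < e))"
    using S0(1,2) by blast
qed

lemma Zexpansion_coeff_R: "Zexpansion v p K P l c F \<Longrightarrow> fps_nth (c ij) n \<in> Zq v K"
  using R_0 by (cases "ij \<in> I") (auto simp: Zexpansion_def Oa_def)

text \<open>The converse needs uniformity in n. All coefficients and values have absolute value at
  most 1, so \<open>split_bound\<close> reduces to finitely many n, and the union of their index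
  sets of large coefficients is a common truncation.\<close>

lemma Zexpansion_coef:
  assumes F: "\<And>n. (\<lambda>x. fps_nth (F x) n) \<in> Z"
  shows "Zexpansion v p K P l (\<lambda>ij. Abs_fps (\<lambda>n. coef (\<lambda>x. fps_nth (F x) n) ij)) F"
  unfolding Zexpansion_def
proof (intro conjI ballI allI impI)
  let ?c = "\<lambda>ij. Abs_fps (\<lambda>n. coef (\<lambda>x. fps_nth (F x) n) ij)"
  have Oa: "?c ij \<in> Oa v K" for ij using Z_coef[OF F] by (simp add: Oa_def)
  then show "?c ij \<in> Oa v K" for ij .
  show "?c ij = 0" if "ij \<notin> I" for ij
    by (rule fps_ext) (simp add: expands_outside[OF Z_expands[OF F] that])
  have F1: "v (fps_nth (F x) n) \<le> 1" for x n by (rule Z_v_le[OF F])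
  define T where "T e n = {ij \<in> I. e \<le> v (coef (\<lambda>x. fps_nth (F x) n) ij)}" for e :: real and n
  have T: "finite (T e n)" "T e n \<subseteq> I" if "0 < e" for e n
    using expands_null[OF Z_expands[OF F] that] by (auto simp: T_def)
  show "finite {ij \<in> I. e \<le> pinorm v p (?c ij)}" if e: "0 < e" for e
  proof -
    obtain N where N: "\<And>n. n \<ge> N \<Longrightarrow> 1 / real p ^ n < e / 2"
      using inverse_p_power_small[of "e / 2"] e by auto
    have "finite (\<Union>n<N. T (e / 2) n)" using T[of "e / 2"] e by auto
    moreover have "{ij \<in> I. e \<le> pinorm v p (?c ij)} \<subseteq> (\<Union>n<N. T (e / 2) n)"
    proof (rule subsetI, rule ccontr)
      fix ij assume ij: "ij \<in> {ij \<in> I. e \<le> pinorm v p (?c ij)}" "ij \<notin> (\<Union>n<N. T (e / 2) n)"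
      have "v (fps_nth (?c ij) n) / real p ^ n \<le> e / 2" for n
        using ij R_le[OF Z_coef[OF F]] by (intro split_bound[OF N]) (auto simp: T_def not_le less_imp_le)
      then have "pinorm v p (?c ij) \<le> e / 2" by (rule pinorm_least)
      then show False using ij(1) e by simp
    qed
    ultimately show ?thesis by (rule rev_finite_subset)
  qed
  show "has_usum (HT v p P l) (HTnorm v p) (\<lambda>ij x. ?c ij * basis v p P l ij x) I F"
    unfolding has_usum_def
  proof (intro conjI allI impI)
    have "(\<lambda>n. supnorm v (\<lambda>x. fps_nth (F x) n) / real p ^ n) \<longlonglongrightarrow> 0"
      by (rule scaled_bound_null, rule supnorm_nonneg[OF Z_H11[OF F]], rule supnorm_least, rule F1)
    then show "F \<in> HT v p P l" using Z_H11[OF F] by (simp add: HT_def)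
    fix e :: real assume e: "0 < e"
    then obtain N where N: "\<And>n. n \<ge> N \<Longrightarrow> 1 / real p ^ n < e / 2"
      using inverse_p_power_small[of "e / 2"] by auto
    have "HTnorm v p (F - (\<Sum>ij\<in>S. (\<lambda>x. ?c ij * basis v p P l ij x))) < e"
      if S: "finite S \<and> (\<Union>n<N. T (e / 2) n) \<subseteq> S \<and> S \<subseteq> I" for S
    proof -
      have "v (fps_nth ((F - (\<Sum>ij\<in>S. (\<lambda>x. ?c ij * basis v p P l ij x))) x) n) / real p ^ n \<le> e / 2" for n x
        unfolding coeff_remainder fps_nth_Abs_fps
      proof (rule split_bound[OF N])
        have "v (\<Sum>ij\<in>S. coef (\<lambda>x. fps_nth (F x) n) ij * B ij x) \<le> 1"
          using S by (intro v_sum_le v_mult_le_1 R_le Z_coef[OF F] v_B) auto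
        then show "v (fps_nth (F x) n - (\<Sum>ij\<in>S. coef (\<lambda>x. fps_nth (F x) n) ij * B ij x)) \<le> 1"
          by (rule v_diff_le[OF F1])
        assume "n < N"
        then have "T (e / 2) n \<subseteq> S" using S by blast
        note TS = this[unfolded T_def]
        from S have "finite S" "S \<subseteq> I" by blast+
        note tail = expands_tail[OF Z_expands[OF F] half_gt_zero[OF e] this TS]
        show "v (fps_nth (F x) n - (\<Sum>ij\<in>S. coef (\<lambda>x. fps_nth (F x) n) ij * B ij x)) \<le> e / 2"
          by (rule less_imp_le, rule tail)
      qed
      then have "HTnorm v p (F - (\<Sum>ij\<in>S. (\<lambda>x. ?c ij * basis v p P l ij x))) \<le> e / 2"
        by (rule HTnorm_least)
      then show ?thesis using e by simp
    qed
    moreover have "(\<Union>n<N. T (e / 2) n) \<subseteq> I" "finite (\<Union>n<N. T (e / 2) n)"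
      using T[of "e / 2"] e by auto
    ultimately show "\<exists>S0\<subseteq>I. finite S0 \<and> (\<forall>S. finite S \<and> S0 \<subseteq> S \<and> S \<subseteq> I \<longrightarrow>
        HTnorm v p (F - (\<Sum>ij\<in>S. (\<lambda>x. ?c ij * basis v p P l ij x))) < e)"
      by blast
  qed
qed

text \<open>The passage to scalars: the weights p^-n supply the convergence over n, so conditions on
  the individual coefficients suffice.\<close>

lemma Zpi_iff: "F \<in> Zpi v p K P l \<longleftrightarrow> (\<forall>n. (\<lambda>x. fps_nth (F x) n) \<in> Z)"
proof
  assume "F \<in> Zpi v p K P l"
  then obtain c where c: "Zexpansion v p K P l c F" by (auto simp: Zpi_def)
  show "\<forall>n. (\<lambda>x. fps_nth (F x) n) \<in> Z"
    by (rule allI, rule Z_I[OF Zexpansion_expands[OF c]], rule Zexpansion_coeff_R[OF c])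
next
  assume "\<forall>n. (\<lambda>x. fps_nth (F x) n) \<in> Z"
  then have "Zexpansion v p K P l (\<lambda>ij. Abs_fps (\<lambda>n. coef (\<lambda>x. fps_nth (F x) n) ij)) F"
    by (intro Zexpansion_coef) blast
  then show "F \<in> Zpi v p K P l" unfolding Zpi_def by blast
qed

lemma Zcoeff_nth:
  assumes F: "F \<in> Zpi v p K P l"
  shows "fps_nth (Zcoeff v p K P l F ij) n = coef (\<lambda>x. fps_nth (F x) n) ij"
proof -
  have "Zcoeff v p K P l F = (\<lambda>ij. Abs_fps (\<lambda>n. coef (\<lambda>x. fps_nth (F x) n) ij))"
    unfolding Zcoeff_def
  proof (rule the_equality)
    show "Zexpansion v p K P l (\<lambda>ij. Abs_fps (\<lambda>n. coef (\<lambda>x. fps_nth (F x) n) ij)) F"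
      by (rule Zexpansion_coef) (use F Zpi_iff in blast)
  next
    fix d assume d: "Zexpansion v p K P l d F"
    show "d = (\<lambda>ij. Abs_fps (\<lambda>n. coef (\<lambda>x. fps_nth (F x) n) ij))"
      by (rule ext, rule fps_ext) (simp add: coef_eqI[OF Zexpansion_expands[OF d]])
  qed
  then show ?thesis by simp
qed

text \<open>The evaluation defined by summing the expansion is the value of the function, so the
  products of twists of g can be evaluated pointwise.\<close>

lemma rho_eq:
  assumes F: "F \<in> Zpi v p K P l" shows "rho v p K P l x F = F x"
  unfolding rho_def
proof (rule usum_eqI)
  have FZ: "\<And>n. (\<lambda>x. fps_nth (F x) n) \<in> Z" using F Zpi_iff by blast
  have c: "fps_nth ((\<lambda>(i, j). Zcoeff v p K P l F (i, j) * fps_const (basisB v p P l i j x)) ij) n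
      = coef (\<lambda>x. fps_nth (F x) n) ij * B ij x" for ij n
    by (cases ij) (simp add: Zcoeff_nth[OF F] basisB_eq)
  show "\<exists>C. \<forall>n. v (fps_nth f n) / real p ^ n \<le> C" if "f \<in> Cser v p" for f
    using that null_sequence_bounded by (simp add: Cser_def)
  show "v (fps_nth ((\<lambda>(i, j). Zcoeff v p K P l F (i, j) * fps_const (basisB v p P l i j x)) ij) n) \<le> 1"
    if "ij \<in> I" for ij n
    unfolding c by (rule v_mult_le_1[OF R_le[OF Z_coef[OF FZ]] v_B[OF that]])
  show F1: "v (fps_nth (F x) n) \<le> 1" for n by (rule Z_v_le[OF FZ])
  show "F x \<in> Cser v p" unfolding Cser_def
    by (rule CollectI, rule scaled_bound_null[OF v_nonneg F1])
  show "summable_to (\<lambda>ij. fps_nth ((\<lambda>(i, j). Zcoeff v p K P l F (i, j) * fps_const (basisB v p P l i j x)) ij) n)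
      (fps_nth (F x) n)" for n
    unfolding c has_usum_def
  proof (intro conjI allI impI UNIV_I)
    fix e :: real assume e: "0 < e"
    obtain S0 where S0: "finite S0" "S0 \<subseteq> I" "\<And>S y. finite S \<Longrightarrow> S0 \<subseteq> S \<Longrightarrow> S \<subseteq> I \<Longrightarrow>
        v (fps_nth (F y) n - (\<Sum>ij\<in>S. coef (\<lambda>x. fps_nth (F x) n) ij * B ij y)) < e"
      using expands_approx[OF Z_expands[OF FZ] e] by blast
    then show "\<exists>S0\<subseteq>I. finite S0 \<and> (\<forall>S. finite S \<and> S0 \<subseteq> S \<and> S \<subseteq> I \<longrightarrow>
        v (fps_nth (F x) n - (\<Sum>ij\<in>S. coef (\<lambda>x. fps_nth (F x) n) ij * B ij x)) < e)"
      by (intro exI[of _ S0]) auto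
  qed
qed

lemma Zpi_mult:
  assumes "F \<in> Zpi v p K P l" "G \<in> Zpi v p K P l" shows "(\<lambda>x. F x * G x) \<in> Zpi v p K P l"
  unfolding Zpi_iff fps_mult_nth
proof (rule allI, rule Z_sum(1))
  fix n i :: nat
  show "(\<lambda>x. fps_nth (F x) i * fps_nth (G x) (n - i)) \<in> Z"
    by (rule Z_mult) (use assms Zpi_iff in blast)+
qed simp

lemma Zpi_frobenius:
  assumes F: "F \<in> Zpi v p K P l" shows "(\<lambda>x. F (x ^ ((p ^ a) ^ m))) \<in> Zpi v p K P l"
proof (cases "m = 0")
  case False
  \<comment> \<open>The same theory with m in place of k gives the substitution of each intermediate
    power; the locale asks for a positive exponent, hence the separate case m = 0.\<close>
  then interpret m: frobenius_disc p v a l "hat p P" "Zq v K" m "(p ^ a) ^ m"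
    by unfold_locales simp_all
  show ?thesis unfolding Zpi_iff
    by (rule allI, rule m.frobenius_Z) (use F Zpi_iff in blast)
qed (use F in simp)

lemma Zpi_frobenius_product:
  assumes g: "g \<in> Zpi v p K P l" and "1 \<le> n"
  shows "(\<lambda>x. \<Prod>m<n. g (x ^ ((p ^ a) ^ m))) \<in> Zpi v p K P l"
  using \<open>1 \<le> n\<close>
proof (induction n rule: nat_induct_at_least)
  case base
  then show ?case using g by simp
next
  case (Suc n)
  then show ?case using Zpi_mult[OF Suc.IH Zpi_frobenius[OF g, of n]] by (simp add: mult.commute)
qed

text \<open>\<open>trace\<close> takes its sum inside \<open>Oa\<close>, so the limit of the
  diagonal sums must itself have coefficients in Z_q. This follows from closedness.\<close>

lemma summable_to_R:
  assumes s: "summable_to t s" and t: "\<And>ij. ij \<in> I \<Longrightarrow> t ij \<in> Zq v K" shows "s \<in> Zq v K"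
proof (rule R_closed)
  fix e :: real assume "0 < e"
  then obtain S0 where S0: "S0 \<subseteq> I" "finite S0" "v (s - sum t S0) < e"
    using s unfolding has_usum_def by blast
  moreover have "sum t S0 \<in> Zq v K" using S0(1) t by (intro R_sum) auto
  ultimately show "\<exists>r\<in>Zq v K. v (s - r) < e" by blast
qed

theorem trace_formula:
  assumes g: "g \<in> Zpi v p K P l"
  shows "trace v p K P l ((\<lambda>F. (Uop p ^^ a) (\<lambda>x. g x * F x)) ^^ k) =
    fps_const (inverse (of_nat (Q - 1))) *
    (\<Sum>x0\<in>X0. rho v p K P l x0 (\<lambda>x. \<Prod>m<k. g (x ^ ((p ^ a) ^ m))))"
proof -
  define G where "G = (\<lambda>x. \<Prod>m<k. g (x ^ ((p ^ a) ^ m)))"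
  have G: "G \<in> Zpi v p K P l" unfolding G_def by (rule Zpi_frobenius_product[OF g k_pos])
  have GZ: "\<And>n. (\<lambda>x. fps_nth (G x) n) \<in> Z" using G Zpi_iff by blast
  define \<phi> where "\<phi> = (\<lambda>F. (Uop p ^^ a) (\<lambda>x. g x * F x)) ^^ k"
  have p0: "0 < p" using p_gt_1 by simp
  have \<phi>: "\<phi> (basis v p P l ij) x = fps_const (inverse (of_nat Q)) * (\<Sum>z | z ^ Q = x. G z * basis v p P l ij z)" for ij x
    unfolding \<phi>_def Q_def G_def by (rule Uop_product_iterate[OF p0 HOL.refl])
  have \<phi>_nth: "(\<lambda>x. fps_nth (\<phi> (basis v p P l ij) x) n) = U (\<lambda>z. fps_nth (G z) n * B ij z)" for ij n
    by (rule ext) (simp add: \<phi> U_def fps_sum_nth coeff_term)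
  have UZ: "U (\<lambda>z. fps_nth (G z) n * B ij z) \<in> Z" if "ij \<in> I" for ij n
    by (rule U_Z, rule Z_mult[OF GZ Z_B[OF that]])
  then have \<phi>Z: "\<phi> (basis v p P l ij) \<in> Zpi v p K P l" if "ij \<in> I" for ij
    using that by (simp add: Zpi_iff \<phi>_nth)
  define t where "t ij = mat_entry v p K P l \<phi> ij ij" for ij
  have t: "fps_nth (t ij) n = diag (\<lambda>x. fps_nth (G x) n) ij" if "ij \<in> I" for ij n
    unfolding t_def mat_entry_def diag_def Zcoeff_nth[OF \<phi>Z[OF that]] \<phi>_nth ..
  have tR: "diag (\<lambda>x. fps_nth (G x) n) ij \<in> Zq v K" if "ij \<in> I" for ij n
    unfolding diag_def by (rule Z_coef[OF UZ[OF that]])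
  define s where "s = fps_const (inverse (of_nat (Q - 1))) * (\<Sum>x0\<in>X0. rho v p K P l x0 G)"
  have s: "fps_nth s n = fixed_sum (\<lambda>x. fps_nth (G x) n)" for n
    by (simp add: s_def fixed_sum_def rho_eq[OF G] fps_sum_nth)
  have lim: "summable_to (diag (\<lambda>x. fps_nth (G x) n)) (fps_nth s n)" for n
    using trace_holds_Z[OF GZ] unfolding s trace_holds_def .
  have sR: "fps_nth s n \<in> Zq v K" for n by (rule summable_to_R[OF lim tR])
  have "usum (Oa v K) (pinorm v p) t I = s"
  proof (rule usum_eqI)
    show "\<exists>C. \<forall>n. v (fps_nth f n) / real p ^ n \<le> C" if "f \<in> Oa v K" for f
      using Oa_le_pinorm[OF that] by blast
    show "v (fps_nth (t ij) n) \<le> 1" if "ij \<in> I" for ij n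
      unfolding t[OF that] by (rule R_le[OF tR[OF that]])
    show "s \<in> Oa v K" using sR by (simp add: Oa_def)
    show "v (fps_nth s n) \<le> 1" for n by (rule R_le[OF sR])
    show "summable_to (\<lambda>ij. fps_nth (t ij) n) (fps_nth s n)" for n
      by (rule summable_to_cong[OF lim]) (simp add: t)
  qed
  then show ?thesis unfolding s_def trace_def t_def \<phi>_def G_def .
qed

end

theorem theorem5p1:
  fixes p a q l k :: nat
    and v :: "'c::{alg_closed_field, field_char_0} \<Rightarrow> real"
    and K :: "'c set"
    and P :: "nat \<Rightarrow> 'c set option"
    and g :: "'c \<Rightarrow> 'c fps"
  assumes Cp: "padic_complex_field p v"
    and a: "a \<ge> 1" and q: "q = p ^ a"
    and Qq: "unramified_extension v a K"
    and l: "l \<ge> 2"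
    and P_range: "\<And>j. j \<in> {1..l} \<Longrightarrow> P j \<in> insert None (Some ` GFq v q)"
    and P_distinct: "inj_on P {1..l}"
    and P1: "P 1 = None" and P2: "P 2 = Some \<zero>\<^bsub>residue_field v\<^esub>"
    and k: "k \<ge> 1"
    and g: "g \<in> Zpi v p K P l"
    and cc: "completely_continuous v p K P l (\<lambda>F. (Uop p ^^ a) (\<lambda>x. g x * F x))"
  shows "trace v p K P l ((\<lambda>F. (Uop p ^^ a) (\<lambda>x. g x * F x)) ^^ k) =
    fps_const (inverse (of_nat (q ^ k - 1))) *
    (\<Sum>x0 \<in> {x0 \<in> teich p ` (GFq v (q ^ k) - {\<zero>\<^bsub>residue_field v\<^esub>}).
                Some x0 \<notin> teich_pt p ` P ` {1..l}}.
        rho v p K P l x0 (\<lambda>x. \<Prod>m<k. g (x ^ (q ^ m))))"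
proof -
  interpret padic_complex_field p v by (rule Cp)
  interpret unramified p v a K by unfold_locales (rule Qq, rule a)
  \<comment> \<open>Distinctness from the first point keeps the others away from
    \<infinity>.\<close>
  have P_Some: "\<exists>c\<in>GFq v (p ^ a). P j = Some c" if j: "j \<in> {2..l}" for j
  proof -
    have "P j \<noteq> P 1" using inj_onD[OF P_distinct, of j 1] j l by auto
    then show ?thesis using P_range[of j] j P1 q by auto
  qed
  have hat_eq: "teich_pt p (P j) = Some (hat p P j)" if "j \<in> {2..l}" for j
    using P_Some[OF that] by (auto simp: hat_def teich_pt_def)
  have hat_teich: "hat p P j ^ (p ^ a) = hat p P j" "P j = Some (residue (hat p P j))"
    if "j \<in> {2..l}" for j
    using P_Some[OF that] teich_GFq[OF a] by (auto simp: hat_def teich_pt_def)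
  have "hat p P 2 = teich p (residue 0)" by (simp add: hat_def teich_pt_def P2 residue_field_zero)
  also have "\<dots> = 0" using p_gt_1 by (intro teich_residue[OF a]) simp
  finally have hat_2: "hat p P 2 = 0" .
  \<comment> \<open>Z_q qualifies as the coefficient ring: it contains the lifts by
    \<open>teich_ZK\<close>, inverses of its units stay in K, and it is closed by
    \<open>closure_ZK\<close>.\<close>
  interpret pi_module p v a K l P k "(p ^ a) ^ k"
  proof unfold_locales
    show "inj_on (hat p P) {2..l}"
    proof (rule inj_onI)
      fix i j assume ij: "i \<in> {2..l}" "j \<in> {2..l}" "hat p P i = hat p P j"
      then have "P i = P j" using hat_teich(2) by simp
      then show "i = j" using inj_onD[OF P_distinct] ij by auto
    qed
    show "inverse r \<in> Zq v K" if "r \<in> Zq v K" "v r = 1" for r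
      using that by (simp add: O_iff K_inverse v_inverse)
    show "r \<in> Zq v K" if "\<And>e. 0 < e \<Longrightarrow> \<exists>s\<in>Zq v K. v (r - s) < e" for r
      by (rule closure_ZK[OF that])
    show "r - s \<in> Zq v K" "r * s \<in> Zq v K" if "r \<in> Zq v K" "s \<in> Zq v K" for r s
      using that by (rule ZK_diff, rule ZK_mult)
  qed (use a l hat_2 hat_teich teich_ZK k K_1 v_1 in \<open>auto simp: O_iff\<close>)
  have "teich_pt p ` P ` {1..l} = insert None (Some ` hat p P ` {2..l})"
  proof -
    have "(\<lambda>j. teich_pt p (P j)) ` {2..l} = (\<lambda>j. Some (hat p P j)) ` {2..l}"
      by (rule image_cong[OF HOL.refl hat_eq])
    moreover have "teich_pt p (P 1) = None" unfolding P1 by (simp add: teich_pt_def)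
    moreover have "{1..l} = insert 1 {2..l}" using l by auto
    ultimately show ?thesis by (simp only: image_insert image_image)
  qed
  moreover have "{2..l} = insert 2 {3..l}" using l by auto
  moreover have "teich p ` (GFq v (q ^ k) - {\<zero>\<^bsub>residue_field v\<^esub>}) = {z. z ^ ((p ^ a) ^ k - 1) = 1}"
    using teich_GFq_units[OF ak_pos] unfolding Q_power[symmetric] q .
  \<comment> \<open>Among roots of unity the exclusion of \<infinity> and of the lift 0 of the
    second point is automatic, so the index set is the one in \<open>X0_roots\<close>.\<close>
  moreover have "z \<noteq> 0" if "z ^ ((p ^ a) ^ k - 1) = 1" for z :: 'c
    using that Q_gt_1 by (auto simp: zero_power)
  ultimately have "{x0 \<in> teich p ` (GFq v (q ^ k) - {\<zero>\<^bsub>residue_field v\<^esub>}).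
      Some x0 \<notin> teich_pt p ` P ` {1..l}} = X0"
    using hat_2 unfolding X0_roots by auto
  then show ?thesis using trace_formula[OF g] unfolding q by simp
qed

end
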